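(* Varieties of continuous algebras correspond bijectively, up to isomorphism, to strongly finitary monads on $\mathsf{CPO}$: assigning to every variety its free-algebra monad yields a bijection between varieties of continuous algebras (up to concrete isomorphism over $\mathsf{CPO}$) and strongly finitary monads on $\mathsf{CPO}$ (up to isomorphism of monads).
   Context: $\mathsf{CPO}$ is the category of posets with joins of $\omega$-chains ("cpos", no least element required) and continuous maps (monotone maps preserving joins of $\omega$-chains). Hom-sets are cpos under the pointwise order. All endofunctors and monads are enriched, i.e. functors are locally continuous: monotone on hom-sets and preserving joins of $\omega$-chains in hom-sets. Natural transformations are ordinary ones. Strong finitarity: let $K:\mathsf{Set}_{\mathrm{fin}}\to\mathsf{CPO}$ send a finite set to the discrete cpo on it. An endofunctor $F$ of $\mathsf{CPO}$ is strongly finitary if $F=\mathrm{Lan}_K(F\cdot K)$ (enriched left Kan extension): for every enriched endofunctor $G$ and every natural transformation $\sigma:FK\to GK$ there is a unique natural transformation $\bar\sigma:F\to G$ with $\bar\sigma K=\sigma$. A monad is strongly finitary if its underlying endofunctor is. Continuous algebras: for a finitary signature $\Sigma$, a continuous algebra is a cpo $A$ with a continuous operation $\sigma_A:A^n\to A$ for each $\sigma\in\Sigma_n$; $\Sigma\text{-}\mathsf{CPO}$ is the category of these and continuous homomorphisms. Let $V$ be a fixed countably infinite set of variables, and $T_\Sigma V$ the set of usual terms. The set $\mathscr{T}_\Sigma V$ of extended terms is the smallest set containing $T_\Sigma V$ and such that for every collection $t_k$ ($k\in\mathbb{N}$) of extended terms containing altogether only finitely many variables, the formal join $\bigvee_{k\in\mathbb{N}}t_k$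 is an extended term. For a continuous algebra $A$ and a map $f:V\to A$, the partial map $f^{@}:\mathscr{T}_\Sigma V\rightharpoonup A$ extends the usual interpretation of terms, and is defined in $\bigvee_k t_k$ iff each $f^{@}(t_k)$ is defined and $f^{@}(t_k)\sqsubseteq f^{@}(t_{k+1})$ for all $k$; then its value is $\bigsqcup_k f^{@}(t_k)$. An equation is a pair $t=t'$ of extended terms; $A$ satisfies it if for every $f:V\to A$ both $f^{@}(t)$ and $f^{@}(t')$ are defined and equal. A variety of continuous algebras is a full subcategory of some $\Sigma\text{-}\mathsf{CPO}$ ($\Sigma$ a finitary signature) presented by a set of equations. The forgetful functor $U_{\mathcal V}:\mathcal V\to\mathsf{CPO}$ of every variety has a left adjoint; the induced monad on $\mathsf{CPO}$ is the free-algebra monad of $\mathcal V$. A concrete isomorphism between varieties is an isomorphism of categories commuting with the forgetful functors to $\mathsf{CPO}$. *)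

theory Defs
  imports Main "HOL-Library.FuncSet" "HOL-Library.Equipollence"
begin

section \<open>The universe of small sets\<close>

text \<open>
  HOL has no type of all sets, so ``all cpos'' means all cpos living in a fixed universe, given by
  a type \<open>'u\<close>: a set is small if it is strictly smaller than \<open>'u\<close>. All that is required of \<open>'u\<close> is
  that it is infinite and that small sets are closed under small unions and countable powers. If the
  cardinality of \<open>'u\<close> is strongly inaccessible and uncountable, then this is a Grothendieck
  universe; but types satisfying these conditions also exist without large cardinals: the
  cardinality may be, for instance, the successor of that of the continuum.
\<close>

definition small :: "'u set \<Rightarrow> bool" where
  "small A \<longleftrightarrow> A \<prec> (UNIV :: 'u set)"

definition universe :: "'u itself \<Rightarrow> bool" where
  "universe (_ :: 'u itself) \<longleftrightarrow>
     infinite (UNIV :: 'u set) \<and>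
     (\<forall>(I :: 'u set) (A :: 'u \<Rightarrow> 'u set). small I \<and> (\<forall>i\<in>I. small (A i)) \<longrightarrow> small (\<Union>i\<in>I. A i)) \<and>
     (\<forall>A :: 'u set. small A \<longrightarrow> ((UNIV :: nat set) \<rightarrow>\<^sub>E A) \<prec> (UNIV :: 'u set))"


section \<open>Cpos and continuous maps\<close>

text \<open>
  A poset is represented by its order relation; its underlying set is the field of that relation.
  Hence the discrete poset on \<open>X\<close> is \<^term>\<open>Id_on X\<close>.
\<close>

definition omega_chain :: "'a rel \<Rightarrow> (nat \<Rightarrow> 'a) \<Rightarrow> bool" where
  "omega_chain A c \<longleftrightarrow> (\<forall>k. (c k, c (Suc k)) \<in> A)"

definition is_join :: "'a rel \<Rightarrow> (nat \<Rightarrow> 'a) \<Rightarrow> 'a \<Rightarrow> bool" where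
  "is_join A c x \<longleftrightarrow> x \<in> Field A \<and> (\<forall>k. (c k, x) \<in> A) \<and>
     (\<forall>y\<in>Field A. (\<forall>k. (c k, y) \<in> A) \<longrightarrow> (x, y) \<in> A)"

definition cpo :: "'a rel \<Rightarrow> bool" where
  "cpo A \<longleftrightarrow> partial_order_on (Field A) A \<and> (\<forall>c. omega_chain A c \<longrightarrow> (\<exists>x. is_join A c x))"

definition continuous_map :: "'a rel \<Rightarrow> 'b rel \<Rightarrow> ('a \<Rightarrow> 'b) \<Rightarrow> bool" where
  "continuous_map A B f \<longleftrightarrow> f \<in> Field A \<rightarrow> Field B \<and>
     (\<forall>x y. (x, y) \<in> A \<longrightarrow> (f x, f y) \<in> B) \<and>
     (\<forall>c x. omega_chain A c \<and> is_join A c x \<longrightarrow> is_join B (f \<circ> c) (f x))"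

text \<open>Morphisms are extensional, so that equality of morphisms is equality in HOL.\<close>

definition cont_maps :: "'a rel \<Rightarrow> 'b rel \<Rightarrow> ('a \<Rightarrow> 'b) set" where
  "cont_maps A B = {f \<in> extensional (Field A). continuous_map A B f}"

definition hom_cpo :: "'a rel \<Rightarrow> 'b rel \<Rightarrow> ('a \<Rightarrow> 'b) rel" where
  "hom_cpo A B = {(f, g). f \<in> cont_maps A B \<and> g \<in> cont_maps A B \<and> (\<forall>x\<in>Field A. (f x, g x) \<in> B)}"

definition power_cpo :: "'a rel \<Rightarrow> nat \<Rightarrow> 'a list rel" where
  "power_cpo A n = {(xs, ys) \<in> listrel A. length xs = n}"


section \<open>Categories, functors, monads and adjunctions\<close>

text \<open>
  Hom-sets need not be disjoint; therefore composition, and functors acting on a morphism, take the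
  objects involved as arguments: \<open>compo C X Y Z g f\<close> is the composite of \<open>f : X \<rightarrow> Y\<close> and
  \<open>g : Y \<rightarrow> Z\<close>.
\<close>

record ('o, 'm) cat =
  obj :: "'o set"
  hom :: "'o \<Rightarrow> 'o \<Rightarrow> 'm set"
  idm :: "'o \<Rightarrow> 'm"
  compo :: "'o \<Rightarrow> 'o \<Rightarrow> 'o \<Rightarrow> 'm \<Rightarrow> 'm \<Rightarrow> 'm"

record ('o, 'm, 'p, 'n) fctr =
  fobj :: "'o \<Rightarrow> 'p"
  fmap :: "'o \<Rightarrow> 'o \<Rightarrow> 'm \<Rightarrow> 'n"

definition is_functor :: "('o, 'm) cat \<Rightarrow> ('p, 'n) cat \<Rightarrow> ('o, 'm, 'p, 'n) fctr \<Rightarrow> bool" where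
  "is_functor C D F \<longleftrightarrow>
     (\<forall>X\<in>obj C. fobj F X \<in> obj D) \<and>
     (\<forall>X\<in>obj C. \<forall>Y\<in>obj C. \<forall>f\<in>hom C X Y. fmap F X Y f \<in> hom D (fobj F X) (fobj F Y)) \<and>
     (\<forall>X\<in>obj C. fmap F X X (idm C X) = idm D (fobj F X)) \<and>
     (\<forall>X\<in>obj C. \<forall>Y\<in>obj C. \<forall>Z\<in>obj C. \<forall>f\<in>hom C X Y. \<forall>g\<in>hom C Y Z.
        fmap F X Z (compo C X Y Z g f) =
        compo D (fobj F X) (fobj F Y) (fobj F Z) (fmap F Y Z g) (fmap F X Y f))"

definition id_functor :: "('o, 'm, 'o, 'm) fctr" where
  "id_functor = \<lparr>fobj = \<lambda>X. X, fmap = \<lambda>X Y f. f\<rparr>"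

definition comp_functor ::
  "('p, 'n, 'q, 'k) fctr \<Rightarrow> ('o, 'm, 'p, 'n) fctr \<Rightarrow> ('o, 'm, 'q, 'k) fctr" (infixl "\<odot>" 70) where
  "G \<odot> F = \<lparr>fobj = \<lambda>X. fobj G (fobj F X),
            fmap = \<lambda>X Y f. fmap G (fobj F X) (fobj F Y) (fmap F X Y f)\<rparr>"

definition nat_trans ::
  "('o, 'm) cat \<Rightarrow> ('p, 'n) cat \<Rightarrow> ('o, 'm, 'p, 'n) fctr \<Rightarrow> ('o, 'm, 'p, 'n) fctr \<Rightarrow> ('o \<Rightarrow> 'n) \<Rightarrow> bool"
  where
  "nat_trans C D F G \<alpha> \<longleftrightarrow>
     \<alpha> \<in> extensional (obj C) \<and>
     (\<forall>X\<in>obj C. \<alpha> X \<in> hom D (fobj F X) (fobj G X)) \<and>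
     (\<forall>X\<in>obj C. \<forall>Y\<in>obj C. \<forall>f\<in>hom C X Y.
        compo D (fobj F X) (fobj G X) (fobj G Y) (fmap G X Y f) (\<alpha> X) =
        compo D (fobj F X) (fobj F Y) (fobj G Y) (\<alpha> Y) (fmap F X Y f))"

record ('o, 'm) monad =
  endo :: "('o, 'm, 'o, 'm) fctr"
  unit :: "'o \<Rightarrow> 'm"
  mult :: "'o \<Rightarrow> 'm"

definition is_monad :: "('o, 'm) cat \<Rightarrow> ('o, 'm) monad \<Rightarrow> bool" where
  "is_monad C M \<longleftrightarrow> (let F = endo M; T = fobj F; \<eta> = unit M; \<mu> = mult M in
     is_functor C C F \<and>
     nat_trans C C id_functor F \<eta> \<and>
     nat_trans C C (F \<odot> F) F \<mu> \<and>
     (\<forall>X\<in>obj C.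
        compo C (T X) (T (T X)) (T X) (\<mu> X) (\<eta> (T X)) = idm C (T X) \<and>
        compo C (T X) (T (T X)) (T X) (\<mu> X) (fmap F X (T X) (\<eta> X)) = idm C (T X) \<and>
        compo C (T (T (T X))) (T (T X)) (T X) (\<mu> X) (\<mu> (T X)) =
        compo C (T (T (T X))) (T (T X)) (T X) (\<mu> X) (fmap F (T (T X)) (T X) (\<mu> X))))"

definition monad_morphism ::
  "('o, 'm) cat \<Rightarrow> ('o, 'm) monad \<Rightarrow> ('o, 'm) monad \<Rightarrow> ('o \<Rightarrow> 'm) \<Rightarrow> bool" where
  "monad_morphism C M N \<phi> \<longleftrightarrow> (let S = fobj (endo M); T = fobj (endo N) in
     nat_trans C C (endo M) (endo N) \<phi> \<and>
     (\<forall>X\<in>obj C.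
        compo C X (S X) (T X) (\<phi> X) (unit M X) = unit N X \<and>
        compo C (S (S X)) (S X) (T X) (\<phi> X) (mult M X) =
        compo C (S (S X)) (T (T X)) (T X) (mult N X)
          (compo C (S (S X)) (T (S X)) (T (T X))
             (fmap (endo N) (S X) (T X) (\<phi> X)) (\<phi> (S X)))))"

definition isomorphic_monads :: "('o, 'm) cat \<Rightarrow> ('o, 'm) monad \<Rightarrow> ('o, 'm) monad \<Rightarrow> bool" where
  "isomorphic_monads C M N \<longleftrightarrow> (let S = fobj (endo M); T = fobj (endo N) in
     \<exists>\<phi> \<psi>. monad_morphism C M N \<phi> \<and> monad_morphism C N M \<psi> \<and>
       (\<forall>X\<in>obj C. compo C (S X) (T X) (S X) (\<psi> X) (\<phi> X) = idm C (S X) \<and>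
                  compo C (T X) (S X) (T X) (\<phi> X) (\<psi> X) = idm C (T X)))"

text \<open>\<open>F : C \<rightarrow> D\<close> is left adjoint to \<open>U : D \<rightarrow> C\<close>, with unit \<open>\<eta>\<close> and counit \<open>\<epsilon>\<close>.\<close>

definition adjunction ::
  "('o, 'm) cat \<Rightarrow> ('p, 'n) cat \<Rightarrow> ('o, 'm, 'p, 'n) fctr \<Rightarrow> ('p, 'n, 'o, 'm) fctr \<Rightarrow>
   ('o \<Rightarrow> 'm) \<Rightarrow> ('p \<Rightarrow> 'n) \<Rightarrow> bool" where
  "adjunction C D F U \<eta> \<epsilon> \<longleftrightarrow> (let f = fobj F; u = fobj U in
     is_functor C D F \<and> is_functor D C U \<and>
     nat_trans C C id_functor (U \<odot> F) \<eta> \<and>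
     nat_trans D D (F \<odot> U) id_functor \<epsilon> \<and>
     (\<forall>X\<in>obj C. compo D (f X) (f (u (f X))) (f X) (\<epsilon> (f X)) (fmap F X (u (f X)) (\<eta> X)) = idm D (f X)) \<and>
     (\<forall>A\<in>obj D. compo C (u A) (u (f (u A))) (u A) (fmap U (f (u A)) A (\<epsilon> A)) (\<eta> (u A)) = idm C (u A)))"

definition adjunction_monad ::
  "('o, 'm) cat \<Rightarrow> ('o, 'm, 'p, 'n) fctr \<Rightarrow> ('p, 'n, 'o, 'm) fctr \<Rightarrow>
   ('o \<Rightarrow> 'm) \<Rightarrow> ('p \<Rightarrow> 'n) \<Rightarrow> ('o, 'm) monad" where
  "adjunction_monad C F U \<eta> \<epsilon> =
     \<lparr>endo = U \<odot> F, unit = \<eta>,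
      mult = (\<lambda>X\<in>obj C. fmap U (fobj F (fobj U (fobj F X))) (fobj F X) (\<epsilon> (fobj F X)))\<rparr>"


section \<open>The category of cpos and strongly finitary monads\<close>

definition CPO :: "('u rel, 'u \<Rightarrow> 'u) cat" where
  "CPO = \<lparr>obj = {A. cpo A \<and> small (Field A)}, hom = cont_maps,
          idm = \<lambda>A. \<lambda>x\<in>Field A. x, compo = \<lambda>A B C g f. compose (Field A) g f\<rparr>"

type_synonym 'u endofunctor = "('u rel, 'u \<Rightarrow> 'u, 'u rel, 'u \<Rightarrow> 'u) fctr"
type_synonym 'u cpo_monad = "('u rel, 'u \<Rightarrow> 'u) monad"

definition enriched_endofunctor :: "'u endofunctor \<Rightarrow> bool" where
  "enriched_endofunctor F \<longleftrightarrow> is_functor CPO CPO F \<and>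
     (\<forall>A\<in>obj CPO. \<forall>B\<in>obj CPO.
        continuous_map (hom_cpo A B) (hom_cpo (fobj F A) (fobj F B)) (fmap F A B))"

definition SetFin :: "('u set, 'u \<Rightarrow> 'u) cat" where
  "SetFin = \<lparr>obj = {X. finite X}, hom = \<lambda>X Y. X \<rightarrow>\<^sub>E Y,
             idm = \<lambda>X. \<lambda>x\<in>X. x, compo = \<lambda>X Y Z g f. compose X g f\<rparr>"

definition K_disc :: "('u set, 'u \<Rightarrow> 'u, 'u rel, 'u \<Rightarrow> 'u) fctr" where
  "K_disc = \<lparr>fobj = \<lambda>X. Id_on X, fmap = \<lambda>X Y f. f\<rparr>"

definition strongly_finitary :: "'u endofunctor \<Rightarrow> bool" where
  "strongly_finitary F \<longleftrightarrow> enriched_endofunctor F \<and>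
     (\<forall>G \<sigma>. enriched_endofunctor G \<and> nat_trans SetFin CPO (F \<odot> K_disc) (G \<odot> K_disc) \<sigma> \<longrightarrow>
        (\<exists>!\<sigma>'. nat_trans CPO CPO F G \<sigma>' \<and> (\<forall>X\<in>obj SetFin. \<sigma>' (fobj K_disc X) = \<sigma> X)))"

definition strongly_finitary_monads :: "'u cpo_monad set" where
  "strongly_finitary_monads = {M. is_monad CPO M \<and> strongly_finitary (endo M)}"

definition monad_iso :: "'u cpo_monad rel" where
  "monad_iso = {(M, N). M \<in> strongly_finitary_monads \<and> N \<in> strongly_finitary_monads \<and>
     isomorphic_monads CPO M N}"


section \<open>Continuous algebras\<close>

text \<open>\<open>\<Sigma> n\<close> is the set of \<open>n\<close>-ary operation symbols.\<close>

type_synonym 'u signature = "nat \<Rightarrow> 'u set"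

definition is_signature :: "'u signature \<Rightarrow> bool" where
  "is_signature \<Sigma> \<longleftrightarrow> (\<forall>n. small (\<Sigma> n))"

text \<open>
  The operation \<open>\<sigma>\<^sub>A : A\<^sup>n \<rightarrow> A\<close> of an \<open>n\<close>-ary symbol \<open>\<sigma>\<close> is \<open>op_of A \<sigma>\<close>, restricted to lists of
  length \<open>n\<close>. A name shared by \<open>\<Sigma> n\<close> and \<open>\<Sigma> m\<close> thus denotes two independent operations.
\<close>

record 'u calg =
  cpo_of :: "'u rel"
  op_of :: "'u \<Rightarrow> 'u list \<Rightarrow> 'u"

definition algebras :: "'u signature \<Rightarrow> 'u calg set" where
  "algebras \<Sigma> = {A. cpo_of A \<in> obj CPO \<and>
     (\<forall>n. \<forall>\<sigma>\<in>\<Sigma> n. continuous_map (power_cpo (cpo_of A) n) (cpo_of A) (op_of A \<sigma>)) \<and>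
     \<comment> \<open>the values that are not part of the structure are normalised\<close>
     (\<forall>\<sigma> xs. \<not> (\<sigma> \<in> \<Sigma> (length xs) \<and> set xs \<subseteq> Field (cpo_of A)) \<longrightarrow> op_of A \<sigma> xs = undefined)}"

definition homs :: "'u signature \<Rightarrow> 'u calg \<Rightarrow> 'u calg \<Rightarrow> ('u \<Rightarrow> 'u) set" where
  "homs \<Sigma> A B = {h \<in> cont_maps (cpo_of A) (cpo_of B).
     \<forall>n. \<forall>\<sigma>\<in>\<Sigma> n. \<forall>xs. length xs = n \<and> set xs \<subseteq> Field (cpo_of A) \<longrightarrow>
       h (op_of A \<sigma> xs) = op_of B \<sigma> (map h xs)}"


section \<open>Extended terms and varieties\<close>

datatype (syms: 'f, vars: 'v) trm = Var 'v | Op 'f "('f, 'v) trm list"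

datatype (xsyms: 'f, xvars: 'v) xtrm = Trm "('f, 'v) trm" | Join "nat \<Rightarrow> ('f, 'v) xtrm"

text \<open>Terms and extended terms over \<open>\<Sigma>\<close>; the fixed countable set of variables is \<^typ>\<open>nat\<close>.\<close>

inductive_set trms :: "'u signature \<Rightarrow> ('u, nat) trm set" for \<Sigma> where
  Var: "Var v \<in> trms \<Sigma>"
| Op: "\<sigma> \<in> \<Sigma> (length ts) \<Longrightarrow> (\<And>t. t \<in> set ts \<Longrightarrow> t \<in> trms \<Sigma>) \<Longrightarrow> Op \<sigma> ts \<in> trms \<Sigma>"

inductive_set xtrms :: "'u signature \<Rightarrow> ('u, nat) xtrm set" for \<Sigma> where
  Trm: "t \<in> trms \<Sigma> \<Longrightarrow> Trm t \<in> xtrms \<Sigma>"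
| Join: "(\<And>k. t k \<in> xtrms \<Sigma>) \<Longrightarrow> finite (\<Union>k. xvars (t k)) \<Longrightarrow> Join t \<in> xtrms \<Sigma>"

primrec teval :: "'u calg \<Rightarrow> ('v \<Rightarrow> 'u) \<Rightarrow> ('u, 'v) trm \<Rightarrow> 'u" where
  "teval A f (Var v) = f v"
| "teval A f (Op \<sigma> ts) = op_of A \<sigma> (map (teval A f) ts)"

text \<open>The partial map \<open>f\<^sup>@\<close>; undefinedness is \<^const>\<open>None\<close>.\<close>

primrec xeval :: "'u calg \<Rightarrow> ('v \<Rightarrow> 'u) \<Rightarrow> ('u, 'v) xtrm \<Rightarrow> 'u option" where
  "xeval A f (Trm t) = Some (teval A f t)"
| "xeval A f (Join t) =
     (if (\<forall>k. xeval A f (t k) \<noteq> None) \<and> omega_chain (cpo_of A) (\<lambda>k. the (xeval A f (t k)))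
      then Some (THE x. is_join (cpo_of A) (\<lambda>k. the (xeval A f (t k))) x)
      else None)"

definition satisfies :: "'u calg \<Rightarrow> ('u, nat) xtrm \<times> ('u, nat) xtrm \<Rightarrow> bool" where
  "satisfies A e \<longleftrightarrow> (\<forall>f. range f \<subseteq> Field (cpo_of A) \<longrightarrow>
     (\<exists>x. xeval A f (fst e) = Some x \<and> xeval A f (snd e) = Some x))"

record 'u variety =
  sig :: "'u signature"
  algs :: "'u calg set"

definition varieties :: "'u variety set" where
  "varieties = {V. is_signature (sig V) \<and>
     (\<exists>E \<subseteq> xtrms (sig V) \<times> xtrms (sig V). algs V = {A \<in> algebras (sig V). \<forall>e\<in>E. satisfies A e})}"

definition variety_cat :: "'u variety \<Rightarrow> ('u calg, 'u \<Rightarrow> 'u) cat" where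
  "variety_cat V = \<lparr>obj = algs V, hom = homs (sig V),
     idm = \<lambda>A. \<lambda>x\<in>Field (cpo_of A). x, compo = \<lambda>A B C g f. compose (Field (cpo_of A)) g f\<rparr>"

definition forgetful :: "('u calg, 'u \<Rightarrow> 'u, 'u rel, 'u \<Rightarrow> 'u) fctr" where
  "forgetful = \<lparr>fobj = cpo_of, fmap = \<lambda>A B h. h\<rparr>"

text \<open>
  The free-algebra monad depends on the choice of a left adjoint (and is determined by the variety
  only up to isomorphism), so it is represented as a relation.
\<close>

definition free_algebra_monad :: "'u variety \<Rightarrow> 'u cpo_monad \<Rightarrow> bool" where
  "free_algebra_monad V M \<longleftrightarrow> (\<exists>F \<eta> \<epsilon>. adjunction CPO (variety_cat V) F forgetful \<eta> \<epsilon> \<and>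
     M = adjunction_monad CPO F forgetful \<eta> \<epsilon>)"

definition concrete_isomorphism ::
  "'u variety \<Rightarrow> 'u variety \<Rightarrow> ('u calg, 'u \<Rightarrow> 'u, 'u calg, 'u \<Rightarrow> 'u) fctr \<Rightarrow> bool" where
  "concrete_isomorphism V W \<Phi> \<longleftrightarrow> (let C = variety_cat V; D = variety_cat W in
     is_functor C D \<Phi> \<and>
     (\<exists>\<Psi>. is_functor D C \<Psi> \<and>
        (\<forall>A\<in>obj C. fobj (\<Psi> \<odot> \<Phi>) A = A) \<and>
        (\<forall>A\<in>obj C. \<forall>B\<in>obj C. \<forall>h\<in>hom C A B. fmap (\<Psi> \<odot> \<Phi>) A B h = h) \<and>
        (\<forall>A\<in>obj D. fobj (\<Phi> \<odot> \<Psi>) A = A) \<and>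
        (\<forall>A\<in>obj D. \<forall>B\<in>obj D. \<forall>h\<in>hom D A B. fmap (\<Phi> \<odot> \<Psi>) A B h = h)) \<and>
     (\<forall>A\<in>obj C. fobj (forgetful \<odot> \<Phi>) A = fobj forgetful A) \<and>
     (\<forall>A\<in>obj C. \<forall>B\<in>obj C. \<forall>h\<in>hom C A B. fmap (forgetful \<odot> \<Phi>) A B h = fmap forgetful A B h))"

definition concrete_iso :: "'u variety rel" where
  "concrete_iso = {(V, W). V \<in> varieties \<and> W \<in> varieties \<and> (\<exists>\<Phi>. concrete_isomorphism V W \<Phi>)}"

end

theory Submission
  imports Defs "HOL-Library.Nat_Bijection"
begin

text \<open>
  Write \<open>F\<close> for an enriched endofunctor. Hom-cpos need not be small here, so the left Kan extension
  cannot be handled through the functors \<open>[[-, A], B]\<close>. Instead its value at a cpo \<open>A\<close> is presented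
  by generators \<open>(X, t)\<close>, with \<open>X\<close> a finite subset of \<open>A\<close> and \<open>t \<in> F X\<close>, subject to the joins that
  must hold. It is an enriched functor in \<open>A\<close> that agrees with \<open>F\<close> on finite discrete cpos; hence \<open>F\<close>
  is strongly finitary iff each \<open>F A\<close> has this presentation.

  For the free-algebra monad \<open>T\<close> of a variety, the presented cpo at \<open>A\<close> is itself an algebra: by
  density an operation is determined by its restriction to generators, where it is computed in
  \<open>T X\<close> for a large enough \<open>X\<close>. The equations hold because they hold in each \<open>T X\<close> and extended
  terms are continuous in finitely many variables. Freeness of \<open>T A\<close> then makes \<open>T A\<close> isomorphic to
  the presented cpo.

  Conversely, a strongly finitary monad \<open>M\<close> is the free-algebra monad of the variety whose \<open>n\<close>-ary
  symbols are the elements of \<open>M n\<close> and whose equations are all those valid in the algebras \<open>M A\<close>;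
  joins in \<open>M n\<close> are captured by equations between extended terms. Finally, the algebras of a
  variety correspond to the Eilenberg-Moore algebras of its monad, so isomorphic monads give
  concretely isomorphic varieties.

  All free objects are subalgebras, generated by small sets, of (large) products; they are small
  since countably branching well-founded trees embed into a countable power of the set of labels.
\<close>

section \<open>Chains and joins\<close>

text \<open>Claims about a presented cpo are settled by density. The points where two continuous
  maps agree, or where a sequence of maps has a prescribed join, are closed under joins of chains;
  so it is enough to look at generators. Operations of several arguments are treated one argument at
  a time. Finite arity is essential here: a separately continuous map of finitely many arguments is
  jointly continuous, and finite powers of a dense set are dense. Likewise an equation can be tested
  on generators because it involves only finitely many variables. Every relation of a presentation
  is a chain with a prescribed join, and a constant chain imposes an equality. Generators sit over
  finite subsets of \<open>A\<close>, not over maps from arbitrary finite sets, since the latter do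
  not form a small set; a map is recovered through its image. The monad of a variety depends on the
  chosen left adjoint, so the properties of free algebras have to be proved for an arbitrary one and
  not only for the constructed one.\<close>

definition chain_join :: "'a rel \<Rightarrow> (nat \<Rightarrow> 'a) \<Rightarrow> 'a \<Rightarrow> bool" where
  "chain_join A c x \<longleftrightarrow> omega_chain A c \<and> is_join A c x"

definition join_closed :: "'a rel \<Rightarrow> 'a set \<Rightarrow> bool" where
  "join_closed A Q \<longleftrightarrow> (\<forall>c x. (\<forall>k. c k \<in> Q) \<and> chain_join A c x \<longrightarrow> x \<in> Q)"

lemma join_closedD: "join_closed A Q \<Longrightarrow> (\<And>k. c k \<in> Q) \<Longrightarrow> chain_join A c x \<Longrightarrow> x \<in> Q"
  unfolding join_closed_def by blast

lemma join_closedI: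
  "(\<And>c x. (\<And>k. c k \<in> Q) \<Longrightarrow> chain_join A c x \<Longrightarrow> x \<in> Q) \<Longrightarrow> join_closed A Q"
  unfolding join_closed_def by blast

lemma cpo_refl: "cpo A \<Longrightarrow> x \<in> Field A \<Longrightarrow> (x, x) \<in> A"
  unfolding cpo_def by (auto dest: partial_order_onD(1) simp: refl_on_def)

lemma cpo_trans: "cpo A \<Longrightarrow> (x, y) \<in> A \<Longrightarrow> (y, z) \<in> A \<Longrightarrow> (x, z) \<in> A"
  unfolding cpo_def by (meson partial_order_onD(2) transE)

lemma cpo_antisym: "cpo A \<Longrightarrow> (x, y) \<in> A \<Longrightarrow> (y, x) \<in> A \<Longrightarrow> x = y"
  unfolding cpo_def by (meson partial_order_onD(3) antisymD)

lemma cpoI: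
  assumes "\<And>x. x \<in> Field A \<Longrightarrow> (x, x) \<in> A"
    and "\<And>x y z. (x, y) \<in> A \<Longrightarrow> (y, z) \<in> A \<Longrightarrow> (x, z) \<in> A"
    and "\<And>x y. (x, y) \<in> A \<Longrightarrow> (y, x) \<in> A \<Longrightarrow> x = y"
    and "\<And>c. omega_chain A c \<Longrightarrow> \<exists>x. is_join A c x"
  shows "cpo A"
  unfolding cpo_def partial_order_on_def preorder_on_def
  using assms by (auto simp: refl_on_def Field_def intro!: transI antisymI)

lemma chain_joinD:
  assumes "chain_join A c x"
  shows "x \<in> Field A" "c k \<in> Field A" "(c k, x) \<in> A" "(c k, c (Suc k)) \<in> A"
  using assms unfolding chain_join_def is_join_def omega_chain_def by (auto simp: Field_def)

lemma chain_join_least: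
  "chain_join A c x \<Longrightarrow> (\<And>k. (c k, y) \<in> A) \<Longrightarrow> (x, y) \<in> A"
  unfolding chain_join_def is_join_def by (meson FieldI2)

lemma chain_joinI:
  assumes "\<And>k. (c k, c (Suc k)) \<in> A" "\<And>k. (c k, x) \<in> A"
    "\<And>y. (\<And>k. (c k, y) \<in> A) \<Longrightarrow> (x, y) \<in> A"
  shows "chain_join A c x"
  unfolding chain_join_def is_join_def omega_chain_def using assms by (meson FieldI2)

lemma chain_join_unique:
  assumes "cpo A" "chain_join A c x" "chain_join A c y"
  shows "x = y"
  by (rule cpo_antisym[OF assms(1)]) (meson assms(2,3) chain_joinD(3) chain_join_least)+

lemma chain_join_exists:
  "cpo A \<Longrightarrow> (\<And>k. (c k, c (Suc k)) \<in> A) \<Longrightarrow> \<exists>x. chain_join A c x"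
  unfolding cpo_def chain_join_def omega_chain_def by blast

lemma chain_join_the:
  assumes "cpo A" "chain_join A c x"
  shows "(THE y. is_join A c y) = x"
  using assms chain_join_unique unfolding chain_join_def by (metis the_equality)

lemma chain_join_const: "cpo A \<Longrightarrow> x \<in> Field A \<Longrightarrow> chain_join A (\<lambda>_. x) x"
  by (rule chain_joinI) (auto intro: cpo_refl)

text \<open>An inequality becomes a join of a chain, so that preservation of joins of chains already
  yields monotonicity in \<open>continuous_mapI\<close>.\<close>

lemma chain_join_pair: "cpo A \<Longrightarrow> (x, y) \<in> A \<Longrightarrow> chain_join A (case_nat x (\<lambda>_. y)) y"
proof (rule chain_joinI)
  assume "cpo A" "(x, y) \<in> A"
  then have "(y, y) \<in> A" by (meson FieldI2 cpo_refl)
  then show "(case_nat x (\<lambda>_. y) k, case_nat x (\<lambda>_. y) (Suc k)) \<in> A"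
    "(case_nat x (\<lambda>_. y) k, y) \<in> A" for k
    using \<open>(x, y) \<in> A\<close> by (auto split: nat.split)
  show "(y, z) \<in> A" if "\<And>k. (case_nat x (\<lambda>_. y) k, z) \<in> A" for z
    using that[of 1] by simp
qed

lemma chain_mono:
  assumes "cpo A" "\<And>k. (c k, c (Suc k)) \<in> A" "m \<le> n"
  shows "(c m, c n) \<in> A"
  using \<open>m \<le> n\<close>
proof (induction rule: dec_induct)
  case base then show ?case using assms by (meson FieldI1 cpo_refl)
next
  case (step n) then show ?case using assms cpo_trans by metis
qed

lemma chain_join_le:
  assumes "cpo A" "chain_join A c x" "chain_join A d y" "\<And>k. (c k, d k) \<in> A"
  shows "(x, y) \<in> A"
  by (rule chain_join_least[OF assms(2)]) (meson assms chain_joinD(3) cpo_trans)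

text \<open>Both iterated joins are the least upper bound of the whole matrix: an upper bound of the
  column joins bounds every entry, hence every row join, hence \<open>z\<close>.\<close>

lemma chain_join_swap:
  assumes A: "cpo A" and r: "\<And>m. chain_join A (\<lambda>n. c m n) (r m)"
    and q: "\<And>n. chain_join A (\<lambda>m. c m n) (q n)" and z: "chain_join A r z"
  shows "chain_join A q z"
proof (rule chain_joinI)
  show "(q k, q (Suc k)) \<in> A" for k
    by (rule chain_join_le[OF A q q]) (rule chain_joinD(4)[OF r])
  show "(q k, z) \<in> A" for k
    by (rule chain_join_least[OF q]) (meson A chain_joinD(3) cpo_trans r z)
  show "(z, y) \<in> A" if "\<And>k. (q k, y) \<in> A" for y
    by (rule chain_join_least[OF z], rule chain_join_least[OF r],
        rule cpo_trans[OF A chain_joinD(3)[OF q] that])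
qed

text \<open>The diagonal is cofinal in a matrix that increases in both directions: the entry at
  \<open>(m, n)\<close> lies below the diagonal entry at \<open>max m n\<close>.\<close>

lemma chain_join_diag:
  assumes A: "cpo A" and r: "\<And>m. chain_join A (\<lambda>n. c m n) (r m)"
    and c: "\<And>m n. (c m n, c (Suc m) n) \<in> A" and z: "chain_join A r z"
  shows "chain_join A (\<lambda>n. c n n) z"
proof (rule chain_joinI)
  show "(c k k, c (Suc k) (Suc k)) \<in> A" for k
    by (meson A c chain_joinD(4) cpo_trans r)
  show "(c k k, z) \<in> A" for k
    by (meson A chain_joinD(3) cpo_trans r z)
  show "(z, y) \<in> A" if *: "\<And>k. (c k k, y) \<in> A" for y
  proof (rule chain_join_least[OF z], rule chain_join_least[OF r])
    fix m n
    have "(c m n, c (max m n) n) \<in> A"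
      by (rule chain_mono[OF A]) (use c in auto)
    moreover have "(c (max m n) n, c (max m n) (max m n)) \<in> A"
      by (rule chain_mono[OF A]) (use chain_joinD(4)[OF r] in auto)
    ultimately show "(c m n, y) \<in> A" using * A cpo_trans by metis
  qed
qed


section \<open>Continuous maps\<close>

lemma continuous_mapI:
  assumes A: "cpo A" and f: "\<And>x. x \<in> Field A \<Longrightarrow> f x \<in> Field B"
    and j: "\<And>c x. chain_join A c x \<Longrightarrow> chain_join B (\<lambda>k. f (c k)) (f x)"
  shows "continuous_map A B f"
  unfolding continuous_map_def
proof (intro conjI allI impI)
  show "(f x, f y) \<in> B" if "(x, y) \<in> A" for x y
    using chain_joinD(4)[OF j[OF chain_join_pair[OF A that]], of 0] by simp
qed (use f j in \<open>auto simp: chain_join_def comp_def\<close>)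

lemma continuous_mapD:
  assumes "continuous_map A B f"
  shows "x \<in> Field A \<Longrightarrow> f x \<in> Field B" "(x, y) \<in> A \<Longrightarrow> (f x, f y) \<in> B"
    "chain_join A c x \<Longrightarrow> chain_join B (\<lambda>k. f (c k)) (f x)"
  using assms unfolding continuous_map_def chain_join_def omega_chain_def comp_def by auto

lemma continuous_map_cong:
  assumes "continuous_map A B f" "\<And>x. x \<in> Field A \<Longrightarrow> f x = g x"
  shows "continuous_map A B g"
proof -
  have "is_join B (g \<circ> c) (g x)" if "omega_chain A c \<and> is_join A c x" for c x
  proof -
    have "c k \<in> Field A" "x \<in> Field A" for k
      using that chain_joinD[of A c x] by (auto simp: chain_join_def)
    then have "g \<circ> c = f \<circ> c" "g x = f x" using assms(2) by (auto simp: comp_def)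
    then show ?thesis using assms(1) that unfolding continuous_map_def by simp
  qed
  moreover have "(g x, g y) \<in> B" if "(x, y) \<in> A" for x y
    using assms that unfolding continuous_map_def by (metis FieldI1 FieldI2)
  ultimately show ?thesis using assms unfolding continuous_map_def by (auto simp: Pi_iff)
qed

lemma continuous_map_comp:
  "continuous_map A B f \<Longrightarrow> continuous_map B C g \<Longrightarrow> continuous_map A C (\<lambda>x. g (f x))"
  unfolding continuous_map_def by (auto simp: omega_chain_def comp_def Pi_iff)

lemma cont_mapsI:
  "f \<in> extensional (Field A) \<Longrightarrow> continuous_map A B f \<Longrightarrow> f \<in> cont_maps A B"
  unfolding cont_maps_def by auto

lemma cont_mapsD: "f \<in> cont_maps A B \<Longrightarrow> continuous_map A B f"
  "f \<in> cont_maps A B \<Longrightarrow> f \<in> extensional (Field A)"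
  unfolding cont_maps_def by auto

lemma cont_maps_eqI:
  "f \<in> cont_maps A B \<Longrightarrow> g \<in> cont_maps A C \<Longrightarrow> (\<And>x. x \<in> Field A \<Longrightarrow> f x = g x) \<Longrightarrow> f = g"
  unfolding cont_maps_def by (auto intro: extensionalityI)

lemma cont_maps_app: "f \<in> cont_maps A B \<Longrightarrow> x \<in> Field A \<Longrightarrow> f x \<in> Field B"
  by (meson cont_mapsD continuous_mapD(1))

lemma cont_maps_restrict: "continuous_map A B f \<Longrightarrow> restrict f (Field A) \<in> cont_maps A B"
  by (rule cont_mapsI) (auto intro: continuous_map_cong)

lemma cont_maps_compose:
  "f \<in> cont_maps A B \<Longrightarrow> g \<in> cont_maps B C \<Longrightarrow> compose (Field A) g f \<in> cont_maps A C"
  unfolding compose_def by (intro cont_maps_restrict continuous_map_comp[OF cont_mapsD(1) cont_mapsD(1)])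

lemma cont_maps_id: "cpo A \<Longrightarrow> (\<lambda>x\<in>Field A. x) \<in> cont_maps A A"
  by (rule cont_maps_restrict) (rule continuous_mapI, auto)

text \<open>At the join of a chain of such points both values are joins of one and the same chain.
  Together with density this reduces an equality of continuous maps to generators.\<close>

lemma join_closed_eq:
  assumes "cpo A" "cpo B" "continuous_map A B f" "continuous_map A B g"
  shows "join_closed A {x \<in> Field A. f x = g x}"
proof (rule join_closedI)
  fix c x assume *: "\<And>k. c k \<in> {x \<in> Field A. f x = g x}" "chain_join A c x"
  have "chain_join B (\<lambda>k. f (c k)) (f x)" "chain_join B (\<lambda>k. f (c k)) (g x)"
    using continuous_mapD(3)[OF assms(3) *(2)] continuous_mapD(3)[OF assms(4) *(2)] *(1) by auto
  then show "x \<in> {x \<in> Field A. f x = g x}"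
    using chain_join_unique assms(2) *(2) chain_joinD(1) by fastforce
qed

text \<open>An interchange of the join over \<open>m\<close> with the join of the argument chain. It
  is the counterpart of \<open>join_closed_eq\<close> for proofs of local continuity and of
  relations.\<close>

lemma join_closed_chain_join:
  assumes A: "cpo A" and B: "cpo B"
    and f: "\<And>m. continuous_map A B (f m)" and g: "continuous_map A B g"
  shows "join_closed A {x \<in> Field A. chain_join B (\<lambda>m. f m x) (g x)}"
proof (rule join_closedI)
  fix c x assume *: "\<And>k. c k \<in> {x \<in> Field A. chain_join B (\<lambda>m. f m x) (g x)}" "chain_join A c x"
  have "chain_join B (\<lambda>m. f m x) (g x)"
  proof (rule chain_join_swap[OF B])
    show "chain_join B (\<lambda>n. f n (c m)) (g (c m))" for m using * by auto
    show "chain_join B (\<lambda>m. f n (c m)) (f n x)" for n by (rule continuous_mapD(3)[OF f *(2)])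
    show "chain_join B (\<lambda>m. g (c m)) (g x)" by (rule continuous_mapD(3)[OF g *(2)])
  qed
  then show "x \<in> {x \<in> Field A. chain_join B (\<lambda>m. f m x) (g x)}" using * chain_joinD by auto
qed


section \<open>Hom-cpos with the pointwise order\<close>

lemma field_hom_cpo: "cpo B \<Longrightarrow> Field (hom_cpo A B) = cont_maps A B"
proof -
  assume B: "cpo B"
  have "(f, f) \<in> hom_cpo A B" if "f \<in> cont_maps A B" for f
    using that unfolding hom_cpo_def by (auto dest: cont_maps_app intro: cpo_refl[OF B])
  then show ?thesis unfolding Field_def by (auto simp: hom_cpo_def)
qed

lemma chain_join_homI:
  assumes "\<And>m. f m \<in> cont_maps A B" "g \<in> cont_maps A B"
    "\<And>x. x \<in> Field A \<Longrightarrow> chain_join B (\<lambda>m. f m x) (g x)"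
  shows "chain_join (hom_cpo A B) f g"
proof (rule chain_joinI)
  show "(f k, f (Suc k)) \<in> hom_cpo A B" "(f k, g) \<in> hom_cpo A B" for k
    using assms chain_joinD unfolding hom_cpo_def by fast+
  show "(g, y) \<in> hom_cpo A B" if "\<And>k. (f k, y) \<in> hom_cpo A B" for y
    using that assms chain_join_least unfolding hom_cpo_def by fast
qed

text \<open>The pointwise join of continuous maps preserves joins of chains because two joins can be
  interchanged; restricting it to the field of \<open>A\<close> makes it a morphism.\<close>

lemma cpo_hom_cpo_pointwise:
  assumes A: "cpo A" and B: "cpo B" and c: "\<And>k. (f k, f (Suc k)) \<in> hom_cpo A B"
  shows "\<exists>g\<in>cont_maps A B. \<forall>x\<in>Field A. chain_join B (\<lambda>m. f m x) (g x)"
proof -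
  have fc: "f m \<in> cont_maps A B" for m using c unfolding hom_cpo_def by blast
  have "\<exists>y. chain_join B (\<lambda>m. f m x) y" if "x \<in> Field A" for x
    by (rule chain_join_exists[OF B]) (use c that in \<open>auto simp: hom_cpo_def\<close>)
  then obtain g where g: "\<And>x. x \<in> Field A \<Longrightarrow> chain_join B (\<lambda>m. f m x) (g x)" by metis
  have "continuous_map A B g"
  proof (rule continuous_mapI[OF A])
    show "g x \<in> Field B" if "x \<in> Field A" for x using g[OF that] chain_joinD by fast
    fix d x assume d: "chain_join A d x"
    show "chain_join B (\<lambda>k. g (d k)) (g x)"
    proof (rule chain_join_swap[OF B])
      show "chain_join B (\<lambda>n. f m (d n)) (f m x)" for m
        using continuous_mapD(3)[OF cont_mapsD(1)[OF fc] d] .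
      show "chain_join B (\<lambda>m. f m (d n)) (g (d n))" for n
        using g chain_joinD(2)[OF d] by blast
      show "chain_join B (\<lambda>m. f m x) (g x)" using g chain_joinD(1)[OF d] by blast
    qed
  qed
  then have "restrict g (Field A) \<in> cont_maps A B" by (rule cont_maps_restrict)
  with g show ?thesis by (intro bexI[of _ "restrict g (Field A)"]) auto
qed

lemma cpo_hom_cpo: "cpo A \<Longrightarrow> cpo B \<Longrightarrow> cpo (hom_cpo A B)"
proof (rule cpoI)
  assume A: "cpo A" and B: "cpo B"
  show "(x, x) \<in> hom_cpo A B" if "x \<in> Field (hom_cpo A B)" for x
    using that unfolding field_hom_cpo[OF B] by (auto simp: hom_cpo_def intro: cpo_refl[OF B] cont_maps_app)
  show "(x, z) \<in> hom_cpo A B" if "(x, y) \<in> hom_cpo A B" "(y, z) \<in> hom_cpo A B" for x y z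
    using that unfolding hom_cpo_def by (auto intro: cpo_trans[OF B])
  show "x = y" if "(x, y) \<in> hom_cpo A B" "(y, x) \<in> hom_cpo A B" for x y
    using that unfolding hom_cpo_def by (auto intro: cont_maps_eqI cpo_antisym[OF B])
  show "\<exists>g. is_join (hom_cpo A B) f g" if "omega_chain (hom_cpo A B) f" for f
  proof -
    have c: "(f k, f (Suc k)) \<in> hom_cpo A B" for k using that unfolding omega_chain_def by auto
    obtain g where "g \<in> cont_maps A B" "\<forall>x\<in>Field A. chain_join B (\<lambda>m. f m x) (g x)"
      using cpo_hom_cpo_pointwise[of A B f, OF A B c] by blast
    then have "chain_join (hom_cpo A B) f g"
      using c by (intro chain_join_homI) (auto simp: hom_cpo_def)
    then show ?thesis unfolding chain_join_def by blast
  qed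
qed

text \<open>A join in the hom-cpo is a least upper bound among continuous maps only. It is
  nevertheless pointwise, since the pointwise join is such a bound and joins are unique.\<close>

lemma chain_join_homD:
  assumes A: "cpo A" and B: "cpo B" and j: "chain_join (hom_cpo A B) f g" and x: "x \<in> Field A"
  shows "chain_join B (\<lambda>m. f m x) (g x)"
proof -
  have c: "(f k, f (Suc k)) \<in> hom_cpo A B" for k using chain_joinD(4)[OF j] .
  obtain g' where g': "g' \<in> cont_maps A B" "\<forall>x\<in>Field A. chain_join B (\<lambda>m. f m x) (g' x)"
    using cpo_hom_cpo_pointwise[of A B f, OF A B c] by blast
  then have "chain_join (hom_cpo A B) f g'"
    using c by (intro chain_join_homI) (auto simp: hom_cpo_def)
  then have "g' = g" using chain_join_unique[OF cpo_hom_cpo[OF A B]] j by blast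
  then show ?thesis using g' x by blast
qed

section \<open>Finite powers of a cpo, represented by lists\<close>

lemma field_power_cpo: "cpo A \<Longrightarrow> Field (power_cpo A n) = {xs. length xs = n \<and> set xs \<subseteq> Field A}"
proof -
  assume A: "cpo A"
  have "(xs, xs) \<in> listrel A" if "set xs \<subseteq> Field A" for xs
    using that cpo_refl[OF A] by (auto simp: listrel_iff_nth subset_iff)
  moreover have "set xs \<subseteq> Field A \<and> set ys \<subseteq> Field A \<and> length xs = length ys" if "(xs, ys) \<in> listrel A" for xs ys
    using that by (induction) (auto simp: Field_def)
  moreover have "x \<in> Field (power_cpo A n) \<longleftrightarrow>
    (\<exists>y. (x, y) \<in> listrel A \<and> length x = n \<or> (y, x) \<in> listrel A \<and> length y = n)" for x
    unfolding power_cpo_def by (auto simp: Field_def)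
  ultimately have "x \<in> Field (power_cpo A n) \<longleftrightarrow> length x = n \<and> set x \<subseteq> Field A" for x
    by metis
  then show ?thesis by blast
qed

lemma power_cpo_iff:
  "(xs, ys) \<in> power_cpo A n \<longleftrightarrow> length xs = n \<and> length ys = n \<and> (\<forall>i<n. (xs ! i, ys ! i) \<in> A)"
  unfolding power_cpo_def by (auto simp: listrel_iff_nth)

lemma chain_join_powerI:
  assumes "\<And>m. length (f m) = n" "length g = n"
    "\<And>i. i < n \<Longrightarrow> chain_join A (\<lambda>m. f m ! i) (g ! i)"
  shows "chain_join (power_cpo A n) f g"
proof (rule chain_joinI)
  show "(f k, f (Suc k)) \<in> power_cpo A n" "(f k, g) \<in> power_cpo A n" for k
    using assms chain_joinD unfolding power_cpo_iff by fast+
  show "(g, y) \<in> power_cpo A n" if "\<And>k. (f k, y) \<in> power_cpo A n" for y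
    using that assms chain_join_least unfolding power_cpo_iff by fast
qed

lemma cpo_power_cpo: "cpo A \<Longrightarrow> cpo (power_cpo A n)"
proof (rule cpoI)
  assume A: "cpo A"
  show "(x, x) \<in> power_cpo A n" if "x \<in> Field (power_cpo A n)" for x
    using that cpo_refl[OF A] unfolding field_power_cpo[OF A] power_cpo_iff by (auto simp: subset_iff)
  show "(x, z) \<in> power_cpo A n" if "(x, y) \<in> power_cpo A n" "(y, z) \<in> power_cpo A n" for x y z
    using that unfolding power_cpo_iff by (auto intro: cpo_trans[OF A])
  show "x = y" if "(x, y) \<in> power_cpo A n" "(y, x) \<in> power_cpo A n" for x y
    using that unfolding power_cpo_iff by (intro nth_equalityI) (auto intro: cpo_antisym[OF A])
  show "\<exists>g. is_join (power_cpo A n) f g" if "omega_chain (power_cpo A n) f" for f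
  proof -
    have c: "length (f k) = n" "i < n \<Longrightarrow> (f k ! i, f (Suc k) ! i) \<in> A" for k i
      using that unfolding omega_chain_def power_cpo_iff by auto
    have "\<exists>y. chain_join A (\<lambda>m. f m ! i) y" if "i < n" for i
      by (rule chain_join_exists[OF A]) (use c that in auto)
    then obtain g where g: "\<And>i. i < n \<Longrightarrow> chain_join A (\<lambda>m. f m ! i) (g i)" by metis
    have "chain_join (power_cpo A n) f (map g [0..<n])"
      by (rule chain_join_powerI) (use g c in auto)
    then show ?thesis unfolding chain_join_def by blast
  qed
qed

lemma chain_join_powerD:
  assumes A: "cpo A" and j: "chain_join (power_cpo A n) f g" and i: "i < n"
  shows "chain_join A (\<lambda>m. f m ! i) (g ! i)"
proof -
  have c: "(f k, f (Suc k)) \<in> power_cpo A n" for k using chain_joinD(4)[OF j] .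
  then have len: "length (f k) = n" for k by (auto simp: power_cpo_iff)
  have "\<exists>y. chain_join A (\<lambda>m. f m ! i) y" if "i < n" for i
    by (rule chain_join_exists[OF A]) (use c that in \<open>auto simp: power_cpo_iff\<close>)
  then obtain h where h: "\<And>i. i < n \<Longrightarrow> chain_join A (\<lambda>m. f m ! i) (h i)" by metis
  have "chain_join (power_cpo A n) f (map h [0..<n])"
    by (rule chain_join_powerI) (use h len in auto)
  then have "map h [0..<n] = g" using chain_join_unique[OF cpo_power_cpo[OF A]] j by blast
  then show ?thesis using h[OF i] i by auto
qed

lemma chain_join_Cons:
  assumes A: "cpo A" and x: "chain_join A c x" and xs: "chain_join (power_cpo A n) d xs"
  shows "chain_join (power_cpo A (Suc n)) (\<lambda>m. c m # d m) (x # xs)"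
proof -
  have "length (d m) = n" "length xs = n" for m
    using chain_joinD[OF xs] by (auto simp: field_power_cpo[OF A])
  then show ?thesis
    by (intro chain_join_powerI)
       (auto simp: nth_Cons x chain_join_powerD[OF A xs] split: nat.split)
qed

lemma chain_join_ConsD:
  assumes A: "cpo A" and j: "chain_join (power_cpo A (Suc n)) d xs"
  shows "chain_join A (\<lambda>m. hd (d m)) (hd xs)" "chain_join (power_cpo A n) (\<lambda>m. tl (d m)) (tl xs)"
proof -
  have l: "length (d m) = Suc n" "length xs = Suc n" for m
    using chain_joinD[OF j] by (auto simp: field_power_cpo[OF A])
  then have "hd (d m) = d m ! 0" "hd xs = xs ! 0" for m by (metis hd_conv_nth length_0_conv nat.distinct(1))+
  then show "chain_join A (\<lambda>m. hd (d m)) (hd xs)"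
    using chain_join_powerD[OF A j, of 0] by simp
  show "chain_join (power_cpo A n) (\<lambda>m. tl (d m)) (tl xs)"
    using l chain_join_powerD[OF A j, of "Suc _"] by (intro chain_join_powerI) (auto simp: nth_tl)
qed

text \<open>Separate continuity in head and tail gives joint continuity: the values along a chain of
  lists form the diagonal of a matrix whose iterated join is the required value.\<close>

lemma continuous_map_Cons:
  assumes A: "cpo A" and B: "cpo B"
    and x: "\<And>xs. xs \<in> Field (power_cpo A n) \<Longrightarrow> continuous_map A B (\<lambda>x. f (x # xs))"
    and xs: "\<And>x. x \<in> Field A \<Longrightarrow> continuous_map (power_cpo A n) B (\<lambda>xs. f (x # xs))"
  shows "continuous_map (power_cpo A (Suc n)) B f"
proof (rule continuous_mapI[OF cpo_power_cpo[OF A]])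
  show "f ys \<in> Field B" if ys: "ys \<in> Field (power_cpo A (Suc n))" for ys
  proof -
    obtain y zs where "ys = y # zs" "y \<in> Field A" "zs \<in> Field (power_cpo A n)"
      using ys unfolding field_power_cpo[OF A] by (auto simp: length_Suc_conv)
    then show ?thesis using continuous_mapD(1)[OF x] by blast
  qed
  fix d ys assume d: "chain_join (power_cpo A (Suc n)) d ys"
  have l: "length (d m) = Suc n" "length ys = Suc n" for m
    using chain_joinD[OF d] by (auto simp: field_power_cpo[OF A])
  then have e: "d m = hd (d m) # tl (d m)" "ys = hd ys # tl ys" for m
    by (metis list.collapse list.size(3) nat.distinct(1))+
  note j = chain_join_ConsD[OF A d]
  have "chain_join B (\<lambda>m. f (hd (d m) # tl (d m))) (f (hd ys # tl ys))"
  proof (rule chain_join_diag[OF B, where c = "\<lambda>m n. f (hd (d m) # tl (d n))"])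
    show "chain_join B (\<lambda>n. f (hd (d m) # tl (d n))) (f (hd (d m) # tl ys))" for m
      by (rule continuous_mapD(3)[OF xs j(2)]) (rule chain_joinD(2)[OF j(1)])
    show "(f (hd (d m) # tl (d n)), f (hd (d (Suc m)) # tl (d n))) \<in> B" for m n
      by (rule continuous_mapD(2)[OF x chain_joinD(4)[OF j(1)]]) (rule chain_joinD(2)[OF j(2)])
    show "chain_join B (\<lambda>m. f (hd (d m) # tl ys)) (f (hd ys # tl ys))"
      by (rule continuous_mapD(3)[OF x j(1)]) (rule chain_joinD(1)[OF j(2)])
  qed
  then show "chain_join B (\<lambda>k. f (d k)) (f ys)" unfolding e[symmetric] .
qed

lemma continuous_map_map:
  assumes A: "cpo A" and B: "cpo B" and f: "continuous_map A B f"
  shows "continuous_map (power_cpo A n) (power_cpo B n) (map f)"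
proof (rule continuous_mapI[OF cpo_power_cpo[OF A]])
  show "map f xs \<in> Field (power_cpo B n)" if "xs \<in> Field (power_cpo A n)" for xs
    using that continuous_mapD(1)[OF f] unfolding field_power_cpo[OF A] field_power_cpo[OF B] by auto
  fix c xs assume c: "chain_join (power_cpo A n) c xs"
  have l: "length (c k) = n" "length xs = n" for k
    using chain_joinD(1,2)[OF c] unfolding field_power_cpo[OF A] by auto
  show "chain_join (power_cpo B n) (\<lambda>k. map f (c k)) (map f xs)"
    by (rule chain_join_powerI)
       (use l continuous_mapD(3)[OF f chain_join_powerD[OF A c]] in auto)
qed


section \<open>Small sets\<close>

text \<open>The name \<open>U\<close> for the whole type fixes the type \<open>'u\<close> and lets
  \<open>A \<prec> U\<close> express smallness of a set over any type, whereas \<open>small\<close>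
  speaks of sets over \<open>'u\<close> only.\<close>

locale small_universe =
  fixes U :: "'u set"
  assumes U: "U = UNIV" and universe: "universe TYPE('u)"
begin

lemma infinite_universe: "infinite (UNIV :: 'u set)"
  using universe unfolding universe_def by blast

lemma sm_small: "(A :: 'u set) \<prec> U \<longleftrightarrow> small A"
  unfolding small_def U ..

lemma sm_lepoll: "(A :: 'a set) \<lesssim> (B :: 'b set) \<Longrightarrow> B \<prec> U \<Longrightarrow> A \<prec> U"
  by (rule lesspoll_trans1)

lemma sm_subset: "A \<subseteq> B \<Longrightarrow> B \<prec> U \<Longrightarrow> A \<prec> U"
  by (meson sm_lepoll subset_imp_lepoll)

lemma sm_image: "(A :: 'a set) \<prec> U \<Longrightarrow> (f ` A :: 'b set) \<prec> U"
  by (meson sm_lepoll image_lepoll)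

lemma sm_inj: "inj_on f (A :: 'a set) \<Longrightarrow> f ` A \<subseteq> (B :: 'b set) \<Longrightarrow> B \<prec> U \<Longrightarrow> A \<prec> U"
  by (meson sm_lepoll lepoll_def)

lemma sm_finite: "finite A \<Longrightarrow> A \<prec> U"
  unfolding U by (rule finite_lesspoll_infinite[OF infinite_universe])

text \<open>The closure conditions in \<open>universe\<close> concern sets over \<open>'u\<close>.
  Such a coding carries them over to sets of functions, lists, trees or pairs.\<close>

lemma sm_encode: "A \<prec> U \<Longrightarrow> \<exists>f :: 'a \<Rightarrow> 'u. inj_on f A \<and> small (f ` A)"
  using sm_image sm_small lesspoll_imp_lepoll unfolding lepoll_def by metis

lemma pairing: "\<exists>p :: 'u \<times> 'u \<Rightarrow> 'u. inj p"
proof -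
  have "(UNIV :: ('u \<times> 'u) set) \<approx> (UNIV :: 'u set)"
    using card_of_Times_same_infinite[OF infinite_universe]
    unfolding eqpoll_iff_card_of_ordIso UNIV_Times_UNIV .
  then show ?thesis unfolding eqpoll_def bij_betw_def by blast
qed

text \<open>Codes for the indices and for each fibre are combined by an injective pairing on
  \<open>'u\<close>; the sum then embeds into a small union of small sets of codes.\<close>

lemma sm_Sigma:
  fixes I :: "'i set" and A :: "'i \<Rightarrow> 'a set"
  assumes I: "I \<prec> U" and A: "\<And>i. i \<in> I \<Longrightarrow> (A i) \<prec> U"
  shows "(Sigma I A) \<prec> U"
proof -
  obtain j :: "'i \<Rightarrow> 'u" where j: "inj_on j I" "small (j ` I)" using sm_encode[OF I] by blast
  have "\<forall>i\<in>I. \<exists>f :: 'a \<Rightarrow> 'u. inj_on f (A i) \<and> small (f ` A i)" using sm_encode[OF A] by blast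
  then obtain f :: "'i \<Rightarrow> 'a \<Rightarrow> 'u" where
    f: "\<And>i. i \<in> I \<Longrightarrow> inj_on (f i) (A i)" "\<And>i. i \<in> I \<Longrightarrow> small (f i ` A i)" by metis
  obtain p :: "'u \<times> 'u \<Rightarrow> 'u" where p: "inj p" using pairing by blast
  define B where "B = (\<lambda>u. (\<lambda>x. p (u, x)) ` f (inv_into I j u) ` A (inv_into I j u))"
  have "small (B u)" if "u \<in> j ` I" for u
    unfolding B_def using that by (metis f(2) inv_into_into sm_image sm_small)
  then have "small (\<Union>u\<in>j ` I. B u)"
    using universe j(2) unfolding universe_def by blast
  moreover have "(\<lambda>(i, x). p (j i, f i x)) ` Sigma I A \<subseteq> (\<Union>u\<in>j ` I. B u)"
  proof clarify
    fix i x assume i: "i \<in> I" "x \<in> A i"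
    then have "p (j i, f i x) \<in> B (j i)" unfolding B_def using inv_into_f_f[OF j(1)] by simp
    then show "p (j i, f i x) \<in> (\<Union>u\<in>j ` I. B u)" using i(1) by blast
  qed
  moreover have "inj_on (\<lambda>(i, x). p (j i, f i x)) (Sigma I A)"
  proof (rule inj_onI)
    fix x y assume x: "x \<in> Sigma I A" and y: "y \<in> Sigma I A"
      and eq: "(\<lambda>(i, x). p (j i, f i x)) x = (\<lambda>(i, x). p (j i, f i x)) y"
    then have "p (j (fst x), f (fst x) (snd x)) = p (j (fst y), f (fst y) (snd y))"
      by (simp add: case_prod_beta)
    from injD[OF p this] have e: "j (fst x) = j (fst y)" "f (fst x) (snd x) = f (fst y) (snd y)"
      by auto
    have m: "fst x \<in> I" "fst y \<in> I" "snd x \<in> A (fst x)" "snd y \<in> A (fst y)"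
      using x y by auto
    have "fst x = fst y" by (rule inj_onD[OF j(1) e(1) m(1,2)])
    moreover from this e m have "snd x = snd y" by (metis f(1) inj_onD)
    ultimately show "x = y" by (rule prod_eqI)
  qed
  ultimately show ?thesis using sm_inj sm_small by blast
qed

lemma sm_UN:
  fixes I :: "'i set" and A :: "'i \<Rightarrow> 'a set"
  shows "I \<prec> U \<Longrightarrow> (\<And>i. i \<in> I \<Longrightarrow> (A i) \<prec> U) \<Longrightarrow> (\<Union>i\<in>I. A i) \<prec> U"
proof -
  assume *: "I \<prec> U" "\<And>i. i \<in> I \<Longrightarrow> (A i) \<prec> U"
  have "(\<Union>i\<in>I. A i) = snd ` Sigma I A" by force
  moreover have "Sigma I A \<prec> U" by (rule sm_Sigma) (use * in auto)
  ultimately show ?thesis using sm_image by simp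
qed

lemma sm_Un: "A \<prec> U \<Longrightarrow> B \<prec> U \<Longrightarrow> (A \<union> B) \<prec> U"
proof -
  assume *: "A \<prec> U" "B \<prec> U"
  have "(\<Union>b\<in>{True, False}. if b then A else B) \<prec> U" by (rule sm_UN[OF sm_finite]) (use * in auto)
  then show ?thesis by (simp add: Un_commute)
qed

lemma sm_insert: "A \<prec> U \<Longrightarrow> (insert x A) \<prec> U"
  using sm_Un[OF sm_finite[of "{x}"]] by simp

lemma sm_countable_power:
  fixes A :: "'a set"
  assumes "A \<prec> U"
  shows "{f :: nat \<Rightarrow> 'a. range f \<subseteq> A} \<prec> U"
proof -
  obtain e :: "'a \<Rightarrow> 'u" where e: "inj_on e A" "small (e ` A)" using sm_encode[OF assms] by blast
  then have "((UNIV :: nat set) \<rightarrow>\<^sub>E e ` A) \<prec> U"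
    using universe unfolding universe_def U by blast
  moreover have "inj_on (\<lambda>f. e \<circ> f) {f :: nat \<Rightarrow> 'a. range f \<subseteq> A}"
  proof (rule inj_onI, rule ext)
    fix f g :: "nat \<Rightarrow> 'a" and n
    assume "f \<in> {f. range f \<subseteq> A}" "g \<in> {f. range f \<subseteq> A}" "e \<circ> f = e \<circ> g"
    then have "f n \<in> A" "g n \<in> A" "e (f n) = e (g n)" by (auto simp: fun_eq_iff)
    then show "f n = g n" using e(1) by (meson inj_onD)
  qed
  ultimately show ?thesis by (rule sm_inj[rotated 2]) auto
qed

text \<open>Smallness of the naturals comes from countable powers: the power of a two-element set is
  small, and it contains the characteristic functions of singletons.\<close>

lemma sm_nat: "(UNIV :: nat set) \<prec> U"
proof -
  have "{f :: nat \<Rightarrow> bool. range f \<subseteq> UNIV} \<prec> U" by (rule sm_countable_power[OF sm_finite]) simp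
  moreover have "inj (\<lambda>n m. m = (n :: nat))" by (auto simp: inj_def fun_eq_iff)
  ultimately show ?thesis by (rule sm_inj[rotated 2]) auto
qed

text \<open>Finite sequences of numbers are the addresses in a countably branching tree. There are
  countably many of them, as \<open>list_decode\<close> is onto, so this is a countable power up to
  renaming.\<close>

lemma sm_list_functions:
  assumes "A \<prec> U"
  shows "{f :: nat list \<Rightarrow> 'a. range f \<subseteq> A} \<prec> U"
proof (rule sm_inj[OF _ _ sm_countable_power[OF assms]])
  show "inj_on (\<lambda>f. f \<circ> list_decode) {f :: nat list \<Rightarrow> 'a. range f \<subseteq> A}"
    by (rule inj_onI) (metis comp_assoc comp_id surj_iff surj_list_decode)
qed auto

lemma sm_lists: "A \<prec> U \<Longrightarrow> {xs. set xs \<subseteq> A} \<prec> U"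
proof (rule sm_inj[OF _ _ sm_countable_power[of "insert None (Some ` A)"]])
  show "inj_on (\<lambda>xs i. if i < length xs then Some (xs ! i) else None) {xs. set xs \<subseteq> A}"
  proof (rule inj_onI)
    fix xs ys :: "'a list"
    assume e: "(\<lambda>i. if i < length xs then Some (xs ! i) else None) =
      (\<lambda>i. if i < length ys then Some (ys ! i) else None)"
    then have l: "i < length xs \<longleftrightarrow> i < length ys" for i by (metis option.distinct(1))
    then have "length xs = length ys" by (metis linorder_neqE_nat nat_less_le)
    moreover have "xs ! i = ys ! i" if "i < length xs" for i
      using fun_cong[OF e, of i] that l by auto
    ultimately show "xs = ys" by (rule nth_equalityI)
  qed
  assume "A \<prec> U"
  then show "(insert None (Some ` A)) \<prec> U" by (intro sm_insert sm_image)
qed (auto simp: subset_iff)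

lemma sm_finite_subsets: "A \<prec> U \<Longrightarrow> {X. finite X \<and> X \<subseteq> A} \<prec> U"
  by (rule sm_subset[OF _ sm_image[OF sm_lists, of A set]]) (auto simp: finite_list image_iff, metis finite_list)

end


section \<open>Countably branching trees\<close>

datatype 'l tree = Lf 'l | Nd 'l "nat \<Rightarrow> 'l tree"

text \<open>A tree is recorded by the labels found at all addresses, and the boolean tells leaves
  from inner nodes. Below a leaf the rest of the address is ignored, which makes the code
  total.\<close>

primrec tree_code :: "'l tree \<Rightarrow> nat list \<Rightarrow> bool \<times> 'l" where
  "tree_code (Lf l) = (\<lambda>_. (False, l))"
| "tree_code (Nd l f) = (\<lambda>p. case p of [] \<Rightarrow> (True, l) | n # q \<Rightarrow> tree_code (f n) q)"

lemma tree_code_inj: "tree_code s = tree_code t \<Longrightarrow> s = t"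
proof (induction s arbitrary: t)
  case (Lf l)
  then show ?case by (cases t) (auto dest!: fun_cong[of _ _ "[]"])
next
  case (Nd l f)
  then show ?case
  proof (cases t)
    case (Lf l') with Nd show ?thesis by (auto dest!: fun_cong[of _ _ "[]"])
  next
    case (Nd l' f')
    have "tree_code (f n) = tree_code (f' n)" for n
    proof
      fix p show "tree_code (f n) p = tree_code (f' n) p"
        using fun_cong[OF Nd.prems, of "n # p"] by (simp add: \<open>t = Nd l' f'\<close>)
    qed
    then have "f = f'" using Nd.IH by (auto simp: fun_eq_iff)
    then show ?thesis using fun_cong[OF Nd.prems, of "[]"] by (simp add: \<open>t = Nd l' f'\<close>)
  qed
qed

context small_universe
begin

text \<open>\<open>tree_code\<close> embeds the trees into functions from a countable set of
  addresses to a small set of labels.\<close>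

lemma sm_trees: "L \<prec> U \<Longrightarrow> {t. set_tree t \<subseteq> L} \<prec> U"
proof (rule sm_inj[OF _ _ sm_list_functions[of "UNIV \<times> L"]])
  show "inj_on tree_code {t. set_tree t \<subseteq> L}" by (rule inj_onI) (rule tree_code_inj)
  have "tree_code t p \<in> UNIV \<times> L" if "set_tree t \<subseteq> L" for t p
    using that
  proof (induction t arbitrary: p)
    case (Nd l f)
    have "tree_code (f n) q \<in> UNIV \<times> L" for n q by (rule Nd.IH) (use Nd.prems in auto)
    with Nd.prems show ?case by (auto split: list.split)
  qed auto
  then show "tree_code ` {t. set_tree t \<subseteq> L} \<subseteq> {f. range f \<subseteq> UNIV \<times> L}" by blast
  assume "L \<prec> U"
  then show "((UNIV :: bool set) \<times> L) \<prec> U" by (intro sm_Sigma[OF sm_finite]) auto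
qed

end


section \<open>The algebra generated in a product\<close>

lemma algebrasD:
  assumes "A \<in> algebras \<Sigma>"
  shows "cpo (cpo_of A)" "small (Field (cpo_of A))" "cpo_of A \<in> obj CPO"
    "\<sigma> \<in> \<Sigma> n \<Longrightarrow> continuous_map (power_cpo (cpo_of A) n) (cpo_of A) (op_of A \<sigma>)"
    "\<not> (\<sigma> \<in> \<Sigma> (length xs) \<and> set xs \<subseteq> Field (cpo_of A)) \<Longrightarrow> op_of A \<sigma> xs = undefined"
  using assms unfolding algebras_def CPO_def by auto

lemma op_of_closed:
  assumes "A \<in> algebras \<Sigma>" "\<sigma> \<in> \<Sigma> (length xs)" "set xs \<subseteq> Field (cpo_of A)"
  shows "op_of A \<sigma> xs \<in> Field (cpo_of A)"
  by (rule continuous_mapD(1)[OF algebrasD(4)[OF assms(1,2)]])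
     (simp add: assms field_power_cpo[OF algebrasD(1)[OF assms(1)]])

lemma homsD:
  assumes "h \<in> homs \<Sigma> A B"
  shows "h \<in> cont_maps (cpo_of A) (cpo_of B)" "continuous_map (cpo_of A) (cpo_of B) h"
    "x \<in> Field (cpo_of A) \<Longrightarrow> h x \<in> Field (cpo_of B)"
    "\<sigma> \<in> \<Sigma> (length xs) \<Longrightarrow> set xs \<subseteq> Field (cpo_of A) \<Longrightarrow> h (op_of A \<sigma> xs) = op_of B \<sigma> (map h xs)"
  using assms unfolding homs_def by (auto dest: cont_mapsD cont_maps_app)

lemma homsI:
  assumes "h \<in> cont_maps (cpo_of A) (cpo_of B)"
    "\<And>\<sigma> xs. \<sigma> \<in> \<Sigma> (length xs) \<Longrightarrow> set xs \<subseteq> Field (cpo_of A) \<Longrightarrow> h (op_of A \<sigma> xs) = op_of B \<sigma> (map h xs)"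
  shows "h \<in> homs \<Sigma> A B"
  using assms unfolding homs_def by auto

lemma homs_compose:
  assumes "h \<in> homs \<Sigma> A B" "k \<in> homs \<Sigma> B C" "A \<in> algebras \<Sigma>"
  shows "compose (Field (cpo_of A)) k h \<in> homs \<Sigma> A C"
proof (rule homsI)
  show "compose (Field (cpo_of A)) k h \<in> cont_maps (cpo_of A) (cpo_of C)"
    by (rule cont_maps_compose) (use assms homsD in auto)
  fix \<sigma> xs assume *: "\<sigma> \<in> \<Sigma> (length xs)" "set xs \<subseteq> Field (cpo_of A)"
  then have "set (map h xs) \<subseteq> Field (cpo_of B)" using homsD(3)[OF assms(1)] by auto
  moreover have e: "map (compose (Field (cpo_of A)) k h) xs = map k (map h xs)"
    using * by (auto simp: compose_def)
  ultimately show "compose (Field (cpo_of A)) k h (op_of A \<sigma> xs) = op_of C \<sigma> (map (compose (Field (cpo_of A)) k h) xs)"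
    unfolding e using * homsD(4)[OF assms(1) *] homsD(4)[OF assms(2), of \<sigma> "map h xs"]
      op_of_closed[OF assms(3) *] by (simp add: compose_def)
qed

lemma homs_id: "A \<in> algebras \<Sigma> \<Longrightarrow> (\<lambda>x\<in>Field (cpo_of A). x) \<in> homs \<Sigma> A A"
proof (rule homsI)
  assume A: "A \<in> algebras \<Sigma>"
  show "(\<lambda>x\<in>Field (cpo_of A). x) \<in> cont_maps (cpo_of A) (cpo_of A)"
    by (rule cont_maps_id) (rule algebrasD(1)[OF A])
  fix \<sigma> xs assume *: "\<sigma> \<in> \<Sigma> (length xs)" "set xs \<subseteq> Field (cpo_of A)"
  then have "map (\<lambda>x\<in>Field (cpo_of A). x) xs = xs" by (intro map_idI) auto
  then show "(\<lambda>x\<in>Field (cpo_of A). x) (op_of A \<sigma> xs) = op_of A \<sigma> (map (\<lambda>x\<in>Field (cpo_of A). x) xs)"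
    using op_of_closed[OF A *] by simp
qed

definition op_closed :: "'u signature \<Rightarrow> 'u calg \<Rightarrow> 'u set \<Rightarrow> bool" where
  "op_closed \<Sigma> A Q \<longleftrightarrow> (\<forall>\<sigma> xs. \<sigma> \<in> \<Sigma> (length xs) \<and> set xs \<subseteq> Q \<longrightarrow> op_of A \<sigma> xs \<in> Q)"

lemma op_closedD:
  "op_closed \<Sigma> A Q \<Longrightarrow> \<sigma> \<in> \<Sigma> (length xs) \<Longrightarrow> set xs \<subseteq> Q \<Longrightarrow> op_of A \<sigma> xs \<in> Q"
  unfolding op_closed_def by blast

text \<open>Minimality is phrased by closed subsets because closing up under operations and joins
  may take transfinitely many rounds. \<open>generatedD\<close> is the resulting induction
  principle.\<close>

definition generated :: "'u signature \<Rightarrow> 'u calg \<Rightarrow> 'u set \<Rightarrow> bool" where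
  "generated \<Sigma> A G \<longleftrightarrow> (\<forall>Q\<subseteq>Field (cpo_of A). G \<subseteq> Q \<and> op_closed \<Sigma> A Q \<and> join_closed (cpo_of A) Q
     \<longrightarrow> Q = Field (cpo_of A))"

lemma generatedD:
  assumes "generated \<Sigma> A G" "x \<in> Field (cpo_of A)"
    and "\<And>x. x \<in> G \<Longrightarrow> P x"
    and "\<And>\<sigma> xs. \<sigma> \<in> \<Sigma> (length xs) \<Longrightarrow> set xs \<subseteq> Field (cpo_of A) \<Longrightarrow> (\<And>x. x \<in> set xs \<Longrightarrow> P x) \<Longrightarrow> P (op_of A \<sigma> xs)"
    and "join_closed (cpo_of A) {x \<in> Field (cpo_of A). P x}"
    and "G \<subseteq> Field (cpo_of A)" "A \<in> algebras \<Sigma>"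
  shows "P x"
proof -
  have "op_closed \<Sigma> A {x \<in> Field (cpo_of A). P x}"
    unfolding op_closed_def using assms(4) op_of_closed[OF assms(7)] by blast
  moreover have "G \<subseteq> {x \<in> Field (cpo_of A). P x}" using assms(3,6) by auto
  ultimately have "{x \<in> Field (cpo_of A). P x} = Field (cpo_of A)"
    using assms(1)[unfolded generated_def, rule_format, of "{x \<in> Field (cpo_of A). P x}"] assms(5) by simp
  then show ?thesis using assms(2) by blast
qed

text \<open>The closure of the tuples \<open>\<lambda>i\<in>I. g i s\<close> inside the product of
  the algebras \<open>B i\<close> with componentwise structure. The index set may be so large that
  the product itself does not live in the universe; this closure still does.\<close>

inductive_set gen :: "'u signature \<Rightarrow> 'i set \<Rightarrow> ('i \<Rightarrow> 'u calg) \<Rightarrow> ('i \<Rightarrow> 's \<Rightarrow> 'u) \<Rightarrow> 's set \<Rightarrow> ('i \<Rightarrow> 'u) set"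
  for \<Sigma> I B g S where
  base: "s \<in> S \<Longrightarrow> (\<lambda>i\<in>I. g i s) \<in> gen \<Sigma> I B g S"
| oper: "\<sigma> \<in> \<Sigma> (length xs) \<Longrightarrow> (\<And>x. x \<in> set xs \<Longrightarrow> x \<in> gen \<Sigma> I B g S) \<Longrightarrow>
    (\<lambda>i\<in>I. op_of (B i) \<sigma> (map (\<lambda>x. x i) xs)) \<in> gen \<Sigma> I B g S"
| join: "(\<And>k. c k \<in> gen \<Sigma> I B g S) \<Longrightarrow> (\<And>i. i \<in> I \<Longrightarrow> omega_chain (cpo_of (B i)) (\<lambda>k. c k i)) \<Longrightarrow>
    (\<lambda>i\<in>I. THE y. is_join (cpo_of (B i)) (\<lambda>k. c k i) y) \<in> gen \<Sigma> I B g S"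

context small_universe
begin

text \<open>Each element of the closure is the value of a countably branching well-founded tree that
  records how it was built, and the trees over a small set of labels form a small set.\<close>

lemma gen_small:
  fixes S :: "'s set" and B :: "'i \<Rightarrow> 'u calg"
  assumes \<Sigma>: "is_signature \<Sigma>" and S: "S \<prec> U"
  shows "gen \<Sigma> I B g S \<prec> U"
proof -
  \<comment> \<open>\<open>Inl s\<close> labels a generator, \<open>Inr (Some (\<sigma>, n))\<close>
    an operation and \<open>Inr None\<close> a join. The arity is part of the label since one name
    may be used with several arities, and it tells how many children are read.\<close>
  define L :: "('s + ('u \<times> nat) option) set" where
    "L = Inl ` S \<union> Inr ` insert None (Some ` (\<Union>n. \<Sigma> n \<times> {n}))"
  have "\<Sigma> n \<prec> U" for n using \<Sigma> sm_small unfolding is_signature_def by blast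
  then have "(\<Union>n. \<Sigma> n \<times> {n}) \<prec> U" by (intro sm_UN sm_nat sm_Sigma) (auto intro: sm_finite)
  then have L: "L \<prec> U" unfolding L_def using S by (intro sm_Un sm_insert sm_image)
  \<comment> \<open>Every inner node has infinitely many children; this leaf fills the places beyond
    the arity of an operation.\<close>
  define dummy :: "('s + ('u \<times> nat) option) tree" where "dummy = Lf (Inr None)"
  define node :: "'s + ('u \<times> nat) option \<Rightarrow> (nat \<Rightarrow> 'i \<Rightarrow> 'u) \<Rightarrow> 'i \<Rightarrow> 'u" where
    "node l f = (\<lambda>i\<in>I. case l of
        Inr (Some (\<sigma>, n)) \<Rightarrow> op_of (B i) \<sigma> (map (\<lambda>k. f k i) [0..<n])
      | _ \<Rightarrow> THE y. is_join (cpo_of (B i)) (\<lambda>k. f k i) y)" for l f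
  \<comment> \<open>The recursor supplies each child paired with its value; \<open>snd\<close>
    extracts the value.\<close>
  define ev :: "('s + ('u \<times> nat) option) tree \<Rightarrow> 'i \<Rightarrow> 'u" where
    "ev = rec_tree (\<lambda>l. \<lambda>i\<in>I. g i (projl l)) (\<lambda>l q. node l (\<lambda>k. snd (q k)))"
  have ev: "ev (Lf l) = (\<lambda>i\<in>I. g i (projl l))" "ev (Nd l t) = node l (\<lambda>k. ev (t k))" for l t
    unfolding ev_def by (simp_all add: comp_def)
  have "gen \<Sigma> I B g S \<subseteq> ev ` {t. set_tree t \<subseteq> L}"
  proof
    fix x assume "x \<in> gen \<Sigma> I B g S"
    then show "x \<in> ev ` {t. set_tree t \<subseteq> L}"
    proof induction
      case (base s)
      then have "set_tree (Lf (Inl s)) \<subseteq> L" unfolding L_def by auto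
      moreover have "(\<lambda>i\<in>I. g i s) = ev (Lf (Inl s))" by (simp add: ev)
      ultimately show ?case by blast
    next
      case (oper \<sigma> xs)
      then have "\<forall>x\<in>set xs. \<exists>t. x = ev t \<and> set_tree t \<subseteq> L" by blast
      then obtain t where t: "\<And>x. x \<in> set xs \<Longrightarrow> x = ev (t x) \<and> set_tree (t x) \<subseteq> L" by metis
      define T where "T = Nd (Inr (Some (\<sigma>, length xs))) (\<lambda>k. if k < length xs then t (xs ! k) else dummy)"
      have "(\<sigma>, length xs) \<in> (\<Union>n. \<Sigma> n \<times> {n})" using oper(1) by blast
      then have "Inr (Some (\<sigma>, length xs)) \<in> L" "Inr None \<in> L" unfolding L_def by blast+
      moreover have "set_tree (if k < length xs then t (xs ! k) else dummy) \<subseteq> L" for k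
        using t[OF nth_mem, of k] \<open>Inr None \<in> L\<close> unfolding dummy_def by simp
      ultimately have "set_tree T \<subseteq> L" unfolding T_def tree.set by blast
      moreover have "map (\<lambda>x. x i) xs = map (\<lambda>k. ev (if k < length xs then t (xs ! k) else dummy) i) [0..<length xs]" for i
        using t[OF nth_mem] by (intro nth_equalityI) simp_all
      then have "(\<lambda>i\<in>I. op_of (B i) \<sigma> (map (\<lambda>x. x i) xs)) = ev T"
        unfolding T_def ev node_def by auto
      ultimately show ?case by blast
    next
      case (join c)
      then have "\<forall>k. \<exists>t. c k = ev t \<and> set_tree t \<subseteq> L" by blast
      then obtain t where t: "\<And>k. c k = ev (t k) \<and> set_tree (t k) \<subseteq> L" by metis
      then have "set_tree (Nd (Inr None) t) \<subseteq> L" by (auto simp: L_def)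
      moreover have "(\<lambda>i\<in>I. THE y. is_join (cpo_of (B i)) (\<lambda>k. c k i) y) = ev (Nd (Inr None) t)"
        unfolding ev node_def using t by auto
      ultimately show ?case by blast
    qed
  qed
  moreover have "ev ` {t. set_tree t \<subseteq> L} \<prec> U" by (rule sm_image[OF sm_trees[OF L]])
  ultimately show ?thesis by (rule sm_subset)
qed

text \<open>The closure \<open>gen\<close> is small, so it can be renamed as a subset of
  \<open>'u\<close> and be given the componentwise structure; the \<open>h i\<close> are the
  projections. Joint reflection of the order by the \<open>h i\<close> says that \<open>C\<close> is
  ordered as a subset of the product, without the product being formed as a cpo.\<close>

theorem generated_algebra:
  fixes S :: "'s set" and I :: "'i set" and B :: "'i \<Rightarrow> 'u calg"
  assumes \<Sigma>: "is_signature \<Sigma>" and S: "S \<prec> U"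
    and B: "\<And>i. i \<in> I \<Longrightarrow> B i \<in> algebras \<Sigma>"
    and g: "\<And>i s. i \<in> I \<Longrightarrow> s \<in> S \<Longrightarrow> g i s \<in> Field (cpo_of (B i))"
  obtains C e h where
    "C \<in> algebras \<Sigma>" "\<And>s. s \<in> S \<Longrightarrow> e s \<in> Field (cpo_of C)"
    "\<And>i. i \<in> I \<Longrightarrow> h i \<in> homs \<Sigma> C (B i)" "\<And>i s. i \<in> I \<Longrightarrow> s \<in> S \<Longrightarrow> h i (e s) = g i s"
    "\<And>x y. x \<in> Field (cpo_of C) \<Longrightarrow> y \<in> Field (cpo_of C) \<Longrightarrow>
      (\<And>i. i \<in> I \<Longrightarrow> (h i x, h i y) \<in> cpo_of (B i)) \<Longrightarrow> (x, y) \<in> cpo_of C"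
    "generated \<Sigma> C (e ` S)"
proof -
  let ?G = "gen \<Sigma> I B g S"
  obtain \<rho> :: "('i \<Rightarrow> 'u) \<Rightarrow> 'u" where \<rho>: "inj_on \<rho> ?G" "small (\<rho> ` ?G)"
    using sm_encode[OF gen_small[OF \<Sigma> S]] by blast
  define \<delta> where "\<delta> = inv_into ?G \<rho>"
  have \<delta>\<rho>: "\<delta> (\<rho> x) = x" if "x \<in> ?G" for x using that \<rho>(1) by (simp add: \<delta>_def)
  have \<delta>G: "\<delta> u \<in> ?G" if "u \<in> \<rho> ` ?G" for u using that by (auto simp: \<delta>\<rho>)
  have \<rho>\<delta>: "\<rho> (\<delta> u) = u" if "u \<in> \<rho> ` ?G" for u using that by (auto simp: \<delta>\<rho>)
  have Bcpo: "cpo (cpo_of (B i))" if "i \<in> I" for i using B[OF that] algebrasD(1) by blast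
  \<comment> \<open>Tuples are extensional on \<open>I\<close>, hence equal as soon as their
    components on \<open>I\<close> agree; antisymmetry of \<open>R\<close> depends on this.\<close>
  have outside: "x i = undefined" if "x \<in> ?G" "i \<notin> I" for x i
    using that by cases auto
  have mem: "x i \<in> Field (cpo_of (B i))" if "x \<in> ?G" "i \<in> I" for x i
    using that
  proof (induction)
    case (oper \<sigma> xs)
    then show ?case by (auto intro!: op_of_closed[OF B])
  next
    case (join c)
    then have "\<exists>y. chain_join (cpo_of (B i)) (\<lambda>k. c k i) y"
      by (intro chain_join_exists[OF Bcpo]) (auto simp: omega_chain_def)
    then show ?case using join.prems chain_join_the[OF Bcpo] chain_joinD(1) by fastforce
  qed (use g in auto)
  define R where "R = {(u, v). u \<in> \<rho> ` ?G \<and> v \<in> \<rho> ` ?G \<and> (\<forall>i\<in>I. (\<delta> u i, \<delta> v i) \<in> cpo_of (B i))}"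
  have FR: "Field R = \<rho> ` ?G"
  proof -
    have "(u, u) \<in> R" if "u \<in> \<rho> ` ?G" for u
      using that mem[OF \<delta>G] cpo_refl[OF Bcpo] unfolding R_def by auto
    then show ?thesis unfolding Field_def R_def by auto
  qed
  \<comment> \<open>The tuple of componentwise joins belongs to the closure by its third rule, so
    joins in \<open>R\<close> exist and are computed componentwise.\<close>
  have Rjoin: "\<exists>z. chain_join R c z \<and> (\<forall>i\<in>I. chain_join (cpo_of (B i)) (\<lambda>k. \<delta> (c k) i) (\<delta> z i))"
    if c: "\<And>k. (c k, c (Suc k)) \<in> R" for c
  proof -
    have cG: "c k \<in> \<rho> ` ?G" for k using c unfolding R_def by blast
    define z where "z = (\<lambda>i\<in>I. THE y. is_join (cpo_of (B i)) (\<lambda>k. \<delta> (c k) i) y)"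
    have zG: "z \<in> ?G" unfolding z_def
      by (rule gen.join) (use c \<delta>G[OF cG] in \<open>auto simp: R_def omega_chain_def\<close>)
    have zi: "chain_join (cpo_of (B i)) (\<lambda>k. \<delta> (c k) i) (\<delta> (\<rho> z) i)" if i: "i \<in> I" for i
    proof -
      have "(\<delta> (c k) i, \<delta> (c (Suc k)) i) \<in> cpo_of (B i)" for k using c i unfolding R_def by auto
      then obtain y where y: "chain_join (cpo_of (B i)) (\<lambda>k. \<delta> (c k) i) y"
        using chain_join_exists[OF Bcpo[OF i], of "\<lambda>k. \<delta> (c k) i"] by blast
      then have "z i = y" unfolding z_def using chain_join_the[OF Bcpo[OF i] y] i by simp
      then show ?thesis using y \<delta>\<rho>[OF zG] by simp
    qed
    have "chain_join R c (\<rho> z)"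
    proof (rule chain_joinI)
      show "(c k, c (Suc k)) \<in> R" for k by (rule c)
      show "(c k, \<rho> z) \<in> R" for k unfolding R_def using cG zG chain_joinD(3)[OF zi] by auto
      show "(\<rho> z, y) \<in> R" if "\<And>k. (c k, y) \<in> R" for y
      proof -
        have "y \<in> \<rho> ` ?G" "\<And>i k. i \<in> I \<Longrightarrow> (\<delta> (c k) i, \<delta> y i) \<in> cpo_of (B i)"
          using that unfolding R_def by auto
        then show ?thesis unfolding R_def using zG chain_join_least[OF zi] by auto
      qed
    qed
    then show ?thesis using zi by blast
  qed
  have R: "cpo R"
  proof (rule cpoI)
    show "(x, x) \<in> R" if "x \<in> Field R" for x
      using that mem[OF \<delta>G] cpo_refl[OF Bcpo] unfolding FR unfolding R_def by auto
    show "(x, z) \<in> R" if "(x, y) \<in> R" "(y, z) \<in> R" for x y z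
      using that cpo_trans[OF Bcpo] unfolding R_def by auto
    show "x = y" if "(x, y) \<in> R" "(y, x) \<in> R" for x y
    proof -
      have G: "x \<in> \<rho> ` ?G" "y \<in> \<rho> ` ?G" using that unfolding R_def by auto
      have "\<delta> x i = \<delta> y i" for i
        using that cpo_antisym[OF Bcpo] outside[OF \<delta>G[OF G(1)]] outside[OF \<delta>G[OF G(2)]]
        unfolding R_def by (cases "i \<in> I") auto
      then show ?thesis using \<rho>\<delta>[OF G(1)] \<rho>\<delta>[OF G(2)] by (metis HOL.ext)
    qed
    show "\<exists>x. is_join R c x" if "omega_chain R c" for c
      using Rjoin[of c] that unfolding omega_chain_def chain_join_def by blast
  qed
  have Rpoint: "chain_join (cpo_of (B i)) (\<lambda>k. \<delta> (c k) i) (\<delta> x i)" if "chain_join R c x" "i \<in> I" for c x i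
    using Rjoin[of c, OF chain_joinD(4)[OF that(1)]] chain_join_unique[OF R that(1)] that(2) by blast
  have RpointI: "chain_join R c x" if c: "\<And>k. c k \<in> Field R" "x \<in> Field R"
    and j: "\<And>i. i \<in> I \<Longrightarrow> chain_join (cpo_of (B i)) (\<lambda>k. \<delta> (c k) i) (\<delta> x i)" for c x
  proof (rule chain_joinI)
    show "(c k, c (Suc k)) \<in> R" "(c k, x) \<in> R" for k
      using c chain_joinD(3,4)[OF j] unfolding FR unfolding R_def by auto
    show "(x, y) \<in> R" if y: "\<And>k. (c k, y) \<in> R" for y
    proof -
      have "y \<in> \<rho> ` ?G" "\<And>i k. i \<in> I \<Longrightarrow> (\<delta> (c k) i, \<delta> y i) \<in> cpo_of (B i)"
        using y unfolding R_def by auto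
      then show ?thesis using c(2) chain_join_least[OF j] unfolding FR unfolding R_def by auto
    qed
  qed
  \<comment> \<open>The value \<open>undefined\<close> elsewhere is the normal form that
    \<open>algebras\<close> prescribes.\<close>
  define opr where "opr = (\<lambda>\<sigma> us. if \<sigma> \<in> \<Sigma> (length us) \<and> set us \<subseteq> \<rho> ` ?G
    then \<rho> (\<lambda>i\<in>I. op_of (B i) \<sigma> (map (\<lambda>u. \<delta> u i) us)) else undefined)"
  have oprG: "(\<lambda>i\<in>I. op_of (B i) \<sigma> (map (\<lambda>u. \<delta> u i) us)) \<in> ?G"
    if "\<sigma> \<in> \<Sigma> (length us)" "set us \<subseteq> \<rho> ` ?G" for \<sigma> us
    using gen.oper[where \<sigma> = \<sigma> and \<Sigma> = \<Sigma> and xs = "map \<delta> us" and S = S and I = I and g = g and B = B] that \<delta>G by (auto simp: comp_def)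
  have oprF: "opr \<sigma> us \<in> \<rho> ` ?G" and oprI: "i \<in> I \<Longrightarrow> \<delta> (opr \<sigma> us) i = op_of (B i) \<sigma> (map (\<lambda>u. \<delta> u i) us)"
    if "\<sigma> \<in> \<Sigma> (length us)" "set us \<subseteq> \<rho> ` ?G" for \<sigma> us i
    using that oprG[OF that] unfolding opr_def by (auto simp: \<delta>\<rho>)
  define C where "C = \<lparr>cpo_of = R, op_of = opr\<rparr>"
  define e where "e s = \<rho> (\<lambda>i\<in>I. g i s)" for s
  define h where "h i = (\<lambda>u\<in>\<rho> ` ?G. \<delta> u i)" for i
  have C: "C \<in> algebras \<Sigma>"
    unfolding algebras_def C_def mem_Collect_eq calg.simps
  proof (intro conjI allI ballI impI)
    show "R \<in> obj CPO" unfolding CPO_def using R FR \<rho>(2) by simp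
    show "opr \<sigma> xs = undefined" if "\<not> (\<sigma> \<in> \<Sigma> (length xs) \<and> set xs \<subseteq> Field R)" for \<sigma> xs
      using that unfolding opr_def FR by auto
    fix n \<sigma> assume \<sigma>: "\<sigma> \<in> \<Sigma> n"
    show "continuous_map (power_cpo R n) R (opr \<sigma>)"
    proof (rule continuous_mapI[OF cpo_power_cpo[OF R]])
      show "opr \<sigma> x \<in> Field R" if "x \<in> Field (power_cpo R n)" for x
        using that oprF \<sigma> unfolding field_power_cpo[OF R] FR by auto
      fix d us assume d: "chain_join (power_cpo R n) d us"
      have m: "length (d k) = n" "set (d k) \<subseteq> \<rho> ` ?G" "length us = n" "set us \<subseteq> \<rho> ` ?G" for k
        using chain_joinD(1,2)[OF d] unfolding field_power_cpo[OF R] FR by auto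
      show "chain_join R (\<lambda>k. opr \<sigma> (d k)) (opr \<sigma> us)"
      proof (rule RpointI)
        show "opr \<sigma> (d k) \<in> Field R" "opr \<sigma> us \<in> Field R" for k
          using m \<sigma> oprF unfolding FR by auto
        fix i assume i: "i \<in> I"
        have "chain_join (power_cpo (cpo_of (B i)) n) (\<lambda>k. map (\<lambda>u. \<delta> u i) (d k)) (map (\<lambda>u. \<delta> u i) us)"
          by (rule chain_join_powerI) (use m Rpoint[OF chain_join_powerD[OF R d] i] in auto)
        from continuous_mapD(3)[OF algebrasD(4)[OF B[OF i] \<sigma>] this]
        show "chain_join (cpo_of (B i)) (\<lambda>k. \<delta> (opr \<sigma> (d k)) i) (\<delta> (opr \<sigma> us) i)"
          using m \<sigma> oprI[OF _ _ i] by simp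
      qed
    qed
  qed
  show thesis
  proof (rule that[of C e h])
    show "C \<in> algebras \<Sigma>" by (fact C)
    show eF: "e s \<in> Field (cpo_of C)" if "s \<in> S" for s
      using gen.base[OF that, where \<Sigma> = \<Sigma> and I = I and B = B and g = g] by (auto simp: e_def C_def FR)
    show "h i \<in> homs \<Sigma> C (B i)" if i: "i \<in> I" for i
    proof (rule homsI)
      have "continuous_map R (cpo_of (B i)) (\<lambda>u. \<delta> u i)"
        by (rule continuous_mapI[OF R]) (use Rpoint i mem[OF \<delta>G] FR in auto)
      from cont_maps_restrict[OF this] show "h i \<in> cont_maps (cpo_of C) (cpo_of (B i))"
        by (simp add: h_def C_def FR)
      fix \<sigma> xs assume "\<sigma> \<in> \<Sigma> (length xs)" "set xs \<subseteq> Field (cpo_of C)"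
      then have *: "\<sigma> \<in> \<Sigma> (length xs)" "set xs \<subseteq> \<rho> ` ?G" by (auto simp: C_def FR)
      have m: "map (h i) xs = map (\<lambda>u. \<delta> u i) xs" unfolding h_def using *(2) by auto
      show "h i (op_of C \<sigma> xs) = op_of (B i) \<sigma> (map (h i) xs)"
        unfolding m using oprF[OF *] oprI[OF * i] by (simp add: C_def h_def)
    qed
    show "h i (e s) = g i s" if "i \<in> I" "s \<in> S" for i s
      using gen.base[OF that(2), where \<Sigma> = \<Sigma> and I = I and B = B and g = g] that by (simp add: h_def e_def \<delta>\<rho>)
    show "(x, y) \<in> cpo_of C" if "x \<in> Field (cpo_of C)" "y \<in> Field (cpo_of C)"
      "\<And>i. i \<in> I \<Longrightarrow> (h i x, h i y) \<in> cpo_of (B i)" for x y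
    proof -
      have "x \<in> \<rho> ` ?G" "y \<in> \<rho> ` ?G" using that(1,2) by (simp_all add: C_def FR)
      then show ?thesis using that(3) by (simp add: h_def C_def R_def)
    qed
    show "generated \<Sigma> C (e ` S)"
      unfolding generated_def
    proof (intro allI impI, elim conjE)
      fix Q assume Q: "Q \<subseteq> Field (cpo_of C)" "e ` S \<subseteq> Q" "op_closed \<Sigma> C Q" "join_closed (cpo_of C) Q"
      have "\<rho> x \<in> Q" if "x \<in> ?G" for x
        using that
      proof (induction)
        case (base s)
        then have "e s \<in> Q" using Q(2) by blast
        then show ?case unfolding e_def restrict_def .
      next
        case (oper \<sigma> xs)
        have "op_of C \<sigma> (map \<rho> xs) \<in> Q"
          by (rule op_closedD[OF Q(3)]) (use oper in auto)
        moreover have "set (map \<rho> xs) \<subseteq> \<rho> ` ?G" using oper by auto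
        then have "op_of C \<sigma> (map \<rho> xs) = \<rho> (\<lambda>i\<in>I. op_of (B i) \<sigma> (map (\<lambda>u. \<delta> u i) (map \<rho> xs)))"
          using oper unfolding C_def opr_def by simp
        moreover have "map (\<lambda>u. \<delta> u i) (map \<rho> xs) = map (\<lambda>x. x i) xs" for i
          using oper \<delta>\<rho> by auto
        ultimately show ?case by (simp only: restrict_def)
      next
        case (join c)
        have "(\<rho> (c k), \<rho> (c (Suc k))) \<in> R" for k
          using join(1,2) \<delta>\<rho> unfolding R_def omega_chain_def by auto
        from Rjoin[of "\<lambda>k. \<rho> (c k)", OF this] obtain z where z: "chain_join R (\<lambda>k. \<rho> (c k)) z"
          "\<And>i. i \<in> I \<Longrightarrow> chain_join (cpo_of (B i)) (\<lambda>k. \<delta> (\<rho> (c k)) i) (\<delta> z i)" by blast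
        have zG: "z \<in> \<rho> ` ?G" using chain_joinD(1)[OF z(1)] FR by simp
        have "(\<lambda>i\<in>I. THE y. is_join (cpo_of (B i)) (\<lambda>k. c k i) y) = \<delta> z"
        proof
          fix i show "(\<lambda>i\<in>I. THE y. is_join (cpo_of (B i)) (\<lambda>k. c k i) y) i = \<delta> z i"
            using chain_join_the[OF Bcpo z(2)] outside[OF \<delta>G[OF zG]] join(1) \<delta>\<rho> by (cases "i \<in> I") auto
        qed
        moreover have "z \<in> Q"
          by (rule join_closedD[OF Q(4), of "\<lambda>k. \<rho> (c k)"]) (use z(1) join.IH in \<open>auto simp: C_def\<close>)
        ultimately show ?case using \<rho>\<delta>[OF zG] by (simp add: restrict_def)
      qed
      then show "Q = Field (cpo_of C)" using Q(1) by (auto simp: C_def FR)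
    qed
  qed
qed

end


section \<open>Evaluation of extended terms\<close>

lemma teval_closed:
  assumes "A \<in> algebras \<Sigma>" "t \<in> trms \<Sigma>" "range f \<subseteq> Field (cpo_of A)"
  shows "teval A f t \<in> Field (cpo_of A)"
  using assms(2)
proof induction
  case (Op \<sigma> ts)
  then show ?case by (auto intro!: op_of_closed[OF assms(1)])
qed (use assms in auto)

lemma teval_hom:
  assumes h: "h \<in> homs \<Sigma> A B" and A: "A \<in> algebras \<Sigma>" and t: "t \<in> trms \<Sigma>"
    and f: "range f \<subseteq> Field (cpo_of A)"
  shows "teval B (\<lambda>v. h (f v)) t = h (teval A f t)"
  using t
proof induction
  case (Op \<sigma> ts)
  have "set (map (teval A f) ts) \<subseteq> Field (cpo_of A)"
    using Op teval_closed[OF A _ f] by auto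
  then have "h (teval A f (trm.Op \<sigma> ts)) = op_of B \<sigma> (map h (map (teval A f) ts))"
    using homsD(4)[OF h, of \<sigma> "map (teval A f) ts"] Op by simp
  also have "map h (map (teval A f) ts) = map (teval B (\<lambda>v. h (f v))) ts" using Op by auto
  finally show ?case by simp
qed simp

lemma teval_cong: "(\<And>v. v \<in> vars t \<Longrightarrow> f v = g v) \<Longrightarrow> teval A f t = teval A g t"
proof (induction t)
  case (Op \<sigma> ts)
  then have "map (teval A f) ts = map (teval A g) ts" by (intro map_cong) auto
  then show ?case by (simp del: map_eq_conv)
qed simp

lemma xeval_cong: "(\<And>v. v \<in> xvars t \<Longrightarrow> f v = g v) \<Longrightarrow> xeval A f t = xeval A g t"
proof (induction t)
  case (Trm t)
  then show ?case using teval_cong[of t f g A] by simp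
next
  case (Join t)
  then have "xeval A f (t k) = xeval A g (t k)" for k by auto
  then show ?case by simp
qed

text \<open>In a cpo the definite description in \<open>xeval\<close> denotes an actual join. From
  here on definedness and value of a formal join are handled together.\<close>

lemma xeval_Join:
  assumes "cpo (cpo_of A)"
  shows "xeval A f (Join t) = Some x \<longleftrightarrow>
    (\<exists>c. (\<forall>k. xeval A f (t k) = Some (c k)) \<and> chain_join (cpo_of A) c x)"
proof
  assume *: "xeval A f (Join t) = Some x"
  define c where "c = (\<lambda>k. the (xeval A f (t k)))"
  from * have c: "\<forall>k. xeval A f (t k) = Some (c k)" "omega_chain (cpo_of A) c"
    and x: "x = (THE x. is_join (cpo_of A) c x)"
    by (auto simp: c_def split: if_splits)
  obtain y where "chain_join (cpo_of A) c y"
    using chain_join_exists[OF assms, of c] c(2) unfolding omega_chain_def by blast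
  then show "\<exists>c. (\<forall>k. xeval A f (t k) = Some (c k)) \<and> chain_join (cpo_of A) c x"
    using chain_join_the[OF assms] x c(1) by blast
next
  assume "\<exists>c. (\<forall>k. xeval A f (t k) = Some (c k)) \<and> chain_join (cpo_of A) c x"
  then obtain c where c: "\<And>k. xeval A f (t k) = Some (c k)" "chain_join (cpo_of A) c x" by blast
  then show "xeval A f (Join t) = Some x"
    using chain_join_the[OF assms c(2)] by (simp add: chain_join_def)
qed

lemma xeval_closed:
  assumes "A \<in> algebras \<Sigma>" "t \<in> xtrms \<Sigma>" "range f \<subseteq> Field (cpo_of A)" "xeval A f t = Some x"
  shows "x \<in> Field (cpo_of A)"
  using assms(2,4)
proof (induction arbitrary: x)
  case (Trm t) then show ?case using teval_closed[OF assms(1) _ assms(3)] by auto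
next
  case (Join t) then show ?case unfolding xeval_Join[OF algebrasD(1)[OF assms(1)]] using chain_joinD(1) by fast
qed

lemma xeval_hom:
  assumes h: "h \<in> homs \<Sigma> A B" and A: "A \<in> algebras \<Sigma>" and B: "B \<in> algebras \<Sigma>"
    and t: "t \<in> xtrms \<Sigma>" and f: "range f \<subseteq> Field (cpo_of A)" and x: "xeval A f t = Some x"
  shows "xeval B (\<lambda>v. h (f v)) t = Some (h x)"
  using t x
proof (induction arbitrary: x)
  case (Trm t) then show ?case using teval_hom[OF h A _ f] by auto
next
  case (Join t)
  from Join.prems obtain c where c: "\<And>k. xeval A f (t k) = Some (c k)" "chain_join (cpo_of A) c x"
    unfolding xeval_Join[OF algebrasD(1)[OF A]] by blast
  have "chain_join (cpo_of B) (\<lambda>k. h (c k)) (h x)"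
    by (rule continuous_mapD(3)[OF homsD(2)[OF h] c(2)])
  then show ?case unfolding xeval_Join[OF algebrasD(1)[OF B]]
    using Join.IH[OF c(1)] by (intro exI[of _ "\<lambda>k. h (c k)"]) simp
qed

text \<open>Homomorphisms only push definedness forward. A family that jointly reflects the order
  also pulls it back, since the values of the \<open>t k\<close> form a chain in \<open>A\<close>
  once their images form chains in all \<open>B i\<close>.\<close>

lemma xeval_reflect:
  assumes A: "A \<in> algebras \<Sigma>" and B: "\<And>i. i \<in> I \<Longrightarrow> B i \<in> algebras \<Sigma>"
    and h: "\<And>i. i \<in> I \<Longrightarrow> h i \<in> homs \<Sigma> A (B i)"
    and r: "\<And>x y. x \<in> Field (cpo_of A) \<Longrightarrow> y \<in> Field (cpo_of A) \<Longrightarrow>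
      (\<And>i. i \<in> I \<Longrightarrow> (h i x, h i y) \<in> cpo_of (B i)) \<Longrightarrow> (x, y) \<in> cpo_of A"
    and f: "range f \<subseteq> Field (cpo_of A)" and t: "t \<in> xtrms \<Sigma>"
    and d: "\<And>i. i \<in> I \<Longrightarrow> xeval (B i) (\<lambda>v. h i (f v)) t \<noteq> None"
  shows "\<exists>x. xeval A f t = Some x"
  using t d
proof (induction)
  case (Join t)
  have j: "\<exists>c x. (\<forall>k. xeval (B i) (\<lambda>v. h i (f v)) (t k) = Some (c k)) \<and> chain_join (cpo_of (B i)) c x"
    if "i \<in> I" for i
    using Join.prems[OF that] xeval_Join[OF algebrasD(1)[OF B[OF that]]] by fast
  then have "\<forall>k. \<exists>x. xeval A f (t k) = Some x" using Join.IH by fastforce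
  then obtain c where c: "\<And>k. xeval A f (t k) = Some (c k)" by metis
  have "(c k, c (Suc k)) \<in> cpo_of A" for k
  proof (rule r)
    show "c k \<in> Field (cpo_of A)" "c (Suc k) \<in> Field (cpo_of A)"
      using xeval_closed[OF A Join.hyps(1) f c] by auto
    fix i assume i: "i \<in> I"
    have e: "xeval (B i) (\<lambda>v. h i (f v)) (t k) = Some (h i (c k))" for k
      by (rule xeval_hom[OF h[OF i] A B[OF i] Join.hyps(1) f c])
    from j[OF i] obtain d x where "\<And>k. xeval (B i) (\<lambda>v. h i (f v)) (t k) = Some (d k)"
      "chain_join (cpo_of (B i)) d x" by blast
    moreover from this(1) have "d k = h i (c k)" for k using e[of k] by simp
    ultimately show "(h i (c k), h i (c (Suc k))) \<in> cpo_of (B i)" using chain_joinD(4) by metis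
  qed
  then obtain x where "chain_join (cpo_of A) c x"
    using chain_join_exists[OF algebrasD(1)[OF A]] by blast
  then show ?case using c xeval_Join[OF algebrasD(1)[OF A]] by blast
qed simp

text \<open>Closure of equational classes under subalgebras of products, where the subalgebra is
  given by a jointly order-reflecting family of homomorphisms.\<close>

lemma satisfies_reflect:
  assumes A: "A \<in> algebras \<Sigma>" and B: "\<And>i. i \<in> I \<Longrightarrow> B i \<in> algebras \<Sigma>"
    and h: "\<And>i. i \<in> I \<Longrightarrow> h i \<in> homs \<Sigma> A (B i)"
    and r: "\<And>x y. x \<in> Field (cpo_of A) \<Longrightarrow> y \<in> Field (cpo_of A) \<Longrightarrow>
      (\<And>i. i \<in> I \<Longrightarrow> (h i x, h i y) \<in> cpo_of (B i)) \<Longrightarrow> (x, y) \<in> cpo_of A"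
    and e: "e \<in> xtrms \<Sigma> \<times> xtrms \<Sigma>" and s: "\<And>i. i \<in> I \<Longrightarrow> satisfies (B i) e"
  shows "satisfies A e"
  unfolding satisfies_def
proof (intro allI impI)
  fix f :: "nat \<Rightarrow> 'a" assume f: "range f \<subseteq> Field (cpo_of A)"
  have hf: "range (\<lambda>v. h i (f v)) \<subseteq> Field (cpo_of (B i))" if "i \<in> I" for i
    using homsD(3)[OF h[OF that]] f by blast
  have t: "fst e \<in> xtrms \<Sigma>" "snd e \<in> xtrms \<Sigma>" using e by auto
  have s': "\<exists>x. xeval (B i) (\<lambda>v. h i (f v)) (fst e) = Some x \<and> xeval (B i) (\<lambda>v. h i (f v)) (snd e) = Some x"
    if "i \<in> I" for i
    using s[OF that] hf[OF that] unfolding satisfies_def by blast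
  have d: "xeval (B i) (\<lambda>v. h i (f v)) (fst e) \<noteq> None" "xeval (B i) (\<lambda>v. h i (f v)) (snd e) \<noteq> None"
    if "i \<in> I" for i
    using s'[OF that] by auto
  obtain x where x: "xeval A f (fst e) = Some x"
    using xeval_reflect[of A \<Sigma> I B h f, OF A B h r f t(1) d(1)] by blast
  obtain y where y: "xeval A f (snd e) = Some y"
    using xeval_reflect[of A \<Sigma> I B h f, OF A B h r f t(2) d(2)] by blast
  have F: "x \<in> Field (cpo_of A)" "y \<in> Field (cpo_of A)"
    using xeval_closed[OF A t(1) f x] xeval_closed[OF A t(2) f y] by auto
  have "h i x = h i y" if "i \<in> I" for i
    using s'[OF that] xeval_hom[OF h[OF that] A B[OF that] t(1) f x]
      xeval_hom[OF h[OF that] A B[OF that] t(2) f y] by auto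
  then have "(h i x, h i y) \<in> cpo_of (B i)" "(h i y, h i x) \<in> cpo_of (B i)" if "i \<in> I" for i
    using that cpo_refl[OF algebrasD(1)[OF B[OF that]] homsD(3)[OF h[OF that] F(2)]] by auto
  then have "x = y" using r[OF F] r[OF F(2,1)] cpo_antisym[OF algebrasD(1)[OF A]] by blast
  then show "\<exists>x. xeval A f (fst e) = Some x \<and> xeval A f (snd e) = Some x" using x y by blast
qed

text \<open>A non-surjective \<open>h\<close> transfers an equation to the assignments with values
  in its image. This is what is available for the map from a free algebra on a finite set into a
  presented algebra.\<close>

lemma satisfies_image:
  assumes A: "A \<in> algebras \<Sigma>" and B: "B \<in> algebras \<Sigma>" and h: "h \<in> homs \<Sigma> A B"
    and e: "e \<in> xtrms \<Sigma> \<times> xtrms \<Sigma>" and s: "satisfies A e"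
    and f: "\<And>v. f v \<in> h ` Field (cpo_of A)"
  shows "\<exists>x. xeval B f (fst e) = Some x \<and> xeval B f (snd e) = Some x"
proof -
  have "\<forall>v. \<exists>x. x \<in> Field (cpo_of A) \<and> f v = h x" using f by blast
  then obtain g where g: "\<And>v. g v \<in> Field (cpo_of A)" "\<And>v. f v = h (g v)" by metis
  then have r: "range g \<subseteq> Field (cpo_of A)" by blast
  then obtain x where "xeval A g (fst e) = Some x" "xeval A g (snd e) = Some x"
    using s unfolding satisfies_def by blast
  moreover have "f = (\<lambda>v. h (g v))" using g by auto
  ultimately show ?thesis using xeval_hom[OF h A B _ r] e by (metis mem_Times_iff)
qed

lemma satisfies_surj:
  assumes "A \<in> algebras \<Sigma>" "B \<in> algebras \<Sigma>" "h \<in> homs \<Sigma> A B" "e \<in> xtrms \<Sigma> \<times> xtrms \<Sigma>" "satisfies A e"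
    and "Field (cpo_of B) \<subseteq> h ` Field (cpo_of A)"
  shows "satisfies B e"
  unfolding satisfies_def
proof (intro allI impI)
  fix f :: "nat \<Rightarrow> 'a" assume "range f \<subseteq> Field (cpo_of B)"
  then have "f v \<in> h ` Field (cpo_of A)" for v using assms(6) by blast
  then show "\<exists>x. xeval B f (fst e) = Some x \<and> xeval B f (snd e) = Some x"
    by (rule satisfies_image[OF assms(1-5)])
qed

lemma teval_continuous:
  assumes A: "A \<in> algebras \<Sigma>" and t: "t \<in> trms \<Sigma>"
    and f: "\<And>v. chain_join (cpo_of A) (\<lambda>m. f m v) (g v)"
  shows "chain_join (cpo_of A) (\<lambda>m. teval A (f m) t) (teval A g t)"
  using t
proof induction
  case (Op \<sigma> ts)
  have "chain_join (power_cpo (cpo_of A) (length ts)) (\<lambda>m. map (teval A (f m)) ts) (map (teval A g) ts)"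
    by (rule chain_join_powerI) (use Op in auto)
  from continuous_mapD(3)[OF algebrasD(4)[OF A Op.hyps(1)] this] show ?case by simp
qed (use f in simp)

lemma xeval_continuous:
  assumes A: "A \<in> algebras \<Sigma>" and t: "t \<in> xtrms \<Sigma>"
    and f: "\<And>v. chain_join (cpo_of A) (\<lambda>m. f m v) (g v)"
    and y: "\<And>m. xeval A (f m) t = Some (y m)"
  shows "\<exists>z. xeval A g t = Some z \<and> chain_join (cpo_of A) y z"
  using t y
proof (induction arbitrary: y)
  case (Trm t)
  then have "y = (\<lambda>m. teval A (f m) t)" by auto
  then show ?case using teval_continuous[OF A Trm.hyps, of f g, OF f] by simp
next
  case (Join t)
  have Ac: "cpo (cpo_of A)" by (rule algebrasD(1)[OF A])
  have "\<forall>m. \<exists>c. (\<forall>k. xeval A (f m) (t k) = Some (c k)) \<and> chain_join (cpo_of A) c (y m)"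
    using Join.prems unfolding xeval_Join[OF Ac] by blast
  then obtain c where c: "\<And>m k. xeval A (f m) (t k) = Some (c m k)"
    "\<And>m. chain_join (cpo_of A) (c m) (y m)" by metis
  have "\<exists>z. xeval A g (t k) = Some z \<and> chain_join (cpo_of A) (\<lambda>m. c m k) z" for k
    by (rule Join.IH) (rule c(1))
  then obtain z where z: "\<And>k. xeval A g (t k) = Some (z k)"
    "\<And>k. chain_join (cpo_of A) (\<lambda>m. c m k) (z k)" by metis
  have "(z k, z (Suc k)) \<in> cpo_of A" for k
    by (rule chain_join_le[OF Ac z(2) z(2)]) (rule chain_joinD(4)[OF c(2)])
  then obtain w where w: "chain_join (cpo_of A) z w" using chain_join_exists[OF Ac] by blast
  have "chain_join (cpo_of A) y w"
    by (rule chain_join_swap[OF Ac z(2) c(2) w])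
  moreover have "xeval A g (Join t) = Some w" unfolding xeval_Join[OF Ac] using z(1) w by blast
  ultimately show ?case by blast
qed

lemma finite_vars: "finite (vars t)"
  by (induction t) auto

lemma finite_xvars: "t \<in> xtrms \<Sigma> \<Longrightarrow> finite (xvars t)"
  by (induction rule: xtrms.induct) (auto simp: finite_vars)

text \<open>Density in the iterated sense: an element may be reached from \<open>G\<close> by
  repeated joins and need not be the join of a single chain in \<open>G\<close>.\<close>

definition join_dense :: "'a rel \<Rightarrow> 'a set \<Rightarrow> bool" where
  "join_dense A G \<longleftrightarrow> (\<forall>Q\<subseteq>Field A. G \<subseteq> Q \<and> join_closed A Q \<longrightarrow> Q = Field A)"

lemma join_denseD:
  assumes "join_dense A G" "x \<in> Field A" "G \<subseteq> Field A" "\<And>x. x \<in> G \<Longrightarrow> P x"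
    "join_closed A {x \<in> Field A. P x}"
  shows "P x"
proof -
  have "G \<subseteq> {x \<in> Field A. P x}" using assms by auto
  then have "{x \<in> Field A. P x} = Field A"
    using assms(1)[unfolded join_dense_def, rule_format, of "{x \<in> Field A. P x}"] assms(5) by simp
  then show ?thesis using assms(2) by blast
qed

text \<open>The variables of the equation are released from \<open>G\<close> one after the other;
  each release is an instance of density, as the values admissible for one variable are closed under
  joins by \<open>xeval_continuous\<close>. The process ends since extended terms have finitely many
  variables.\<close>

lemma satisfies_dense:
  assumes A: "A \<in> algebras \<Sigma>" and G: "join_dense (cpo_of A) G" "G \<subseteq> Field (cpo_of A)"
    and e: "e \<in> xtrms \<Sigma> \<times> xtrms \<Sigma>"
    and s: "\<And>f. range f \<subseteq> Field (cpo_of A) \<Longrightarrow> (\<And>v. v \<in> xvars (fst e) \<union> xvars (snd e) \<Longrightarrow> f v \<in> G) \<Longrightarrow>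
      \<exists>x. xeval A f (fst e) = Some x \<and> xeval A f (snd e) = Some x"
  shows "satisfies A e"
proof -
  have t: "fst e \<in> xtrms \<Sigma>" "snd e \<in> xtrms \<Sigma>" using e by auto
  let ?V = "xvars (fst e) \<union> xvars (snd e)"
  let ?s = "\<lambda>f. \<exists>x. xeval A f (fst e) = Some x \<and> xeval A f (snd e) = Some x"
  have Ac: "cpo (cpo_of A)" by (rule algebrasD(1)[OF A])
  \<comment> \<open>\<open>W\<close> collects the variables already released: they take arbitrary
    values, whereas the other variables of the equation still take values in
    \<open>G\<close>.\<close>
  have *: "?s f" if "finite W" "range f \<subseteq> Field (cpo_of A)" "\<And>v. v \<in> ?V - W \<Longrightarrow> f v \<in> G" for W f
    using that
  proof (induction W arbitrary: f rule: finite_induct)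
    case empty
    then show ?case using s by simp
  next
    case (insert w W)
    have "?s (f(w := x))" if x: "x \<in> Field (cpo_of A)" for x
    proof (rule join_denseD[OF G(1) x G(2), where P = "\<lambda>x. ?s (f(w := x))"])
      show "?s (f(w := x))" if "x \<in> G" for x
      proof (rule insert.IH)
        show "range (f(w := x)) \<subseteq> Field (cpo_of A)" using that insert.prems G by auto
        show "(f(w := x)) v \<in> G" if "v \<in> ?V - W" for v
          using insert.prems(2)[of v] that \<open>x \<in> G\<close> by (cases "v = w") auto
      qed
      show "join_closed (cpo_of A) {x \<in> Field (cpo_of A). ?s (f(w := x))}"
      proof (rule join_closedI)
        fix c x assume c: "\<And>k. c k \<in> {x \<in> Field (cpo_of A). ?s (f(w := x))}"
          and x: "chain_join (cpo_of A) c x"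
        have "\<forall>k. \<exists>y. xeval A (f(w := c k)) (fst e) = Some y \<and> xeval A (f(w := c k)) (snd e) = Some y"
          using c by blast
        then obtain y where y: "\<And>k. xeval A (f(w := c k)) (fst e) = Some (y k)"
          "\<And>k. xeval A (f(w := c k)) (snd e) = Some (y k)" by metis
        have j: "chain_join (cpo_of A) (\<lambda>k. (f(w := c k)) v) ((f(w := x)) v)" for v
        proof (cases "v = w")
          case False
          then show ?thesis using chain_join_const[OF Ac, of "f v"] insert.prems(1) by auto
        qed (use x in simp)
        have "?s (f(w := x))"
          using xeval_continuous[of A \<Sigma> "fst e" "\<lambda>k. f(w := c k)" "f(w := x)" y, OF A t(1) j y(1)]
            xeval_continuous[of A \<Sigma> "snd e" "\<lambda>k. f(w := c k)" "f(w := x)" y, OF A t(2) j y(2)]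
            chain_join_unique[OF Ac] by blast
        then show "x \<in> {x \<in> Field (cpo_of A). ?s (f(w := x))}" using chain_joinD(1)[OF x] by blast
      qed
    qed
    from this[of "f w"] insert.prems(1) show ?case by auto
  qed
  show ?thesis unfolding satisfies_def
    using *[of ?V] finite_xvars[OF t(1)] finite_xvars[OF t(2)] by auto
qed


section \<open>Cpos presented by generators and joins\<close>

text \<open>Induction on the length. With the head in \<open>G\<close>, density of the shorter lists
  frees the tail; with an arbitrary tail fixed, density of \<open>G\<close> frees the head.\<close>

lemma join_dense_power:
  assumes C: "cpo C" and G: "join_dense C G" "G \<subseteq> Field C"
  shows "join_dense (power_cpo C n) {xs. length xs = n \<and> set xs \<subseteq> G}"
proof (induction n)
  case 0
  show ?case unfolding join_dense_def field_power_cpo[OF C] by auto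
next
  case (Suc n)
  show ?case unfolding join_dense_def
  proof (intro allI impI, elim conjE)
    fix Q assume Q: "Q \<subseteq> Field (power_cpo C (Suc n))"
      "{xs. length xs = Suc n \<and> set xs \<subseteq> G} \<subseteq> Q" "join_closed (power_cpo C (Suc n)) Q"
    have GF: "{xs. length xs = n \<and> set xs \<subseteq> G} \<subseteq> Field (power_cpo C n)"
      using G(2) by (auto simp: field_power_cpo[OF C])
    have s: "s # xs \<in> Q" if "s \<in> G" "xs \<in> Field (power_cpo C n)" for s xs
    proof (rule join_denseD[OF Suc that(2) GF])
      show "s # xs \<in> Q" if "xs \<in> {xs. length xs = n \<and> set xs \<subseteq> G}" for xs
        by (rule subsetD[OF Q(2)]) (use that \<open>s \<in> G\<close> in auto)
      show "join_closed (power_cpo C n) {xs \<in> Field (power_cpo C n). s # xs \<in> Q}"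
      proof (rule join_closedI)
        fix c xs assume c: "\<And>k. c k \<in> {xs \<in> Field (power_cpo C n). s # xs \<in> Q}"
          "chain_join (power_cpo C n) c xs"
        have "s \<in> Field C" using \<open>s \<in> G\<close> G(2) by blast
        then have "chain_join (power_cpo C (Suc n)) (\<lambda>k. s # c k) (s # xs)"
          using chain_join_Cons[OF C chain_join_const[OF C] c(2)] by blast
        then have "s # xs \<in> Q" using join_closedD[OF Q(3), of "\<lambda>k. s # c k"] c(1) by blast
        then show "xs \<in> {xs \<in> Field (power_cpo C n). s # xs \<in> Q}" using chain_joinD(1)[OF c(2)] by blast
      qed
    qed
    have "x # xs \<in> Q" if x: "x \<in> Field C" and xs: "xs \<in> Field (power_cpo C n)" for x xs
    proof (rule join_denseD[OF G(1) x G(2)])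
      show "s # xs \<in> Q" if "s \<in> G" for s by (rule s[OF that xs])
      show "join_closed C {x \<in> Field C. x # xs \<in> Q}"
      proof (rule join_closedI)
        fix c x assume c: "\<And>k. c k \<in> {x \<in> Field C. x # xs \<in> Q}" "chain_join C c x"
        have "chain_join (power_cpo C (Suc n)) (\<lambda>k. c k # xs) (x # xs)"
          by (rule chain_join_Cons[OF C c(2) chain_join_const[OF cpo_power_cpo[OF C] xs]])
        then have "x # xs \<in> Q" using join_closedD[OF Q(3), of "\<lambda>k. c k # xs"] c(1) by blast
        then show "x \<in> {x \<in> Field C. x # xs \<in> Q}" using chain_joinD(1)[OF c(2)] by blast
      qed
    qed
    then have "Field (power_cpo C (Suc n)) \<subseteq> Q"
      by (auto simp: field_power_cpo[OF C] length_Suc_conv)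
    then show "Q = Field (power_cpo C (Suc n))" using Q(1) by blast
  qed
qed

text \<open>A pair in \<open>J\<close> is a relation of a presentation: a sequence of generators and
  the generator that has to become its join. A constant sequence forces two generators to be
  equal.\<close>

definition model :: "((nat \<Rightarrow> 's) \<times> 's) set \<Rightarrow> 'a rel \<Rightarrow> ('s \<Rightarrow> 'a) \<Rightarrow> bool" where
  "model J D g \<longleftrightarrow> (\<forall>(c, s)\<in>J. chain_join D (\<lambda>k. g (c k)) (g s))"

text \<open>The cpo presented by \<open>S\<close> and \<open>J\<close>, up to isomorphism.
  Join-density makes the extension \<open>h\<close> unique, in place of an explicit uniqueness
  clause.\<close>

definition free_cpo :: "'s set \<Rightarrow> ((nat \<Rightarrow> 's) \<times> 's) set \<Rightarrow> 'u rel \<Rightarrow> ('s \<Rightarrow> 'u) \<Rightarrow> bool" where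
  "free_cpo S J C e \<longleftrightarrow> C \<in> obj CPO \<and> e ` S \<subseteq> Field C \<and> model J C e \<and> join_dense C (e ` S) \<and>
     (\<forall>D\<in>obj CPO. \<forall>g :: 's \<Rightarrow> 'u. g ` S \<subseteq> Field D \<and> model J D g \<longrightarrow>
        (\<exists>h\<in>cont_maps C D. \<forall>s\<in>S. h (e s) = g s))"

lemma CPO_cpo: "A \<in> obj CPO \<Longrightarrow> cpo A"
  unfolding CPO_def by simp

lemma CPO_small: "A \<in> obj CPO \<Longrightarrow> small (Field A)"
  unfolding CPO_def by simp

text \<open>A cpo is an algebra for the empty signature; in this way
  \<open>generated_algebra\<close> also serves to construct presented cpos.\<close>

definition plain :: "'u rel \<Rightarrow> 'u calg" where
  "plain D = \<lparr>cpo_of = D, op_of = \<lambda>_ _. undefined\<rparr>"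

lemma plain_algebra: "D \<in> obj CPO \<Longrightarrow> plain D \<in> algebras (\<lambda>_. {})"
  unfolding plain_def algebras_def by auto

lemma plain_homs: "homs (\<lambda>_. {}) A B = cont_maps (cpo_of A) (cpo_of B)"
  unfolding homs_def by auto

context small_universe
begin

text \<open>The sub-cpo generated by \<open>S\<close> in the product of all models has the universal
  property by its projections. It is itself a model, since joins are detected by the
  order-reflecting projections.\<close>

lemma free_cpo_exists:
  fixes S :: "'s set"
  assumes S: "S \<prec> U" and J: "\<And>c s. (c, s) \<in> J \<Longrightarrow> range c \<subseteq> S \<and> s \<in> S"
  shows "\<exists>(C :: 'u rel) e. free_cpo S J C e"
proof -
  \<comment> \<open>All models in the universe, indexing the components of the product. This index
    set need not be small.\<close>
  define I :: "('u rel \<times> ('s \<Rightarrow> 'u)) set" where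
    "I = {(D, g). D \<in> obj CPO \<and> g ` S \<subseteq> Field D \<and> model J D g}"
  have "{} \<prec> U" by (rule sm_finite) simp
  then have \<Sigma>: "is_signature (\<lambda>_. {} :: 'u set)" unfolding is_signature_def using sm_small by blast
  obtain C :: "'u calg" and e h where
    C: "C \<in> algebras (\<lambda>_. {})" "\<And>s. s \<in> S \<Longrightarrow> e s \<in> Field (cpo_of C)"
    and h: "\<And>i. i \<in> I \<Longrightarrow> h i \<in> homs (\<lambda>_. {}) C (plain (fst i))" "\<And>i s. i \<in> I \<Longrightarrow> s \<in> S \<Longrightarrow> h i (e s) = snd i s"
    and r: "\<And>x y. x \<in> Field (cpo_of C) \<Longrightarrow> y \<in> Field (cpo_of C) \<Longrightarrow>
      (\<And>i. i \<in> I \<Longrightarrow> (h i x, h i y) \<in> cpo_of (plain (fst i))) \<Longrightarrow> (x, y) \<in> cpo_of C"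
    and gen: "generated (\<lambda>_. {}) C (e ` S)"
    by (rule generated_algebra[OF \<Sigma> S, of I "\<lambda>i. plain (fst i)" snd])
       (auto simp: I_def plain_algebra, auto simp: plain_def)
  have "free_cpo S J (cpo_of C) e"
    unfolding free_cpo_def
  proof (intro conjI ballI allI impI)
    show "cpo_of C \<in> obj CPO" "e ` S \<subseteq> Field (cpo_of C)" using C algebrasD(3) by auto
    show "join_dense (cpo_of C) (e ` S)"
      using gen unfolding join_dense_def generated_def op_closed_def by simp
    show "\<exists>h\<in>cont_maps (cpo_of C) D. \<forall>s\<in>S. h (e s) = g s"
      if "D \<in> obj CPO" "g ` S \<subseteq> Field D \<and> model J D g"
      for D :: "'u rel" and g
      using that h[of "(D, g)"] by (auto simp: I_def plain_homs plain_def)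
    show "model J (cpo_of C) e"
      unfolding model_def
    proof clarify
      fix c s assume cs: "(c, s) \<in> J"
      then have S: "c k \<in> S" "s \<in> S" for k using J[OF cs] by auto
      have j: "chain_join (fst i) (\<lambda>k. h i (e (c k))) (h i (e s))" if "i \<in> I" for i
        using that cs S h(2)[OF that] unfolding I_def model_def by auto
      show "chain_join (cpo_of C) (\<lambda>k. e (c k)) (e s)"
      proof (rule chain_joinI)
        show "(e (c k), e (c (Suc k))) \<in> cpo_of C" "(e (c k), e s) \<in> cpo_of C" for k
          by (rule r; use C(2) S chain_joinD(3,4)[OF j] in \<open>simp add: plain_def\<close>)+
        fix y assume y: "\<And>k. (e (c k), y) \<in> cpo_of C"
        show "(e s, y) \<in> cpo_of C"
        proof (rule r)
          show "e s \<in> Field (cpo_of C)" "y \<in> Field (cpo_of C)" using C(2) S y by (auto intro: FieldI2)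
          fix i assume i: "i \<in> I"
          have "continuous_map (cpo_of C) (fst i) (h i)"
            using h(1)[OF i] by (auto simp: plain_homs plain_def dest: cont_mapsD)
          from chain_join_least[OF j[OF i] continuous_mapD(2)[OF this y]]
          show "(h i (e s), h i y) \<in> cpo_of (plain (fst i))" by (simp add: plain_def)
        qed
      qed
    qed
  qed
  then show ?thesis by blast
qed

end

lemma free_cpoD:
  assumes "free_cpo S J C e"
  shows "cpo C" "C \<in> obj CPO" "s \<in> S \<Longrightarrow> e s \<in> Field C" "(c, s) \<in> J \<Longrightarrow> chain_join C (\<lambda>k. e (c k)) (e s)"
    "join_dense C (e ` S)" "e ` S \<subseteq> Field C"
  using assms unfolding free_cpo_def model_def by (auto simp: CPO_cpo)

lemma free_cpo_ext:
  fixes C D :: "'u rel"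
  assumes "free_cpo S J C e" "D \<in> obj CPO" "\<And>s. s \<in> S \<Longrightarrow> g s \<in> Field D"
    "\<And>c s. (c, s) \<in> J \<Longrightarrow> chain_join D (\<lambda>k. g (c k)) (g s)"
  obtains h where "h \<in> cont_maps C D" "\<And>s. s \<in> S \<Longrightarrow> h (e s) = g s"
proof -
  have "g ` S \<subseteq> Field D" "model J D g" using assms unfolding model_def by auto
  then have "\<exists>h\<in>cont_maps C D. \<forall>s\<in>S. h (e s) = g s"
    using assms(1,2) unfolding free_cpo_def by blast
  then show ?thesis using that by blast
qed

text \<open>The power \<open>C^n\<close> is presented by lists of generators, with relations imposed
  in one argument at a time. The induction extends the tail for each generator in head position and
  then extends in the head; density shows that the head relations hold for arbitrary tails.\<close>

lemma free_cpo_multi_ext: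
  fixes C D :: "'u rel"
  assumes F: "free_cpo S J C e" and D: "D \<in> obj CPO" and J: "\<And>c s. (c, s) \<in> J \<Longrightarrow> range c \<subseteq> S \<and> s \<in> S"
    and g: "\<And>ss. length ss = n \<Longrightarrow> set ss \<subseteq> S \<Longrightarrow> g ss \<in> Field D"
    and j: "\<And>c s p q. (c, s) \<in> J \<Longrightarrow> set p \<subseteq> S \<Longrightarrow> set q \<subseteq> S \<Longrightarrow> Suc (length p + length q) = n \<Longrightarrow>
      chain_join D (\<lambda>k. g (p @ c k # q)) (g (p @ s # q))"
  shows "\<exists>h. continuous_map (power_cpo C n) D h \<and> (\<forall>ss. length ss = n \<and> set ss \<subseteq> S \<longrightarrow> h (map e ss) = g ss)"
  using g j
proof (induction n arbitrary: g)
  case 0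
  have Dc: "cpo D" and C: "cpo C" by (rule CPO_cpo[OF D], rule free_cpoD(1)[OF F])
  have "g [] \<in> Field D" using "0.prems"(1)[of "[]"] by simp
  then have "continuous_map (power_cpo C 0) D (\<lambda>_. g [])"
    by (intro continuous_mapI[OF cpo_power_cpo[OF C]] chain_join_const[OF Dc])
  then show ?case by auto
next
  case (Suc n)
  have Dc: "cpo D" and C: "cpo C" by (rule CPO_cpo[OF D], rule free_cpoD(1)[OF F])
  note PC = cpo_power_cpo[OF C]
  have "\<exists>h. continuous_map (power_cpo C n) D h \<and> (\<forall>ss. length ss = n \<and> set ss \<subseteq> S \<longrightarrow> h (map e ss) = g (s # ss))"
    if s: "s \<in> S" for s
  proof (rule Suc.IH)
    show "g (s # ss) \<in> Field D" if "length ss = n" "set ss \<subseteq> S" for ss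
      using Suc.prems(1)[of "s # ss"] that s by simp
    show "chain_join D (\<lambda>k. g (s # p @ c k # q)) (g (s # p @ t # q))"
      if "(c, t) \<in> J" "set p \<subseteq> S" "set q \<subseteq> S" "Suc (length p + length q) = n" for c t p q
      using Suc.prems(2)[of c t "s # p" q] that s by simp
  qed
  then obtain H where H: "\<And>s. s \<in> S \<Longrightarrow> continuous_map (power_cpo C n) D (H s)"
    "\<And>s ss. s \<in> S \<Longrightarrow> length ss = n \<Longrightarrow> set ss \<subseteq> S \<Longrightarrow> H s (map e ss) = g (s # ss)" by metis
  have dense: "join_dense (power_cpo C n) {xs. length xs = n \<and> set xs \<subseteq> e ` S}"
    by (rule join_dense_power[OF C free_cpoD(5,6)[OF F]])
  have sub: "{xs. length xs = n \<and> set xs \<subseteq> e ` S} \<subseteq> Field (power_cpo C n)"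
    using free_cpoD(6)[OF F] by (auto simp: field_power_cpo[OF C])
  \<comment> \<open>The relation in the head is known for tails of generators only. Both sides are
    continuous in the tail, so it holds for all tails by density of the power.\<close>
  have Hj: "chain_join D (\<lambda>k. H (c k) xs) (H s xs)"
    if cs: "(c, s) \<in> J" and xs: "xs \<in> Field (power_cpo C n)" for c s xs
  proof (rule join_denseD[OF dense xs sub])
    have S: "c k \<in> S" "s \<in> S" for k using J[OF cs] by auto
    show "join_closed (power_cpo C n) {xs \<in> Field (power_cpo C n). chain_join D (\<lambda>k. H (c k) xs) (H s xs)}"
      by (rule join_closed_chain_join[OF PC Dc]) (use H(1) S in auto)
    fix xs assume "xs \<in> {xs. length xs = n \<and> set xs \<subseteq> e ` S}"
    then have "xs \<in> lists (e ` S)" "length xs = n" by auto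
    then obtain ss where "xs = map e ss" "ss \<in> lists S" "length xs = n"
      unfolding lists_image by blast
    then have "xs = map e ss" "set ss \<subseteq> S" "length ss = n" by auto
    then show "chain_join D (\<lambda>k. H (c k) xs) (H s xs)"
      using Suc.prems(2)[OF cs, of "[]" ss] H(2) S by simp
  qed
  have "\<exists>h\<in>cont_maps C D. \<forall>s\<in>S. h (e s) = H s xs" if xs: "xs \<in> Field (power_cpo C n)" for xs
  proof -
    obtain h where "h \<in> cont_maps C D" "\<And>s. s \<in> S \<Longrightarrow> h (e s) = H s xs"
      by (rule free_cpo_ext[OF F D, of "\<lambda>s. H s xs"]) (use continuous_mapD(1)[OF H(1) xs] Hj[OF _ xs] in auto)
    then show ?thesis by blast
  qed
  then obtain K where K: "\<And>xs. xs \<in> Field (power_cpo C n) \<Longrightarrow> K xs \<in> cont_maps C D"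
    "\<And>xs s. xs \<in> Field (power_cpo C n) \<Longrightarrow> s \<in> S \<Longrightarrow> K xs (e s) = H s xs" by metis
  define h where "h ys = K (tl ys) (hd ys)" for ys
  have "continuous_map (power_cpo C (Suc n)) D h"
  proof (rule continuous_map_Cons[OF C Dc])
    show "continuous_map C D (\<lambda>x. h (x # xs))" if "xs \<in> Field (power_cpo C n)" for xs
      using cont_mapsD(1)[OF K(1)[OF that]] by (simp add: h_def)
    fix x assume x: "x \<in> Field C"
    \<comment> \<open>Continuity in the tail is known when the head is a generator, from
      \<open>H\<close>; density in the head extends it to every \<open>x\<close>.\<close>
    have "chain_join D (\<lambda>k. K (d k) x) (K xs x)" if d: "chain_join (power_cpo C n) d xs" for d xs
    proof (rule join_denseD[OF free_cpoD(5)[OF F] x free_cpoD(6)[OF F]])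
      have m: "d k \<in> Field (power_cpo C n)" "xs \<in> Field (power_cpo C n)" for k
        using chain_joinD(1,2)[OF d] by auto
      show "chain_join D (\<lambda>k. K (d k) x) (K xs x)" if "x \<in> e ` S" for x
        using that continuous_mapD(3)[OF H(1) d] K(2) m by auto
      show "join_closed C {x \<in> Field C. chain_join D (\<lambda>k. K (d k) x) (K xs x)}"
        by (rule join_closed_chain_join[OF C Dc])
           (rule cont_mapsD(1)[OF K(1)[OF m(1)]], rule cont_mapsD(1)[OF K(1)[OF m(2)]])
    qed
    then show "continuous_map (power_cpo C n) D (\<lambda>xs. h (x # xs))"
      by (intro continuous_mapI[OF PC]) (simp_all add: h_def cont_maps_app[OF K(1) x])
  qed
  moreover have "h (map e ss) = g ss" if ss': "length ss = Suc n" "set ss \<subseteq> S" for ss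
  proof -
    obtain s rs where ss: "ss = s # rs" "length rs = n" "s \<in> S" "set rs \<subseteq> S"
      using ss' by (auto simp: length_Suc_conv)
    then have "map e rs \<in> Field (power_cpo C n)" using free_cpoD(3)[OF F] by (auto simp: field_power_cpo[OF C])
    then show ?thesis using ss K(2) H(2) by (simp add: h_def)
  qed
  ultimately show ?case by blast
qed


section \<open>Strongly finitary functors as pointwise left Kan extensions\<close>

lemma CPO_simps [simp]:
  "hom CPO = cont_maps" "idm CPO A = (\<lambda>x\<in>Field A. x)" "compo CPO A B C g f = compose (Field A) g f"
  unfolding CPO_def by auto

lemma CPO_compose_app: "x \<in> Field A \<Longrightarrow> compose (Field A) g f x = g (f x)"
  by (simp add: compose_def)

lemma nat_trans_CPO_I:
  assumes "\<alpha> \<in> extensional (obj CPO)" "\<And>A. A \<in> obj CPO \<Longrightarrow> \<alpha> A \<in> cont_maps (fobj F A) (fobj G A)"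
    "\<And>A B f x. A \<in> obj CPO \<Longrightarrow> B \<in> obj CPO \<Longrightarrow> f \<in> cont_maps A B \<Longrightarrow> x \<in> Field (fobj F A) \<Longrightarrow>
      fmap G A B f (\<alpha> A x) = \<alpha> B (fmap F A B f x)"
  shows "nat_trans CPO CPO F G \<alpha>"
  unfolding nat_trans_def using assms by (auto simp: compose_def fun_eq_iff)

lemma nat_trans_CPO_D:
  assumes "nat_trans CPO CPO F G \<alpha>"
  shows "\<alpha> \<in> extensional (obj CPO)" "A \<in> obj CPO \<Longrightarrow> \<alpha> A \<in> cont_maps (fobj F A) (fobj G A)"
    "A \<in> obj CPO \<Longrightarrow> B \<in> obj CPO \<Longrightarrow> f \<in> cont_maps A B \<Longrightarrow> x \<in> Field (fobj F A) \<Longrightarrow>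
      fmap G A B f (\<alpha> A x) = \<alpha> B (fmap F A B f x)"
proof -
  show "\<alpha> \<in> extensional (obj CPO)" "A \<in> obj CPO \<Longrightarrow> \<alpha> A \<in> cont_maps (fobj F A) (fobj G A)"
    using assms unfolding nat_trans_def by auto
  assume "A \<in> obj CPO" "B \<in> obj CPO" "f \<in> cont_maps A B" and x: "x \<in> Field (fobj F A)"
  then have "compose (Field (fobj F A)) (fmap G A B f) (\<alpha> A) = compose (Field (fobj F A)) (\<alpha> B) (fmap F A B f)"
    using assms unfolding nat_trans_def by simp
  from fun_cong[OF this, of x] x show "fmap G A B f (\<alpha> A x) = \<alpha> B (fmap F A B f x)"
    by (simp add: compose_def)
qed

lemma Field_Id_on [simp]: "Field (Id_on X) = X"
  by (auto simp: Field_def)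

lemma cpo_Id_on: "cpo (Id_on X)"
proof (rule cpoI)
  fix c assume "Defs.omega_chain (Id_on X) c"
  then have *: "c k \<in> X" "c (Suc k) = c k" for k unfolding omega_chain_def by auto
  then have "c k = c 0" for k by (induction k) auto
  moreover from this * have "(c k, c 0) \<in> Id_on X" for k by (metis Id_onI)
  ultimately show "\<exists>x. is_join (Id_on X) c x" using * by (intro exI[of _ "c 0"]) (auto simp: is_join_def)
qed auto

lemma chain_join_Id_on: "chain_join (Id_on X) c x \<Longrightarrow> x \<in> X \<and> (\<forall>k. c k = x)"
  using chain_joinD(1,3)[of "Id_on X" c x] by (metis Field_Id_on Id_onE Pair_inject)

lemma cont_maps_Id_on: "cpo B \<Longrightarrow> cont_maps (Id_on X) B = X \<rightarrow>\<^sub>E Field B"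
proof (intro set_eqI iffI)
  fix f assume B: "cpo B" and f: "f \<in> X \<rightarrow>\<^sub>E Field B"
  have "continuous_map (Id_on X) B f"
  proof (rule continuous_mapI[OF cpo_Id_on])
    fix c x assume "chain_join (Id_on X) c x"
    then have x: "x \<in> X" "\<And>k. c k = x" using chain_join_Id_on[of X c x] by auto
    then show "chain_join B (\<lambda>k. f (c k)) (f x)" using chain_join_const[OF B, of "f x"] f by auto
  qed (use f in auto)
  then show "f \<in> cont_maps (Id_on X) B" using f by (intro cont_mapsI) (auto simp: PiE_def)
next
  fix f assume "f \<in> cont_maps (Id_on X) B"
  from cont_mapsD(2)[OF this] cont_maps_app[OF this] show "f \<in> X \<rightarrow>\<^sub>E Field B" by (auto simp: PiE_iff)
qed

lemma nat_trans_SetFin_I: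
  assumes "\<sigma> \<in> extensional {X. finite X}"
    "\<And>X. finite X \<Longrightarrow> \<sigma> X \<in> cont_maps (fobj F (Id_on X)) (fobj G (Id_on X))"
    "\<And>X Y f x. finite X \<Longrightarrow> finite Y \<Longrightarrow> f \<in> X \<rightarrow>\<^sub>E Y \<Longrightarrow> x \<in> Field (fobj F (Id_on X)) \<Longrightarrow>
      fmap G (Id_on X) (Id_on Y) f (\<sigma> X x) = \<sigma> Y (fmap F (Id_on X) (Id_on Y) f x)"
  shows "nat_trans SetFin CPO (F \<odot> K_disc) (G \<odot> K_disc) \<sigma>"
  unfolding nat_trans_def SetFin_def comp_functor_def K_disc_def
  using assms by (auto simp: compose_def fun_eq_iff)

lemma nat_trans_SetFin_D:
  assumes "nat_trans SetFin CPO (F \<odot> K_disc) (G \<odot> K_disc) \<sigma>"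
  shows "finite X \<Longrightarrow> \<sigma> X \<in> cont_maps (fobj F (Id_on X)) (fobj G (Id_on X))"
    "finite X \<Longrightarrow> finite Y \<Longrightarrow> f \<in> X \<rightarrow>\<^sub>E Y \<Longrightarrow> x \<in> Field (fobj F (Id_on X)) \<Longrightarrow>
      fmap G (Id_on X) (Id_on Y) f (\<sigma> X x) = \<sigma> Y (fmap F (Id_on X) (Id_on Y) f x)"
proof -
  show "finite X \<Longrightarrow> \<sigma> X \<in> cont_maps (fobj F (Id_on X)) (fobj G (Id_on X))"
    using assms unfolding nat_trans_def SetFin_def comp_functor_def K_disc_def by auto
  assume "finite X" "finite Y" "f \<in> X \<rightarrow>\<^sub>E Y" and x: "x \<in> Field (fobj F (Id_on X))"
  then have "compose (Field (fobj F (Id_on X))) (fmap G (Id_on X) (Id_on Y) f) (\<sigma> X)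
    = compose (Field (fobj F (Id_on X))) (\<sigma> Y) (fmap F (Id_on X) (Id_on Y) f)"
    using assms unfolding nat_trans_def SetFin_def comp_functor_def K_disc_def by auto
  from fun_cong[OF this, of x] x
  show "fmap G (Id_on X) (Id_on Y) f (\<sigma> X x) = \<sigma> Y (fmap F (Id_on X) (Id_on Y) f x)"
    by (simp add: compose_def)
qed

text \<open>Being extensional and independent of the target, this one function is the inclusion of
  \<open>X\<close> into every larger set and, read as a morphism, of the discrete cpo on
  \<open>X\<close> into every cpo containing \<open>X\<close>.\<close>

definition incl :: "'u set \<Rightarrow> 'u \<Rightarrow> 'u" where
  "incl X = (\<lambda>x\<in>X. x)"

lemma incl_app [simp]: "x \<in> X \<Longrightarrow> incl X x = x"
  unfolding incl_def by simp

lemma incl_image [simp]: "incl X ` X = X"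
  unfolding incl_def by simp

lemma compose_incl_left: "f \<in> X \<rightarrow>\<^sub>E Y \<Longrightarrow> compose X (incl Y) f = f"
  by (auto simp: compose_def fun_eq_iff PiE_iff extensional_def)

lemma incl_PiE: "X \<subseteq> Y \<Longrightarrow> incl X \<in> X \<rightarrow>\<^sub>E Y"
  by (auto simp: incl_def)

lemma incl_comp: "X \<subseteq> Y \<Longrightarrow> compose X (incl Y) (incl X) = incl X"
  by (auto simp: compose_def incl_def fun_eq_iff)

text \<open>The Kan extension is a colimit over all maps from finite discrete cpos to
  \<open>A\<close>, but the finite subsets of \<open>'u\<close> do not form a small set. Every such
  map factors through its image, so finite subsets of \<open>A\<close> suffice, and these are small
  in number.\<close>

definition lan_gens :: "'u endofunctor \<Rightarrow> 'u rel \<Rightarrow> ('u set \<times> 'u) set" where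
  "lan_gens F A = {(X, t). finite X \<and> X \<subseteq> Field A \<and> t \<in> Field (fobj F (Id_on X))}"

text \<open>The generator \<open>(X, t)\<close> stands for the value at \<open>t\<close> of \<open>F\<close> applied to the inclusion of the
  finite discrete cpo on \<open>X\<close> into \<open>A\<close>; \<open>vary\<close> makes that value continuous in the
  embedding.\<close>

inductive_set lan_joins :: "'u endofunctor \<Rightarrow> 'u rel \<Rightarrow> ((nat \<Rightarrow> 'u set \<times> 'u) \<times> ('u set \<times> 'u)) set"
  for F A where
  chain: "finite X \<Longrightarrow> X \<subseteq> Field A \<Longrightarrow> chain_join (fobj F (Id_on X)) c t \<Longrightarrow>
    (\<lambda>m. (X, c m), (X, t)) \<in> lan_joins F A"
| enlarge: "finite Y \<Longrightarrow> X \<subseteq> Y \<Longrightarrow> Y \<subseteq> Field A \<Longrightarrow> t \<in> Field (fobj F (Id_on X)) \<Longrightarrow>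
    (\<lambda>_. (X, t), (Y, fmap F (Id_on X) (Id_on Y) (incl X) t)) \<in> lan_joins F A"
| vary: "finite Z \<Longrightarrow> chain_join (hom_cpo (Id_on Z) A) a b \<Longrightarrow> t \<in> Field (fobj F (Id_on Z)) \<Longrightarrow>
    (\<lambda>m. (a m ` Z, fmap F (Id_on Z) (Id_on (a m ` Z)) (a m) t),
      (b ` Z, fmap F (Id_on Z) (Id_on (b ` Z)) b t)) \<in> lan_joins F A"

lemma lan_joins_cases [consumes 1, case_names chain enlarge vary]:
  assumes "(c, s) \<in> lan_joins F A"
    and "\<And>X c' t. c = (\<lambda>m. (X, c' m)) \<Longrightarrow> s = (X, t) \<Longrightarrow> finite X \<Longrightarrow> X \<subseteq> Field A \<Longrightarrow>
      chain_join (fobj F (Id_on X)) c' t \<Longrightarrow> P"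
    and "\<And>Y X t. c = (\<lambda>_. (X, t)) \<Longrightarrow> s = (Y, fmap F (Id_on X) (Id_on Y) (incl X) t) \<Longrightarrow> finite Y \<Longrightarrow>
      X \<subseteq> Y \<Longrightarrow> Y \<subseteq> Field A \<Longrightarrow> t \<in> Field (fobj F (Id_on X)) \<Longrightarrow> P"
    and "\<And>Z a b t. c = (\<lambda>m. (a m ` Z, fmap F (Id_on Z) (Id_on (a m ` Z)) (a m) t)) \<Longrightarrow>
      s = (b ` Z, fmap F (Id_on Z) (Id_on (b ` Z)) b t) \<Longrightarrow> finite Z \<Longrightarrow>
      chain_join (hom_cpo (Id_on Z) A) a b \<Longrightarrow> t \<in> Field (fobj F (Id_on Z)) \<Longrightarrow> P"
  shows P
proof -
  obtain Y r where s: "s = (Y, r)" by (cases s)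
  from assms(1) show P unfolding s
  proof (rule lan_joins.cases, goal_cases)
    case (1 X c' t) then show ?case by (intro assms(2)[of X c' t]) (simp_all add: s)
  next
    case (2 Y X t) then show ?case by (intro assms(3)[of X t Y]) (simp_all add: s)
  next
    case (3 Z a b t) then show ?case by (intro assms(4)[of a Z t b]) (simp_all add: s)
  qed
qed

definition can :: "'u endofunctor \<Rightarrow> 'u rel \<Rightarrow> 'u set \<times> 'u \<Rightarrow> 'u" where
  "can F A = (\<lambda>(X, t). fmap F (Id_on X) A (incl X) t)"

definition pointwise_lan :: "'u endofunctor \<Rightarrow> bool" where
  "pointwise_lan F \<longleftrightarrow> (\<forall>A\<in>obj CPO. free_cpo (lan_gens F A) (lan_joins F A) (fobj F A) (can F A))"

lemma free_cpo_iso: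
  fixes C D :: "'u rel"
  assumes F: "free_cpo S J C e" and J: "\<And>c s. (c, s) \<in> J \<Longrightarrow> range c \<subseteq> S \<and> s \<in> S"
    and D: "D \<in> obj CPO" and h: "h \<in> cont_maps C D" and k: "k \<in> cont_maps D C"
    and hk: "\<And>y. y \<in> Field D \<Longrightarrow> h (k y) = y" and kh: "\<And>x. x \<in> Field C \<Longrightarrow> k (h x) = x"
    and e': "\<And>s. s \<in> S \<Longrightarrow> e' s = h (e s)"
  shows "free_cpo S J D e'"
  unfolding free_cpo_def
proof (intro conjI ballI allI impI)
  note hc = cont_mapsD(1)[OF h] and kc = cont_mapsD(1)[OF k]
  show "D \<in> obj CPO" by (rule D)
  show "e' ` S \<subseteq> Field D" using e' free_cpoD(3)[OF F] cont_maps_app[OF h] by auto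
  show "model J D e'"
    unfolding model_def
  proof clarify
    fix c s assume cs: "(c, s) \<in> J"
    have "c k \<in> S" "s \<in> S" for k using J[OF cs] by auto
    then show "chain_join D (\<lambda>k. e' (c k)) (e' s)"
      using continuous_mapD(3)[OF hc free_cpoD(4)[OF F cs]] e' by simp
  qed
  show "join_dense D (e' ` S)"
    unfolding join_dense_def
  proof (intro allI impI, elim conjE)
    fix Q assume Q: "Q \<subseteq> Field D" "e' ` S \<subseteq> Q" "join_closed D Q"
    have "h x \<in> Q" if "x \<in> Field C" for x
    proof (rule join_denseD[OF free_cpoD(5)[OF F] that free_cpoD(6)[OF F]])
      show "h x \<in> Q" if "x \<in> e ` S" for x using that Q(2) e' by auto
      show "join_closed C {x \<in> Field C. h x \<in> Q}"
      proof (rule join_closedI)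
        fix c x assume c: "\<And>k. c k \<in> {x \<in> Field C. h x \<in> Q}" "chain_join C c x"
        have "h x \<in> Q" by (rule join_closedD[OF Q(3) _ continuous_mapD(3)[OF hc c(2)]]) (use c(1) in blast)
        then show "x \<in> {x \<in> Field C. h x \<in> Q}" using chain_joinD(1)[OF c(2)] by blast
      qed
    qed
    then have "y \<in> Q" if "y \<in> Field D" for y using hk[OF that] cont_maps_app[OF k that] by metis
    then show "Q = Field D" using Q(1) by blast
  qed
  fix B :: "'u rel" and g assume B: "B \<in> obj CPO" "g ` S \<subseteq> Field B \<and> model J B g"
  obtain l where l: "l \<in> cont_maps C B" "\<And>s. s \<in> S \<Longrightarrow> l (e s) = g s"
    by (rule free_cpo_ext[OF F B(1), of g]) (use B(2) in \<open>auto simp: model_def\<close>)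
  show "\<exists>h\<in>cont_maps D B. \<forall>s\<in>S. h (e' s) = g s"
  proof (intro bexI[of _ "compose (Field D) l k"] ballI)
    show "compose (Field D) l k \<in> cont_maps D B" by (rule cont_maps_compose[OF k l(1)])
    fix s assume s: "s \<in> S"
    then have "h (e s) \<in> Field D" using free_cpoD(3)[OF F] cont_maps_app[OF h] by blast
    then show "compose (Field D) l k (e' s) = g s"
      using s e' kh[OF free_cpoD(3)[OF F s]] l(2) by (simp add: compose_def)
  qed
qed

section \<open>Enriched functors and cocones over the maps from finite sets into a cpo\<close>

locale enriched_functor = small_universe U for U :: "'u set" +
  fixes F :: "'u endofunctor"
  assumes enriched: "enriched_endofunctor F"
begin

lemma F_obj: "A \<in> obj CPO \<Longrightarrow> fobj F A \<in> obj CPO"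
  using enriched unfolding enriched_endofunctor_def is_functor_def by blast

lemma F_map: "A \<in> obj CPO \<Longrightarrow> B \<in> obj CPO \<Longrightarrow> f \<in> cont_maps A B \<Longrightarrow>
    fmap F A B f \<in> cont_maps (fobj F A) (fobj F B)"
  using enriched unfolding enriched_endofunctor_def is_functor_def by simp

lemma F_app: "A \<in> obj CPO \<Longrightarrow> B \<in> obj CPO \<Longrightarrow> f \<in> cont_maps A B \<Longrightarrow> t \<in> Field (fobj F A) \<Longrightarrow>
    fmap F A B f t \<in> Field (fobj F B)"
  using cont_maps_app[OF F_map] .

lemma F_id: "A \<in> obj CPO \<Longrightarrow> t \<in> Field (fobj F A) \<Longrightarrow> fmap F A A (\<lambda>x\<in>Field A. x) t = t"
  using enriched unfolding enriched_endofunctor_def is_functor_def by simp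

lemma F_comp:
  assumes "A \<in> obj CPO" "B \<in> obj CPO" "C \<in> obj CPO" "f \<in> cont_maps A B" "g \<in> cont_maps B C"
    "t \<in> Field (fobj F A)"
  shows "fmap F B C g (fmap F A B f t) = fmap F A C (compose (Field A) g f) t"
proof -
  have "fmap F A C (compose (Field A) g f) = compose (Field (fobj F A)) (fmap F B C g) (fmap F A B f)"
    using enriched assms unfolding enriched_endofunctor_def is_functor_def by simp
  then show ?thesis using assms(6) by (simp add: compose_def)
qed

lemma F_chain_join:
  assumes "A \<in> obj CPO" "B \<in> obj CPO" "chain_join (hom_cpo A B) a b" "t \<in> Field (fobj F A)"
  shows "chain_join (fobj F B) (\<lambda>m. fmap F A B (a m) t) (fmap F A B b t)"
proof -
  have "continuous_map (hom_cpo A B) (hom_cpo (fobj F A) (fobj F B)) (fmap F A B)"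
    using enriched assms unfolding enriched_endofunctor_def by blast
  from continuous_mapD(3)[OF this assms(3)]
  show ?thesis by (rule chain_join_homD[OF CPO_cpo[OF F_obj[OF assms(1)]] CPO_cpo[OF F_obj[OF assms(2)]]])
    (rule assms(4))
qed

lemma disc_obj: "finite (X :: 'u set) \<Longrightarrow> Id_on X \<in> obj CPO"
  unfolding CPO_def using cpo_Id_on sm_finite sm_small by auto

lemma disc_maps: "finite (X :: 'u set) \<Longrightarrow> A \<in> obj CPO \<Longrightarrow> cont_maps (Id_on X) A = X \<rightarrow>\<^sub>E Field A"
  by (rule cont_maps_Id_on[OF CPO_cpo])

lemma incl_map: "finite (X :: 'u set) \<Longrightarrow> A \<in> obj CPO \<Longrightarrow> X \<subseteq> Field A \<Longrightarrow> incl X \<in> cont_maps (Id_on X) A"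
  unfolding disc_maps incl_def by auto

lemma disc_comp:
  assumes "finite X" "finite Y" "C \<in> obj CPO" "f \<in> X \<rightarrow>\<^sub>E Y" "g \<in> Y \<rightarrow>\<^sub>E Field C" "t \<in> Field (fobj F (Id_on X))"
  shows "fmap F (Id_on Y) C g (fmap F (Id_on X) (Id_on Y) f t) = fmap F (Id_on X) C (compose X g f) t"
  using F_comp[of "Id_on X" "Id_on Y" C f g t] assms disc_obj by (simp add: disc_maps)

lemma disc_app:
  assumes "finite X" "finite Y" "f \<in> X \<rightarrow>\<^sub>E Y" "t \<in> Field (fobj F (Id_on X))"
  shows "fmap F (Id_on X) (Id_on Y) f t \<in> Field (fobj F (Id_on Y))"
  using F_app[of "Id_on X" "Id_on Y" f t] assms disc_obj by (simp add: disc_maps)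

lemma disc_id: "finite X \<Longrightarrow> t \<in> Field (fobj F (Id_on X)) \<Longrightarrow> fmap F (Id_on X) (Id_on X) (incl X) t = t"
  using F_id[of "Id_on X" t] disc_obj by (simp add: incl_def)

lemma hom_disc_chain:
  assumes "A \<in> obj CPO" "finite (Z :: 'u set)" "chain_join (hom_cpo (Id_on Z) A) a b"
  shows "a m \<in> Z \<rightarrow>\<^sub>E Field A" "b \<in> Z \<rightarrow>\<^sub>E Field A" "z \<in> Z \<Longrightarrow> chain_join A (\<lambda>m. a m z) (b z)"
  using chain_joinD(1,2)[OF assms(3)] chain_join_homD[OF cpo_Id_on CPO_cpo[OF assms(1)] assms(3)]
  unfolding field_hom_cpo[OF CPO_cpo[OF assms(1)]] disc_maps[OF assms(2,1)] by simp_all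

lemma lan_joins_gens:
  assumes A: "A \<in> obj CPO" and "(c, s) \<in> lan_joins F A"
  shows "range c \<subseteq> lan_gens F A \<and> s \<in> lan_gens F A"
  using assms(2)
proof (cases rule: lan_joins_cases)
  case (chain X c' t)
  then show ?thesis using chain_joinD[OF chain(5)] by (auto simp: lan_gens_def)
next
  case (enlarge Y X t)
  then have "finite X" by (auto dest: finite_subset)
  then show ?thesis using enlarge disc_app[of X Y "incl X" t] by (auto simp: lan_gens_def incl_def)
next
  case (vary Z a b t)
  note m = hom_disc_chain(1,2)[OF A vary(3,4)]
  have g: "(u ` Z, fmap F (Id_on Z) (Id_on (u ` Z)) u t) \<in> lan_gens F A" if "u \<in> Z \<rightarrow>\<^sub>E Field A" for u
  proof -
    have "u \<in> Z \<rightarrow>\<^sub>E u ` Z" using that by auto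
    then show ?thesis using disc_app[OF vary(3) _ _ vary(5)] vary(3) that by (auto simp: lan_gens_def)
  qed
  show ?thesis using g m vary(1,2) by auto
qed

lemma lan_gens_small: "A \<in> obj CPO \<Longrightarrow> lan_gens F A \<prec> U"
proof -
  assume A: "A \<in> obj CPO"
  have "Sigma {X. finite X \<and> X \<subseteq> Field A} (\<lambda>X. Field (fobj F (Id_on X))) \<prec> U"
  proof (rule sm_Sigma[OF sm_finite_subsets])
    show "Field A \<prec> U" using CPO_small[OF A] sm_small by blast
    show "Field (fobj F (Id_on X)) \<prec> U" if "X \<in> {X. finite X \<and> X \<subseteq> Field A}" for X
      using that CPO_small[OF F_obj[OF disc_obj]] sm_small by blast
  qed
  then show ?thesis by (rule sm_subset[rotated]) (auto simp: lan_gens_def)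
qed

definition cocone :: "'u rel \<Rightarrow> 'u rel \<Rightarrow> ('u set \<times> 'u \<Rightarrow> 'u) \<Rightarrow> bool" where
  "cocone A D g \<longleftrightarrow> D \<in> obj CPO \<and> (\<forall>s\<in>lan_gens F A. g s \<in> Field D) \<and>
     (\<forall>(c, s)\<in>lan_joins F A. chain_join D (\<lambda>k. g (c k)) (g s))"

text \<open>Extends a cocone from the inclusions of finite subsets to an arbitrary map
  \<open>u : Z \<rightarrow> A\<close>, which is factored through its image.\<close>

definition leaf :: "('u set \<times> 'u \<Rightarrow> 'u) \<Rightarrow> 'u set \<Rightarrow> ('u \<Rightarrow> 'u) \<Rightarrow> 'u \<Rightarrow> 'u" where
  "leaf g Z u t = g (u ` Z, fmap F (Id_on Z) (Id_on (u ` Z)) u t)"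

lemma free_cpo_cocone: "free_cpo (lan_gens F A) (lan_joins F A) C e \<Longrightarrow> cocone A C e"
  unfolding cocone_def by (auto intro: free_cpoD(2,3,4))

text \<open>The \<open>enlarge\<close> relation has a constant chain, and a constant chain has its
  own value as join; hence the two generators are identified.\<close>

lemma cocone_incl:
  assumes "cocone A D g" "finite Y" "X \<subseteq> Y" "Y \<subseteq> Field A" "t \<in> Field (fobj F (Id_on X))"
  shows "g (Y, fmap F (Id_on X) (Id_on Y) (incl X) t) = g (X, t)"
proof -
  have "(\<lambda>_. (X, t), (Y, fmap F (Id_on X) (Id_on Y) (incl X) t)) \<in> lan_joins F A"
    using assms by (intro lan_joins.enlarge)
  then have "chain_join D (\<lambda>_. g (X, t)) (g (Y, fmap F (Id_on X) (Id_on Y) (incl X) t))"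
    using assms(1) unfolding cocone_def by auto
  moreover from chain_joinD(2)[OF this] have "g (X, t) \<in> Field D" .
  ultimately show ?thesis
    using chain_join_unique[OF CPO_cpo, of D] chain_join_const[OF CPO_cpo, of D] assms(1) unfolding cocone_def by blast
qed

lemma leaf_incl: "(X, t) \<in> lan_gens F A \<Longrightarrow> leaf g X (incl X) t = g (X, t)"
  unfolding leaf_def lan_gens_def by (auto simp: disc_id)

text \<open>The compatibility of a colimit cocone with all maps of finite sets. The image of the
  composite lies in the image of \<open>u\<close>, so functoriality together with
  \<open>enlarge\<close> compares the two generators.\<close>

lemma leaf_nat:
  assumes g: "cocone A D g" and A: "A \<in> obj CPO" and Z: "finite Z" "finite W" and u: "u \<in> Z \<rightarrow>\<^sub>E Field A"
    and v: "v \<in> W \<rightarrow>\<^sub>E Z" and t: "t \<in> Field (fobj F (Id_on W))"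
  shows "leaf g Z u (fmap F (Id_on W) (Id_on Z) v t) = leaf g W (compose W u v) t"
proof -
  let ?w = "compose W u v"
  have sub: "?w ` W \<subseteq> u ` Z" using v by (auto simp: compose_def PiE_iff)
  have u': "u \<in> Z \<rightarrow>\<^sub>E u ` Z" and w': "?w \<in> W \<rightarrow>\<^sub>E ?w ` W" "?w \<in> W \<rightarrow>\<^sub>E u ` Z" and i: "incl (?w ` W) \<in> ?w ` W \<rightarrow>\<^sub>E u ` Z"
    using u v sub by (auto simp: compose_def incl_def PiE_iff)
  have fu: "finite (u ` Z)" "finite (?w ` W)" using Z by auto
  have uA: "u ` Z \<subseteq> Field A" using u by auto
  have "leaf g W ?w t = g (u ` Z, fmap F (Id_on (?w ` W)) (Id_on (u ` Z)) (incl (?w ` W)) (fmap F (Id_on W) (Id_on (?w ` W)) ?w t))"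
    unfolding leaf_def using cocone_incl[OF g fu(1) sub uA disc_app[OF Z(2) fu(2) w'(1) t]] ..
  also have "fmap F (Id_on (?w ` W)) (Id_on (u ` Z)) (incl (?w ` W)) (fmap F (Id_on W) (Id_on (?w ` W)) ?w t)
    = fmap F (Id_on W) (Id_on (u ` Z)) (compose W (incl (?w ` W)) ?w) t"
    using disc_comp[OF Z(2) fu(2) disc_obj[OF fu(1)] w'(1) _ t] i by simp
  also have "compose W (incl (?w ` W)) ?w = ?w" by (rule compose_incl_left[OF w'(1)])
  also have "fmap F (Id_on W) (Id_on (u ` Z)) ?w t = fmap F (Id_on Z) (Id_on (u ` Z)) u (fmap F (Id_on W) (Id_on Z) v t)"
    using disc_comp[OF Z(2,1) disc_obj[OF fu(1)] v _ t] u' by simp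
  finally show ?thesis unfolding leaf_def by simp
qed

lemma leaf_mem:
  assumes g: "cocone A D g" and Z: "finite Z" and u: "u \<in> Z \<rightarrow>\<^sub>E Field A" and t: "t \<in> Field (fobj F (Id_on Z))"
  shows "leaf g Z u t \<in> Field D"
proof -
  have "u \<in> Z \<rightarrow>\<^sub>E u ` Z" using u by auto
  then have "(u ` Z, fmap F (Id_on Z) (Id_on (u ` Z)) u t) \<in> lan_gens F A"
    unfolding lan_gens_def using disc_app[OF Z _ _ t] Z u by auto
  then show ?thesis using g unfolding cocone_def leaf_def by blast
qed

lemma leaf_chain:
  assumes g: "cocone A D g" and Z: "finite Z" and u: "u \<in> Z \<rightarrow>\<^sub>E Field A"
    and t: "chain_join (fobj F (Id_on Z)) c t"
  shows "chain_join D (\<lambda>m. leaf g Z u (c m)) (leaf g Z u t)"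
proof -
  have fu: "finite (u ` Z)" using Z by auto
  have "u \<in> Z \<rightarrow>\<^sub>E u ` Z" using u by auto
  then have "u \<in> cont_maps (Id_on Z) (Id_on (u ` Z))" using disc_maps[OF Z disc_obj[OF fu]] by simp
  from F_map[OF disc_obj[OF Z] disc_obj[OF fu] this]
  have "chain_join (fobj F (Id_on (u ` Z))) (\<lambda>m. fmap F (Id_on Z) (Id_on (u ` Z)) u (c m)) (fmap F (Id_on Z) (Id_on (u ` Z)) u t)"
    using continuous_mapD(3)[OF cont_mapsD(1) t] by blast
  then have "(\<lambda>m. (u ` Z, fmap F (Id_on Z) (Id_on (u ` Z)) u (c m)), (u ` Z, fmap F (Id_on Z) (Id_on (u ` Z)) u t)) \<in> lan_joins F A"
    using fu u by (intro lan_joins.chain) auto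
  then show ?thesis using g unfolding cocone_def leaf_def by auto
qed

lemma leaf_vary:
  assumes g: "cocone A D g" and Z: "finite Z" and ab: "chain_join (hom_cpo (Id_on Z) A) a b"
    and t: "t \<in> Field (fobj F (Id_on Z))"
  shows "chain_join D (\<lambda>m. leaf g Z (a m) t) (leaf g Z b t)"
  using g lan_joins.vary[OF Z ab t] unfolding cocone_def leaf_def by fast

text \<open>The converse of \<open>leaf_nat\<close>, \<open>leaf_chain\<close> and
  \<open>leaf_vary\<close>: a family indexed by all maps \<open>u\<close> is determined by its
  restriction to inclusions, and that restriction is a cocone. Maps out of a Kan extension are
  defined in this form, so that images of maps never have to be handled again.\<close>

lemma cocone_leafI:
  assumes A: "A \<in> obj CPO" and D: "D \<in> obj CPO"
    and mem: "\<And>Z u t. finite Z \<Longrightarrow> u \<in> Z \<rightarrow>\<^sub>E Field A \<Longrightarrow> t \<in> Field (fobj F (Id_on Z)) \<Longrightarrow> l Z u t \<in> Field D"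
    and nat: "\<And>Z W u v t. finite Z \<Longrightarrow> finite W \<Longrightarrow> u \<in> Z \<rightarrow>\<^sub>E Field A \<Longrightarrow> v \<in> W \<rightarrow>\<^sub>E Z \<Longrightarrow>
      t \<in> Field (fobj F (Id_on W)) \<Longrightarrow> l Z u (fmap F (Id_on W) (Id_on Z) v t) = l W (compose W u v) t"
    and chain: "\<And>Z u c t. finite Z \<Longrightarrow> u \<in> Z \<rightarrow>\<^sub>E Field A \<Longrightarrow> chain_join (fobj F (Id_on Z)) c t \<Longrightarrow>
      chain_join D (\<lambda>m. l Z u (c m)) (l Z u t)"
    and vary: "\<And>Z a b t. finite Z \<Longrightarrow> (\<And>m. a m \<in> Z \<rightarrow>\<^sub>E Field A) \<Longrightarrow> b \<in> Z \<rightarrow>\<^sub>E Field A \<Longrightarrow>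
      chain_join (hom_cpo (Id_on Z) A) a b \<Longrightarrow> t \<in> Field (fobj F (Id_on Z)) \<Longrightarrow>
      chain_join D (\<lambda>m. l Z (a m) t) (l Z b t)"
  defines "g \<equiv> \<lambda>(X, t). l X (incl X) t"
  shows "cocone A D g" and "\<And>Z u t. finite Z \<Longrightarrow> u \<in> Z \<rightarrow>\<^sub>E Field A \<Longrightarrow> t \<in> Field (fobj F (Id_on Z)) \<Longrightarrow> leaf g Z u t = l Z u t"
proof -
  have i: "incl X \<in> X \<rightarrow>\<^sub>E Field A" if "X \<subseteq> Field A" for X using that by (auto simp: incl_def)
  show lg: "leaf g Z u t = l Z u t"
    if "finite Z" "u \<in> Z \<rightarrow>\<^sub>E Field A" "t \<in> Field (fobj F (Id_on Z))" for Z u t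
  proof -
    have "u \<in> Z \<rightarrow>\<^sub>E u ` Z" "u ` Z \<subseteq> Field A" using that by auto
    then show ?thesis unfolding leaf_def g_def
      using nat[OF finite_imageI[OF that(1)] that(1) i _ that(3)] compose_incl_left[of u Z "u ` Z"] by simp
  qed
  have "chain_join D (\<lambda>k. g (c k)) (g s)" if "(c, s) \<in> lan_joins F A" for c s
    using that
  proof (cases rule: lan_joins_cases)
    case (chain X c' t)
    then show ?thesis using assms(5)[OF chain(3) i[OF chain(4)] chain(5)] by (simp add: g_def)
  next
    case (enlarge Y X t)
    have X: "finite X" "X \<subseteq> Field A" using enlarge finite_subset by auto
    have "l Y (incl Y) (fmap F (Id_on X) (Id_on Y) (incl X) t) = l X (compose X (incl Y) (incl X)) t"
      by (rule nat[OF enlarge(3) X(1) i[OF enlarge(5)] _ enlarge(6)]) (use enlarge(4) in \<open>auto simp: incl_def\<close>)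
    also have "compose X (incl Y) (incl X) = incl X"
      using enlarge(4) by (auto simp: compose_def incl_def fun_eq_iff)
    finally show ?thesis using enlarge(1,2) chain_join_const[OF CPO_cpo[OF D] mem[OF X(1) i[OF X(2)] enlarge(6)]]
      by (simp add: g_def)
  next
    case (vary Z a b t)
    note m = hom_disc_chain[OF A vary(3,4)]
    show ?thesis using assms(6)[OF vary(3) m(1,2) vary(4,5)] lg[OF vary(3) m(1) vary(5)] lg[OF vary(3) m(2) vary(5)] vary(1,2)
      by (simp add: leaf_def)
  qed
  then show "cocone A D g" unfolding cocone_def using D mem i by (auto simp: g_def lan_gens_def)
qed

lemma can_cocone:
  assumes A: "A \<in> obj CPO"
  shows "cocone A (fobj F A) (can F A)"
    and "finite Z \<Longrightarrow> u \<in> Z \<rightarrow>\<^sub>E Field A \<Longrightarrow> t \<in> Field (fobj F (Id_on Z)) \<Longrightarrow> leaf (can F A) Z u t = fmap F (Id_on Z) A u t"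
proof -
  have *: "fmap F (Id_on Z) A u t \<in> Field (fobj F A)"
    if "finite Z" "u \<in> Z \<rightarrow>\<^sub>E Field A" "t \<in> Field (fobj F (Id_on Z))" for Z u t
    using F_app[OF disc_obj[OF that(1)] A _ that(3)] that disc_maps[OF that(1) A] by blast
  note C = cocone_leafI[OF A F_obj[OF A], where l = "\<lambda>Z u t. fmap F (Id_on Z) A u t"]
  have c: "chain_join (fobj F A) (\<lambda>m. fmap F (Id_on Z) A u (c m)) (fmap F (Id_on Z) A u t)"
    if "finite Z" "u \<in> Z \<rightarrow>\<^sub>E Field A" "chain_join (fobj F (Id_on Z)) c t" for Z u c t
    by (rule continuous_mapD(3)[OF cont_mapsD(1)[OF F_map[OF disc_obj[OF that(1)] A]] that(3)])
       (use that(2) disc_maps[OF that(1) A] in blast)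
  show "cocone A (fobj F A) (can F A)" unfolding can_def
    by (rule C(1)[OF * disc_comp[OF _ _ A] c F_chain_join[OF disc_obj A]])
  show "finite Z \<Longrightarrow> u \<in> Z \<rightarrow>\<^sub>E Field A \<Longrightarrow> t \<in> Field (fobj F (Id_on Z)) \<Longrightarrow> leaf (can F A) Z u t = fmap F (Id_on Z) A u t"
    unfolding can_def
    by (rule C(2)[OF * disc_comp[OF _ _ A] c F_chain_join[OF disc_obj A]])
qed

end


section \<open>The pointwise Kan extension as an enriched endofunctor, compared with strong
  finitarity\<close>

context enriched_functor
begin

lemma lan_ext:
  assumes C: "free_cpo (lan_gens F A) (lan_joins F A) C e" and g: "cocone A D g"
  obtains h where "h \<in> cont_maps C D" "\<And>s. s \<in> lan_gens F A \<Longrightarrow> h (e s) = g s"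
    "\<And>Z u t. finite Z \<Longrightarrow> u \<in> Z \<rightarrow>\<^sub>E Field A \<Longrightarrow> t \<in> Field (fobj F (Id_on Z)) \<Longrightarrow> h (leaf e Z u t) = leaf g Z u t"
proof -
  have D: "D \<in> obj CPO" and gm: "\<And>s. s \<in> lan_gens F A \<Longrightarrow> g s \<in> Field D"
    and gj: "\<And>c s. (c, s) \<in> lan_joins F A \<Longrightarrow> chain_join D (\<lambda>k. g (c k)) (g s)"
    using g unfolding cocone_def by auto
  obtain h where h: "h \<in> cont_maps C D" "\<And>s. s \<in> lan_gens F A \<Longrightarrow> h (e s) = g s"
    by (rule free_cpo_ext[OF C D, of g]) (use gm gj in auto)
  have "h (leaf e Z u t) = leaf g Z u t"
    if Z: "finite Z" "u \<in> Z \<rightarrow>\<^sub>E Field A" "t \<in> Field (fobj F (Id_on Z))" for Z u t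
  proof -
    have "u \<in> Z \<rightarrow>\<^sub>E u ` Z" using Z by auto
    then have "(u ` Z, fmap F (Id_on Z) (Id_on (u ` Z)) u t) \<in> lan_gens F A"
      unfolding lan_gens_def using disc_app[OF Z(1) _ _ Z(3)] Z by auto
    then show ?thesis unfolding leaf_def by (rule h(2))
  qed
  then show ?thesis using that h by blast
qed

lemma lan_induct:
  assumes C: "free_cpo (lan_gens F A) (lan_joins F A) C e" and x: "x \<in> Field C"
    and P: "\<And>X t. finite X \<Longrightarrow> X \<subseteq> Field A \<Longrightarrow> incl X \<in> X \<rightarrow>\<^sub>E Field A \<Longrightarrow>
      t \<in> Field (fobj F (Id_on X)) \<Longrightarrow> P (leaf e X (incl X) t)"
    and j: "join_closed C {x \<in> Field C. P x}"
  shows "P x"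
proof (rule join_denseD[OF free_cpoD(5)[OF C] x free_cpoD(6)[OF C] _ j])
  fix y assume "y \<in> e ` lan_gens F A"
  then obtain X t where y: "y = e (X, t)" "(X, t) \<in> lan_gens F A" by auto
  then have "P (leaf e X (incl X) t)" by (intro P) (auto simp: lan_gens_def incl_def)
  then show "P y" using leaf_incl[OF y(2)] y(1) by simp
qed

lemma lan_eqI:
  assumes C: "free_cpo (lan_gens F A) (lan_joins F A) C e" and D: "cpo D"
    and h: "h \<in> cont_maps C D" "h' \<in> cont_maps C D" and x: "x \<in> Field C"
    and P: "\<And>X t. finite X \<Longrightarrow> X \<subseteq> Field A \<Longrightarrow> incl X \<in> X \<rightarrow>\<^sub>E Field A \<Longrightarrow>
      t \<in> Field (fobj F (Id_on X)) \<Longrightarrow> h (leaf e X (incl X) t) = h' (leaf e X (incl X) t)"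
  shows "h x = h' x"
  by (rule lan_induct[OF C x P join_closed_eq[OF free_cpoD(1)[OF C] D cont_mapsD(1)[OF h(1)] cont_mapsD(1)[OF h(2)]]])

text \<open>A choice, for each \<open>A\<close>, of the presented cpo together with its generating
  map.\<close>

definition L_pair :: "'u rel \<Rightarrow> 'u rel \<times> ('u set \<times> 'u \<Rightarrow> 'u)" where
  "L_pair A = (SOME p. free_cpo (lan_gens F A) (lan_joins F A) (fst p) (snd p))"

abbreviation "L_obj A \<equiv> fst (L_pair A)"
abbreviation "L_leaf A \<equiv> leaf (snd (L_pair A))"

lemma L_free: "A \<in> obj CPO \<Longrightarrow> free_cpo (lan_gens F A) (lan_joins F A) (L_obj A) (snd (L_pair A))"
proof -
  assume A: "A \<in> obj CPO"
  obtain C :: "'u rel" and e where "free_cpo (lan_gens F A) (lan_joins F A) C e"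
    using free_cpo_exists[OF lan_gens_small[OF A] lan_joins_gens[OF A]] by blast
  then have "\<exists>p :: 'u rel \<times> ('u set \<times> 'u \<Rightarrow> 'u). free_cpo (lan_gens F A) (lan_joins F A) (fst p) (snd p)"
    by (intro exI[of _ "(C, e)"]) simp
  then show ?thesis unfolding L_pair_def by (rule someI_ex)
qed

lemma L_cocone: "A \<in> obj CPO \<Longrightarrow> cocone A (L_obj A) (snd (L_pair A))"
  by (rule free_cpo_cocone[OF L_free])

lemma L_obj: "A \<in> obj CPO \<Longrightarrow> L_obj A \<in> obj CPO"
  using L_cocone unfolding cocone_def by blast

lemma compose_PiE: "u \<in> Z \<rightarrow>\<^sub>E Field A \<Longrightarrow> f \<in> cont_maps A B \<Longrightarrow> compose Z f u \<in> Z \<rightarrow>\<^sub>E Field B"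
  by (auto simp: compose_def PiE_iff dest: cont_maps_app)

lemma compose_hom_chain:
  assumes A: "A \<in> obj CPO" and B: "B \<in> obj CPO" and Z: "finite (Z :: 'u set)"
    and ab: "\<And>m. a m \<in> Z \<rightarrow>\<^sub>E Field B" "b \<in> Z \<rightarrow>\<^sub>E Field B"
    and j: "\<And>z. z \<in> Z \<Longrightarrow> chain_join B (\<lambda>m. a m z) (b z)"
  shows "chain_join (hom_cpo (Id_on Z) B) a b"
  by (rule chain_join_homI) (use ab j disc_maps[OF Z B] in auto)

text \<open>Composition with \<open>f\<close> turns maps into \<open>A\<close> into maps into
  \<open>B\<close>. It preserves the relations; for \<open>vary\<close> this uses that
  \<open>f\<close> is continuous.\<close>

lemma L_map_exists:
  assumes A: "A \<in> obj CPO" and B: "B \<in> obj CPO" and f: "f \<in> cont_maps A B"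
  shows "\<exists>h\<in>cont_maps (L_obj A) (L_obj B). \<forall>Z u t. finite Z \<and> u \<in> Z \<rightarrow>\<^sub>E Field A \<and> t \<in> Field (fobj F (Id_on Z)) \<longrightarrow>
    h (L_leaf A Z u t) = L_leaf B Z (compose Z f u) t"
proof -
  let ?l = "\<lambda>Z u t. L_leaf B Z (compose Z f u) t"
  note LB = L_cocone[OF B]
  have 1: "?l Z u t \<in> Field (L_obj B)" if "finite Z" "u \<in> Z \<rightarrow>\<^sub>E Field A" "t \<in> Field (fobj F (Id_on Z))" for Z u t
    by (rule leaf_mem[OF LB that(1) compose_PiE[OF that(2) f] that(3)])
  have 2: "?l Z u (fmap F (Id_on W) (Id_on Z) v t) = ?l W (compose W u v) t"
    if "finite Z" "finite W" "u \<in> Z \<rightarrow>\<^sub>E Field A" "v \<in> W \<rightarrow>\<^sub>E Z" "t \<in> Field (fobj F (Id_on W))" for Z W u v t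
  proof -
    have "compose W (compose Z f u) v = compose W f (compose W u v)"
      using that(4) by (auto simp: compose_def fun_eq_iff)
    then show ?thesis using leaf_nat[OF LB B that(1,2) compose_PiE[OF that(3) f] that(4,5)] by simp
  qed
  have 3: "chain_join (L_obj B) (\<lambda>m. ?l Z u (c m)) (?l Z u t)"
    if "finite Z" "u \<in> Z \<rightarrow>\<^sub>E Field A" "chain_join (fobj F (Id_on Z)) c t" for Z u c t
    by (rule leaf_chain[OF LB that(1) compose_PiE[OF that(2) f] that(3)])
  have 4: "chain_join (L_obj B) (\<lambda>m. ?l Z (a m) t) (?l Z b t)"
    if "finite Z" "\<And>m. a m \<in> Z \<rightarrow>\<^sub>E Field A" "b \<in> Z \<rightarrow>\<^sub>E Field A" "chain_join (hom_cpo (Id_on Z) A) a b"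
      "t \<in> Field (fobj F (Id_on Z))" for Z a b t
  proof (rule leaf_vary[OF LB that(1) _ that(5)])
    show "chain_join (hom_cpo (Id_on Z) B) (\<lambda>m. compose Z f (a m)) (compose Z f b)"
    proof (rule compose_hom_chain[OF A B that(1) compose_PiE[OF that(2) f] compose_PiE[OF that(3) f]])
      fix z assume z: "z \<in> Z"
      show "chain_join B (\<lambda>m. compose Z f (a m) z) (compose Z f b z)"
        using continuous_mapD(3)[OF cont_mapsD(1)[OF f] hom_disc_chain(3)[OF A that(1,4) z]] z
        by (simp add: compose_def)
    qed
  qed
  note C = cocone_leafI[of A "L_obj B" ?l, OF A L_obj[OF B] 1 2 3 4]
  obtain h where h: "h \<in> cont_maps (L_obj A) (L_obj B)"
    "\<And>Z u t. finite Z \<Longrightarrow> u \<in> Z \<rightarrow>\<^sub>E Field A \<Longrightarrow> t \<in> Field (fobj F (Id_on Z)) \<Longrightarrow>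
      h (L_leaf A Z u t) = leaf (\<lambda>(X, t). ?l X (incl X) t) Z u t"
    by (rule lan_ext[OF L_free[OF A] C(1)]) auto
  show ?thesis
    by (rule bexI[OF _ h(1)]) (simp add: h(2) C(2))
qed

definition L_map :: "'u rel \<Rightarrow> 'u rel \<Rightarrow> ('u \<Rightarrow> 'u) \<Rightarrow> 'u \<Rightarrow> 'u" where
  "L_map A B f = (SOME h. h \<in> cont_maps (L_obj A) (L_obj B) \<and>
    (\<forall>Z u t. finite Z \<and> u \<in> Z \<rightarrow>\<^sub>E Field A \<and> t \<in> Field (fobj F (Id_on Z)) \<longrightarrow>
      h (L_leaf A Z u t) = L_leaf B Z (compose Z f u) t))"

lemma L_map:
  assumes "A \<in> obj CPO" "B \<in> obj CPO" "f \<in> cont_maps A B"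
  shows "L_map A B f \<in> cont_maps (L_obj A) (L_obj B)"
    "finite Z \<Longrightarrow> u \<in> Z \<rightarrow>\<^sub>E Field A \<Longrightarrow> t \<in> Field (fobj F (Id_on Z)) \<Longrightarrow>
      L_map A B f (L_leaf A Z u t) = L_leaf B Z (compose Z f u) t"
proof -
  have "\<exists>h. h \<in> cont_maps (L_obj A) (L_obj B) \<and>
    (\<forall>Z u t. finite Z \<and> u \<in> Z \<rightarrow>\<^sub>E Field A \<and> t \<in> Field (fobj F (Id_on Z)) \<longrightarrow>
      h (L_leaf A Z u t) = L_leaf B Z (compose Z f u) t)"
    using L_map_exists[OF assms] by blast
  from someI_ex[OF this]
  show "L_map A B f \<in> cont_maps (L_obj A) (L_obj B)"
    "finite Z \<Longrightarrow> u \<in> Z \<rightarrow>\<^sub>E Field A \<Longrightarrow> t \<in> Field (fobj F (Id_on Z)) \<Longrightarrow>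
      L_map A B f (L_leaf A Z u t) = L_leaf B Z (compose Z f u) t"
    unfolding L_map_def by auto
qed

definition L :: "'u endofunctor" where
  "L = \<lparr>fobj = L_obj, fmap = L_map\<rparr>"

lemma L_simps [simp]: "fobj L = L_obj" "fmap L = L_map"
  by (auto simp: L_def)

lemma L_leaf_mem: "A \<in> obj CPO \<Longrightarrow> finite Z \<Longrightarrow> u \<in> Z \<rightarrow>\<^sub>E Field A \<Longrightarrow> t \<in> Field (fobj F (Id_on Z)) \<Longrightarrow>
    L_leaf A Z u t \<in> Field (L_obj A)"
  by (rule leaf_mem[OF L_cocone])

text \<open>All laws are checked on generators, where \<open>L_map\<close> is composition of maps.
  Local continuity is what the relation \<open>vary\<close> was imposed for.\<close>

lemma L_enriched: "enriched_endofunctor L"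
  unfolding enriched_endofunctor_def is_functor_def L_simps CPO_simps
proof (intro conjI ballI)
  fix A :: "'u rel" assume A: "A \<in> obj CPO"
  show "L_obj A \<in> obj CPO" by (rule L_obj[OF A])
  have i: "(\<lambda>x\<in>Field A. x) \<in> cont_maps A A" by (rule cont_maps_id[OF CPO_cpo[OF A]])
  have i': "(\<lambda>x\<in>Field (L_obj A). x) \<in> cont_maps (L_obj A) (L_obj A)"
    by (rule cont_maps_id[OF CPO_cpo[OF L_obj[OF A]]])
  show "L_map A A (\<lambda>x\<in>Field A. x) = (\<lambda>x\<in>Field (L_obj A). x)"
  proof (rule cont_maps_eqI[OF L_map(1)[OF A A i] i'])
    fix x assume x: "x \<in> Field (L_obj A)"
    show "L_map A A (\<lambda>x\<in>Field A. x) x = (\<lambda>x\<in>Field (L_obj A). x) x"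
    proof (rule lan_eqI[OF L_free[OF A] CPO_cpo[OF L_obj[OF A]] L_map(1)[OF A A i] i' x])
      fix X t assume X: "finite X" "X \<subseteq> Field A" "incl X \<in> X \<rightarrow>\<^sub>E Field A" "t \<in> Field (fobj F (Id_on X))"
      have "compose X (\<lambda>x\<in>Field A. x) (incl X) = incl X" using X(2) by (auto simp: compose_def incl_def fun_eq_iff)
      then show "L_map A A (\<lambda>x\<in>Field A. x) (L_leaf A X (incl X) t) = (\<lambda>x\<in>Field (L_obj A). x) (L_leaf A X (incl X) t)"
        using L_map(2)[OF A A i X(1,3,4)] L_leaf_mem[OF A X(1,3,4)] by simp
    qed
  qed
next
  fix A B :: "'u rel" and f assume A: "A \<in> obj CPO" and B: "B \<in> obj CPO" and f: "f \<in> cont_maps A B"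
  show "L_map A B f \<in> cont_maps (L_obj A) (L_obj B)" by (rule L_map(1)[OF A B f])
next
  fix A B C :: "'u rel" and f g assume A: "A \<in> obj CPO" and B: "B \<in> obj CPO" and C: "C \<in> obj CPO"
    and f: "f \<in> cont_maps A B" and g: "g \<in> cont_maps B C"
  let ?c = "compose (Field A) g f" and ?d = "compose (Field (L_obj A)) (L_map B C g) (L_map A B f)"
  have c: "?c \<in> cont_maps A C" by (rule cont_maps_compose[OF f g])
  have d: "?d \<in> cont_maps (L_obj A) (L_obj C)"
    by (rule cont_maps_compose[OF L_map(1)[OF A B f] L_map(1)[OF B C g]])
  show "L_map A C ?c = ?d"
  proof (rule cont_maps_eqI[OF L_map(1)[OF A C c] d])
    fix x assume x: "x \<in> Field (L_obj A)"
    show "L_map A C ?c x = ?d x"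
    proof (rule lan_eqI[OF L_free[OF A] CPO_cpo[OF L_obj[OF C]] L_map(1)[OF A C c] d x])
      fix X t assume X: "finite X" "X \<subseteq> Field A" "incl X \<in> X \<rightarrow>\<^sub>E Field A" "t \<in> Field (fobj F (Id_on X))"
      have "compose X g (compose X f (incl X)) = compose X ?c (incl X)"
        using X(2) by (auto simp: compose_def fun_eq_iff)
      then show "L_map A C ?c (L_leaf A X (incl X) t) = ?d (L_leaf A X (incl X) t)"
        using L_map(2)[OF A C c X(1,3,4)] L_map(2)[OF A B f X(1,3,4)]
          L_map(2)[OF B C g X(1) compose_PiE[OF X(3) f] X(4)] L_leaf_mem[OF A X(1,3,4)]
        by (simp add: CPO_compose_app)
    qed
  qed
next
  fix A B :: "'u rel" assume A: "A \<in> obj CPO" and B: "B \<in> obj CPO"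
  show "continuous_map (hom_cpo A B) (hom_cpo (L_obj A) (L_obj B)) (L_map A B)"
  proof (rule continuous_mapI[OF cpo_hom_cpo[OF CPO_cpo[OF A] CPO_cpo[OF B]]])
    show "L_map A B f \<in> Field (hom_cpo (L_obj A) (L_obj B))" if "f \<in> Field (hom_cpo A B)" for f
      using that L_map(1)[OF A B]
      unfolding field_hom_cpo[OF CPO_cpo[OF B]] field_hom_cpo[OF CPO_cpo[OF L_obj[OF B]]] by simp
    fix f g assume fg: "chain_join (hom_cpo A B) f g"
    then have m: "f k \<in> cont_maps A B" "g \<in> cont_maps A B" for k
      using chain_joinD(1,2)[OF fg] field_hom_cpo[OF CPO_cpo[OF B]] by auto
    show "chain_join (hom_cpo (L_obj A) (L_obj B)) (\<lambda>k. L_map A B (f k)) (L_map A B g)"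
    proof (rule chain_join_homI[OF L_map(1)[OF A B m(1)] L_map(1)[OF A B m(2)]])
      fix x assume x: "x \<in> Field (L_obj A)"
      show "chain_join (L_obj B) (\<lambda>k. L_map A B (f k) x) (L_map A B g x)"
      proof (rule lan_induct[OF L_free[OF A] x])
        show "join_closed (L_obj A) {x \<in> Field (L_obj A). chain_join (L_obj B) (\<lambda>k. L_map A B (f k) x) (L_map A B g x)}"
          by (rule join_closed_chain_join[OF CPO_cpo[OF L_obj[OF A]] CPO_cpo[OF L_obj[OF B]]
            cont_mapsD(1)[OF L_map(1)[OF A B m(1)]] cont_mapsD(1)[OF L_map(1)[OF A B m(2)]]])
        fix X t assume X: "finite X" "X \<subseteq> Field A" "incl X \<in> X \<rightarrow>\<^sub>E Field A" "t \<in> Field (fobj F (Id_on X))"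
        \<comment> \<open>A chain of maps \<open>f k\<close> restricts to a chain of maps from the
          finite set \<open>X\<close> into \<open>B\<close>, to which \<open>leaf_vary\<close>
          applies.\<close>
        have "chain_join (hom_cpo (Id_on X) B) (\<lambda>k. compose X (f k) (incl X)) (compose X g (incl X))"
        proof (rule compose_hom_chain[OF A B X(1) compose_PiE[OF X(3) m(1)] compose_PiE[OF X(3) m(2)]])
          fix z assume "z \<in> X"
          then show "chain_join B (\<lambda>k. compose X (f k) (incl X) z) (compose X g (incl X) z)"
            using chain_join_homD[OF CPO_cpo[OF A] CPO_cpo[OF B] fg, of z] X(2) by (auto simp: compose_def)
        qed
        from leaf_vary[OF L_cocone[OF B] X(1) this X(4)]
        show "chain_join (L_obj B) (\<lambda>k. L_map A B (f k) (L_leaf A X (incl X) t)) (L_map A B g (L_leaf A X (incl X) t))"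
          using L_map(2)[OF A B m(1) X(1,3,4)] L_map(2)[OF A B m(2) X(1,3,4)] by simp
      qed
    qed
  qed
qed

text \<open>Strong finitarity produces a transformation \<open>\<tau>\<close> from \<open>F\<close>
  to \<open>L\<close>, and the presentation produces the canonical \<open>\<kappa>\<close> from
  \<open>L\<close> to \<open>F\<close>. They are inverse to each other: one composite by uniqueness
  of extensions from finite discrete cpos, the other by inspection of generators. Hence
  \<open>F A\<close> inherits the presentation.\<close>

theorem strongly_finitary_pointwise:
  assumes SF: "strongly_finitary F"
  shows "pointwise_lan F"
proof -
  \<comment> \<open>On a finite discrete cpo \<open>X\<close> the element \<open>t\<close> is sent
    to the generator \<open>(X, t)\<close>.\<close>
  define \<sigma> where "\<sigma> = (\<lambda>X\<in>{X. finite X}. \<lambda>t\<in>Field (fobj F (Id_on X)). L_leaf (Id_on X) X (incl X) t)"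
  have "nat_trans SetFin CPO (F \<odot> K_disc) (L \<odot> K_disc) \<sigma>"
  proof (rule nat_trans_SetFin_I)
    show "\<sigma> \<in> extensional {X. finite X}" unfolding \<sigma>_def by simp
    fix X :: "'u set" assume X: "finite X"
    have i: "incl X \<in> X \<rightarrow>\<^sub>E Field (Id_on X)" by (auto simp: incl_def)
    note C = L_cocone[OF disc_obj[OF X]]
    have "continuous_map (fobj F (Id_on X)) (L_obj (Id_on X)) (\<lambda>t. L_leaf (Id_on X) X (incl X) t)"
      by (rule continuous_mapI[OF CPO_cpo[OF F_obj[OF disc_obj[OF X]]] leaf_mem[OF C X i] leaf_chain[OF C X i]])
    from cont_maps_restrict[OF this]
    show "\<sigma> X \<in> cont_maps (fobj F (Id_on X)) (fobj L (Id_on X))" unfolding \<sigma>_def using X by simp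
  next
    fix X Y :: "'u set" and f x assume X: "finite X" and Y: "finite Y" and f: "f \<in> X \<rightarrow>\<^sub>E Y"
      and x: "x \<in> Field (fobj F (Id_on X))"
    have f': "f \<in> cont_maps (Id_on X) (Id_on Y)" using f disc_maps[OF X disc_obj[OF Y]] by simp
    have i: "incl X \<in> X \<rightarrow>\<^sub>E Field (Id_on X)" "incl Y \<in> Y \<rightarrow>\<^sub>E Field (Id_on Y)" by (auto simp: incl_def)
    have "compose X f (incl X) = f" "compose X (incl Y) f = f"
      using f by (auto simp: compose_def fun_eq_iff PiE_iff extensional_def)
    then show "fmap L (Id_on X) (Id_on Y) f (\<sigma> X x) = \<sigma> Y (fmap F (Id_on X) (Id_on Y) f x)"
      using L_map(2)[OF disc_obj[OF X] disc_obj[OF Y] f' X i(1) x]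
        leaf_nat[OF L_cocone[OF disc_obj[OF Y]] disc_obj[OF Y] Y X i(2) f x] disc_app[OF X Y f x]
      by (simp add: \<sigma>_def X Y x)
  qed
  then have "\<exists>!\<tau>. nat_trans CPO CPO F L \<tau> \<and> (\<forall>X\<in>obj SetFin. \<tau> (fobj K_disc X) = \<sigma> X)"
    using SF L_enriched unfolding strongly_finitary_def by blast
  then obtain \<tau> where "nat_trans CPO CPO F L \<tau> \<and> (\<forall>X\<in>obj SetFin. \<tau> (fobj K_disc X) = \<sigma> X)"
    by (rule ex1E)
  then have \<tau>: "nat_trans CPO CPO F L \<tau>" "\<And>X. finite X \<Longrightarrow> \<tau> (Id_on X) = \<sigma> X"
    by (simp_all add: SetFin_def K_disc_def)
  \<comment> \<open>The comparison map \<open>\<kappa> A\<close> is induced by the canonical cocone,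
    which sends \<open>u\<close> and \<open>t\<close> to the value of \<open>F u\<close> at
    \<open>t\<close>.\<close>
  have "\<exists>h\<in>cont_maps (L_obj A) (fobj F A). \<forall>Z u t. finite Z \<and> u \<in> Z \<rightarrow>\<^sub>E Field A \<and> t \<in> Field (fobj F (Id_on Z)) \<longrightarrow>
      h (L_leaf A Z u t) = fmap F (Id_on Z) A u t" if A: "A \<in> obj CPO" for A
  proof -
    obtain h where "h \<in> cont_maps (L_obj A) (fobj F A)"
      "\<And>Z u t. finite Z \<Longrightarrow> u \<in> Z \<rightarrow>\<^sub>E Field A \<Longrightarrow> t \<in> Field (fobj F (Id_on Z)) \<Longrightarrow>
        h (L_leaf A Z u t) = leaf (can F A) Z u t"
      by (rule lan_ext[OF L_free[OF A] can_cocone(1)[OF A]]) auto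
    then show ?thesis using can_cocone(2)[OF A] by (intro bexI[of _ h]) auto
  qed
  then obtain \<kappa> where \<kappa>: "\<And>A. A \<in> obj CPO \<Longrightarrow> \<kappa> A \<in> cont_maps (L_obj A) (fobj F A)"
    "\<And>A Z u t. A \<in> obj CPO \<Longrightarrow> finite Z \<Longrightarrow> u \<in> Z \<rightarrow>\<^sub>E Field A \<Longrightarrow> t \<in> Field (fobj F (Id_on Z)) \<Longrightarrow>
      \<kappa> A (L_leaf A Z u t) = fmap F (Id_on Z) A u t" by metis
  have \<kappa>nat: "fmap F A B f (\<kappa> A x) = \<kappa> B (L_map A B f x)"
    if A: "A \<in> obj CPO" and B: "B \<in> obj CPO" and f: "f \<in> cont_maps A B" and x: "x \<in> Field (L_obj A)" for A B f x
  proof -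
    have "compose (Field (L_obj A)) (fmap F A B f) (\<kappa> A) x = compose (Field (L_obj A)) (\<kappa> B) (L_map A B f) x"
    proof (rule lan_eqI[OF L_free[OF A] CPO_cpo[OF F_obj[OF B]] cont_maps_compose[OF \<kappa>(1)[OF A] F_map[OF A B f]]
        cont_maps_compose[OF L_map(1)[OF A B f] \<kappa>(1)[OF B]] x])
      fix X t assume X: "finite X" "X \<subseteq> Field A" "incl X \<in> X \<rightarrow>\<^sub>E Field A" "t \<in> Field (fobj F (Id_on X))"
      have i: "incl X \<in> cont_maps (Id_on X) A" using incl_map[OF X(1) A X(2)] .
      show "compose (Field (L_obj A)) (fmap F A B f) (\<kappa> A) (L_leaf A X (incl X) t)
        = compose (Field (L_obj A)) (\<kappa> B) (L_map A B f) (L_leaf A X (incl X) t)"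
        using \<kappa>(2)[OF A X(1,3,4)] \<kappa>(2)[OF B X(1) compose_PiE[OF X(3) f] X(4)] L_map(2)[OF A B f X(1,3,4)]
          F_comp[OF disc_obj[OF X(1)] A B i f X(4)] L_leaf_mem[OF A X(1,3,4)]
        by (simp add: CPO_compose_app)
    qed
    then show ?thesis using x by (simp add: CPO_compose_app)
  qed
  have \<tau>m: "\<tau> A \<in> cont_maps (fobj F A) (L_obj A)" if "A \<in> obj CPO" for A
    using nat_trans_CPO_D(2)[OF \<tau>(1) that] by simp
  let ?id = "\<lambda>A\<in>obj CPO. \<lambda>x\<in>Field (fobj F A). x"
  let ?\<kappa>\<tau> = "\<lambda>A\<in>obj CPO. compose (Field (fobj F A)) (\<kappa> A) (\<tau> A)"
  \<comment> \<open>Both \<open>?\<kappa>\<tau>\<close> and \<open>?id\<close> extend the identity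
    transformation \<open>?\<iota>\<close> of the restriction of \<open>F\<close>, so the uniqueness
    clause of strong finitarity, taken with \<open>F\<close> as target, makes them equal.\<close>
  let ?\<iota> = "\<lambda>X\<in>{X. finite X}. \<lambda>x\<in>Field (fobj F (Id_on X)). x"
  have \<iota>: "nat_trans SetFin CPO (F \<odot> K_disc) (F \<odot> K_disc) ?\<iota>"
    by (rule nat_trans_SetFin_I)
       (use disc_app in \<open>auto intro!: cont_maps_id CPO_cpo F_obj disc_obj\<close>)
  have n1: "nat_trans CPO CPO F F ?id"
    by (rule nat_trans_CPO_I) (use F_app in \<open>auto intro!: cont_maps_id CPO_cpo F_obj\<close>)
  have n2: "nat_trans CPO CPO F F ?\<kappa>\<tau>"
  proof (rule nat_trans_CPO_I)
    show "?\<kappa>\<tau> A \<in> cont_maps (fobj F A) (fobj F A)" if "A \<in> obj CPO" for A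
      using cont_maps_compose[OF \<tau>m[OF that] \<kappa>(1)[OF that]] that by simp
    fix A B :: "'u rel" and f x assume A: "A \<in> obj CPO" and B: "B \<in> obj CPO" and f: "f \<in> cont_maps A B"
      and x: "x \<in> Field (fobj F A)"
    show "fmap F A B f (?\<kappa>\<tau> A x) = ?\<kappa>\<tau> B (fmap F A B f x)"
      using \<kappa>nat[OF A B f cont_maps_app[OF \<tau>m[OF A] x]] nat_trans_CPO_D(3)[OF \<tau>(1) A B f x] F_app[OF A B f x] x A B
      by (simp add: CPO_compose_app)
  qed simp
  have e1: "?\<kappa>\<tau> (Id_on X) = ?\<iota> X" if X: "finite X" for X
  proof
    fix t show "?\<kappa>\<tau> (Id_on X) t = ?\<iota> X t"
    proof (cases "t \<in> Field (fobj F (Id_on X))")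
      case True
      have i: "incl X \<in> X \<rightarrow>\<^sub>E Field (Id_on X)" by (auto simp: incl_def)
      show ?thesis using \<kappa>(2)[OF disc_obj[OF X] X i True] True X disc_id[OF X True]
        by (simp add: disc_obj \<tau>(2) \<sigma>_def CPO_compose_app)
    qed (use X in \<open>simp add: disc_obj compose_def\<close>)
  qed
  have ex1: "\<exists>!\<sigma>'. nat_trans CPO CPO F F \<sigma>' \<and> (\<forall>X\<in>obj SetFin. \<sigma>' (fobj K_disc X) = ?\<iota> X)"
    using SF \<iota> enriched unfolding strongly_finitary_def by blast
  have "?\<kappa>\<tau> = ?id"
  proof -
    have "\<forall>X\<in>obj SetFin. ?\<kappa>\<tau> (fobj K_disc X) = ?\<iota> X" using e1 by (simp only: SetFin_def K_disc_def cat.simps fctr.simps mem_Collect_eq) blast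
    moreover have "\<forall>X\<in>obj SetFin. ?id (fobj K_disc X) = ?\<iota> X" by (simp add: SetFin_def K_disc_def disc_obj)
    ultimately show ?thesis using ex1 n1 n2 by blast
  qed
  then have \<kappa>\<tau>: "\<kappa> A (\<tau> A y) = y" if "A \<in> obj CPO" "y \<in> Field (fobj F A)" for A y
    using that by (metis (no_types, lifting) CPO_compose_app restrict_apply')
  \<comment> \<open>On a generator over \<open>X\<close> naturality of \<open>\<tau>\<close> at the
    inclusion of \<open>X\<close> leads back to \<open>\<tau>\<close> on the discrete cpo, where it
    is \<open>\<sigma>\<close>.\<close>
  have \<tau>\<kappa>: "\<tau> A (\<kappa> A x) = x" if A: "A \<in> obj CPO" and x: "x \<in> Field (L_obj A)" for A x
  proof -
    have "compose (Field (L_obj A)) (\<tau> A) (\<kappa> A) x = (\<lambda>x\<in>Field (L_obj A). x) x"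
    proof (rule lan_eqI[OF L_free[OF A] CPO_cpo[OF L_obj[OF A]] cont_maps_compose[OF \<kappa>(1)[OF A] \<tau>m[OF A]]
        cont_maps_id[OF CPO_cpo[OF L_obj[OF A]]] x])
      fix X t assume X: "finite X" "X \<subseteq> Field A" "incl X \<in> X \<rightarrow>\<^sub>E Field A" "t \<in> Field (fobj F (Id_on X))"
      have i: "incl X \<in> cont_maps (Id_on X) A" using incl_map[OF X(1) A X(2)] .
      have i': "incl X \<in> X \<rightarrow>\<^sub>E Field (Id_on X)" by (auto simp: incl_def)
      have "\<tau> A (fmap F (Id_on X) A (incl X) t) = L_map (Id_on X) A (incl X) (\<tau> (Id_on X) t)"
        using nat_trans_CPO_D(3)[OF \<tau>(1) disc_obj[OF X(1)] A i X(4)] by simp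
      also have "\<tau> (Id_on X) t = L_leaf (Id_on X) X (incl X) t" using \<tau>(2)[OF X(1)] X(1,4) by (simp add: \<sigma>_def)
      also have "L_map (Id_on X) A (incl X) (L_leaf (Id_on X) X (incl X) t) = L_leaf A X (compose X (incl X) (incl X)) t"
        by (rule L_map(2)[OF disc_obj[OF X(1)] A i X(1) i' X(4)])
      also have "compose X (incl X) (incl X) = incl X" by (auto simp: compose_def incl_def)
      finally show "compose (Field (L_obj A)) (\<tau> A) (\<kappa> A) (L_leaf A X (incl X) t) = (\<lambda>x\<in>Field (L_obj A). x) (L_leaf A X (incl X) t)"
        using \<kappa>(2)[OF A X(1,3,4)] L_leaf_mem[OF A X(1,3,4)] by (simp add: CPO_compose_app)
    qed
    then show ?thesis using x by (simp add: CPO_compose_app)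
  qed
  show ?thesis unfolding pointwise_lan_def
  proof
    fix A :: "'u rel" assume A: "A \<in> obj CPO"
    show "free_cpo (lan_gens F A) (lan_joins F A) (fobj F A) (can F A)"
    proof (rule free_cpo_iso[OF L_free[OF A] lan_joins_gens[OF A] F_obj[OF A] \<kappa>(1)[OF A] \<tau>m[OF A] \<kappa>\<tau>[OF A] \<tau>\<kappa>[OF A]])
      fix s assume s: "s \<in> lan_gens F A"
      obtain X t where [simp]: "s = (X, t)" by (cases s)
      have "finite X" "incl X \<in> X \<rightarrow>\<^sub>E Field A" "t \<in> Field (fobj F (Id_on X))"
        using s by (auto simp: lan_gens_def incl_def)
      from \<kappa>(2)[OF A this] leaf_incl[of X t A "snd (L_pair A)"] s
      show "can F A s = \<kappa> A (snd (L_pair A) s)" by (simp add: can_def)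
    qed
  qed
qed

text \<open>The family sending \<open>u\<close> and \<open>t\<close> to the value of
  \<open>G u\<close> at \<open>\<sigma> Z t\<close> respects all relations, because \<open>G\<close>
  is enriched and \<open>\<sigma>\<close> natural; so it extends to \<open>F A\<close>. Naturality
  and uniqueness only have to be seen on generators.\<close>

theorem pointwise_strongly_finitary:
  assumes pw: "pointwise_lan F"
  shows "strongly_finitary F"
  unfolding strongly_finitary_def
proof (intro conjI allI impI, rule enriched, elim conjE)
  fix G :: "'u endofunctor" and \<sigma>
  assume G: "enriched_endofunctor G" and \<sigma>: "nat_trans SetFin CPO (F \<odot> K_disc) (G \<odot> K_disc) \<sigma>"
  interpret G: enriched_functor U G by unfold_locales (rule G)
  have free: "free_cpo (lan_gens F A) (lan_joins F A) (fobj F A) (can F A)" if "A \<in> obj CPO" for A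
    using pw that unfolding pointwise_lan_def by blast
  have \<sigma>m: "\<sigma> Z \<in> cont_maps (fobj F (Id_on Z)) (fobj G (Id_on Z))" if "finite Z" for Z
    using nat_trans_SetFin_D(1)[OF \<sigma> that] .
  note \<sigma>n = nat_trans_SetFin_D(2)[OF \<sigma>]
  let ?l = "\<lambda>A Z u t. fmap G (Id_on Z) A u (\<sigma> Z t)"
  have "\<exists>h\<in>cont_maps (fobj F A) (fobj G A). \<forall>Z u t. finite Z \<and> u \<in> Z \<rightarrow>\<^sub>E Field A \<and> t \<in> Field (fobj F (Id_on Z)) \<longrightarrow>
      h (fmap F (Id_on Z) A u t) = ?l A Z u t" if A: "A \<in> obj CPO" for A
  proof -
    have 1: "?l A Z u t \<in> Field (fobj G A)" if "finite Z" "u \<in> Z \<rightarrow>\<^sub>E Field A" "t \<in> Field (fobj F (Id_on Z))" for Z u t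
      using G.F_app[OF disc_obj[OF that(1)] A _ cont_maps_app[OF \<sigma>m[OF that(1)] that(3)]] that(2) disc_maps[OF that(1) A] by simp
    have 2: "?l A Z u (fmap F (Id_on W) (Id_on Z) v t) = ?l A W (compose W u v) t"
      if "finite Z" "finite W" "u \<in> Z \<rightarrow>\<^sub>E Field A" "v \<in> W \<rightarrow>\<^sub>E Z" "t \<in> Field (fobj F (Id_on W))" for Z W u v t
      using G.disc_comp[OF that(2,1) A that(4,3) cont_maps_app[OF \<sigma>m[OF that(2)] that(5)]] \<sigma>n[OF that(2,1,4,5)] by simp
    have 3: "chain_join (fobj G A) (\<lambda>m. ?l A Z u (c m)) (?l A Z u t)"
      if "finite Z" "u \<in> Z \<rightarrow>\<^sub>E Field A" "chain_join (fobj F (Id_on Z)) c t" for Z u c t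
    proof -
      have "u \<in> cont_maps (Id_on Z) A" using that(2) disc_maps[OF that(1) A] by simp
      from continuous_mapD(3)[OF cont_mapsD(1)[OF G.F_map[OF disc_obj[OF that(1)] A this]]
          continuous_mapD(3)[OF cont_mapsD(1)[OF \<sigma>m[OF that(1)]] that(3)]]
      show ?thesis .
    qed
    have 4: "chain_join (fobj G A) (\<lambda>m. ?l A Z (a m) t) (?l A Z b t)"
      if "finite Z" "\<And>m. a m \<in> Z \<rightarrow>\<^sub>E Field A" "b \<in> Z \<rightarrow>\<^sub>E Field A" "chain_join (hom_cpo (Id_on Z) A) a b"
        "t \<in> Field (fobj F (Id_on Z))" for Z a b t
      by (rule G.F_chain_join[OF disc_obj[OF that(1)] A that(4) cont_maps_app[OF \<sigma>m[OF that(1)] that(5)]])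
    note C = cocone_leafI[of A "fobj G A" "?l A", OF A G.F_obj[OF A] 1 2 3 4]
    obtain h where h: "h \<in> cont_maps (fobj F A) (fobj G A)"
      "\<And>Z u t. finite Z \<Longrightarrow> u \<in> Z \<rightarrow>\<^sub>E Field A \<Longrightarrow> t \<in> Field (fobj F (Id_on Z)) \<Longrightarrow>
        h (leaf (can F A) Z u t) = leaf (\<lambda>(X, t). ?l A X (incl X) t) Z u t"
      by (rule lan_ext[OF free[OF A] C(1)]) auto
    show ?thesis
    proof (rule bexI[OF _ h(1)], intro allI impI, elim conjE)
      fix Z u t assume Z: "finite Z" "u \<in> Z \<rightarrow>\<^sub>E Field A" "t \<in> Field (fobj F (Id_on Z))"
      show "h (fmap F (Id_on Z) A u t) = ?l A Z u t"
        using h(2)[OF Z] can_cocone(2)[OF A Z] Z by (simp add: C(2))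
    qed
  qed
  then obtain \<tau> where \<tau>: "\<And>A. A \<in> obj CPO \<Longrightarrow> \<tau> A \<in> cont_maps (fobj F A) (fobj G A)"
    "\<And>A Z u t. A \<in> obj CPO \<Longrightarrow> finite Z \<Longrightarrow> u \<in> Z \<rightarrow>\<^sub>E Field A \<Longrightarrow> t \<in> Field (fobj F (Id_on Z)) \<Longrightarrow>
      \<tau> A (fmap F (Id_on Z) A u t) = ?l A Z u t" by metis
  define \<tau>' where "\<tau>' = (\<lambda>A\<in>obj CPO. \<tau> A)"
  have n: "nat_trans CPO CPO F G \<tau>'"
  proof (rule nat_trans_CPO_I)
    show "\<tau>' \<in> extensional (obj CPO)" unfolding \<tau>'_def by simp
    show "\<tau>' A \<in> cont_maps (fobj F A) (fobj G A)" if "A \<in> obj CPO" for A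
      unfolding \<tau>'_def using \<tau>(1) that by simp
    fix A B :: "'u rel" and f x assume A: "A \<in> obj CPO" and B: "B \<in> obj CPO" and f: "f \<in> cont_maps A B"
      and x: "x \<in> Field (fobj F A)"
    have "compose (Field (fobj F A)) (fmap G A B f) (\<tau> A) x = compose (Field (fobj F A)) (\<tau> B) (fmap F A B f) x"
    proof (rule lan_eqI[OF free[OF A] CPO_cpo[OF G.F_obj[OF B]] cont_maps_compose[OF \<tau>(1)[OF A] G.F_map[OF A B f]]
        cont_maps_compose[OF F_map[OF A B f] \<tau>(1)[OF B]] x])
      fix X t assume X: "finite X" "X \<subseteq> Field A" "incl X \<in> X \<rightarrow>\<^sub>E Field A" "t \<in> Field (fobj F (Id_on X))"
      have i: "incl X \<in> cont_maps (Id_on X) A" using incl_map[OF X(1) A X(2)] .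
      show "compose (Field (fobj F A)) (fmap G A B f) (\<tau> A) (leaf (can F A) X (incl X) t)
        = compose (Field (fobj F A)) (\<tau> B) (fmap F A B f) (leaf (can F A) X (incl X) t)"
        using \<tau>(2)[OF A X(1,3,4)] \<tau>(2)[OF B X(1) compose_PiE[OF X(3) f] X(4)]
          F_comp[OF disc_obj[OF X(1)] A B i f X(4)] can_cocone(2)[OF A X(1,3,4)]
          F_app[OF disc_obj[OF X(1)] A i X(4)]
          G.F_comp[OF disc_obj[OF X(1)] A B i f cont_maps_app[OF \<sigma>m[OF X(1)] X(4)]]
        by (simp add: CPO_compose_app)
    qed
    then show "fmap G A B f (\<tau>' A x) = \<tau>' B (fmap F A B f x)"
      unfolding \<tau>'_def using x A B by (simp add: CPO_compose_app)
  qed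
  have r: "\<tau>' (Id_on X) = \<sigma> X" if X: "finite X" for X
  proof (rule cont_maps_eqI)
    show "\<tau>' (Id_on X) \<in> cont_maps (fobj F (Id_on X)) (fobj G (Id_on X))"
      by (rule nat_trans_CPO_D(2)[OF n disc_obj[OF X]])
    show "\<sigma> X \<in> cont_maps (fobj F (Id_on X)) (fobj G (Id_on X))" by (rule \<sigma>m[OF X])
    fix t assume t: "t \<in> Field (fobj F (Id_on X))"
    have i: "incl X \<in> X \<rightarrow>\<^sub>E Field (Id_on X)" by (auto simp: incl_def)
    show "\<tau>' (Id_on X) t = \<sigma> X t"
      using \<tau>(2)[OF disc_obj[OF X] X i t] disc_id[OF X t] G.disc_id[OF X cont_maps_app[OF \<sigma>m[OF X] t]] disc_obj[OF X]
      by (simp add: \<tau>'_def)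
  qed
  show "\<exists>!\<sigma>'. nat_trans CPO CPO F G \<sigma>' \<and> (\<forall>X\<in>obj SetFin. \<sigma>' (fobj K_disc X) = \<sigma> X)"
  proof (rule ex1I[of _ \<tau>'])
    show "nat_trans CPO CPO F G \<tau>' \<and> (\<forall>X\<in>obj SetFin. \<tau>' (fobj K_disc X) = \<sigma> X)"
      using n r by (simp add: SetFin_def K_disc_def)
    fix \<rho> assume "nat_trans CPO CPO F G \<rho> \<and> (\<forall>X\<in>obj SetFin. \<rho> (fobj K_disc X) = \<sigma> X)"
    then have \<rho>: "nat_trans CPO CPO F G \<rho>" "\<And>X. finite X \<Longrightarrow> \<rho> (Id_on X) = \<sigma> X"
      by (auto simp: SetFin_def K_disc_def)
    show "\<rho> = \<tau>'"
    proof (rule extensionalityI[OF nat_trans_CPO_D(1)[OF \<rho>(1)] nat_trans_CPO_D(1)[OF n]])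
      fix A :: "'u rel" assume A: "A \<in> obj CPO"
      show "\<rho> A = \<tau>' A"
      proof (rule cont_maps_eqI[OF nat_trans_CPO_D(2)[OF \<rho>(1) A] nat_trans_CPO_D(2)[OF n A]])
        fix x assume x: "x \<in> Field (fobj F A)"
        show "\<rho> A x = \<tau>' A x"
        proof (rule lan_eqI[OF free[OF A] CPO_cpo[OF G.F_obj[OF A]] nat_trans_CPO_D(2)[OF \<rho>(1) A] nat_trans_CPO_D(2)[OF n A] x])
          fix X t assume X: "finite X" "X \<subseteq> Field A" "incl X \<in> X \<rightarrow>\<^sub>E Field A" "t \<in> Field (fobj F (Id_on X))"
          have i: "incl X \<in> cont_maps (Id_on X) A" using incl_map[OF X(1) A X(2)] .
          show "\<rho> A (leaf (can F A) X (incl X) t) = \<tau>' A (leaf (can F A) X (incl X) t)"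
            using can_cocone(2)[OF A X(1,3,4)] nat_trans_CPO_D(3)[OF \<rho>(1) disc_obj[OF X(1)] A i X(4)]
              nat_trans_CPO_D(3)[OF n disc_obj[OF X(1)] A i X(4)] \<rho>(2)[OF X(1)] r[OF X(1)] by simp
        qed
      qed
    qed
  qed
qed

end


section \<open>Free algebras in a variety\<close>

lemma varietyD:
  assumes "V \<in> varieties"
  shows "is_signature (sig V)" "A \<in> algs V \<Longrightarrow> A \<in> algebras (sig V)"
  using assms unfolding varieties_def by auto

lemma variety_equations:
  assumes "V \<in> varieties"
  obtains E where "E \<subseteq> xtrms (sig V) \<times> xtrms (sig V)" "algs V = {A \<in> algebras (sig V). \<forall>e\<in>E. satisfies A e}"
  using assms unfolding varieties_def by blast

lemma variety_reflect:
  assumes V: "V \<in> varieties" and A: "A \<in> algebras (sig V)" and B: "\<And>i. i \<in> I \<Longrightarrow> B i \<in> algs V"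
    and h: "\<And>i. i \<in> I \<Longrightarrow> h i \<in> homs (sig V) A (B i)"
    and r: "\<And>x y. x \<in> Field (cpo_of A) \<Longrightarrow> y \<in> Field (cpo_of A) \<Longrightarrow>
      (\<And>i. i \<in> I \<Longrightarrow> (h i x, h i y) \<in> cpo_of (B i)) \<Longrightarrow> (x, y) \<in> cpo_of A"
  shows "A \<in> algs V"
proof -
  obtain E where E: "E \<subseteq> xtrms (sig V) \<times> xtrms (sig V)" "algs V = {A \<in> algebras (sig V). \<forall>e\<in>E. satisfies A e}"
    by (rule variety_equations[OF V])
  have "satisfies A e" if "e \<in> E" for e
    by (rule satisfies_reflect[of A "sig V" I B h, OF A _ h r]) (use B E that in auto)
  then show ?thesis using A E(2) by blast
qed

text \<open>Closure under surjective images holds since homomorphisms preserve definedness of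
  extended terms, and every assignment lifts along a surjection.\<close>

lemma variety_surj:
  assumes V: "V \<in> varieties" and A: "A \<in> algs V" and B: "B \<in> algebras (sig V)"
    and h: "h \<in> homs (sig V) A B" and s: "Field (cpo_of B) \<subseteq> h ` Field (cpo_of A)"
  shows "B \<in> algs V"
proof -
  obtain E where E: "E \<subseteq> xtrms (sig V) \<times> xtrms (sig V)" "algs V = {A \<in> algebras (sig V). \<forall>e\<in>E. satisfies A e}"
    by (rule variety_equations[OF V])
  have "satisfies B e" if "e \<in> E" for e
    by (rule satisfies_surj[OF _ B h _ _ s]) (use A E that in auto)
  then show ?thesis using B E(2) by blast
qed

lemma homs_eqI:
  assumes A: "A \<in> algebras \<Sigma>" and B: "B \<in> algebras \<Sigma>" and h: "h \<in> homs \<Sigma> A B" "k \<in> homs \<Sigma> A B"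
    and G: "generated \<Sigma> A G" "G \<subseteq> Field (cpo_of A)" and e: "\<And>x. x \<in> G \<Longrightarrow> h x = k x"
  shows "h = k"
proof (rule cont_maps_eqI[OF homsD(1)[OF h(1)] homsD(1)[OF h(2)]])
  fix x assume x: "x \<in> Field (cpo_of A)"
  show "h x = k x"
  proof (rule generatedD[OF G(1) x e _ _ G(2) A])
    fix \<sigma> xs assume *: "\<sigma> \<in> \<Sigma> (length xs)" "set xs \<subseteq> Field (cpo_of A)" "\<And>x. x \<in> set xs \<Longrightarrow> h x = k x"
    then have "map h xs = map k xs" by auto
    then show "h (op_of A \<sigma> xs) = k (op_of A \<sigma> xs)"
      unfolding homsD(4)[OF h(1) *(1,2)] homsD(4)[OF h(2) *(1,2)] by (rule arg_cong)
  qed (assumption | rule join_closed_eq[OF algebrasD(1)[OF A] algebrasD(1)[OF B] homsD(2)[OF h(1)] homsD(2)[OF h(2)]])+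
qed

definition free_on :: "'u variety \<Rightarrow> 'u rel \<Rightarrow> 'u calg \<Rightarrow> ('u \<Rightarrow> 'u) \<Rightarrow> bool" where
  "free_on V X C e \<longleftrightarrow> C \<in> algs V \<and> e \<in> cont_maps X (cpo_of C) \<and>
     (\<forall>B\<in>algs V. \<forall>f\<in>cont_maps X (cpo_of B). \<exists>!h. h \<in> homs (sig V) C B \<and> (\<forall>x\<in>Field X. h (e x) = f x))"

context small_universe
begin

text \<open>The subalgebra generated by \<open>X\<close> in the product of all algebras of
  \<open>V\<close> over all continuous maps from \<open>X\<close> to them. It stays in
  \<open>V\<close> by \<open>variety_reflect\<close>, and its generating map is continuous since
  every component is.\<close>

lemma generated_free_exists:
  assumes V: "V \<in> varieties" and X: "(X :: 'u rel) \<in> obj CPO"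
  shows "\<exists>C e. free_on V X C e \<and> generated (sig V) C (e ` Field X)"
proof -
  define I where "I = {(B, f). B \<in> algs V \<and> f \<in> cont_maps X (cpo_of B)}"
  have S: "Field X \<prec> U" using CPO_small[OF X] sm_small by blast
  have I: "fst i \<in> algs V" "fst i \<in> algebras (sig V)" "snd i \<in> cont_maps X (cpo_of (fst i))" if "i \<in> I" for i
    using that varietyD(2)[OF V] unfolding I_def by auto
  obtain C e h where
    C: "C \<in> algebras (sig V)" "\<And>s. s \<in> Field X \<Longrightarrow> e s \<in> Field (cpo_of C)"
    and h: "\<And>i. i \<in> I \<Longrightarrow> h i \<in> homs (sig V) C (fst i)" "\<And>i s. i \<in> I \<Longrightarrow> s \<in> Field X \<Longrightarrow> h i (e s) = snd i s"
    and r: "\<And>x y. x \<in> Field (cpo_of C) \<Longrightarrow> y \<in> Field (cpo_of C) \<Longrightarrow>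
      (\<And>i. i \<in> I \<Longrightarrow> (h i x, h i y) \<in> cpo_of (fst i)) \<Longrightarrow> (x, y) \<in> cpo_of C"
    and gen: "generated (sig V) C (e ` Field X)"
    by (rule generated_algebra[OF varietyD(1)[OF V] S, of I fst snd]) (use I(2) cont_maps_app[OF I(3)] in blast)+
  have CV: "C \<in> algs V" by (rule variety_reflect[OF V C(1) I(1) h(1) r])
  have "continuous_map X (cpo_of C) e"
  proof (rule continuous_mapI[OF CPO_cpo[OF X] C(2)])
    fix c x assume c: "chain_join X c x"
    have m: "c k \<in> Field X" "x \<in> Field X" for k using chain_joinD(1,2)[OF c] by auto
    have j: "chain_join (cpo_of (fst i)) (\<lambda>k. h i (e (c k))) (h i (e x))" if "i \<in> I" for i
      using continuous_mapD(3)[OF cont_mapsD(1)[OF I(3)[OF that]] c] h(2)[OF that] m by simp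
    show "chain_join (cpo_of C) (\<lambda>k. e (c k)) (e x)"
    proof (rule chain_joinI)
      show "(e (c k), e (c (Suc k))) \<in> cpo_of C" for k
        by (rule r[OF C(2)[OF m(1)] C(2)[OF m(1)] chain_joinD(4)[OF j]])
      show "(e (c k), e x) \<in> cpo_of C" for k
        by (rule r[OF C(2)[OF m(1)] C(2)[OF m(2)] chain_joinD(3)[OF j]])
      fix y assume y: "\<And>k. (e (c k), y) \<in> cpo_of C"
      have "y \<in> Field (cpo_of C)" using y[of 0] by (rule FieldI2)
      then show "(e x, y) \<in> cpo_of C"
        by (rule r[OF C(2)[OF m(2)]])
           (rule chain_join_least[OF j continuous_mapD(2)[OF homsD(2)[OF h(1)] y]])
    qed
  qed
  from cont_maps_restrict[OF this] have e: "restrict e (Field X) \<in> cont_maps X (cpo_of C)" .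
  have img: "restrict e (Field X) ` Field X = e ` Field X" by auto
  have "\<exists>!k. k \<in> homs (sig V) C B \<and> (\<forall>x\<in>Field X. k (restrict e (Field X) x) = f x)"
    if B: "B \<in> algs V" and f: "f \<in> cont_maps X (cpo_of B)" for B f
  proof (rule ex1I)
    have i: "(B, f) \<in> I" unfolding I_def using B f by simp
    then show "h (B, f) \<in> homs (sig V) C B \<and> (\<forall>x\<in>Field X. h (B, f) (restrict e (Field X) x) = f x)"
      using h(1)[OF i] h(2)[OF i] by simp
    fix k assume k: "k \<in> homs (sig V) C B \<and> (\<forall>x\<in>Field X. k (restrict e (Field X) x) = f x)"
    show "k = h (B, f)"
      by (rule homs_eqI[OF C(1) varietyD(2)[OF V B] _ _ gen]) (use k h(1)[OF i] h(2)[OF i] C(2) in auto)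
  qed
  then have "free_on V X C (restrict e (Field X))"
    unfolding free_on_def using CV e by blast
  then show ?thesis using gen img by metis
qed

text \<open>A given left adjoint may use free algebras other than the constructed one. Both are
  isomorphic over \<open>X\<close> by their universal properties, and being generated is carried
  along the isomorphism.\<close>

lemma free_generated:
  assumes V: "V \<in> varieties" and X: "(X :: 'u rel) \<in> obj CPO" and C: "free_on V X C e"
  shows "generated (sig V) C (e ` Field X)"
proof -
  obtain D d where D: "free_on V X D d" and gen: "generated (sig V) D (d ` Field X)"
    using generated_free_exists[OF V X] by blast
  have CV: "C \<in> algs V" "D \<in> algs V" and e: "e \<in> cont_maps X (cpo_of C)" and d: "d \<in> cont_maps X (cpo_of D)"
    using C D unfolding free_on_def by auto
  note CA = varietyD(2)[OF V CV(1)] and DA = varietyD(2)[OF V CV(2)]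
  obtain h where h: "h \<in> homs (sig V) C D" "\<And>x. x \<in> Field X \<Longrightarrow> h (e x) = d x"
    using C CV(2) d unfolding free_on_def by blast
  obtain k where k: "k \<in> homs (sig V) D C" "\<And>x. x \<in> Field X \<Longrightarrow> k (d x) = e x"
    using D CV(1) e unfolding free_on_def by blast
  have u: "\<exists>!l. l \<in> homs (sig V) C C \<and> (\<forall>x\<in>Field X. l (e x) = e x)"
    using C CV(1) e unfolding free_on_def by blast
  have eF: "e x \<in> Field (cpo_of C)" "d x \<in> Field (cpo_of D)" if "x \<in> Field X" for x
    using cont_maps_app[OF e that] cont_maps_app[OF d that] .
  let ?c = "compose (Field (cpo_of C)) k h" and ?i = "\<lambda>x\<in>Field (cpo_of C). x"
  have "?c \<in> homs (sig V) C C \<and> (\<forall>x\<in>Field X. ?c (e x) = e x)"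
    using homs_compose[OF h(1) k(1) CA] by (simp add: CPO_compose_app eF h(2) k(2))
  moreover have "?i \<in> homs (sig V) C C \<and> (\<forall>x\<in>Field X. ?i (e x) = e x)"
    using homs_id[OF CA] by (simp add: eF)
  ultimately have ci: "?c = ?i" using u by blast
  have kh: "k (h x) = x" if "x \<in> Field (cpo_of C)" for x
    using fun_cong[OF ci, of x] that by (simp add: compose_def)
  show ?thesis unfolding generated_def
  proof (intro allI impI, elim conjE)
    fix Q assume Q: "Q \<subseteq> Field (cpo_of C)" "e ` Field X \<subseteq> Q" "op_closed (sig V) C Q" "join_closed (cpo_of C) Q"
    have "k y \<in> Q" if y: "y \<in> Field (cpo_of D)" for y
    proof (rule generatedD[OF gen y _ _ _ _ DA])
      show "k x \<in> Q" if "x \<in> d ` Field X" for x using that k(2) Q(2) by auto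
      show "k (op_of D \<sigma> xs) \<in> Q" if "\<sigma> \<in> sig V (length xs)" "set xs \<subseteq> Field (cpo_of D)" "\<And>x. x \<in> set xs \<Longrightarrow> k x \<in> Q" for \<sigma> xs
        using op_closedD[OF Q(3), of \<sigma> "map k xs"] that homsD(4)[OF k(1) that(1,2)] by auto
      show "join_closed (cpo_of D) {x \<in> Field (cpo_of D). k x \<in> Q}"
      proof (rule join_closedI)
        fix c x assume c: "\<And>i. c i \<in> {x \<in> Field (cpo_of D). k x \<in> Q}" "chain_join (cpo_of D) c x"
        have "k x \<in> Q" by (rule join_closedD[OF Q(4) _ continuous_mapD(3)[OF homsD(2)[OF k(1)] c(2)]]) (use c(1) in blast)
        then show "x \<in> {x \<in> Field (cpo_of D). k x \<in> Q}" using chain_joinD(1)[OF c(2)] by blast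
      qed
      show "d ` Field X \<subseteq> Field (cpo_of D)" using eF by auto
    qed
    then have "x \<in> Q" if "x \<in> Field (cpo_of C)" for x using kh[OF that] homsD(3)[OF h(1) that] by metis
    then show "Q = Field (cpo_of C)" using Q(1) by blast
  qed
qed

end

lemma variety_cat_simps [simp]:
  "obj (variety_cat V) = algs V" "hom (variety_cat V) = homs (sig V)"
  "idm (variety_cat V) A = (\<lambda>x\<in>Field (cpo_of A). x)"
  "compo (variety_cat V) A B C g f = compose (Field (cpo_of A)) g f"
  unfolding variety_cat_def by auto

lemma forgetful_simps [simp]: "fobj forgetful = cpo_of" "fmap forgetful A B h = h"
  unfolding forgetful_def by auto

lemma functor_simps [simp]: "fobj id_functor X = X" "fmap id_functor X Y f = f"
  "fobj (G \<odot> F) X = fobj G (fobj F X)"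
  "fmap (G \<odot> F) X Y f = fmap G (fobj F X) (fobj F Y) (fmap F X Y f)"
  unfolding id_functor_def comp_functor_def by auto

lemma eq_on_compose:
  assumes "compose S g f = compose S g' f'" "x \<in> S"
  shows "g (f x) = g' (f' x)"
  using fun_cong[OF assms(1), of x] assms(2) by (simp add: compose_def)

text \<open>An adjunction over \<open>CPO\<close> written elementwise: free algebras with an action
  on maps, a unit and a counit. \<open>adjunction\<close> and
  \<open>adjunction_free_algebra_functor\<close> pass between the two forms.\<close>

locale free_algebra_functor = small_universe U for U :: "'u set" +
  fixes V :: "'u variety" and F :: "('u rel, 'u \<Rightarrow> 'u, 'u calg, 'u \<Rightarrow> 'u) fctr"
    and \<eta> :: "'u rel \<Rightarrow> 'u \<Rightarrow> 'u" and \<epsilon> :: "'u calg \<Rightarrow> 'u \<Rightarrow> 'u"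
  assumes V: "V \<in> varieties"
    and free: "X \<in> obj CPO \<Longrightarrow> free_on V X (fobj F X) (\<eta> X)"
    and fmap_hom: "X \<in> obj CPO \<Longrightarrow> Y \<in> obj CPO \<Longrightarrow> f \<in> cont_maps X Y \<Longrightarrow>
      fmap F X Y f \<in> homs (sig V) (fobj F X) (fobj F Y)"
    and fmap_unit: "X \<in> obj CPO \<Longrightarrow> Y \<in> obj CPO \<Longrightarrow> f \<in> cont_maps X Y \<Longrightarrow> x \<in> Field X \<Longrightarrow>
      fmap F X Y f (\<eta> X x) = \<eta> Y (f x)"
    and unit_ext: "\<eta> \<in> extensional (obj CPO)" and counit_ext: "\<epsilon> \<in> extensional (algs V)"
    and counit_hom: "B \<in> algs V \<Longrightarrow> \<epsilon> B \<in> homs (sig V) (fobj F (cpo_of B)) B"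
    and counit_unit: "B \<in> algs V \<Longrightarrow> b \<in> Field (cpo_of B) \<Longrightarrow> \<epsilon> B (\<eta> (cpo_of B) b) = b"
begin

abbreviation "\<Sigma> \<equiv> sig V"

lemma alg: "A \<in> algs V \<Longrightarrow> A \<in> algebras \<Sigma>"
  by (rule varietyD(2)[OF V])

lemma alg_obj: "A \<in> algs V \<Longrightarrow> cpo_of A \<in> obj CPO"
  using algebrasD(3)[OF alg] .

lemma alg_cpo: "A \<in> algs V \<Longrightarrow> cpo (cpo_of A)"
  using algebrasD(1)[OF alg] .

lemma F_algs: "X \<in> obj CPO \<Longrightarrow> fobj F X \<in> algs V"
  using free unfolding free_on_def by blast

lemma T_obj: "X \<in> obj CPO \<Longrightarrow> cpo_of (fobj F X) \<in> obj CPO"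
  using alg_obj[OF F_algs] .

lemma unit_map: "X \<in> obj CPO \<Longrightarrow> \<eta> X \<in> cont_maps X (cpo_of (fobj F X))"
  using free unfolding free_on_def by blast

lemma unit_app: "X \<in> obj CPO \<Longrightarrow> x \<in> Field X \<Longrightarrow> \<eta> X x \<in> Field (cpo_of (fobj F X))"
  using cont_maps_app[OF unit_map] .

lemma F_generated: "X \<in> obj CPO \<Longrightarrow> generated \<Sigma> (fobj F X) (\<eta> X ` Field X)"
  by (rule free_generated[OF V _ free])

lemma unit_sub: "X \<in> obj CPO \<Longrightarrow> \<eta> X ` Field X \<subseteq> Field (cpo_of (fobj F X))"
  using unit_app by blast

lemma hom_eq:
  assumes "X \<in> obj CPO" "B \<in> algs V" "h \<in> homs \<Sigma> (fobj F X) B" "k \<in> homs \<Sigma> (fobj F X) B"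
    "\<And>x. x \<in> Field X \<Longrightarrow> h (\<eta> X x) = k (\<eta> X x)"
  shows "h = k"
  by (rule homs_eqI[OF alg[OF F_algs[OF assms(1)]] alg[OF assms(2)] assms(3,4) F_generated[OF assms(1)] unit_sub[OF assms(1)]])
     (use assms(5) in auto)

lemma extension:
  assumes "X \<in> obj CPO" "B \<in> algs V" "f \<in> cont_maps X (cpo_of B)"
  obtains h where "h \<in> homs \<Sigma> (fobj F X) B" "\<And>x. x \<in> Field X \<Longrightarrow> h (\<eta> X x) = f x"
  using free[OF assms(1)] assms(2,3) unfolding free_on_def by blast

lemma F_compose:
  "h \<in> homs \<Sigma> (fobj F X) B \<Longrightarrow> k \<in> homs \<Sigma> B C \<Longrightarrow> X \<in> obj CPO \<Longrightarrow>
    compose (Field (cpo_of (fobj F X))) k h \<in> homs \<Sigma> (fobj F X) C"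
  by (rule homs_compose[OF _ _ alg[OF F_algs]])

lemma fmap_id: "X \<in> obj CPO \<Longrightarrow> fmap F X X (\<lambda>x\<in>Field X. x) = (\<lambda>x\<in>Field (cpo_of (fobj F X)). x)"
proof -
  assume X: "X \<in> obj CPO"
  have i: "(\<lambda>x\<in>Field X. x) \<in> cont_maps X X" by (rule cont_maps_id[OF CPO_cpo[OF X]])
  show ?thesis
    by (rule hom_eq[OF X F_algs[OF X] fmap_hom[OF X X i] homs_id[OF alg[OF F_algs[OF X]]]])
       (simp add: fmap_unit[OF X X i] unit_app[OF X])
qed

lemma fmap_comp:
  assumes X: "X \<in> obj CPO" and Y: "Y \<in> obj CPO" and Z: "Z \<in> obj CPO"
    and f: "f \<in> cont_maps X Y" and g: "g \<in> cont_maps Y Z"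
  shows "fmap F X Z (compose (Field X) g f) = compose (Field (cpo_of (fobj F X))) (fmap F Y Z g) (fmap F X Y f)"
  by (rule hom_eq[OF X F_algs[OF Z] fmap_hom[OF X Z cont_maps_compose[OF f g]]
        F_compose[OF fmap_hom[OF X Y f] fmap_hom[OF Y Z g] X]])
     (simp add: fmap_unit[OF X Y f] fmap_unit[OF Y Z g] fmap_unit[OF X Z cont_maps_compose[OF f g]]
        CPO_compose_app unit_app[OF X] cont_maps_app[OF f])

lemma counit_nat:
  assumes A: "A \<in> algs V" and B: "B \<in> algs V" and h: "h \<in> homs \<Sigma> A B"
  shows "compose (Field (cpo_of (fobj F (cpo_of A)))) h (\<epsilon> A) =
    compose (Field (cpo_of (fobj F (cpo_of A)))) (\<epsilon> B) (fmap F (cpo_of A) (cpo_of B) h)"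
  by (rule hom_eq[OF alg_obj[OF A] B F_compose[OF counit_hom[OF A] h alg_obj[OF A]]
        F_compose[OF fmap_hom[OF alg_obj[OF A] alg_obj[OF B] homsD(1)[OF h]] counit_hom[OF B] alg_obj[OF A]]])
     (simp add: CPO_compose_app unit_app[OF alg_obj[OF A]] counit_unit[OF A] counit_unit[OF B]
        fmap_unit[OF alg_obj[OF A] alg_obj[OF B] homsD(1)[OF h]] homsD(3)[OF h])

lemma counit_fmap_unit:
  assumes X: "X \<in> obj CPO"
  shows "compose (Field (cpo_of (fobj F X))) (\<epsilon> (fobj F X)) (fmap F X (cpo_of (fobj F X)) (\<eta> X)) =
    (\<lambda>x\<in>Field (cpo_of (fobj F X)). x)"
  by (rule hom_eq[OF X F_algs[OF X] F_compose[OF fmap_hom[OF X T_obj[OF X] unit_map[OF X]] counit_hom[OF F_algs[OF X]] X]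
        homs_id[OF alg[OF F_algs[OF X]]]])
     (simp add: CPO_compose_app unit_app[OF X] fmap_unit[OF X T_obj[OF X] unit_map[OF X]] counit_unit[OF F_algs[OF X]])

lemma adjunction: "adjunction CPO (variety_cat V) F forgetful \<eta> \<epsilon>"
  unfolding adjunction_def Let_def is_functor_def nat_trans_def
proof (simp only: variety_cat_simps forgetful_simps functor_simps CPO_simps, intro conjI ballI)
  show "fmap F X Y f \<in> homs \<Sigma> (fobj F X) (fobj F Y)" if "X \<in> obj CPO" "Y \<in> obj CPO" "f \<in> cont_maps X Y" for X Y f
    by (rule fmap_hom[OF that])
  show "compose (Field X) (fmap F X Y f) (\<eta> X) = compose (Field X) (\<eta> Y) f"
    if "X \<in> obj CPO" "Y \<in> obj CPO" "f \<in> cont_maps X Y" for X Y f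
    using fmap_unit[OF that] by (auto simp: compose_def fun_eq_iff)
  show "compose (Field (cpo_of A)) (\<epsilon> A) (\<eta> (cpo_of A)) = (\<lambda>x\<in>Field (cpo_of A). x)" if "A \<in> algs V" for A
    using counit_unit[OF that] by (auto simp: compose_def fun_eq_iff)
qed (simp_all add: F_algs fmap_id fmap_comp alg_obj homsD(1) unit_ext unit_map counit_ext counit_hom
      counit_nat counit_fmap_unit)

end

text \<open>The homomorphism extending \<open>f : X \<rightarrow> B\<close> is the counit of
  \<open>B\<close> after the functor applied to \<open>f\<close>. The triangle identities and
  naturality of unit and counit give existence and uniqueness.\<close>

lemma (in small_universe) adjunction_free_algebra_functor:
  assumes V: "V \<in> varieties" and adj: "adjunction CPO (variety_cat V) F forgetful \<eta> \<epsilon>"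
  shows "free_algebra_functor U V F \<eta> \<epsilon>"
proof -
  have F: "fobj F X \<in> algs V" if "X \<in> obj CPO" for X
    using adj that unfolding adjunction_def is_functor_def Let_def by simp
  have fh: "fmap F X Y f \<in> homs (sig V) (fobj F X) (fobj F Y)"
    if "X \<in> obj CPO" "Y \<in> obj CPO" "f \<in> cont_maps X Y" for X Y f
    using adj that unfolding adjunction_def is_functor_def Let_def by simp
  have fc: "fmap F X Z (compose (Field X) g f) = compose (Field (cpo_of (fobj F X))) (fmap F Y Z g) (fmap F X Y f)"
    if "X \<in> obj CPO" "Y \<in> obj CPO" "Z \<in> obj CPO" "f \<in> cont_maps X Y" "g \<in> cont_maps Y Z" for X Y Z f g
    using adj that unfolding adjunction_def is_functor_def Let_def by simp
  have u: "\<eta> \<in> extensional (obj CPO)" "\<And>X. X \<in> obj CPO \<Longrightarrow> \<eta> X \<in> cont_maps X (cpo_of (fobj F X))"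
    using adj unfolding adjunction_def nat_trans_def Let_def by simp_all
  have un: "fmap F X Y f (\<eta> X x) = \<eta> Y (f x)"
    if "X \<in> obj CPO" "Y \<in> obj CPO" "f \<in> cont_maps X Y" "x \<in> Field X" for X Y f x
  proof -
    have "compose (Field X) (fmap F X Y f) (\<eta> X) = compose (Field X) (\<eta> Y) f"
      using adj that unfolding adjunction_def nat_trans_def Let_def by simp
    from eq_on_compose[OF this that(4)] show ?thesis .
  qed
  have c: "\<epsilon> \<in> extensional (algs V)" "\<And>B. B \<in> algs V \<Longrightarrow> \<epsilon> B \<in> homs (sig V) (fobj F (cpo_of B)) B"
    using adj unfolding adjunction_def nat_trans_def Let_def by simp_all
  have cn: "compose (Field (cpo_of (fobj F (cpo_of A)))) h (\<epsilon> A) =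
      compose (Field (cpo_of (fobj F (cpo_of A)))) (\<epsilon> B) (fmap F (cpo_of A) (cpo_of B) h)"
    if "A \<in> algs V" "B \<in> algs V" "h \<in> homs (sig V) A B" for A B h
    using adj that unfolding adjunction_def nat_trans_def Let_def by simp
  have t1: "compose (Field (cpo_of (fobj F X))) (\<epsilon> (fobj F X)) (fmap F X (cpo_of (fobj F X)) (\<eta> X)) =
      (\<lambda>x\<in>Field (cpo_of (fobj F X)). x)" if "X \<in> obj CPO" for X
    using adj that unfolding adjunction_def Let_def by simp
  have t2: "\<epsilon> B (\<eta> (cpo_of B) b) = b" if "B \<in> algs V" "b \<in> Field (cpo_of B)" for B b
  proof -
    have "compose (Field (cpo_of B)) (\<epsilon> B) (\<eta> (cpo_of B)) = (\<lambda>x\<in>Field (cpo_of B). x)"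
      using adj that unfolding adjunction_def Let_def by simp
    from fun_cong[OF this, of b] show ?thesis using that(2) by (simp add: compose_def)
  qed
  have obj: "cpo_of B \<in> obj CPO" if "B \<in> algs V" for B by (rule algebrasD(3)[OF varietyD(2)[OF V that]])
  have "free_on V X (fobj F X) (\<eta> X)" if X: "X \<in> obj CPO" for X
    unfolding free_on_def
  proof (intro conjI ballI)
    show "fobj F X \<in> algs V" "\<eta> X \<in> cont_maps X (cpo_of (fobj F X))" by (rule F[OF X], rule u(2)[OF X])
    fix B f assume B: "B \<in> algs V" and f: "f \<in> cont_maps X (cpo_of B)"
    show "\<exists>!h. h \<in> homs (sig V) (fobj F X) B \<and> (\<forall>x\<in>Field X. h (\<eta> X x) = f x)"
    proof (rule ex1I)
      let ?h = "compose (Field (cpo_of (fobj F X))) (\<epsilon> B) (fmap F X (cpo_of B) f)"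
      show "?h \<in> homs (sig V) (fobj F X) B \<and> (\<forall>x\<in>Field X. ?h (\<eta> X x) = f x)"
        using homs_compose[OF fh[OF X obj[OF B] f] c(2)[OF B] varietyD(2)[OF V F[OF X]]]
          cont_maps_app[OF u(2)[OF X]] un[OF X obj[OF B] f] t2[OF B] cont_maps_app[OF f]
        by (simp add: CPO_compose_app)
      fix k assume k: "k \<in> homs (sig V) (fobj F X) B \<and> (\<forall>x\<in>Field X. k (\<eta> X x) = f x)"
      then have kh: "k \<in> homs (sig V) (fobj F X) B" by simp
      have kf: "compose (Field X) k (\<eta> X) = f"
        using k cont_mapsD(2)[OF f] by (auto simp: compose_def fun_eq_iff extensional_def)
      note TX = obj[OF F[OF X]]
      show "k = ?h"
      proof (rule cont_maps_eqI[OF homsD(1)[OF kh] homsD(1)[OF homs_compose[OF fh[OF X obj[OF B] f] c(2)[OF B] varietyD(2)[OF V F[OF X]]]]])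
        fix y assume y: "y \<in> Field (cpo_of (fobj F X))"
        have y': "fmap F X (cpo_of (fobj F X)) (\<eta> X) y \<in> Field (cpo_of (fobj F (cpo_of (fobj F X))))"
          by (rule homsD(3)[OF fh[OF X TX u(2)[OF X]] y])
        \<comment> \<open>A triangle identity expands \<open>y\<close>, naturality of the counit
          moves \<open>k\<close> under the functor, and there \<open>k\<close> composed with the
          unit is \<open>f\<close>.\<close>
        have "k y = k (\<epsilon> (fobj F X) (fmap F X (cpo_of (fobj F X)) (\<eta> X) y))"
          using fun_cong[OF t1[OF X], of y] y by (simp add: compose_def)
        also have "\<dots> = \<epsilon> B (fmap F (cpo_of (fobj F X)) (cpo_of B) k (fmap F X (cpo_of (fobj F X)) (\<eta> X) y))"
          by (rule eq_on_compose[OF cn[OF F[OF X] B kh] y'])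
        also have "fmap F (cpo_of (fobj F X)) (cpo_of B) k (fmap F X (cpo_of (fobj F X)) (\<eta> X) y) = fmap F X (cpo_of B) f y"
          using fun_cong[OF fc[OF X TX obj[OF B] u(2)[OF X] homsD(1)[OF kh]], of y] y kf by (simp add: compose_def)
        finally show "k y = ?h y" using y by (simp add: compose_def)
      qed
    qed
  qed
  then show ?thesis
    using V fh un u(1) c t2 by unfold_locales auto
qed

lemma (in small_universe) free_algebra_functor_exists:
  assumes V: "V \<in> varieties"
  shows "\<exists>F \<eta> \<epsilon>. free_algebra_functor U V F \<eta> \<epsilon>"
proof -
  have "\<forall>X. \<exists>p. X \<in> obj CPO \<longrightarrow> free_on V X (fst p) (snd p)"
    using generated_free_exists[OF V] by (metis fst_conv snd_conv)
  then obtain p where p: "\<And>X. X \<in> obj CPO \<Longrightarrow> free_on V X (fst (p X)) (snd (p X))" by metis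
  have ex: "\<exists>h. X \<in> obj CPO \<and> B \<in> algs V \<and> f \<in> cont_maps X (cpo_of B) \<longrightarrow>
      h \<in> homs (sig V) (fst (p X)) B \<and> (\<forall>x\<in>Field X. h (snd (p X) x) = f x)" for X B f
    using p[of X] unfolding free_on_def by blast
  define ext where "ext X B f = (SOME h. X \<in> obj CPO \<and> B \<in> algs V \<and> f \<in> cont_maps X (cpo_of B) \<longrightarrow>
      h \<in> homs (sig V) (fst (p X)) B \<and> (\<forall>x\<in>Field X. h (snd (p X) x) = f x))" for X B f
  have ext: "ext X B f \<in> homs (sig V) (fst (p X)) B" "\<And>x. x \<in> Field X \<Longrightarrow> ext X B f (snd (p X) x) = f x"
    if "X \<in> obj CPO" "B \<in> algs V" "f \<in> cont_maps X (cpo_of B)" for X B f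
    using someI_ex[OF ex[of X B f]] that unfolding ext_def by auto
  have pV: "fst (p X) \<in> algs V" and pm: "snd (p X) \<in> cont_maps X (cpo_of (fst (p X)))" if "X \<in> obj CPO" for X
    using p[OF that] unfolding free_on_def by auto
  have B: "cpo_of B \<in> obj CPO" "(\<lambda>x\<in>Field (cpo_of B). x) \<in> cont_maps (cpo_of B) (cpo_of B)" if "B \<in> algs V" for B
    using algebrasD(3)[OF varietyD(2)[OF V that]] cont_maps_id[OF algebrasD(1)[OF varietyD(2)[OF V that]]] by auto
  define F where "F = \<lparr>fobj = \<lambda>X. fst (p X), fmap = \<lambda>X Y f. ext X (fst (p Y)) (compose (Field X) (snd (p Y)) f)\<rparr>"
  have "free_algebra_functor U V F (\<lambda>X\<in>obj CPO. snd (p X)) (\<lambda>B\<in>algs V. ext (cpo_of B) B (\<lambda>x\<in>Field (cpo_of B). x))"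
  proof unfold_locales
    show "V \<in> varieties" by (rule V)
    fix X Y :: "'u rel" and f assume X: "X \<in> obj CPO" and Y: "Y \<in> obj CPO" and f: "f \<in> cont_maps X Y"
    note c = cont_maps_compose[OF f pm[OF Y]]
    show "fmap F X Y f \<in> homs (sig V) (fobj F X) (fobj F Y)"
      using ext(1)[OF X pV[OF Y] c] by (simp add: F_def)
    show "fmap F X Y f ((\<lambda>X\<in>obj CPO. snd (p X)) X x) = (\<lambda>X\<in>obj CPO. snd (p X)) Y (f x)" if "x \<in> Field X" for x
      using ext(2)[OF X pV[OF Y] c that] X Y that by (simp add: F_def CPO_compose_app)
  next
    show "free_on V X (fobj F X) ((\<lambda>X\<in>obj CPO. snd (p X)) X)" if "X \<in> obj CPO" for X
      using p[OF that] that by (simp add: F_def)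
  next
    fix A assume A: "A \<in> algs V"
    show "(\<lambda>B\<in>algs V. ext (cpo_of B) B (\<lambda>x\<in>Field (cpo_of B). x)) A \<in> homs (sig V) (fobj F (cpo_of A)) A"
      using ext(1)[OF B(1)[OF A] A B(2)[OF A]] A by (simp add: F_def)
    show "(\<lambda>B\<in>algs V. ext (cpo_of B) B (\<lambda>x\<in>Field (cpo_of B). x)) A ((\<lambda>X\<in>obj CPO. snd (p X)) (cpo_of A) b) = b"
      if "b \<in> Field (cpo_of A)" for b
      using ext(2)[OF B(1)[OF A] A B(2)[OF A] that] A B(1)[OF A] that by simp
  qed auto
  then show ?thesis by blast
qed

section \<open>The monad of a variety and its local continuity\<close>

context free_algebra_functor
begin

abbreviation M :: "'u cpo_monad" where
  "M \<equiv> adjunction_monad CPO F forgetful \<eta> \<epsilon>"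

lemma M_simps [simp]: "fobj (endo M) X = cpo_of (fobj F X)" "fmap (endo M) X Y f = fmap F X Y f"
  "unit M = \<eta>" "X \<in> obj CPO \<Longrightarrow> mult M X = \<epsilon> (fobj F X)"
  unfolding adjunction_monad_def by auto

lemma M_functor: "is_functor CPO CPO (endo M)"
  unfolding is_functor_def by (auto simp: T_obj fmap_id fmap_comp intro: homsD(1)[OF fmap_hom])

lemma M_monad: "is_monad CPO M"
  unfolding is_monad_def Let_def
proof (intro conjI ballI)
  show "is_functor CPO CPO (endo M)" by (rule M_functor)
  show "nat_trans CPO CPO id_functor (endo M) (unit M)"
    by (rule nat_trans_CPO_I) (simp_all add: unit_ext unit_map fmap_unit)
  show "nat_trans CPO CPO (endo M \<odot> endo M) (endo M) (mult M)"
  proof (rule nat_trans_CPO_I)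
    show "mult M \<in> extensional (obj CPO)" by (simp add: adjunction_monad_def)
    show "mult M X \<in> cont_maps (fobj (endo M \<odot> endo M) X) (fobj (endo M) X)" if "X \<in> obj CPO" for X
      using homsD(1)[OF counit_hom[OF F_algs[OF that]]] that by simp
    fix X Y :: "'u rel" and f x assume X: "X \<in> obj CPO" and Y: "Y \<in> obj CPO" and f: "f \<in> cont_maps X Y"
      and x: "x \<in> Field (fobj (endo M \<odot> endo M) X)"
    show "fmap (endo M) X Y f (mult M X x) = mult M Y (fmap (endo M \<odot> endo M) X Y f x)"
      using eq_on_compose[OF counit_nat[OF F_algs[OF X] F_algs[OF Y] fmap_hom[OF X Y f]], of x] x X Y by simp
  qed
  fix X :: "'u rel" assume X: "X \<in> obj CPO"
  note TX = T_obj[OF X] and FX = F_algs[OF X]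
  show "compo CPO (fobj (endo M) X) (fobj (endo M) (fobj (endo M) X)) (fobj (endo M) X) (mult M X) (unit M (fobj (endo M) X)) = idm CPO (fobj (endo M) X)"
    using counit_unit[OF FX] X by (auto simp: compose_def fun_eq_iff)
  show "compo CPO (fobj (endo M) X) (fobj (endo M) (fobj (endo M) X)) (fobj (endo M) X) (mult M X)
      (fmap (endo M) X (fobj (endo M) X) (unit M X)) = idm CPO (fobj (endo M) X)"
    using counit_fmap_unit[OF X] X by simp
  show "compo CPO (fobj (endo M) (fobj (endo M) (fobj (endo M) X))) (fobj (endo M) (fobj (endo M) X)) (fobj (endo M) X)
      (mult M X) (mult M (fobj (endo M) X)) =
    compo CPO (fobj (endo M) (fobj (endo M) (fobj (endo M) X))) (fobj (endo M) (fobj (endo M) X)) (fobj (endo M) X)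
      (mult M X) (fmap (endo M) (fobj (endo M) (fobj (endo M) X)) (fobj (endo M) X) (mult M X))"
    using counit_nat[OF F_algs[OF TX] FX counit_hom[OF FX]] X TX by simp
qed

text \<open>The elements at which the images of the \<open>f k\<close> converge to the image of
  \<open>g\<close> contain the units and are closed under operations and joins. As free algebras are
  generated by units, these are all elements.\<close>

lemma M_enriched: "enriched_endofunctor (endo M)"
  unfolding enriched_endofunctor_def
proof (intro conjI M_functor ballI)
  fix X Y :: "'u rel" assume X: "X \<in> obj CPO" and Y: "Y \<in> obj CPO"
  note FX = alg[OF F_algs[OF X]] and FY = alg[OF F_algs[OF Y]]
  have "continuous_map (hom_cpo X Y) (hom_cpo (cpo_of (fobj F X)) (cpo_of (fobj F Y))) (fmap F X Y)"
  proof (rule continuous_mapI[OF cpo_hom_cpo[OF CPO_cpo[OF X] CPO_cpo[OF Y]]])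
    show "fmap F X Y f \<in> Field (hom_cpo (cpo_of (fobj F X)) (cpo_of (fobj F Y)))" if "f \<in> Field (hom_cpo X Y)" for f
      using that homsD(1)[OF fmap_hom[OF X Y]] unfolding field_hom_cpo[OF CPO_cpo[OF Y]] field_hom_cpo[OF CPO_cpo[OF T_obj[OF Y]]] by simp
    fix f g assume fg: "chain_join (hom_cpo X Y) f g"
    have m: "f k \<in> cont_maps X Y" "g \<in> cont_maps X Y" for k
      using chain_joinD(1,2)[OF fg] unfolding field_hom_cpo[OF CPO_cpo[OF Y]] by auto
    note fh = fmap_hom[OF X Y m(1)] and gh = fmap_hom[OF X Y m(2)]
    show "chain_join (hom_cpo (cpo_of (fobj F X)) (cpo_of (fobj F Y))) (\<lambda>k. fmap F X Y (f k)) (fmap F X Y g)"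
    proof (rule chain_join_homI[OF homsD(1)[OF fh] homsD(1)[OF gh]])
      fix y assume y: "y \<in> Field (cpo_of (fobj F X))"
      show "chain_join (cpo_of (fobj F Y)) (\<lambda>k. fmap F X Y (f k) y) (fmap F X Y g y)"
      proof (rule generatedD[OF F_generated[OF X] y _ _ _ unit_sub[OF X] FX])
        fix z assume "z \<in> \<eta> X ` Field X"
        then obtain x where z: "z = \<eta> X x" "x \<in> Field X" by blast
        have "chain_join (cpo_of (fobj F Y)) (\<lambda>k. \<eta> Y (f k x)) (\<eta> Y (g x))"
          using continuous_mapD(3)[OF cont_mapsD(1)[OF unit_map[OF Y]] chain_join_homD[OF CPO_cpo[OF X] CPO_cpo[OF Y] fg z(2)]] .
        then show "chain_join (cpo_of (fobj F Y)) (\<lambda>k. fmap F X Y (f k) z) (fmap F X Y g z)"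
          using fmap_unit[OF X Y m(1) z(2)] fmap_unit[OF X Y m(2) z(2)] z(1) by simp
      next
        fix \<sigma> xs assume xs: "\<sigma> \<in> \<Sigma> (length xs)" "set xs \<subseteq> Field (cpo_of (fobj F X))"
          "\<And>x. x \<in> set xs \<Longrightarrow> chain_join (cpo_of (fobj F Y)) (\<lambda>k. fmap F X Y (f k) x) (fmap F X Y g x)"
        have "chain_join (power_cpo (cpo_of (fobj F Y)) (length xs)) (\<lambda>k. map (fmap F X Y (f k)) xs) (map (fmap F X Y g) xs)"
          by (rule chain_join_powerI) (use xs(3) in auto)
        from continuous_mapD(3)[OF algebrasD(4)[OF FY xs(1)] this]
        show "chain_join (cpo_of (fobj F Y)) (\<lambda>k. fmap F X Y (f k) (op_of (fobj F X) \<sigma> xs)) (fmap F X Y g (op_of (fobj F X) \<sigma> xs))"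
          using homsD(4)[OF fh xs(1,2)] homsD(4)[OF gh xs(1,2)] by simp
      next
        show "join_closed (cpo_of (fobj F X)) {y \<in> Field (cpo_of (fobj F X)).
            chain_join (cpo_of (fobj F Y)) (\<lambda>k. fmap F X Y (f k) y) (fmap F X Y g y)}"
          by (rule join_closed_chain_join[OF algebrasD(1)[OF FX] algebrasD(1)[OF FY] homsD(2)[OF fh] homsD(2)[OF gh]])
      qed
    qed
  qed
  moreover have "fmap (endo M) X Y = fmap F X Y" by (rule ext) simp
  ultimately show "continuous_map (hom_cpo X Y) (hom_cpo (fobj (endo M) X) (fobj (endo M) Y)) (fmap (endo M) X Y)"
    by simp
qed

end


section \<open>The free-algebra monad is strongly finitary\<close>

text \<open>Provides a copy of \<open>Z\<close> disjoint from the supports of the other arguments,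
  so that a map on \<open>Z\<close> and the inclusion of those supports can be glued even where
  \<open>Z\<close> itself meets \<open>R\<close>.\<close>

lemma (in small_universe) rename_apart:
  assumes Z: "finite (Z :: 'u set)" and R: "finite (R :: 'u set)"
  obtains Z' r r' where "finite Z'" "Z' \<inter> R = {}" "r \<in> Z' \<rightarrow>\<^sub>E Z" "r' \<in> Z \<rightarrow>\<^sub>E Z'" "r ` Z' = Z"
    "\<And>z. z \<in> Z \<Longrightarrow> r (r' z) = z"
proof -
  have "infinite (- R)" using R infinite_universe by (metis finite_compl double_complement)
  then obtain Z' where Z': "finite Z'" "card Z' = card Z" "Z' \<subseteq> - R"
    using infinite_arbitrarily_large by blast
  then obtain b where b: "bij_betw b Z' Z" using finite_same_card_bij[OF Z'(1) Z] by blast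
  show thesis
  proof (rule that[of Z' "restrict b Z'" "restrict (inv_into Z' b) Z"])
    show "restrict b Z' \<in> Z' \<rightarrow>\<^sub>E Z" "restrict b Z' ` Z' = Z" using b by (auto simp: bij_betw_def)
    show i: "restrict (inv_into Z' b) Z \<in> Z \<rightarrow>\<^sub>E Z'" using bij_betw_inv_into[OF b] by (auto simp: bij_betw_def)
    show "restrict b Z' (restrict (inv_into Z' b) Z z) = z" if "z \<in> Z" for z
      using i that b bij_betw_inv_into_right[OF b that] by auto
  qed (use Z' in auto)
qed

context free_algebra_functor
begin

sublocale T: enriched_functor U "endo M"
  by unfold_locales (rule M_enriched)

abbreviation "Td X \<equiv> cpo_of (fobj F (Id_on X))"
abbreviation "Tm X Y \<equiv> fmap F (Id_on X) (Id_on Y)"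
abbreviation "To X \<equiv> op_of (fobj F (Id_on X))"

lemma gensD: "(X, t) \<in> lan_gens (endo M) A \<longleftrightarrow> finite X \<and> X \<subseteq> Field A \<and> t \<in> Field (Td X)"
  unfolding lan_gens_def by simp

lemma d_algs: "finite X \<Longrightarrow> fobj F (Id_on X) \<in> algs V"
  by (rule F_algs[OF T.disc_obj])

lemma d_hom: "finite X \<Longrightarrow> finite Y \<Longrightarrow> u \<in> X \<rightarrow>\<^sub>E Y \<Longrightarrow> Tm X Y u \<in> homs \<Sigma> (fobj F (Id_on X)) (fobj F (Id_on Y))"
  by (rule fmap_hom[OF T.disc_obj T.disc_obj]) (simp_all add: T.disc_maps T.disc_obj)

lemma d_app: "finite X \<Longrightarrow> finite Y \<Longrightarrow> u \<in> X \<rightarrow>\<^sub>E Y \<Longrightarrow> t \<in> Field (Td X) \<Longrightarrow> Tm X Y u t \<in> Field (Td Y)"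
  by (rule homsD(3)[OF d_hom])

lemma d_comp: "finite X \<Longrightarrow> finite Y \<Longrightarrow> finite Z \<Longrightarrow> f \<in> X \<rightarrow>\<^sub>E Y \<Longrightarrow> g \<in> Y \<rightarrow>\<^sub>E Z \<Longrightarrow> t \<in> Field (Td X) \<Longrightarrow>
    Tm Y Z g (Tm X Y f t) = Tm X Z (compose X g f) t"
  using T.disc_comp[of X Y "Id_on Z" f g t] T.disc_obj[of Z] by simp

lemma d_id: "finite X \<Longrightarrow> t \<in> Field (Td X) \<Longrightarrow> Tm X X (incl X) t = t"
  using T.disc_id[of X t] by simp

text \<open>The operation on generators: the arguments are moved to the union of their supports and
  combined in the free algebra on it. For a constant the union is empty, so its value lives over the
  empty set.\<close>

definition gop :: "'u \<Rightarrow> ('u set \<times> 'u) list \<Rightarrow> 'u set \<times> 'u" where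
  "gop \<sigma> ss = (let R = (\<Union>s\<in>set ss. fst s) in (R, To R \<sigma> (map (\<lambda>s. Tm (fst s) R (incl (fst s)) (snd s)) ss)))"

lemma gop_mem:
  assumes \<sigma>: "\<sigma> \<in> \<Sigma> (length ss)" and ss: "set ss \<subseteq> lan_gens (endo M) A"
  shows "gop \<sigma> ss \<in> lan_gens (endo M) A"
proof -
  let ?R = "\<Union>s\<in>set ss. fst s"
  have s: "finite (fst s)" "fst s \<subseteq> Field A" "snd s \<in> Field (Td (fst s))" if "s \<in> set ss" for s
    using that ss gensD[of "fst s" "snd s" A] by auto
  have R: "finite ?R" "?R \<subseteq> Field A"
    using s(1) by (auto simp del: UN_simps intro!: UN_least[OF s(2)])
  have "Tm (fst s) ?R (incl (fst s)) (snd s) \<in> Field (Td ?R)" if "s \<in> set ss" for s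
    by (rule d_app[OF s(1)[OF that] R(1) incl_PiE s(3)[OF that]]) (use that in blast)
  then have "To ?R \<sigma> (map (\<lambda>s. Tm (fst s) ?R (incl (fst s)) (snd s)) ss) \<in> Field (Td ?R)"
    by (intro op_of_closed[OF alg[OF d_algs[OF R(1)]]]) (use \<sigma> in auto)
  then show ?thesis unfolding gop_def Let_def gensD using R by simp
qed

text \<open>With all arguments but one fixed, the operation on generators is given by a continuous family:
  the remaining argument \<open>u : Z \<rightarrow> A\<close>, \<open>t\<close> enters through a map out of the disjoint union of \<open>Z\<close> with
  the supports of the other arguments.\<close>

lemma gop_uniform:
  assumes A: "A \<in> obj CPO" and C: "T.cocone A D e" and \<sigma>: "\<sigma> \<in> \<Sigma> (Suc (length p + length q))"
    and p: "set p \<subseteq> lan_gens (endo M) A" and q: "set q \<subseteq> lan_gens (endo M) A" and Z: "finite Z"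
  obtains Z' \<theta> W where "finite Z'" "\<And>u. u \<in> Z \<rightarrow>\<^sub>E Field A \<Longrightarrow> W u \<in> Z' \<rightarrow>\<^sub>E Field A"
    "\<And>t. t \<in> Field (Td Z) \<Longrightarrow> \<theta> t \<in> Field (Td Z')"
    "\<And>c t. chain_join (Td Z) c t \<Longrightarrow> chain_join (Td Z') (\<lambda>m. \<theta> (c m)) (\<theta> t)"
    "\<And>a b. chain_join (hom_cpo (Id_on Z) A) a b \<Longrightarrow> chain_join (hom_cpo (Id_on Z') A) (\<lambda>m. W (a m)) (W b)"
    "\<And>u t. u \<in> Z \<rightarrow>\<^sub>E Field A \<Longrightarrow> t \<in> Field (Td Z) \<Longrightarrow>
      e (gop \<sigma> (p @ (u ` Z, Tm Z (u ` Z) u t) # q)) = T.leaf e Z' (W u) (\<theta> t)"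
proof -
  define R where "R = (\<Union>s\<in>set p \<union> set q. fst s)"
  have s: "finite (fst s)" "fst s \<subseteq> Field A" "snd s \<in> Field (Td (fst s))" "fst s \<subseteq> R" if "s \<in> set p \<union> set q" for s
    using that p q gensD[of "fst s" "snd s" A] unfolding R_def by auto
  have R: "finite R" "R \<subseteq> Field A"
    unfolding R_def using s(1) by (auto simp del: UN_simps intro!: UN_least[OF s(2)])
  obtain Z1 r r' where Z1: "finite Z1" "Z1 \<inter> R = {}" "r \<in> Z1 \<rightarrow>\<^sub>E Z" "r' \<in> Z \<rightarrow>\<^sub>E Z1" "r ` Z1 = Z"
    "\<And>z. z \<in> Z \<Longrightarrow> r (r' z) = z" using rename_apart[OF Z R(1)] by metis
  define Z' where "Z' = Z1 \<union> R"
  \<comment> \<open>\<open>u\<close> on the renamed copy of \<open>Z\<close>, the inclusion on the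
    other supports. Only this map depends on \<open>u\<close>; the algebraic part
    \<open>\<theta>\<close> depends on \<open>t\<close> alone, so the two kinds of limits can be
    taken separately.\<close>
  define W where "W u = (\<lambda>z\<in>Z'. if z \<in> Z1 then u (r z) else z)" for u
  define \<tau> where "\<tau> t = Tm Z Z' r' t" for t
  define \<phi> where "\<phi> s = Tm (fst s) Z' (incl (fst s)) (snd s)" for s
  define \<theta> where "\<theta> t = To Z' \<sigma> (map \<phi> p @ \<tau> t # map \<phi> q)" for t
  have Z': "finite Z'" unfolding Z'_def using Z1 R by auto
  have r': "r' \<in> Z \<rightarrow>\<^sub>E Z'" using Z1(4) unfolding Z'_def by auto
  have \<phi>: "\<phi> s \<in> Field (Td Z')" if "s \<in> set p \<union> set q" for s
    unfolding \<phi>_def by (rule d_app[OF s(1)[OF that] Z' incl_PiE s(3)[OF that]]) (use s(4)[OF that] in \<open>auto simp: Z'_def\<close>)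
  have \<tau>: "\<tau> t \<in> Field (Td Z')" if "t \<in> Field (Td Z)" for t unfolding \<tau>_def by (rule d_app[OF Z Z' r' that])
  have W: "W u \<in> Z' \<rightarrow>\<^sub>E Field A" if u: "u \<in> Z \<rightarrow>\<^sub>E Field A" for u
  proof (rule PiE_I)
    fix z assume z: "z \<in> Z'"
    show "W u z \<in> Field A"
    proof (cases "z \<in> Z1")
      case True
      then have "r z \<in> Z" using Z1(3) by (auto simp: PiE_iff)
      then show ?thesis using u True z by (auto simp: W_def PiE_iff)
    next
      case False
      then show ?thesis using z R(2) by (auto simp: W_def Z'_def)
    qed
  qed (simp add: W_def)
  show thesis
  proof (rule that[of Z' W \<theta>])
    show "finite Z'" by (rule Z')
    show "W u \<in> Z' \<rightarrow>\<^sub>E Field A" if "u \<in> Z \<rightarrow>\<^sub>E Field A" for u by (rule W[OF that])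
    note ZA = alg[OF d_algs[OF Z']]
    show "\<theta> t \<in> Field (Td Z')" if "t \<in> Field (Td Z)" for t
      unfolding \<theta>_def by (rule op_of_closed[OF ZA]) (use \<sigma> \<tau>[OF that] \<phi> in auto)
    show "chain_join (Td Z') (\<lambda>m. \<theta> (c m)) (\<theta> t)" if c: "chain_join (Td Z) c t" for c t
    proof -
      have j: "chain_join (Td Z') (\<lambda>m. \<tau> (c m)) (\<tau> t)" unfolding \<tau>_def
        by (rule continuous_mapD(3)[OF homsD(2)[OF d_hom[OF Z Z' r']] c])
      have "chain_join (power_cpo (Td Z') (Suc (length p + length q))) (\<lambda>m. map \<phi> p @ \<tau> (c m) # map \<phi> q) (map \<phi> p @ \<tau> t # map \<phi> q)"
      proof (rule chain_join_powerI)
        fix i assume "i < Suc (length p + length q)"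
        then consider "i < length p" | "i = length p" | "length p < i" "i - Suc (length p) < length q" by linarith
        then show "chain_join (Td Z') (\<lambda>m. (map \<phi> p @ \<tau> (c m) # map \<phi> q) ! i) ((map \<phi> p @ \<tau> t # map \<phi> q) ! i)"
        proof cases
          case 1
          then show ?thesis using chain_join_const[OF algebrasD(1)[OF ZA] \<phi>[of "p ! i"]] by (simp add: nth_append)
        next
          case 2
          then show ?thesis using j by (simp add: nth_append)
        next
          case 3
          then have "i - length p = Suc (i - Suc (length p))" by simp
          then show ?thesis using 3 chain_join_const[OF algebrasD(1)[OF ZA] \<phi>[of "q ! (i - Suc (length p))"]]
            by (simp add: nth_append)
        qed
      qed auto
      from continuous_mapD(3)[OF algebrasD(4)[OF ZA \<sigma>] this] show ?thesis unfolding \<theta>_def .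
    qed
    show "chain_join (hom_cpo (Id_on Z') A) (\<lambda>m. W (a m)) (W b)" if ab: "chain_join (hom_cpo (Id_on Z) A) a b" for a b
    proof (rule T.compose_hom_chain[OF A A Z'])
      note m = T.hom_disc_chain[OF A Z ab]
      show "W (a m) \<in> Z' \<rightarrow>\<^sub>E Field A" "W b \<in> Z' \<rightarrow>\<^sub>E Field A" for m by (rule W[OF m(1)], rule W[OF m(2)])
      fix z assume z: "z \<in> Z'"
      show "chain_join A (\<lambda>m. W (a m) z) (W b z)"
      proof (cases "z \<in> Z1")
        case True
        then have "r z \<in> Z" using Z1(3) by (auto simp: PiE_iff)
        from m(3)[OF this] show ?thesis using True z by (simp add: W_def)
      next
        case False
        then have "z \<in> Field A" using z R(2) by (auto simp: Z'_def)
        then show ?thesis using False z chain_join_const[OF CPO_cpo[OF A]] by (simp add: W_def)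
      qed
    qed
    fix u t assume u: "u \<in> Z \<rightarrow>\<^sub>E Field A" and t: "t \<in> Field (Td Z)"
    let ?Q = "W u ` Z'"
    \<comment> \<open>The image of the glued map is exactly the union of supports that
      \<open>gop\<close> uses, so the generators on the two sides lie over the same set.\<close>
    have Q: "?Q = u ` Z \<union> R"
    proof -
      have "W u ` Z1 = u ` r ` Z1" by (auto simp: W_def Z'_def image_iff)
      moreover have "W u ` R = R" using Z1(2) by (force simp: W_def Z'_def)
      ultimately show ?thesis unfolding Z'_def image_Un using Z1(5) by simp
    qed
    have uQ: "u \<in> Z \<rightarrow>\<^sub>E u ` Z" "u ` Z \<subseteq> ?Q" "finite (u ` Z)" and fQ: "finite ?Q" using u Q Z Z' R(1) by auto
    have WQ: "W u \<in> Z' \<rightarrow>\<^sub>E ?Q" using W[OF u] by auto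
    have e1: "Tm Z' ?Q (W u) (\<phi> s) = Tm (fst s) ?Q (incl (fst s)) (snd s)" if sm: "s \<in> set p \<union> set q" for s
    proof -
      have sub: "fst s \<subseteq> Z'" using s(4)[OF sm] by (auto simp: Z'_def)
      have "compose (fst s) (W u) (incl (fst s)) = incl (fst s)"
        using s(4)[OF sm] Z1(2) sub by (auto simp: compose_def incl_def W_def fun_eq_iff)
      then show ?thesis unfolding \<phi>_def
        using d_comp[OF s(1)[OF sm] Z' fQ incl_PiE[OF sub] WQ s(3)[OF sm]] by simp
    qed
    have e2: "Tm Z' ?Q (W u) (\<tau> t) = Tm (u ` Z) ?Q (incl (u ` Z)) (Tm Z (u ` Z) u t)"
    proof -
      have "compose Z (W u) r' = u"
      proof
        fix z show "compose Z (W u) r' z = u z"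
          using Z1(4,6) u by (cases "z \<in> Z") (auto simp: compose_def W_def Z'_def PiE_iff extensional_def)
      qed
      moreover have "compose Z (incl (u ` Z)) u = u" by (rule compose_incl_left[OF uQ(1)])
      ultimately show ?thesis unfolding \<tau>_def
        using d_comp[OF Z Z' fQ r' WQ t] d_comp[OF Z uQ(3) fQ uQ(1) incl_PiE[OF uQ(2)] t] by simp
    qed
    have U: "(\<Union>s\<in>set (p @ (u ` Z, Tm Z (u ` Z) u t) # q). fst s) = ?Q"
      unfolding Q R_def by auto
    have "Tm Z' ?Q (W u) (\<theta> t) = To ?Q \<sigma> (map (Tm Z' ?Q (W u)) (map \<phi> p @ \<tau> t # map \<phi> q))"
      unfolding \<theta>_def by (rule homsD(4)[OF d_hom[OF Z' fQ WQ]]) (use \<sigma> \<tau>[OF t] \<phi> in auto)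
    also have "map (Tm Z' ?Q (W u)) (map \<phi> p @ \<tau> t # map \<phi> q) =
        map (\<lambda>s. Tm (fst s) ?Q (incl (fst s)) (snd s)) (p @ (u ` Z, Tm Z (u ` Z) u t) # q)"
      using e1 e2 by simp
    finally show "e (gop \<sigma> (p @ (u ` Z, Tm Z (u ` Z) u t) # q)) = T.leaf e Z' (W u) (\<theta> t)"
      unfolding gop_def Let_def U T.leaf_def by simp
  qed
qed

text \<open>The hypothesis of \<open>free_cpo_multi_ext\<close> for \<open>gop\<close>. For
  \<open>chain\<close> and \<open>vary\<close> it follows from \<open>gop_uniform\<close>; for
  \<open>enlarge\<close> the union of supports itself changes.\<close>

lemma gop_joins:
  assumes A: "A \<in> obj CPO" and C: "T.cocone A D e" and \<sigma>: "\<sigma> \<in> \<Sigma> (Suc (length p + length q))"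
    and p: "set p \<subseteq> lan_gens (endo M) A" and q: "set q \<subseteq> lan_gens (endo M) A"
    and cs: "(c, s) \<in> lan_joins (endo M) A"
  shows "chain_join D (\<lambda>k. e (gop \<sigma> (p @ c k # q))) (e (gop \<sigma> (p @ s # q)))"
  using cs
proof (cases rule: lan_joins_cases)
  case (chain X c' t)
  obtain Z' \<theta> W where Z: "finite Z'" "\<And>u. u \<in> X \<rightarrow>\<^sub>E Field A \<Longrightarrow> W u \<in> Z' \<rightarrow>\<^sub>E Field A"
    "\<And>c t. chain_join (Td X) c t \<Longrightarrow> chain_join (Td Z') (\<lambda>m. \<theta> (c m)) (\<theta> t)"
    and l: "\<And>u t. u \<in> X \<rightarrow>\<^sub>E Field A \<Longrightarrow> t \<in> Field (Td X) \<Longrightarrow>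
      e (gop \<sigma> (p @ (u ` X, Tm X (u ` X) u t) # q)) = T.leaf e Z' (W u) (\<theta> t)"
    by (rule gop_uniform[OF A C \<sigma> p q chain(3)]) blast
  have j: "chain_join (Td X) c' t" using chain(5) by simp
  have i: "incl X \<in> X \<rightarrow>\<^sub>E Field A" by (rule incl_PiE[OF chain(4)])
  have "e (gop \<sigma> (p @ (X, t) # q)) = T.leaf e Z' (W (incl X)) (\<theta> t)" if "t \<in> Field (Td X)" for t
    using l[OF i that] d_id[OF chain(3) that] by simp
  then show ?thesis
    using T.leaf_chain[OF C Z(1) Z(2)[OF i], of "\<lambda>m. \<theta> (c' m)" "\<theta> t"] Z(3)[OF j] chain(1,2) chain_joinD(1,2)[OF j] by simp
next
  \<comment> \<open>Replacing \<open>X\<close> by \<open>Y\<close> enlarges the union of supports.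
    The map induced by the inclusion of the unions is a homomorphism, so it takes one value of
    \<open>gop\<close> to the other, and \<open>cocone_incl\<close> identifies them.\<close>
  case (enlarge Y X t)
  have fX: "finite X" and XA: "X \<subseteq> Field A" and t: "t \<in> Field (Td X)" using enlarge finite_subset by auto
  have Xi: "(X, t) \<in> lan_gens (endo M) A" using fX XA t by (simp add: gensD)
  have Yi: "(Y, Tm X Y (incl X) t) \<in> lan_gens (endo M) A"
    using d_app[OF fX enlarge(3) incl_PiE[OF enlarge(4)] t] enlarge by (simp add: gensD)
  let ?sX = "p @ (X, t) # q" and ?sY = "p @ (Y, Tm X Y (incl X) t) # q"
  let ?RX = "\<Union>s\<in>set ?sX. fst s" and ?RY = "\<Union>s\<in>set ?sY. fst s"
  have gX: "gop \<sigma> ?sX \<in> lan_gens (endo M) A" and gY: "gop \<sigma> ?sY \<in> lan_gens (endo M) A"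
    using gop_mem[of \<sigma> ?sX A] gop_mem[of \<sigma> ?sY A] \<sigma> p q Xi Yi by auto
  have R: "finite ?RX" "finite ?RY" "?RX \<subseteq> ?RY" "?RY \<subseteq> Field A"
    using gX gY enlarge(4) unfolding gop_def Let_def gensD by auto
  have m: "finite (fst s)" "snd s \<in> Field (Td (fst s))" if "s \<in> set ?sX" for s
    using that p q Xi gensD[of "fst s" "snd s" A] by auto
  have e: "Tm ?RX ?RY (incl ?RX) (Tm (fst s) ?RX (incl (fst s)) (snd s)) = Tm (fst s) ?RY (incl (fst s)) (snd s)"
    if "s \<in> set ?sX" for s
  proof -
    have "fst s \<subseteq> ?RX" using that by blast
    then show ?thesis
      using d_comp[OF m(1)[OF that] R(1,2) incl_PiE incl_PiE[OF R(3)] m(2)[OF that]] incl_comp[of "fst s" ?RX] by simp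
  qed
  have eX: "Tm Y ?RY (incl Y) (Tm X Y (incl X) t) = Tm X ?RY (incl X) t"
    using d_comp[OF fX enlarge(3) R(2) incl_PiE[OF enlarge(4)] incl_PiE[of Y ?RY] t] incl_comp[OF enlarge(4)] by auto
  have mRX: "Tm (fst s) ?RX (incl (fst s)) (snd s) \<in> Field (Td ?RX)" if "s \<in> set ?sX" for s
    by (rule d_app[OF m(1)[OF that] R(1) incl_PiE m(2)[OF that]]) (use that in blast)
  have "Tm ?RX ?RY (incl ?RX) (To ?RX \<sigma> (map (\<lambda>s. Tm (fst s) ?RX (incl (fst s)) (snd s)) ?sX))
    = To ?RY \<sigma> (map (Tm ?RX ?RY (incl ?RX)) (map (\<lambda>s. Tm (fst s) ?RX (incl (fst s)) (snd s)) ?sX))"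
    by (rule homsD(4)[OF d_hom[OF R(1,2) incl_PiE[OF R(3)]]]) (use \<sigma> mRX in auto)
  also have "map (Tm ?RX ?RY (incl ?RX)) (map (\<lambda>s. Tm (fst s) ?RX (incl (fst s)) (snd s)) ?sX)
    = map (\<lambda>s. Tm (fst s) ?RY (incl (fst s)) (snd s)) ?sX"
    unfolding map_map comp_def by (rule map_cong[OF refl]) (rule e)
  also have "\<dots> = map (\<lambda>s. Tm (fst s) ?RY (incl (fst s)) (snd s)) ?sY" using eX by simp
  finally have "gop \<sigma> ?sY = (?RY, Tm ?RX ?RY (incl ?RX) (snd (gop \<sigma> ?sX)))"
    unfolding gop_def Let_def by (simp del: set_append)
  moreover have "gop \<sigma> ?sX = (?RX, snd (gop \<sigma> ?sX))" unfolding gop_def Let_def by simp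
  moreover have "snd (gop \<sigma> ?sX) \<in> Field (Td ?RX)" using gX unfolding gop_def Let_def gensD by simp
  ultimately have "e (gop \<sigma> ?sY) = e (gop \<sigma> ?sX)"
    using T.cocone_incl[OF C R(2,3,4), of "snd (gop \<sigma> ?sX)"] by simp
  moreover have "e (gop \<sigma> ?sX) \<in> Field D" "cpo D" using C gX CPO_cpo unfolding T.cocone_def by auto
  ultimately show ?thesis using chain_join_const[of D "e (gop \<sigma> ?sX)"] enlarge(1,2) by simp
next
  case (vary Z a b t)
  obtain Z' \<theta> W where Z: "finite Z'" "\<And>u. u \<in> Z \<rightarrow>\<^sub>E Field A \<Longrightarrow> W u \<in> Z' \<rightarrow>\<^sub>E Field A"
    "\<And>t. t \<in> Field (Td Z) \<Longrightarrow> \<theta> t \<in> Field (Td Z')"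
    "\<And>a b. chain_join (hom_cpo (Id_on Z) A) a b \<Longrightarrow> chain_join (hom_cpo (Id_on Z') A) (\<lambda>m. W (a m)) (W b)"
    and l: "\<And>u t. u \<in> Z \<rightarrow>\<^sub>E Field A \<Longrightarrow> t \<in> Field (Td Z) \<Longrightarrow>
      e (gop \<sigma> (p @ (u ` Z, Tm Z (u ` Z) u t) # q)) = T.leaf e Z' (W u) (\<theta> t)"
    by (rule gop_uniform[OF A C \<sigma> p q vary(3)]) blast
  have t: "t \<in> Field (Td Z)" using vary(5) by simp
  note m = T.hom_disc_chain(1,2)[OF A vary(3,4)]
  show ?thesis
    using T.leaf_vary[OF C Z(1) Z(4)[OF vary(4)], of "\<theta> t"] Z(3)[OF t] l[OF m(1) t] l[OF m(2) t] vary(1,2) by simp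
qed

end


section \<open>The presented cpo as an algebra of the variety\<close>

context free_algebra_functor
begin

abbreviation "LO A \<equiv> fst (T.L_pair A)"
abbreviation "Le A \<equiv> snd (T.L_pair A)"

lemma Le_mem: "A \<in> obj CPO \<Longrightarrow> s \<in> lan_gens (endo M) A \<Longrightarrow> Le A s \<in> Field (LO A)"
  by (rule free_cpoD(3)[OF T.L_free])

lemma lan_algebra_exists:
  assumes A: "A \<in> obj CPO"
  shows "\<exists>B\<in>algebras \<Sigma>. cpo_of B = LO A \<and> (\<forall>\<sigma> ss. \<sigma> \<in> \<Sigma> (length ss) \<and> set ss \<subseteq> lan_gens (endo M) A \<longrightarrow>
    op_of B \<sigma> (map (Le A) ss) = Le A (gop \<sigma> ss))"
proof -
  note LC = CPO_cpo[OF T.L_obj[OF A]]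
  define P where "P n \<sigma> h \<longleftrightarrow> continuous_map (power_cpo (LO A) n) (LO A) h \<and>
      (\<forall>ss. length ss = n \<and> set ss \<subseteq> lan_gens (endo M) A \<longrightarrow> h (map (Le A) ss) = Le A (gop \<sigma> ss))" for n \<sigma> h
  define H where "H n \<sigma> = (SOME h. P n \<sigma> h)" for n \<sigma>
  have ex: "\<exists>h. P n \<sigma> h" if \<sigma>: "\<sigma> \<in> \<Sigma> n" for \<sigma> n
    unfolding P_def
  proof (rule free_cpo_multi_ext[OF T.L_free[OF A] T.L_obj[OF A] T.lan_joins_gens[OF A], where g = "\<lambda>ss. Le A (gop \<sigma> ss)"])
    show "Le A (gop \<sigma> ss) \<in> Field (LO A)" if "length ss = n" "set ss \<subseteq> lan_gens (endo M) A" for ss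
      by (rule Le_mem[OF A gop_mem]) (use that \<sigma> in auto)
    show "chain_join (LO A) (\<lambda>k. Le A (gop \<sigma> (p @ c k # q))) (Le A (gop \<sigma> (p @ s # q)))"
      if "(c, s) \<in> lan_joins (endo M) A" "set p \<subseteq> lan_gens (endo M) A" "set q \<subseteq> lan_gens (endo M) A"
        "Suc (length p + length q) = n" for c s p q
      by (rule gop_joins[OF A T.L_cocone[OF A] _ that(2,3,1)]) (use \<sigma> that(4) in simp)
  qed
  have P: "P n \<sigma> (H n \<sigma>)" if "\<sigma> \<in> \<Sigma> n" for \<sigma> n
    unfolding H_def by (rule someI_ex[OF ex[OF that]])
  have H: "\<And>\<sigma> n. \<sigma> \<in> \<Sigma> n \<Longrightarrow> continuous_map (power_cpo (LO A) n) (LO A) (H n \<sigma>)"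
    "\<And>\<sigma> n ss. \<sigma> \<in> \<Sigma> n \<Longrightarrow> length ss = n \<Longrightarrow> set ss \<subseteq> lan_gens (endo M) A \<Longrightarrow> H n \<sigma> (map (Le A) ss) = Le A (gop \<sigma> ss)"
    using P unfolding P_def by blast+
  define B where "B = \<lparr>cpo_of = LO A, op_of = \<lambda>\<sigma> xs. if \<sigma> \<in> \<Sigma> (length xs) \<and> set xs \<subseteq> Field (LO A)
    then H (length xs) \<sigma> xs else undefined\<rparr>"
  have "B \<in> algebras \<Sigma>"
    unfolding algebras_def B_def mem_Collect_eq calg.simps
  proof (intro conjI allI ballI impI)
    show "LO A \<in> obj CPO" by (rule T.L_obj[OF A])
    show "continuous_map (power_cpo (LO A) n) (LO A)
        (\<lambda>xs. if \<sigma> \<in> \<Sigma> (length xs) \<and> set xs \<subseteq> Field (LO A) then H (length xs) \<sigma> xs else undefined)"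
      if "\<sigma> \<in> \<Sigma> n" for \<sigma> n
      by (rule continuous_map_cong[OF H(1)[OF that]]) (use that in \<open>auto simp: field_power_cpo[OF LC]\<close>)
  qed auto
  moreover have "op_of B \<sigma> (map (Le A) ss) = Le A (gop \<sigma> ss)"
    if "\<sigma> \<in> \<Sigma> (length ss)" "set ss \<subseteq> lan_gens (endo M) A" for \<sigma> ss
  proof -
    have "set (map (Le A) ss) \<subseteq> Field (LO A)" using Le_mem[OF A] that(2) by auto
    then show ?thesis unfolding B_def using that H(2)[OF that(1) refl that(2)] by simp
  qed
  moreover have "cpo_of B = LO A" by (simp add: B_def)
  ultimately show ?thesis by blast
qed

text \<open>When all arguments lie over the same \<open>R\<close>, \<open>gop\<close> is the
  operation of the free algebra on \<open>R\<close>. Thus every finite stage maps homomorphically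
  into the presented algebra, which makes its equations available there.\<close>

lemma lan_algebra_hom:
  assumes A: "A \<in> obj CPO" and B: "B \<in> algebras \<Sigma>" "cpo_of B = LO A"
    and o: "\<And>\<sigma> ss. \<sigma> \<in> \<Sigma> (length ss) \<Longrightarrow> set ss \<subseteq> lan_gens (endo M) A \<Longrightarrow> op_of B \<sigma> (map (Le A) ss) = Le A (gop \<sigma> ss)"
    and R: "finite R" "R \<subseteq> Field A"
  shows "(\<lambda>t\<in>Field (Td R). Le A (R, t)) \<in> homs \<Sigma> (fobj F (Id_on R)) B"
proof (rule homsI)
  note C = T.L_cocone[OF A]
  have i: "incl R \<in> R \<rightarrow>\<^sub>E Field A" by (rule incl_PiE[OF R(2)])
  have l: "T.leaf (Le A) R (incl R) t = Le A (R, t)" if "t \<in> Field (Td R)" for t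
    by (rule T.leaf_incl[of R t A]) (use that R in \<open>simp add: gensD\<close>)
  have "continuous_map (Td R) (LO A) (\<lambda>t. T.leaf (Le A) R (incl R) t)"
    by (rule continuous_mapI[OF algebrasD(1)[OF alg[OF d_algs[OF R(1)]]]])
       (use T.leaf_mem[OF C R(1) i] T.leaf_chain[OF C R(1) i] in simp_all)
  then have "continuous_map (Td R) (LO A) (\<lambda>t. Le A (R, t))" by (rule continuous_map_cong) (rule l)
  from cont_maps_restrict[OF this]
  show "(\<lambda>t\<in>Field (Td R). Le A (R, t)) \<in> cont_maps (cpo_of (fobj F (Id_on R))) (cpo_of B)" using B(2) by simp
  fix \<sigma> xs assume \<sigma>: "\<sigma> \<in> \<Sigma> (length xs)" and xs: "set xs \<subseteq> Field (Td R)"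
  define ss where "ss = map (Pair R) xs"
  have ss: "set ss \<subseteq> lan_gens (endo M) A" "length ss = length xs" unfolding ss_def using xs R by (auto simp: gensD)
  have "map (\<lambda>t\<in>Field (Td R). Le A (R, t)) xs = map (Le A) ss" unfolding ss_def using xs by auto
  then have "op_of B \<sigma> (map (\<lambda>t\<in>Field (Td R). Le A (R, t)) xs) = Le A (gop \<sigma> ss)"
    using o[of \<sigma> ss] \<sigma> ss by simp
  also have "\<dots> = Le A (R, To R \<sigma> xs)"
  proof -
    let ?Q = "\<Union>s\<in>set ss. fst s"
    \<comment> \<open>For a constant the list is empty and the union is empty instead of
      \<open>R\<close>; hence the transport along the inclusion and the use of
      \<open>cocone_incl\<close>.\<close>
    have Q: "?Q \<subseteq> R" unfolding ss_def by auto
    have g: "gop \<sigma> ss \<in> lan_gens (endo M) A" by (rule gop_mem) (use \<sigma> ss in auto)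
    have gop: "gop \<sigma> ss = (?Q, snd (gop \<sigma> ss))" unfolding gop_def Let_def by simp
    have sQ: "snd (gop \<sigma> ss) \<in> Field (Td ?Q)" and fQ: "finite ?Q" using g gop by (metis gensD)+
    have R': "fst s = R" "?Q = R" if "s \<in> set ss" for s using that unfolding ss_def by auto
    have m: "snd s \<in> Field (Td R)" if "s \<in> set ss" for s using that xs unfolding ss_def by auto
    have "Tm ?Q R (incl ?Q) (snd (gop \<sigma> ss)) = To R \<sigma> (map (Tm ?Q R (incl ?Q)) (map (\<lambda>s. Tm (fst s) ?Q (incl (fst s)) (snd s)) ss))"
      unfolding gop_def Let_def snd_conv
    proof (rule homsD(4)[OF d_hom[OF fQ R(1) incl_PiE[OF Q]]])
      show "set (map (\<lambda>s. Tm (fst s) ?Q (incl (fst s)) (snd s)) ss) \<subseteq> Field (Td ?Q)"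
        using R' m d_id[OF R(1) m] by auto
    qed (use \<sigma> ss in simp)
    also have "map (Tm ?Q R (incl ?Q)) (map (\<lambda>s. Tm (fst s) ?Q (incl (fst s)) (snd s)) ss) = map snd ss"
      unfolding map_map comp_def by (rule map_cong[OF refl]) (simp only: R' d_id[OF R(1) m])
    also have "map snd ss = xs" unfolding ss_def by (simp add: comp_def)
    finally have "Le A (R, To R \<sigma> xs) = Le A (R, Tm ?Q R (incl ?Q) (snd (gop \<sigma> ss)))" by simp
    also have "\<dots> = Le A (?Q, snd (gop \<sigma> ss))"
      using T.cocone_incl[OF C R(1) Q R(2)] sQ by simp
    finally show ?thesis using gop by simp
  qed
  finally show "(\<lambda>t\<in>Field (Td R). Le A (R, t)) (To R \<sigma> xs) = op_of B \<sigma> (map (\<lambda>t\<in>Field (Td R). Le A (R, t)) xs)"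
    using op_of_closed[OF alg[OF d_algs[OF R(1)]] \<sigma> xs] by simp
qed

text \<open>By \<open>satisfies_dense\<close> it is enough to assign generators to the variables of
  an equation. Their supports lie in one finite \<open>R\<close>, so the assignment comes from the
  free algebra on \<open>R\<close>, where the equation holds.\<close>

lemma lan_algebra_variety:
  assumes A: "A \<in> obj CPO" and B: "B \<in> algebras \<Sigma>" "cpo_of B = LO A"
    and o: "\<And>\<sigma> ss. \<sigma> \<in> \<Sigma> (length ss) \<Longrightarrow> set ss \<subseteq> lan_gens (endo M) A \<Longrightarrow> op_of B \<sigma> (map (Le A) ss) = Le A (gop \<sigma> ss)"
  shows "B \<in> algs V"
proof -
  obtain E where E: "E \<subseteq> xtrms \<Sigma> \<times> xtrms \<Sigma>" "algs V = {A \<in> algebras \<Sigma>. \<forall>e\<in>E. satisfies A e}"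
    by (rule variety_equations[OF V])
  let ?G = "Le A ` lan_gens (endo M) A"
  note free = T.L_free[OF A]
  have dense: "join_dense (cpo_of B) ?G" "?G \<subseteq> Field (cpo_of B)" using free_cpoD(5,6)[OF free] B(2) by auto
  have "satisfies B eq" if eq: "eq \<in> E" for eq
  proof (rule satisfies_dense[OF B(1) dense])
    show eqx: "eq \<in> xtrms \<Sigma> \<times> xtrms \<Sigma>" using E eq by blast
    fix f :: "nat \<Rightarrow> 'u"
    assume f: "range f \<subseteq> Field (cpo_of B)" and fG: "\<And>v. v \<in> xvars (fst eq) \<union> xvars (snd eq) \<Longrightarrow> f v \<in> ?G"
    \<comment> \<open>Without generators the carrier would be empty by density, and then there would
      be no assignment \<open>f\<close>. A generator is wanted as a default value.\<close>
    have "lan_gens (endo M) A \<noteq> {}"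
    proof
      assume "lan_gens (endo M) A = {}"
      then have "{} = Field (cpo_of B)"
        using dense(1) unfolding join_dense_def by (metis empty_subsetI image_empty join_closed_def empty_iff)
      then show False using f by blast
    qed
    then obtain s0 where s0: "s0 \<in> lan_gens (endo M) A" by blast
    have "\<forall>v. \<exists>s. s \<in> lan_gens (endo M) A \<and> (v \<in> xvars (fst eq) \<union> xvars (snd eq) \<longrightarrow> f v = Le A s)"
      using fG s0 by blast
    then obtain s where s: "\<And>v. s v \<in> lan_gens (endo M) A"
      "\<And>v. v \<in> xvars (fst eq) \<union> xvars (snd eq) \<Longrightarrow> f v = Le A (s v)" by metis
    let ?W = "xvars (fst eq) \<union> xvars (snd eq)"
    \<comment> \<open>Variables outside the equation all get the default \<open>s0\<close>. Only
      finitely many generators then occur, and a single finite \<open>R\<close> contains their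
      supports.\<close>
    define s' where "s' v = (if v \<in> ?W then s v else s0)" for v
    have fin: "finite ?W" using finite_xvars eqx by (metis finite_UnI mem_Times_iff)
    define R where "R = (\<Union>x\<in>s ` ?W \<union> {s0}. fst x)"
    have xs: "finite (fst x)" "fst x \<subseteq> Field A" "snd x \<in> Field (Td (fst x))" if "x \<in> lan_gens (endo M) A" for x
      using that gensD[of "fst x" "snd x" A] by auto
    have R: "finite R" "R \<subseteq> Field A"
      unfolding R_def using fin xs(1)[OF s(1)] xs(1)[OF s0] xs(2)[OF s(1)] xs(2)[OF s0] by auto
    have s'R: "s' v \<in> lan_gens (endo M) A" "fst (s' v) \<subseteq> R" for v
      unfolding s'_def R_def using s(1) s0 by auto
    let ?k = "\<lambda>t\<in>Field (Td R). Le A (R, t)"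
    have k: "?k \<in> homs \<Sigma> (fobj F (Id_on R)) B" by (rule lan_algebra_hom[OF A B o R])
    have img: "Le A (s' v) \<in> ?k ` Field (Td R)" for v
    proof -
      have t: "Tm (fst (s' v)) R (incl (fst (s' v))) (snd (s' v)) \<in> Field (Td R)"
        by (rule d_app[OF xs(1)[OF s'R(1)] R(1) incl_PiE[OF s'R(2)] xs(3)[OF s'R(1)]])
      have "Le A (s' v) = ?k (Tm (fst (s' v)) R (incl (fst (s' v))) (snd (s' v)))"
        using T.cocone_incl[OF T.L_cocone[OF A] R(1) s'R(2) R(2), of "snd (s' v)"] xs(3)[OF s'R(1)] t by simp
      then show ?thesis using t by blast
    qed
    have "satisfies (fobj F (Id_on R)) eq" using d_algs[OF R(1)] E(2) eq by blast
    from satisfies_image[OF alg[OF d_algs[OF R(1)]] B(1) k eqx this, of "\<lambda>v. Le A (s' v)", OF img]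
    obtain x where x: "xeval B (\<lambda>v. Le A (s' v)) (fst eq) = Some x" "xeval B (\<lambda>v. Le A (s' v)) (snd eq) = Some x"
      by blast
    have "xeval B f (fst eq) = xeval B (\<lambda>v. Le A (s' v)) (fst eq)" "xeval B f (snd eq) = xeval B (\<lambda>v. Le A (s' v)) (snd eq)"
      by (rule xeval_cong; use s(2) in \<open>simp add: s'_def\<close>)+
    then show "\<exists>x. xeval B f (fst eq) = Some x \<and> xeval B f (snd eq) = Some x" using x by simp
  qed
  then show ?thesis using B(1) E(2) by blast
qed

text \<open>Freeness gives \<open>u\<close> from the free algebra to the presented one, and the
  presentation gives \<open>\<kappa>\<close> back. Since \<open>\<kappa>\<close> is a homomorphism,
  freeness makes the composite on the free algebra the identity; on the presented side generators
  decide.\<close>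

lemma M_pointwise: "pointwise_lan (endo M)"
  unfolding pointwise_lan_def
proof
  fix A :: "'u rel" assume A: "A \<in> obj CPO"
  note free = T.L_free[OF A] and C = T.L_cocone[OF A] and FA = F_algs[OF A]
  obtain B where B: "B \<in> algebras \<Sigma>" "cpo_of B = LO A"
    and o: "\<And>\<sigma> ss. \<sigma> \<in> \<Sigma> (length ss) \<Longrightarrow> set ss \<subseteq> lan_gens (endo M) A \<Longrightarrow> op_of B \<sigma> (map (Le A) ss) = Le A (gop \<sigma> ss)"
    using lan_algebra_exists[OF A] by blast
  have BV: "B \<in> algs V" by (rule lan_algebra_variety[OF A B o])
  define j where "j x = Le A ({x}, \<eta> (Id_on {x}) x)" for x
  have \<eta>1: "\<eta> (Id_on X) x \<in> Field (Td X)" if "finite X" "x \<in> X" for X x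
    using unit_app[OF T.disc_obj[OF that(1)]] that(2) by simp
  have \<eta>T: "Tm X Y u (\<eta> (Id_on X) x) = \<eta> (Id_on Y) (u x)" if "finite X" "finite Y" "u \<in> X \<rightarrow>\<^sub>E Y" "x \<in> X" for X Y u x
    using fmap_unit[OF T.disc_obj[OF that(1)] T.disc_obj[OF that(2)], of u x] that T.disc_maps[OF that(1) T.disc_obj[OF that(2)]] by simp
  \<comment> \<open>Writing \<open>j x\<close> with a fixed one-point set and a varying map into
    \<open>A\<close> makes its dependence on \<open>x\<close> an instance of
    \<open>leaf_vary\<close>, which yields continuity of \<open>j\<close>.\<close>
  have jl: "T.leaf (Le A) {z} (\<lambda>y\<in>{z}. x) (\<eta> (Id_on {z}) z) = j x" for z x
  proof -
    have "(\<lambda>y\<in>{z}. x) ` {z} = {x}" by simp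
    moreover have "Tm {z} {x} (\<lambda>y\<in>{z}. x) (\<eta> (Id_on {z}) z) = \<eta> (Id_on {x}) x" using \<eta>T[of "{z}" "{x}" "\<lambda>y\<in>{z}. x" z] by simp
    ultimately show ?thesis unfolding T.leaf_def j_def by (simp del: restrict_apply)
  qed
  have jF: "j x \<in> Field (LO A)" if "x \<in> Field A" for x
    unfolding j_def by (rule Le_mem[OF A]) (use that \<eta>1[of "{x}" x] in \<open>simp add: gensD\<close>)
  have "continuous_map A (LO A) j"
  proof (rule continuous_mapI[OF CPO_cpo[OF A] jF])
    fix c x assume c: "chain_join A c x"
    have m: "c k \<in> Field A" "x \<in> Field A" for k using chain_joinD(1,2)[OF c] by auto
    have "chain_join (hom_cpo (Id_on {x}) A) (\<lambda>k. \<lambda>y\<in>{x}. c k) (\<lambda>y\<in>{x}. x)"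
      by (rule T.compose_hom_chain[OF A A]) (use c m in auto)
    from T.leaf_vary[OF C _ this, of "\<eta> (Id_on {x}) x"] show "chain_join (LO A) (\<lambda>k. j (c k)) (j x)"
      using \<eta>1[of "{x}" x] unfolding jl by simp
  qed
  from cont_maps_restrict[OF this] have jm: "restrict j (Field A) \<in> cont_maps A (cpo_of B)" using B(2) by simp
  obtain u where u: "u \<in> homs \<Sigma> (fobj F A) B" "\<And>x. x \<in> Field A \<Longrightarrow> u (\<eta> A x) = restrict j (Field A) x"
    using extension[OF A BV jm] by blast
  have um: "u \<in> cont_maps (cpo_of (fobj F A)) (LO A)" using homsD(1)[OF u(1)] B(2) by simp
  \<comment> \<open>Both sides are homomorphisms in \<open>t\<close> from the free algebra on the
    discrete cpo \<open>X\<close>, and they agree on the units.\<close>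
  have uT: "u (fmap F (Id_on X) A (incl X) t) = Le A (X, t)" if X: "finite X" "X \<subseteq> Field A" and t: "t \<in> Field (Td X)" for X t
  proof -
    note i = T.incl_map[OF X(1) A X(2)] and D = T.disc_obj[OF X(1)]
    have "compose (Field (Td X)) u (fmap F (Id_on X) A (incl X)) = (\<lambda>t\<in>Field (Td X). Le A (X, t))"
    proof (rule hom_eq[OF D BV F_compose[OF fmap_hom[OF D A i] u(1) D] lan_algebra_hom[OF A B o X]])
      fix x assume x: "x \<in> Field (Id_on X)"
      then have xX: "x \<in> X" "x \<in> Field A" "{x} \<subseteq> X" using X(2) by auto
      have "Le A (X, \<eta> (Id_on X) x) = Le A ({x}, \<eta> (Id_on {x}) x)"
        using T.cocone_incl[OF C X(1) xX(3) X(2), of "\<eta> (Id_on {x}) x"] \<eta>1[of "{x}" x]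
          \<eta>T[OF _ X(1) incl_PiE[OF xX(3)], of x] by simp
      then show "compose (Field (Td X)) u (fmap F (Id_on X) A (incl X)) (\<eta> (Id_on X) x) = (\<lambda>t\<in>Field (Td X). Le A (X, t)) (\<eta> (Id_on X) x)"
        using \<eta>1[OF X(1) xX(1)] fmap_unit[OF D A i x] u(2)[OF xX(2)] xX by (simp add: CPO_compose_app j_def)
    qed
    from fun_cong[OF this, of t] t show ?thesis by (simp add: CPO_compose_app)
  qed
  obtain \<kappa> where \<kappa>: "\<kappa> \<in> cont_maps (LO A) (fobj (endo M) A)" "\<And>s. s \<in> lan_gens (endo M) A \<Longrightarrow> \<kappa> (Le A s) = can (endo M) A s"
    using T.lan_ext[OF free T.can_cocone(1)[OF A]] by metis
  have \<kappa>m: "\<kappa> \<in> cont_maps (cpo_of B) (cpo_of (fobj F A))" using \<kappa>(1) B(2) by simp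
  have \<kappa>can: "\<kappa> (Le A (X, t)) = fmap F (Id_on X) A (incl X) t" if "(X, t) \<in> lan_gens (endo M) A" for X t
    using \<kappa>(2)[OF that] by (simp add: can_def)
  \<comment> \<open>Both sides of the homomorphism law are continuous in the list of arguments, so
    by \<open>join_dense_power\<close> lists of generators suffice. For these the computation takes
    place in the free algebra on the union of supports.\<close>
  have \<kappa>h: "\<kappa> \<in> homs \<Sigma> B (fobj F A)"
  proof (rule homsI[OF \<kappa>m])
    fix \<sigma> xs assume \<sigma>: "\<sigma> \<in> \<Sigma> (length xs)" and xs: "set xs \<subseteq> Field (cpo_of B)"
    let ?n = "length xs"
    let ?P = "power_cpo (LO A) ?n"
    note LC = CPO_cpo[OF T.L_obj[OF A]]
    have c1: "continuous_map ?P (cpo_of (fobj F A)) (\<lambda>ys. \<kappa> (op_of B \<sigma> ys))"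
      using continuous_map_comp[OF algebrasD(4)[OF B(1) \<sigma>] cont_mapsD(1)[OF \<kappa>m]] B(2) by simp
    have c2: "continuous_map ?P (power_cpo (cpo_of (fobj F A)) ?n) (map \<kappa>)"
      by (rule continuous_map_map[OF LC alg_cpo[OF FA]]) (use cont_mapsD(1)[OF \<kappa>(1)] in simp)
    have c3: "continuous_map ?P (cpo_of (fobj F A)) (\<lambda>ys. op_of (fobj F A) \<sigma> (map \<kappa> ys))"
      by (rule continuous_map_comp[OF c2 algebrasD(4)[OF alg[OF FA] \<sigma>]])
    have xP: "xs \<in> Field ?P" using xs B(2) unfolding field_power_cpo[OF LC] by simp
    show "\<kappa> (op_of B \<sigma> xs) = op_of (fobj F A) \<sigma> (map \<kappa> xs)"
    proof (rule join_denseD[OF join_dense_power[OF LC free_cpoD(5,6)[OF free]] xP])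
      show "join_closed ?P {ys \<in> Field ?P. \<kappa> (op_of B \<sigma> ys) = op_of (fobj F A) \<sigma> (map \<kappa> ys)}"
        by (rule join_closed_eq[OF cpo_power_cpo[OF LC] alg_cpo[OF FA] c1 c3])
      show "{ys. length ys = ?n \<and> set ys \<subseteq> Le A ` lan_gens (endo M) A} \<subseteq> Field ?P"
        using free_cpoD(6)[OF free] unfolding field_power_cpo[OF LC] by auto
      fix ys assume "ys \<in> {ys. length ys = ?n \<and> set ys \<subseteq> Le A ` lan_gens (endo M) A}"
      then have "ys \<in> lists (Le A ` lan_gens (endo M) A)" "length ys = ?n" by auto
      then obtain ss where "ys = map (Le A) ss" "ss \<in> lists (lan_gens (endo M) A)" unfolding lists_image by blast
      then have ss: "ys = map (Le A) ss" "set ss \<subseteq> lan_gens (endo M) A" "length ss = ?n" using \<open>length ys = ?n\<close> by auto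
      let ?R = "\<Union>s\<in>set ss. fst s"
      have g: "gop \<sigma> ss \<in> lan_gens (endo M) A" by (rule gop_mem) (use \<sigma> ss in auto)
      have gop: "gop \<sigma> ss = (?R, snd (gop \<sigma> ss))" unfolding gop_def Let_def by simp
      have R: "finite ?R" "?R \<subseteq> Field A" using g gop by (metis gensD)+
      note i = T.incl_map[OF R(1) A R(2)]
      have m: "finite (fst s)" "fst s \<subseteq> Field A" "snd s \<in> Field (Td (fst s))" "fst s \<subseteq> ?R" if "s \<in> set ss" for s
        using that ss(2) gensD[of "fst s" "snd s" A] by auto
      have e: "fmap F (Id_on ?R) A (incl ?R) (Tm (fst s) ?R (incl (fst s)) (snd s)) = \<kappa> (Le A s)" if s: "s \<in> set ss" for s
      proof -
        have "compose (fst s) (incl ?R) (incl (fst s)) = incl (fst s)" by (rule incl_comp[OF m(4)[OF s]])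
        then have "fmap F (Id_on ?R) A (incl ?R) (Tm (fst s) ?R (incl (fst s)) (snd s)) = fmap F (Id_on (fst s)) A (incl (fst s)) (snd s)"
          using T.disc_comp[OF m(1)[OF s] R(1) A incl_PiE[OF m(4)[OF s]] incl_PiE[OF R(2)], of "snd s"] m(3)[OF s] by simp
        moreover have "(fst s, snd s) \<in> lan_gens (endo M) A" using s ss(2) by auto
        ultimately show ?thesis using \<kappa>can[of "fst s" "snd s"] by simp
      qed
      have mR: "set (map (\<lambda>s. Tm (fst s) ?R (incl (fst s)) (snd s)) ss) \<subseteq> Field (Td ?R)"
        using d_app[OF m(1) R(1) incl_PiE[OF m(4)] m(3)] by auto
      have "\<kappa> (op_of B \<sigma> ys) = \<kappa> (Le A (?R, snd (gop \<sigma> ss)))" using o[of \<sigma> ss] \<sigma> ss gop by simp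
      also have "\<dots> = fmap F (Id_on ?R) A (incl ?R) (snd (gop \<sigma> ss))" by (rule \<kappa>can) (use g gop in simp)
      also have "\<dots> = op_of (fobj F A) \<sigma> (map (fmap F (Id_on ?R) A (incl ?R)) (map (\<lambda>s. Tm (fst s) ?R (incl (fst s)) (snd s)) ss))"
        unfolding gop_def Let_def snd_conv
        by (rule homsD(4)[OF fmap_hom[OF T.disc_obj[OF R(1)] A i] _ mR]) (use \<sigma> ss in simp)
      also have "map (fmap F (Id_on ?R) A (incl ?R)) (map (\<lambda>s. Tm (fst s) ?R (incl (fst s)) (snd s)) ss) = map \<kappa> ys"
        unfolding ss(1) map_map comp_def by (rule map_cong[OF refl]) (rule e)
      finally show "\<kappa> (op_of B \<sigma> ys) = op_of (fobj F A) \<sigma> (map \<kappa> ys)" .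
    qed
  qed
  have ku: "\<kappa> (u y) = y" if y: "y \<in> Field (fobj (endo M) A)" for y
  proof -
    have "compose (Field (cpo_of (fobj F A))) \<kappa> u = (\<lambda>y\<in>Field (cpo_of (fobj F A)). y)"
    proof (rule hom_eq[OF A FA F_compose[OF u(1) \<kappa>h A] homs_id[OF alg[OF FA]]])
      fix x assume x: "x \<in> Field A"
      have g: "({x}, \<eta> (Id_on {x}) x) \<in> lan_gens (endo M) A" using x \<eta>1[of "{x}" x] by (simp add: gensD)
      have i: "incl {x} \<in> cont_maps (Id_on {x}) A" by (rule T.incl_map[OF _ A]) (use x in auto)
      have "\<kappa> (j x) = \<eta> A x"
        unfolding j_def \<kappa>can[OF g] using fmap_unit[OF T.disc_obj A i, of x] by simp
      then show "compose (Field (cpo_of (fobj F A))) \<kappa> u (\<eta> A x) = (\<lambda>y\<in>Field (cpo_of (fobj F A)). y) (\<eta> A x)"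
        using u(2)[OF x] x unit_app[OF A x] by (simp add: CPO_compose_app)
    qed
    from fun_cong[OF this, of y] show ?thesis using y by (simp add: CPO_compose_app)
  qed
  have uk: "u (\<kappa> x) = x" if x: "x \<in> Field (LO A)" for x
  proof -
    have "compose (Field (LO A)) u \<kappa> x = (\<lambda>x\<in>Field (LO A). x) x"
    proof (rule T.lan_eqI[OF free CPO_cpo[OF T.L_obj[OF A]] _ cont_maps_id[OF CPO_cpo[OF T.L_obj[OF A]]] x])
      show "compose (Field (LO A)) u \<kappa> \<in> cont_maps (LO A) (LO A)"
        by (rule cont_maps_compose[OF \<kappa>(1)]) (use um in simp)
      fix X t assume X: "finite X" "X \<subseteq> Field A" "incl X \<in> X \<rightarrow>\<^sub>E Field A" "t \<in> Field (fobj (endo M) (Id_on X))"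
      then have g: "(X, t) \<in> lan_gens (endo M) A" by (simp add: gensD)
      show "compose (Field (LO A)) u \<kappa> (T.leaf (Le A) X (incl X) t) = (\<lambda>x\<in>Field (LO A). x) (T.leaf (Le A) X (incl X) t)"
        using uT[OF X(1,2)] X(4) \<kappa>can[OF g] Le_mem[OF A g] T.leaf_incl[OF g, of "Le A"] by (simp add: CPO_compose_app)
    qed
    then show ?thesis using x by (simp add: CPO_compose_app)
  qed
  show "free_cpo (lan_gens (endo M) A) (lan_joins (endo M) A) (fobj (endo M) A) (can (endo M) A)"
  proof (rule free_cpo_iso[OF free T.lan_joins_gens[OF A] T.F_obj[OF A] \<kappa>(1) _ ku uk])
    show "u \<in> cont_maps (fobj (endo M) A) (LO A)" using um by simp
    show "can (endo M) A s = \<kappa> (Le A s)" if "s \<in> lan_gens (endo M) A" for s using \<kappa>(2)[OF that] by simp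
  qed
qed

theorem M_strongly_finitary: "M \<in> strongly_finitary_monads"
  unfolding strongly_finitary_monads_def using M_monad T.pointwise_strongly_finitary[OF M_pointwise] by simp

end


section \<open>The variety of a strongly finitary monad\<close>

locale sf_monad = small_universe U for U :: "'u set" +
  fixes M :: "'u cpo_monad"
  assumes M: "M \<in> strongly_finitary_monads"
begin

abbreviation "T \<equiv> fobj (endo M)"
abbreviation "Tmap \<equiv> fmap (endo M)"
abbreviation "\<eta> \<equiv> unit M"
abbreviation "\<mu> \<equiv> mult M"

lemma M_sf: "strongly_finitary (endo M)" and M_monad: "is_monad CPO M"
  using M unfolding strongly_finitary_monads_def by auto

sublocale T: enriched_functor U "endo M"
  by unfold_locales (use M_sf in \<open>simp add: strongly_finitary_def\<close>)

lemma pointwise: "A \<in> obj CPO \<Longrightarrow> free_cpo (lan_gens (endo M) A) (lan_joins (endo M) A) (T A) (can (endo M) A)"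
  using T.strongly_finitary_pointwise[OF M_sf] unfolding pointwise_lan_def by blast

lemma unit_trans: "nat_trans CPO CPO id_functor (endo M) \<eta>" and mult_trans: "nat_trans CPO CPO (endo M \<odot> endo M) (endo M) \<mu>"
  using M_monad unfolding is_monad_def Let_def by auto

lemma unit_map: "X \<in> obj CPO \<Longrightarrow> \<eta> X \<in> cont_maps X (T X)"
  using nat_trans_CPO_D(2)[OF unit_trans] by simp

lemma unit_app: "X \<in> obj CPO \<Longrightarrow> x \<in> Field X \<Longrightarrow> \<eta> X x \<in> Field (T X)"
  using cont_maps_app[OF unit_map] .

lemma unit_nat: "X \<in> obj CPO \<Longrightarrow> Y \<in> obj CPO \<Longrightarrow> f \<in> cont_maps X Y \<Longrightarrow> x \<in> Field X \<Longrightarrow> Tmap X Y f (\<eta> X x) = \<eta> Y (f x)"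
  using nat_trans_CPO_D(3)[OF unit_trans] by simp

lemma mult_map: "X \<in> obj CPO \<Longrightarrow> \<mu> X \<in> cont_maps (T (T X)) (T X)"
  using nat_trans_CPO_D(2)[OF mult_trans] by simp

lemma mult_app: "X \<in> obj CPO \<Longrightarrow> z \<in> Field (T (T X)) \<Longrightarrow> \<mu> X z \<in> Field (T X)"
  using cont_maps_app[OF mult_map] .

lemma mult_nat: "X \<in> obj CPO \<Longrightarrow> Y \<in> obj CPO \<Longrightarrow> f \<in> cont_maps X Y \<Longrightarrow> z \<in> Field (T (T X)) \<Longrightarrow>
    Tmap X Y f (\<mu> X z) = \<mu> Y (Tmap (T X) (T Y) (Tmap X Y f) z)"
  using nat_trans_CPO_D(3)[OF mult_trans] by simp

lemma mult_unit:
  assumes X: "X \<in> obj CPO" and y: "y \<in> Field (T X)"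
  shows "\<mu> X (\<eta> (T X) y) = y" "\<mu> X (Tmap X (T X) (\<eta> X) y) = y"
proof -
  have "compose (Field (T X)) (\<mu> X) (\<eta> (T X)) = (\<lambda>x\<in>Field (T X). x)"
    "compose (Field (T X)) (\<mu> X) (Tmap X (T X) (\<eta> X)) = (\<lambda>x\<in>Field (T X). x)"
    using M_monad X unfolding is_monad_def Let_def by auto
  from this[THEN fun_cong, of y] show "\<mu> X (\<eta> (T X) y) = y" "\<mu> X (Tmap X (T X) (\<eta> X) y) = y"
    using y by (simp_all add: compose_def)
qed

lemma mult_assoc:
  assumes X: "X \<in> obj CPO" and w: "w \<in> Field (T (T (T X)))"
  shows "\<mu> X (\<mu> (T X) w) = \<mu> X (Tmap (T (T X)) (T X) (\<mu> X) w)"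
proof -
  have "compose (Field (T (T (T X)))) (\<mu> X) (\<mu> (T X)) = compose (Field (T (T (T X)))) (\<mu> X) (Tmap (T (T X)) (T X) (\<mu> X))"
    using M_monad X unfolding is_monad_def Let_def by auto
  from eq_on_compose[OF this w] show ?thesis .
qed

section \<open>Finite arities inside the universe, and the signature of a monad\<close>

definition \<iota> :: "nat \<Rightarrow> 'u" where
  "\<iota> = (SOME f. inj f)"

lemma \<iota>: "inj \<iota>"
proof -
  have "\<exists>f :: nat \<Rightarrow> 'u. inj f" using infinite_universe infinite_countable_subset by blast
  then show ?thesis unfolding \<iota>_def by (rule someI_ex)
qed

text \<open>The monad acts on cpos over \<open>'u\<close> only, so the numbers below
  \<open>n\<close> are represented by \<open>n\<close> chosen elements of \<open>'u\<close>.\<close>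

definition N :: "nat \<Rightarrow> 'u set" where
  "N n = \<iota> ` {..<n}"

text \<open>The correspondence between lists of length \<open>n\<close>, the arguments of an
  operation, and maps from the chosen \<open>n\<close>-element set.\<close>

definition as :: "'u list \<Rightarrow> 'u \<Rightarrow> 'u" where
  "as xs = (\<lambda>u\<in>N (length xs). xs ! inv \<iota> u)"

lemma N_finite [simp]: "finite (N n)"
  unfolding N_def by simp

lemma N_obj [simp]: "Id_on (N n) \<in> obj CPO"
  by (rule T.disc_obj) simp

lemma as_app [simp]: "i < length xs \<Longrightarrow> as xs (\<iota> i) = xs ! i"
  unfolding as_def N_def using inv_f_f[OF \<iota>] by auto

lemma N_E: assumes "u \<in> N n" obtains i where "i < n" "u = \<iota> i"
  using assms unfolding N_def by auto

lemma N_I [simp]: "i < n \<Longrightarrow> \<iota> i \<in> N n"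
  unfolding N_def by simp

lemma as_PiE: "set xs \<subseteq> S \<Longrightarrow> length xs = n \<Longrightarrow> as xs \<in> N n \<rightarrow>\<^sub>E S"
proof (rule PiE_I)
  fix u assume "set xs \<subseteq> S" "length xs = n" "u \<in> N n"
  then show "as xs u \<in> S" by (auto elim!: N_E)
qed (auto simp: as_def)

lemma as_eqI:
  assumes "\<And>i. i < length xs \<Longrightarrow> g (\<iota> i) = xs ! i" "g \<in> extensional (N (length xs))"
  shows "g = as xs"
proof
  fix u show "g u = as xs u"
    using assms by (cases "u \<in> N (length xs)") (auto elim!: N_E simp: extensional_def as_def inv_f_f[OF \<iota>])
qed

lemma as_map: "compose (N (length xs)) g (as xs) = as (map g xs)"
  using as_eqI[of "map g xs" "compose (N (length xs)) g (as xs)"] by (simp add: compose_def)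

lemma as_cont: "A \<in> obj CPO \<Longrightarrow> set xs \<subseteq> Field A \<Longrightarrow> as xs \<in> cont_maps (Id_on (N (length xs))) A"
  using T.disc_maps[of "N (length xs)" A] as_PiE[of xs "Field A"] by simp

definition Sg :: "nat \<Rightarrow> 'u set" where
  "Sg n = Field (T (Id_on (N n)))"

lemma Sg_signature: "is_signature Sg"
  unfolding is_signature_def Sg_def using CPO_small[OF T.F_obj[OF N_obj]] by blast

text \<open>The free Eilenberg-Moore algebra on \<open>A\<close> viewed as an algebra for the
  signature \<open>Sg\<close>: an operation symbol \<open>p\<close> is evaluated by substituting the
  arguments for its variables and multiplying.\<close>

definition Alg :: "'u rel \<Rightarrow> 'u calg" where
  "Alg A = \<lparr>cpo_of = T A, op_of = \<lambda>p xs. if p \<in> Sg (length xs) \<and> set xs \<subseteq> Field (T A)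
    then \<mu> A (Tmap (Id_on (N (length xs))) (T A) (as xs) p) else undefined\<rparr>"

lemma Alg_cpo [simp]: "cpo_of (Alg A) = T A"
  by (simp add: Alg_def)

lemma Alg_op: "p \<in> Sg (length xs) \<Longrightarrow> set xs \<subseteq> Field (T A) \<Longrightarrow>
    op_of (Alg A) p xs = \<mu> A (Tmap (Id_on (N (length xs))) (T A) (as xs) p)"
  by (simp add: Alg_def)

lemma subst_app: "A \<in> obj CPO \<Longrightarrow> p \<in> Sg (length xs) \<Longrightarrow> set xs \<subseteq> Field A \<Longrightarrow>
    Tmap (Id_on (N (length xs))) A (as xs) p \<in> Field (T A)"
  by (rule T.F_app[OF N_obj _ as_cont]) (simp_all add: Sg_def)

lemma subst_map: "A \<in> obj CPO \<Longrightarrow> B \<in> obj CPO \<Longrightarrow> p \<in> Sg (length xs) \<Longrightarrow> set xs \<subseteq> Field A \<Longrightarrow> g \<in> cont_maps A B \<Longrightarrow>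
    Tmap A B g (Tmap (Id_on (N (length xs))) A (as xs) p) = Tmap (Id_on (N (length xs))) B (as (map g xs)) p"
  using T.F_comp[OF N_obj _ _ as_cont, of A B xs g p] by (simp add: Sg_def as_map)

lemma Alg_algebra: "A \<in> obj CPO \<Longrightarrow> Alg A \<in> algebras Sg"
  unfolding algebras_def mem_Collect_eq
proof (intro conjI allI ballI impI)
  assume A: "A \<in> obj CPO"
  note TA = T.F_obj[OF A] and TTA = T.F_obj[OF T.F_obj[OF A]]
  show "cpo_of (Alg A) \<in> obj CPO" using TA by simp
  fix n p assume p: "p \<in> Sg n"
  have "continuous_map (power_cpo (T A) n) (T A) (\<lambda>xs. \<mu> A (Tmap (Id_on (N n)) (T A) (as xs) p))"
  proof (rule continuous_mapI[OF cpo_power_cpo[OF CPO_cpo[OF TA]]])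
    show "\<mu> A (Tmap (Id_on (N n)) (T A) (as xs) p) \<in> Field (T A)" if "xs \<in> Field (power_cpo (T A) n)" for xs
      using that mult_app[OF A subst_app[OF TA, of p xs]] p unfolding field_power_cpo[OF CPO_cpo[OF TA]] by auto
    fix d xs assume d: "chain_join (power_cpo (T A) n) d xs"
    have l: "length (d k) = n" "set (d k) \<subseteq> Field (T A)" "length xs = n" "set xs \<subseteq> Field (T A)" for k
      using chain_joinD(1,2)[OF d] unfolding field_power_cpo[OF CPO_cpo[OF TA]] by auto
    have "chain_join (hom_cpo (Id_on (N n)) (T A)) (\<lambda>k. as (d k)) (as xs)"
    proof (rule T.compose_hom_chain[OF TA TA N_finite as_PiE[OF l(2,1)] as_PiE[OF l(4,3)]])
      fix z assume "z \<in> N n"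
      then obtain i where i: "i < n" "z = \<iota> i" by (rule N_E)
      then show "chain_join (T A) (\<lambda>k. as (d k) z) (as xs z)"
        using chain_join_powerD[OF CPO_cpo[OF TA] d i(1)] l by simp
    qed
    from T.F_chain_join[OF N_obj TA this] p
    have "chain_join (T (T A)) (\<lambda>k. Tmap (Id_on (N n)) (T A) (as (d k)) p) (Tmap (Id_on (N n)) (T A) (as xs) p)"
      unfolding Sg_def by blast
    from continuous_mapD(3)[OF cont_mapsD(1)[OF mult_map[OF A]] this]
    show "chain_join (T A) (\<lambda>k. \<mu> A (Tmap (Id_on (N n)) (T A) (as (d k)) p)) (\<mu> A (Tmap (Id_on (N n)) (T A) (as xs) p))" .
  qed
  then show "continuous_map (power_cpo (cpo_of (Alg A)) n) (cpo_of (Alg A)) (op_of (Alg A) p)"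
    unfolding Alg_cpo
    by (rule continuous_map_cong) (use p in \<open>auto simp: field_power_cpo[OF CPO_cpo[OF TA]] Alg_op\<close>)
qed (auto simp: Alg_def)

lemma Tmap_hom: "A \<in> obj CPO \<Longrightarrow> B \<in> obj CPO \<Longrightarrow> f \<in> cont_maps A B \<Longrightarrow> Tmap A B f \<in> homs Sg (Alg A) (Alg B)"
proof (rule homsI)
  assume A: "A \<in> obj CPO" and B: "B \<in> obj CPO" and f: "f \<in> cont_maps A B"
  note m = T.F_map[OF A B f]
  show "Tmap A B f \<in> cont_maps (cpo_of (Alg A)) (cpo_of (Alg B))" using m by simp
  fix p xs assume p: "p \<in> Sg (length xs)" and "set xs \<subseteq> Field (cpo_of (Alg A))"
  then have xs: "set xs \<subseteq> Field (T A)" by simp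
  have "set (map (Tmap A B f) xs) \<subseteq> Field (T B)" using xs cont_maps_app[OF m] by auto
  then show "Tmap A B f (op_of (Alg A) p xs) = op_of (Alg B) p (map (Tmap A B f) xs)"
    using p xs mult_nat[OF A B f subst_app[OF T.F_obj[OF A] p xs]] subst_map[OF T.F_obj[OF A] T.F_obj[OF B] p xs m]
    by (simp add: Alg_op)
qed

text \<open>Associativity of the monad read off at one operation symbol. It identifies the
  multiplication with the counit in \<open>Var_M_monad\<close>.\<close>

lemma mult_hom: "A \<in> obj CPO \<Longrightarrow> \<mu> A \<in> homs Sg (Alg (T A)) (Alg A)"
proof (rule homsI)
  assume A: "A \<in> obj CPO"
  note TA = T.F_obj[OF A] and TTA = T.F_obj[OF T.F_obj[OF A]]
  show "\<mu> A \<in> cont_maps (cpo_of (Alg (T A))) (cpo_of (Alg A))" using mult_map[OF A] by simp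
  fix p xs assume p: "p \<in> Sg (length xs)" and "set xs \<subseteq> Field (cpo_of (Alg (T A)))"
  then have xs: "set xs \<subseteq> Field (T (T A))" by simp
  have "set (map (\<mu> A) xs) \<subseteq> Field (T A)" using xs mult_app[OF A] by auto
  then show "\<mu> A (op_of (Alg (T A)) p xs) = op_of (Alg A) p (map (\<mu> A) xs)"
    using p xs mult_assoc[OF A subst_app[OF TTA p xs]] subst_map[OF TTA TA p xs mult_map[OF A]]
    by (simp add: Alg_op)
qed

text \<open>Taking everything valid in the free algebras puts these into the variety at once. What
  is then extracted from it are the laws for variables, substitution and joins of operation
  symbols.\<close>

definition Eqs :: "(('u, nat) xtrm \<times> ('u, nat) xtrm) set" where
  "Eqs = {e \<in> xtrms Sg \<times> xtrms Sg. \<forall>A\<in>obj CPO. satisfies (Alg A) e}"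

definition Var_M :: "'u variety" where
  "Var_M = \<lparr>sig = Sg, algs = {B \<in> algebras Sg. \<forall>e\<in>Eqs. satisfies B e}\<rparr>"

lemma Var_M_simps [simp]: "sig Var_M = Sg" "B \<in> algs Var_M \<longleftrightarrow> B \<in> algebras Sg \<and> (\<forall>e\<in>Eqs. satisfies B e)"
  by (auto simp: Var_M_def)

lemma Var_M_variety: "Var_M \<in> varieties"
  unfolding varieties_def
proof (intro CollectI conjI exI)
  show "is_signature (sig Var_M)" using Sg_signature by simp
  show "Eqs \<subseteq> xtrms (sig Var_M) \<times> xtrms (sig Var_M)" by (auto simp: Eqs_def)
  show "algs Var_M = {A \<in> algebras (sig Var_M). \<forall>e\<in>Eqs. satisfies A e}" by (simp add: Var_M_def)
qed

lemma Alg_algs: "A \<in> obj CPO \<Longrightarrow> Alg A \<in> algs Var_M"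
  using Alg_algebra by (auto simp: Eqs_def)

section \<open>Laws of the operations in every algebra of the variety\<close>

lemma algebra_nonempty:
  assumes "B \<in> algebras Sg" "p \<in> Sg (length ys)" "set ys \<subseteq> Field (cpo_of B)"
  shows "\<exists>b. b \<in> Field (cpo_of B)"
  using op_of_closed[OF assms] by blast

text \<open>\<open>satisfies\<close> speaks about assignments of all variables, so a list of
  arguments has to be continued by some default element. One exists even for the empty list, namely
  the value of the operation symbol \<open>p\<close>.\<close>

lemma assignment:
  assumes "B \<in> algebras Sg" "p \<in> Sg (length ys)" "set ys \<subseteq> Field (cpo_of B)"
  obtains f :: "nat \<Rightarrow> 'u" where "range f \<subseteq> Field (cpo_of B)" "map f [0..<length ys] = ys"
proof -
  obtain b where b: "b \<in> Field (cpo_of B)" using algebra_nonempty[OF assms] by blast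
  define f where "f i = (if i < length ys then ys ! i else b)" for i
  have "range f \<subseteq> Field (cpo_of B)" using assms(3) b by (auto simp: f_def)
  moreover have "map f [0..<length ys] = ys" by (rule nth_equalityI) (auto simp: f_def)
  ultimately show ?thesis using that by blast
qed

definition vars_op :: "'u \<Rightarrow> nat \<Rightarrow> ('u, nat) trm" where
  "vars_op p n = Op p (map Var [0..<n])"

lemma vars_op: "p \<in> Sg n \<Longrightarrow> vars_op p n \<in> trms Sg" "teval B f (vars_op p n) = op_of B p (map f [0..<n])"
  unfolding vars_op_def by (auto intro!: trms.intros simp: comp_def)

text \<open>A variable, regarded as an operation symbol, acts as a projection. In the free algebras
  this is naturality of the unit and a unit law.\<close>

lemma op_unit:
  assumes B: "B \<in> algs Var_M" and i: "i < length ys" and ys: "set ys \<subseteq> Field (cpo_of B)"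
  shows "op_of B (\<eta> (Id_on (N (length ys))) (\<iota> i)) ys = ys ! i"
proof -
  let ?n = "length ys" and ?p = "\<eta> (Id_on (N (length ys))) (\<iota> i)"
  have p: "?p \<in> Sg ?n" unfolding Sg_def by (rule unit_app) (use i in auto)
  let ?e = "(Trm (vars_op ?p ?n), Trm (Var i :: ('u, nat) trm))"
  have "satisfies (Alg A) ?e" if A: "A \<in> obj CPO" for A
    unfolding satisfies_def
  proof (intro allI impI)
    fix f :: "nat \<Rightarrow> 'u" assume "range f \<subseteq> Field (cpo_of (Alg A))"
    then have xs: "set (map f [0..<?n]) \<subseteq> Field (T A)" and fi: "f i \<in> Field (T A)" by auto
    have "Tmap (Id_on (N ?n)) (T A) (as (map f [0..<?n])) ?p = \<eta> (T A) (f i)"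
      using unit_nat[OF N_obj T.F_obj[OF A] _, of _ ?n "\<iota> i"] as_cont[OF T.F_obj[OF A] xs] i by simp
    then have "op_of (Alg A) ?p (map f [0..<?n]) = f i"
      using Alg_op[of ?p "map f [0..<?n]" A] p xs mult_unit(1)[OF A, of "f i"] i fi by auto
    then show "\<exists>x. xeval (Alg A) f (fst ?e) = Some x \<and> xeval (Alg A) f (snd ?e) = Some x"
      by (simp add: vars_op(2))
  qed
  then have "?e \<in> Eqs" unfolding Eqs_def using vars_op(1)[OF p] by (auto intro: xtrms.intros trms.intros)
  then have s: "satisfies B ?e" using B by simp
  have BA: "B \<in> algebras Sg" using B by simp
  obtain f :: "nat \<Rightarrow> 'u" where f: "range f \<subseteq> Field (cpo_of B)" "map f [0..<length ys] = ys"
    by (rule assignment[OF BA p ys])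
  have "op_of B ?p (map f [0..<?n]) = f i" using s f(1) unfolding satisfies_def by (simp add: vars_op(2))
  moreover have "f i = ys ! i" using f(2) i by (metis add_0 length_map length_upt minus_nat.diff_0 nth_map_upt)
  ultimately show ?thesis using f(2) by simp
qed

text \<open>Substitution of symbols into a symbol acts as composition of operations. In the free
  algebras this follows from naturality of the multiplication and associativity.\<close>

lemma op_subst:
  assumes B: "B \<in> algs Var_M" and p: "p \<in> Sg (length qs)" and qs: "set qs \<subseteq> Sg (length ys)"
    and ys: "set ys \<subseteq> Field (cpo_of B)"
  shows "op_of B (\<mu> (Id_on (N (length ys))) (Tmap (Id_on (N (length qs))) (T (Id_on (N (length ys)))) (as qs) p)) ys
    = op_of B p (map (\<lambda>q. op_of B q ys) qs)"
proof -
  let ?m = "length ys" and ?n = "length qs"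
  let ?r = "\<mu> (Id_on (N ?m)) (Tmap (Id_on (N ?n)) (T (Id_on (N ?m))) (as qs) p)"
  have qsT: "set qs \<subseteq> Field (T (Id_on (N ?m)))" using qs unfolding Sg_def by simp
  have sp: "Tmap (Id_on (N ?n)) (T (Id_on (N ?m))) (as qs) p \<in> Field (T (T (Id_on (N ?m))))"
    by (rule subst_app[OF T.F_obj[OF N_obj] p qsT])
  have r: "?r \<in> Sg ?m" unfolding Sg_def by (rule mult_app[OF N_obj sp])
  let ?e = "(Trm (vars_op ?r ?m), Trm (Op p (map (\<lambda>q. vars_op q ?m) qs)))"
  have "satisfies (Alg A) ?e" if A: "A \<in> obj CPO" for A
    unfolding satisfies_def
  proof (intro allI impI)
    fix f :: "nat \<Rightarrow> 'u" assume "range f \<subseteq> Field (cpo_of (Alg A))"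
    then have xs: "set (map f [0..<?m]) \<subseteq> Field (T A)" by auto
    note TA = T.F_obj[OF A] and TTA = T.F_obj[OF T.F_obj[OF A]]
    let ?a = "as (map f [0..<?m])" and ?K = "Id_on (N ?m)"
    have a: "?a \<in> cont_maps ?K (T A)" using as_cont[OF TA xs] by simp
    have Ta: "Tmap ?K (T A) ?a \<in> cont_maps (T ?K) (T (T A))" by (rule T.F_map[OF N_obj TA a])
    have k: "compose (Field (T ?K)) (\<mu> A) (Tmap ?K (T A) ?a) \<in> cont_maps (T ?K) (T A)"
      by (rule cont_maps_compose[OF Ta mult_map[OF A]])
    have q: "op_of (Alg A) q (map f [0..<?m]) = compose (Field (T ?K)) (\<mu> A) (Tmap ?K (T A) ?a) q" if "q \<in> set qs" for q
      using Alg_op[of q "map f [0..<?m]" A] that qs qsT xs by (auto simp: compose_def)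
    have "op_of (Alg A) ?r (map f [0..<?m]) = \<mu> A (Tmap ?K (T A) ?a ?r)"
      using Alg_op[of ?r "map f [0..<?m]" A] r xs by simp
    also have "Tmap ?K (T A) ?a ?r = \<mu> (T A) (Tmap (T ?K) (T (T A)) (Tmap ?K (T A) ?a) (Tmap (Id_on (N ?n)) (T ?K) (as qs) p))"
      by (rule mult_nat[OF N_obj TA a sp])
    also have "\<mu> A \<dots> = \<mu> A (Tmap (T (T A)) (T A) (\<mu> A) (Tmap (T ?K) (T (T A)) (Tmap ?K (T A) ?a) (Tmap (Id_on (N ?n)) (T ?K) (as qs) p)))"
      by (rule mult_assoc[OF A T.F_app[OF T.F_obj[OF N_obj] TTA Ta sp]])
    also have "Tmap (T (T A)) (T A) (\<mu> A) (Tmap (T ?K) (T (T A)) (Tmap ?K (T A) ?a) (Tmap (Id_on (N ?n)) (T ?K) (as qs) p))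
      = Tmap (T ?K) (T A) (compose (Field (T ?K)) (\<mu> A) (Tmap ?K (T A) ?a)) (Tmap (Id_on (N ?n)) (T ?K) (as qs) p)"
      by (rule T.F_comp[OF T.F_obj[OF N_obj] TTA TA Ta mult_map[OF A] sp])
    also have "\<dots> = Tmap (Id_on (N ?n)) (T A) (as (map (compose (Field (T ?K)) (\<mu> A) (Tmap ?K (T A) ?a)) qs)) p"
      by (rule subst_map[OF T.F_obj[OF N_obj] TA p qsT k])
    also have "map (compose (Field (T ?K)) (\<mu> A) (Tmap ?K (T A) ?a)) qs = map (\<lambda>q. op_of (Alg A) q (map f [0..<?m])) qs"
      using q by auto
    finally have "op_of (Alg A) ?r (map f [0..<?m]) = \<mu> A (Tmap (Id_on (N ?n)) (T A) (as (map (\<lambda>q. op_of (Alg A) q (map f [0..<?m])) qs)) p)" .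
    moreover have "set (map (\<lambda>q. op_of (Alg A) q (map f [0..<?m])) qs) \<subseteq> Field (T A)"
      using op_of_closed[OF Alg_algebra[OF A], of _ "map f [0..<?m]"] qs xs by auto
    ultimately have "op_of (Alg A) ?r (map f [0..<?m]) = op_of (Alg A) p (map (\<lambda>q. op_of (Alg A) q (map f [0..<?m])) qs)"
      using Alg_op[of p "map (\<lambda>q. op_of (Alg A) q (map f [0..<?m])) qs" A] p by simp
    then show "\<exists>x. xeval (Alg A) f (fst ?e) = Some x \<and> xeval (Alg A) f (snd ?e) = Some x"
      by (simp add: vars_op(2) comp_def)
  qed
  moreover have "Op p (map (\<lambda>q. vars_op q ?m) qs) \<in> trms Sg"
    by (rule trms.Op) (use p qs vars_op(1) in auto)
  ultimately have "?e \<in> Eqs" unfolding Eqs_def using vars_op(1)[OF r] by (auto intro: xtrms.intros)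
  then have s: "satisfies B ?e" using B by simp
  have BA: "B \<in> algebras Sg" using B by simp
  obtain f :: "nat \<Rightarrow> 'u" where f: "range f \<subseteq> Field (cpo_of B)" "map f [0..<length ys] = ys"
    by (rule assignment[OF BA r ys])
  have "op_of B ?r (map f [0..<?m]) = op_of B p (map (\<lambda>q. op_of B q (map f [0..<?m])) qs)"
    using s f(1) unfolding satisfies_def by (simp add: vars_op(2) comp_def)
  then show ?thesis using f(2) by simp
qed

text \<open>Here a formal join enters: the equation states that the symbol \<open>p\<close> is the
  join of the \<open>c k\<close>. Its satisfaction includes definedness, so the values are known to
  form a chain. Only \<open>length ys\<close> variables occur, as required of an extended
  term.\<close>

lemma op_chain:
  assumes B: "B \<in> algs Var_M" and c: "chain_join (T (Id_on (N (length ys)))) c p"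
    and ys: "set ys \<subseteq> Field (cpo_of B)"
  shows "chain_join (cpo_of B) (\<lambda>k. op_of B (c k) ys) (op_of B p ys)"
proof -
  let ?n = "length ys"
  have p: "c k \<in> Sg ?n" "p \<in> Sg ?n" for k using chain_joinD(1,2)[OF c] unfolding Sg_def by auto
  let ?e = "(Join (\<lambda>k. Trm (vars_op (c k) ?n)), Trm (vars_op p ?n))"
  have "satisfies (Alg A) ?e" if A: "A \<in> obj CPO" for A
    unfolding satisfies_def
  proof (intro allI impI)
    fix f :: "nat \<Rightarrow> 'u" assume "range f \<subseteq> Field (cpo_of (Alg A))"
    then have xs: "set (map f [0..<?n]) \<subseteq> Field (T A)" by auto
    note TA = T.F_obj[OF A]
    have a: "as (map f [0..<?n]) \<in> cont_maps (Id_on (N ?n)) (T A)" using as_cont[OF TA xs] by simp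
    have "chain_join (T A) (\<lambda>k. \<mu> A (Tmap (Id_on (N ?n)) (T A) (as (map f [0..<?n])) (c k)))
        (\<mu> A (Tmap (Id_on (N ?n)) (T A) (as (map f [0..<?n])) p))"
      by (rule continuous_mapD(3)[OF cont_mapsD(1)[OF mult_map[OF A]]
          continuous_mapD(3)[OF cont_mapsD(1)[OF T.F_map[OF N_obj TA a]] c]])
    then have "chain_join (T A) (\<lambda>k. op_of (Alg A) (c k) (map f [0..<?n])) (op_of (Alg A) p (map f [0..<?n]))"
      using Alg_op[of _ "map f [0..<?n]" A] p xs by simp
    then have "xeval (Alg A) f (Join (\<lambda>k. Trm (vars_op (c k) ?n))) = Some (op_of (Alg A) p (map f [0..<?n]))"
      using xeval_Join[OF algebrasD(1)[OF Alg_algebra[OF A]], of f "\<lambda>k. Trm (vars_op (c k) ?n)"]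
      by (auto simp del: xeval.simps(2) simp: vars_op(2))
    then show "\<exists>x. xeval (Alg A) f (fst ?e) = Some x \<and> xeval (Alg A) f (snd ?e) = Some x"
      by (simp del: xeval.simps(2) add: vars_op(2))
  qed
  moreover have "Join (\<lambda>k. Trm (vars_op (c k) ?n)) \<in> xtrms Sg"
  proof (rule xtrms.Join)
    show "Trm (vars_op (c k) ?n) \<in> xtrms Sg" for k using vars_op(1)[OF p(1)] by (rule xtrms.Trm)
    show "finite (\<Union>k. xvars (Trm (vars_op (c k) ?n)))"
      by (rule finite_subset[of _ "{..<?n}"]) (auto simp: vars_op_def)
  qed
  ultimately have "?e \<in> Eqs" unfolding Eqs_def using vars_op(1)[OF p(2)] by (auto intro: xtrms.intros)
  then have s: "satisfies B ?e" using B by simp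
  have BA: "B \<in> algebras Sg" using B by simp
  obtain f :: "nat \<Rightarrow> 'u" where f: "range f \<subseteq> Field (cpo_of B)" "map f [0..<length ys] = ys"
    by (rule assignment[OF BA p(2) ys])
  have "xeval B f (Join (\<lambda>k. Trm (vars_op (c k) ?n))) = Some (op_of B p ys)"
    using s f unfolding satisfies_def by (auto simp del: xeval.simps(2) simp: vars_op(2))
  then show ?thesis unfolding xeval_Join[OF algebrasD(1)[OF BA]] using f(2) by (auto simp: vars_op(2))
qed

text \<open>Renaming variables along \<open>u\<close> is the substitution of variables for
  variables, hence a case of \<open>op_subst\<close> and \<open>op_unit\<close>.\<close>

lemma op_rename:
  assumes B: "B \<in> algs Var_M" and p: "p \<in> Sg n" and u: "u \<in> N n \<rightarrow>\<^sub>E N (length ys)"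
    and ys: "set ys \<subseteq> Field (cpo_of B)"
  shows "op_of B (Tmap (Id_on (N n)) (Id_on (N (length ys))) u p) ys = op_of B p (map (\<lambda>i. as ys (u (\<iota> i))) [0..<n])"
proof -
  let ?K = "Id_on (N (length ys))"
  define qs where "qs = map (\<lambda>i. \<eta> ?K (u (\<iota> i))) [0..<n]"
  have uF: "u (\<iota> i) \<in> N (length ys)" if "i < n" for i using u that by (auto simp: PiE_iff)
  have qs: "length qs = n" "set qs \<subseteq> Field (T ?K)" unfolding qs_def using uF unit_app[OF N_obj] by auto
  have uc: "u \<in> cont_maps (Id_on (N n)) ?K" using u T.disc_maps[OF N_finite N_obj] by simp
  have pT: "p \<in> Field (T (Id_on (N n)))" using p by (simp add: Sg_def)
  have asq: "compose (N n) (\<eta> ?K) u = as qs"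
    by (rule as_eqI) (auto simp: qs(1), simp add: qs_def compose_def)
  have "Tmap (Id_on (N n)) ?K u p = \<mu> ?K (Tmap ?K (T ?K) (\<eta> ?K) (Tmap (Id_on (N n)) ?K u p))"
    using mult_unit(2)[OF N_obj T.F_app[OF N_obj N_obj uc pT]] by simp
  also have "Tmap ?K (T ?K) (\<eta> ?K) (Tmap (Id_on (N n)) ?K u p) = Tmap (Id_on (N n)) (T ?K) (as qs) p"
    using T.F_comp[OF N_obj N_obj T.F_obj[OF N_obj] uc unit_map[OF N_obj] pT] asq by simp
  finally have "op_of B (Tmap (Id_on (N n)) ?K u p) ys = op_of B p (map (\<lambda>q. op_of B q ys) qs)"
    using op_subst[OF B, of p qs ys] p qs ys by (simp add: Sg_def)
  also have "map (\<lambda>q. op_of B q ys) qs = map (\<lambda>i. as ys (u (\<iota> i))) [0..<n]"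
  proof -
    have "op_of B (\<eta> ?K (u (\<iota> i))) ys = as ys (u (\<iota> i))" if "i < n" for i
    proof -
      have "u (\<iota> i) \<in> N (length ys)" by (rule uF[OF that])
      then obtain j where "j < length ys" "u (\<iota> i) = \<iota> j" by (rule N_E)
      then show ?thesis using op_unit[OF B _ ys] by simp
    qed
    then show ?thesis unfolding qs_def by simp
  qed
  finally show ?thesis .
qed

section \<open>Operations indexed by arbitrary finite subsets of the universe\<close>

definition enum :: "'u set \<Rightarrow> 'u list" where
  "enum Z = (SOME zs. set zs = Z)"

text \<open>A chosen position of each element in the enumeration. The enumeration may contain
  repetitions; \<open>as_num\<close> only uses that the chosen position holds the right
  element.\<close>

definition num :: "'u set \<Rightarrow> 'u \<Rightarrow> 'u" where
  "num Z = (\<lambda>z\<in>Z. \<iota> (SOME i. i < length (enum Z) \<and> enum Z ! i = z))"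

lemma enum: "finite Z \<Longrightarrow> set (enum Z) = Z"
  unfolding enum_def by (rule someI_ex[OF finite_list])

lemma num:
  assumes "finite Z" "z \<in> Z"
  obtains i where "i < length (enum Z)" "enum Z ! i = z" "num Z z = \<iota> i"
proof -
  have "\<exists>i. i < length (enum Z) \<and> enum Z ! i = z" using assms enum[OF assms(1)] by (metis in_set_conv_nth)
  from someI_ex[OF this] show ?thesis
    by (intro that[of "SOME i. i < length (enum Z) \<and> enum Z ! i = z"]) (use assms(2) in \<open>auto simp: num_def\<close>)
qed

lemma num_PiE: "finite Z \<Longrightarrow> num Z \<in> Z \<rightarrow>\<^sub>E N (length (enum Z))"
proof (rule PiE_I)
  fix z assume "finite Z" "z \<in> Z"
  then obtain i where "i < length (enum Z)" "num Z z = \<iota> i" by (metis num)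
  then show "num Z z \<in> N (length (enum Z))" by simp
qed (simp add: num_def)

lemma as_num: "finite Z \<Longrightarrow> z \<in> Z \<Longrightarrow> as (map g (enum Z)) (num Z z) = g z"
  by (rule num[of Z z]) auto

text \<open>The value of \<open>t\<close>, a symbol in the variables \<open>Z\<close>, under the
  assignment \<open>k\<close> of these variables in \<open>B\<close>. The numbering only serves to
  express it by an actual operation symbol.\<close>

definition opZ :: "'u calg \<Rightarrow> 'u set \<Rightarrow> ('u \<Rightarrow> 'u) \<Rightarrow> 'u \<Rightarrow> 'u" where
  "opZ B Z k t = op_of B (Tmap (Id_on Z) (Id_on (N (length (enum Z)))) (num Z) t) (map k (enum Z))"

lemma num_app: "finite Z \<Longrightarrow> t \<in> Field (T (Id_on Z)) \<Longrightarrow>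
    Tmap (Id_on Z) (Id_on (N (length (enum Z)))) (num Z) t \<in> Sg (length (enum Z))"
  unfolding Sg_def by (rule T.disc_app[OF _ N_finite num_PiE])

lemma num_cont: "finite Z \<Longrightarrow> num Z \<in> cont_maps (Id_on Z) (Id_on (N (length (enum Z))))"
  using num_PiE T.disc_maps[of Z "Id_on (N (length (enum Z)))"] by simp

lemma opZ_mem: "B \<in> algs Var_M \<Longrightarrow> finite Z \<Longrightarrow> k ` Z \<subseteq> Field (cpo_of B) \<Longrightarrow> t \<in> Field (T (Id_on Z)) \<Longrightarrow>
    opZ B Z k t \<in> Field (cpo_of B)"
  unfolding opZ_def by (rule op_of_closed[of B Sg]) (use num_app enum in auto)

lemma opZ_unit: "B \<in> algs Var_M \<Longrightarrow> finite Z \<Longrightarrow> k ` Z \<subseteq> Field (cpo_of B) \<Longrightarrow> z \<in> Z \<Longrightarrow>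
    opZ B Z k (\<eta> (Id_on Z) z) = k z"
proof -
  assume B: "B \<in> algs Var_M" and Z: "finite Z" and k: "k ` Z \<subseteq> Field (cpo_of B)" and z: "z \<in> Z"
  obtain i where i: "i < length (enum Z)" "enum Z ! i = z" "num Z z = \<iota> i" by (rule num[OF Z z])
  have "Tmap (Id_on Z) (Id_on (N (length (enum Z)))) (num Z) (\<eta> (Id_on Z) z) = \<eta> (Id_on (N (length (enum Z)))) (\<iota> i)"
    using unit_nat[OF T.disc_obj[OF Z] N_obj num_cont[OF Z], of z] z i(3) by simp
  then show ?thesis unfolding opZ_def
    using op_unit[OF B, of i "map k (enum Z)"] i k enum[OF Z] by simp
qed

lemma opZ_nat:
  assumes B: "B \<in> algs Var_M" and Z: "finite Z" "finite W" and k: "k ` Z \<subseteq> Field (cpo_of B)"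
    and v: "v \<in> W \<rightarrow>\<^sub>E Z" and t: "t \<in> Field (T (Id_on W))"
  shows "opZ B Z k (Tmap (Id_on W) (Id_on Z) v t) = opZ B W (\<lambda>w. k (v w)) t"
proof -
  let ?n = "length (enum W)" and ?m = "length (enum Z)"
  \<comment> \<open>A position in the enumeration of \<open>W\<close> is sent to the number of the
    image of its element under \<open>v\<close>. This makes the square with the two numberings
    commute.\<close>
  define u where "u = as (map (\<lambda>w. num Z (v w)) (enum W))"
  have vF: "v w \<in> Z" if "w \<in> W" for w using v that by auto
  have "set (map (\<lambda>w. num Z (v w)) (enum W)) \<subseteq> N ?m"
    using enum[OF Z(2)] vF num_PiE[OF Z(1)] by auto
  then have u: "u \<in> N ?n \<rightarrow>\<^sub>E N ?m" unfolding u_def by (rule as_PiE) simp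
  have "compose W (num Z) v = compose W u (num W)"
    unfolding u_def using as_num[OF Z(2)] by (auto simp: compose_def fun_eq_iff)
  then have e: "Tmap (Id_on Z) (Id_on (N ?m)) (num Z) (Tmap (Id_on W) (Id_on Z) v t)
      = Tmap (Id_on (N ?n)) (Id_on (N ?m)) u (Tmap (Id_on W) (Id_on (N ?n)) (num W) t)"
    using T.disc_comp[OF Z(2,1) N_obj v _ t, of "num Z" ?m] T.disc_comp[OF Z(2) N_finite N_obj num_PiE[OF Z(2)] _ t, of u ?m]
      num_PiE[OF Z(1)] u by simp
  have "opZ B Z k (Tmap (Id_on W) (Id_on Z) v t) =
      op_of B (Tmap (Id_on W) (Id_on (N ?n)) (num W) t) (map (\<lambda>i. as (map k (enum Z)) (u (\<iota> i))) [0..<?n])"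
    unfolding opZ_def e using op_rename[OF B num_app[OF Z(2) t], of u "map k (enum Z)"] u k enum[OF Z(1)] by simp
  also have "map (\<lambda>i. as (map k (enum Z)) (u (\<iota> i))) [0..<?n] = map (\<lambda>w. k (v w)) (enum W)"
  proof (rule nth_equalityI)
    fix i assume "i < length (map (\<lambda>i. as (map k (enum Z)) (u (\<iota> i))) [0..<?n])"
    then have i: "i < ?n" by simp
    then have "enum W ! i \<in> W" using enum[OF Z(2)] nth_mem by blast
    then show "map (\<lambda>i. as (map k (enum Z)) (u (\<iota> i))) [0..<?n] ! i = map (\<lambda>w. k (v w)) (enum W) ! i"
      using i as_num[OF Z(1) vF, of "enum W ! i" k] by (simp add: u_def)
  qed simp
  finally show ?thesis unfolding opZ_def .
qed

text \<open>For a fixed assignment, evaluation is a homomorphism from the free algebra on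
  \<open>Z\<close> to \<open>B\<close>, written out with \<open>op_subst\<close>.\<close>

lemma opZ_subst:
  assumes B: "B \<in> algs Var_M" and Z: "finite Z" and k: "k ` Z \<subseteq> Field (cpo_of B)"
    and p: "p \<in> Sg (length ss)" and ss: "set ss \<subseteq> Field (T (Id_on Z))"
  shows "opZ B Z k (\<mu> (Id_on Z) (Tmap (Id_on (N (length ss))) (T (Id_on Z)) (as ss) p)) = op_of B p (map (opZ B Z k) ss)"
proof -
  let ?m = "length (enum Z)" and ?D = "Id_on Z"
  let ?K = "Id_on (N ?m)" and ?b = "num Z"
  note D = T.disc_obj[OF Z]
  note b = num_cont[OF Z] and Tb = T.F_map[OF D N_obj num_cont[OF Z]]
  have "Tmap ?D ?K ?b (\<mu> ?D (Tmap (Id_on (N (length ss))) (T ?D) (as ss) p))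
      = \<mu> ?K (Tmap (T ?D) (T ?K) (Tmap ?D ?K ?b) (Tmap (Id_on (N (length ss))) (T ?D) (as ss) p))"
    by (rule mult_nat[OF D N_obj b subst_app[OF T.F_obj[OF D] p ss]])
  also have "Tmap (T ?D) (T ?K) (Tmap ?D ?K ?b) (Tmap (Id_on (N (length ss))) (T ?D) (as ss) p)
      = Tmap (Id_on (N (length ss))) (T ?K) (as (map (Tmap ?D ?K ?b) ss)) p"
    by (rule subst_map[OF T.F_obj[OF D] T.F_obj[OF N_obj] p ss Tb])
  finally have e: "Tmap ?D ?K ?b (\<mu> ?D (Tmap (Id_on (N (length ss))) (T ?D) (as ss) p)) =
      \<mu> ?K (Tmap (Id_on (N (length ss))) (T ?K) (as (map (Tmap ?D ?K ?b) ss)) p)" .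
  have "set (map (Tmap ?D ?K ?b) ss) \<subseteq> Sg ?m" using num_app[OF Z] ss by auto
  then show ?thesis unfolding opZ_def e
    using op_subst[OF B, of p "map (Tmap ?D ?K ?b) ss" "map k (enum Z)"] p k enum[OF Z] by (simp add: comp_def opZ_def)
qed

text \<open>Each generator of the presented cpo is the value of an operation symbol at units, by the
  unit law for the map induced by \<open>\<eta>\<close>. Hence homomorphisms from
  \<open>Alg A\<close> are determined on units.\<close>

lemma leaf_op:
  assumes A: "A \<in> obj CPO" and X: "finite X" "X \<subseteq> Field A" and t: "t \<in> Field (T (Id_on X))"
  shows "Tmap (Id_on X) A (incl X) t = opZ (Alg A) X (\<eta> A) t"
proof -
  let ?n = "length (enum X)" and ?ys = "map (\<eta> A) (enum X)"
  let ?K = "Id_on (N ?n)"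
  note TA = T.F_obj[OF A] and i = T.incl_map[OF X(1) A X(2)]
  have ys: "set ?ys \<subseteq> Field (T A)" using enum[OF X(1)] X(2) unit_app[OF A] by auto
  have a: "as ?ys \<in> N ?n \<rightarrow>\<^sub>E Field (T A)" by (rule as_PiE[OF ys]) simp
  have "compose X (as ?ys) (num X) = compose X (\<eta> A) (incl X)"
    using as_num[OF X(1)] by (auto simp: compose_def fun_eq_iff)
  then have e: "Tmap ?K (T A) (as ?ys) (Tmap (Id_on X) ?K (num X) t) = Tmap A (T A) (\<eta> A) (Tmap (Id_on X) A (incl X) t)"
    using T.disc_comp[OF X(1) N_finite TA num_PiE[OF X(1)] a t] T.F_comp[OF T.disc_obj[OF X(1)] A TA i unit_map[OF A] t] by simp
  show ?thesis unfolding opZ_def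
    using Alg_op[of _ ?ys A] num_app[OF X(1) t] ys e mult_unit(2)[OF A T.F_app[OF T.disc_obj[OF X(1)] A i t]] by simp
qed

text \<open>Strong finitarity supplies the extension: on a generator it evaluates the symbol
  \<open>t\<close> in \<open>B\<close>. The relations hold by \<open>op_chain\<close>, by
  \<open>opZ_nat\<close> and by continuity of the operations of \<open>B\<close>. The homomorphism
  law is checked on generators, and uniqueness rests on \<open>leaf_op\<close>.\<close>

lemma Alg_free:
  assumes A: "A \<in> obj CPO"
  shows "free_on Var_M A (Alg A) (\<eta> A)"
  unfolding free_on_def
proof (intro conjI ballI)
  show "Alg A \<in> algs Var_M" by (rule Alg_algs[OF A])
  show "\<eta> A \<in> cont_maps A (cpo_of (Alg A))" using unit_map[OF A] by simp
  note TA = T.F_obj[OF A] and free = pointwise[OF A]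
  fix B f assume B: "B \<in> algs Var_M" and f: "f \<in> cont_maps A (cpo_of B)"
  have BA: "B \<in> algebras Sg" using B by simp
  note Bo = algebrasD(3)[OF BA] and Bc = algebrasD(1)[OF BA]
  let ?l = "\<lambda>Z u t. opZ B Z (\<lambda>z. f (u z)) t"
  have fu: "(\<lambda>z. f (u z)) ` Z \<subseteq> Field (cpo_of B)" if "u \<in> Z \<rightarrow>\<^sub>E Field A" for u Z
    using that cont_maps_app[OF f] by auto
  have 1: "?l Z u t \<in> Field (cpo_of B)" if "finite Z" "u \<in> Z \<rightarrow>\<^sub>E Field A" "t \<in> Field (T (Id_on Z))" for Z u t
    by (rule opZ_mem[OF B that(1) fu[OF that(2)] that(3)])
  have 2: "?l Z u (Tmap (Id_on W) (Id_on Z) v t) = ?l W (compose W u v) t"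
    if "finite Z" "finite W" "u \<in> Z \<rightarrow>\<^sub>E Field A" "v \<in> W \<rightarrow>\<^sub>E Z" "t \<in> Field (T (Id_on W))" for Z W u v t
  proof -
    have "map (\<lambda>w. f (u (v w))) (enum W) = map (\<lambda>w. f (compose W u v w)) (enum W)"
      using enum[OF that(2)] by (auto simp: compose_def)
    then show ?thesis using opZ_nat[OF B that(1,2) fu[OF that(3)] that(4,5)] unfolding opZ_def by (simp only:)
  qed
  have 3: "chain_join (cpo_of B) (\<lambda>m. ?l Z u (c m)) (?l Z u t)"
    if "finite Z" "u \<in> Z \<rightarrow>\<^sub>E Field A" "chain_join (T (Id_on Z)) c t" for Z u c t
    unfolding opZ_def
    by (rule op_chain[OF B]) (use continuous_mapD(3)[OF cont_mapsD(1)[OF T.F_map[OF T.disc_obj[OF that(1)] N_obj num_cont[OF that(1)]]] that(3)]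
      fu[OF that(2)] enum[OF that(1)] in auto)
  have 4: "chain_join (cpo_of B) (\<lambda>m. ?l Z (a m) t) (?l Z b t)"
    if Z: "finite Z" "\<And>m. a m \<in> Z \<rightarrow>\<^sub>E Field A" "b \<in> Z \<rightarrow>\<^sub>E Field A" "chain_join (hom_cpo (Id_on Z) A) a b"
      "t \<in> Field (T (Id_on Z))" for Z a b t
  proof -
    have "chain_join (power_cpo (cpo_of B) (length (enum Z))) (\<lambda>m. map (\<lambda>z. f (a m z)) (enum Z)) (map (\<lambda>z. f (b z)) (enum Z))"
    proof (rule chain_join_powerI)
      fix i assume i: "i < length (enum Z)"
      then have "enum Z ! i \<in> Z" using enum[OF Z(1)] nth_mem by blast
      from continuous_mapD(3)[OF cont_mapsD(1)[OF f] T.hom_disc_chain(3)[OF A Z(1,4) this]] i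
      show "chain_join (cpo_of B) (\<lambda>m. map (\<lambda>z. f (a m z)) (enum Z) ! i) (map (\<lambda>z. f (b z)) (enum Z) ! i)" by simp
    qed auto
    from continuous_mapD(3)[OF algebrasD(4)[OF BA num_app[OF Z(1,5)]] this]
    show ?thesis unfolding opZ_def .
  qed
  note C = T.cocone_leafI[of A "cpo_of B" ?l, OF A Bo 1 2 3 4]
  obtain h where h: "h \<in> cont_maps (T A) (cpo_of B)"
    "\<And>Z u t. finite Z \<Longrightarrow> u \<in> Z \<rightarrow>\<^sub>E Field A \<Longrightarrow> t \<in> Field (T (Id_on Z)) \<Longrightarrow>
      h (T.leaf (can (endo M) A) Z u t) = T.leaf (\<lambda>(X, t). ?l X (incl X) t) Z u t"
    by (rule T.lan_ext[OF free C(1)]) auto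
  have hl: "h (Tmap (Id_on Z) A u t) = ?l Z u t"
    if "finite Z" "u \<in> Z \<rightarrow>\<^sub>E Field A" "t \<in> Field (T (Id_on Z))" for Z u t
    using h(2)[OF that] T.can_cocone(2)[OF A that] that by (simp add: C(2))
  have h\<eta>: "h (\<eta> A x) = f x" if x: "x \<in> Field A" for x
  proof -
    have i: "incl {x} \<in> {x} \<rightarrow>\<^sub>E Field A" using x by (auto simp: incl_def)
    have "\<eta> A x = Tmap (Id_on {x}) A (incl {x}) (\<eta> (Id_on {x}) x)"
      using unit_nat[OF T.disc_obj A, of "{x}" "incl {x}" x] i T.disc_maps[of "{x}" A] A by simp
    then show ?thesis
      using hl[OF _ i unit_app[OF T.disc_obj], of x] opZ_unit[OF B _ fu[OF i], of x] by simp
  qed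
  have hh: "h \<in> homs Sg (Alg A) B"
  proof (rule homsI)
    show hA: "h \<in> cont_maps (cpo_of (Alg A)) (cpo_of B)" using h(1) by simp
    fix p xs assume p: "p \<in> Sg (length xs)" and xs: "set xs \<subseteq> Field (cpo_of (Alg A))"
    let ?n = "length xs"
    let ?P = "power_cpo (T A) ?n" and ?G = "can (endo M) A ` lan_gens (endo M) A"
    note Tc = CPO_cpo[OF TA]
    have c1: "continuous_map ?P (cpo_of B) (\<lambda>ys. h (op_of (Alg A) p ys))"
      using continuous_map_comp[OF algebrasD(4)[OF Alg_algebra[OF A] p] cont_mapsD(1)[OF hA]] by simp
    have c2: "continuous_map ?P (power_cpo (cpo_of B) ?n) (map h)"
      by (rule continuous_map_map[OF Tc Bc cont_mapsD(1)[OF h(1)]])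
    have c3: "continuous_map ?P (cpo_of B) (\<lambda>ys. op_of B p (map h ys))"
      by (rule continuous_map_comp[OF c2 algebrasD(4)[OF BA p]])
    have xP: "xs \<in> Field ?P" using xs unfolding field_power_cpo[OF Tc] by simp
    show "h (op_of (Alg A) p xs) = op_of B p (map h xs)"
    proof (rule join_denseD[OF join_dense_power[OF Tc free_cpoD(5,6)[OF free]] xP])
      show "join_closed ?P {ys \<in> Field ?P. h (op_of (Alg A) p ys) = op_of B p (map h ys)}"
        by (rule join_closed_eq[OF cpo_power_cpo[OF Tc] Bc c1 c3])
      show "{ys. length ys = ?n \<and> set ys \<subseteq> ?G} \<subseteq> Field ?P"
        using free_cpoD(6)[OF free] unfolding field_power_cpo[OF Tc] by auto
      fix ys assume "ys \<in> {ys. length ys = ?n \<and> set ys \<subseteq> ?G}"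
      then have "ys \<in> lists ?G" "length ys = ?n" by auto
      then obtain gs where "ys = map (can (endo M) A) gs" "gs \<in> lists (lan_gens (endo M) A)" unfolding lists_image by blast
      then have gs: "ys = map (can (endo M) A) gs" "set gs \<subseteq> lan_gens (endo M) A" "length gs = ?n" using \<open>length ys = ?n\<close> by auto
      \<comment> \<open>One finite set containing the supports of all arguments. Over it the
        operation is a substitution in the free algebra on \<open>R\<close>, which
        \<open>opZ_subst\<close> evaluates in \<open>B\<close>.\<close>
      define R where "R = (\<Union>s\<in>set gs. fst s)"
      have m: "finite (fst s)" "fst s \<subseteq> Field A" "snd s \<in> Field (T (Id_on (fst s)))" "fst s \<subseteq> R" if "s \<in> set gs" for s
      proof -
        have "(fst s, snd s) \<in> lan_gens (endo M) A" using that gs(2) by auto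
        then show "finite (fst s)" "fst s \<subseteq> Field A" "snd s \<in> Field (T (Id_on (fst s)))"
          unfolding lan_gens_def by auto
        show "fst s \<subseteq> R" using that unfolding R_def by blast
      qed
      have R: "finite R" "R \<subseteq> Field A"
        unfolding R_def using m(1) by (auto simp del: UN_simps intro!: UN_least[OF m(2)])
      note D = T.disc_obj[OF R(1)] and i = T.incl_map[OF R(1) A R(2)]
      have iR: "incl R \<in> R \<rightarrow>\<^sub>E Field A" using R(2) by (auto simp: incl_def)
      define ss where "ss = map (\<lambda>s. Tmap (Id_on (fst s)) (Id_on R) (incl (fst s)) (snd s)) gs"
      have ss: "length ss = ?n" "set ss \<subseteq> Field (T (Id_on R))"
        unfolding ss_def using gs(3) T.disc_app[OF m(1) R(1) incl_PiE[OF m(4)] m(3)] by auto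
      have ys: "ys = map (Tmap (Id_on R) A (incl R)) ss"
      proof -
        have "Tmap (Id_on R) A (incl R) (Tmap (Id_on (fst s)) (Id_on R) (incl (fst s)) (snd s)) = can (endo M) A s" if s: "s \<in> set gs" for s
        proof -
          show ?thesis
            using T.disc_comp[OF m(1)[OF s] R(1) A incl_PiE[OF m(4)[OF s]] iR m(3)[OF s]] incl_comp[OF m(4)[OF s]]
            by (simp add: can_def case_prod_beta)
        qed
        then show ?thesis unfolding gs(1) ss_def by simp
      qed
      have ysT: "set ys \<subseteq> Field (T A)" unfolding ys using ss(2) T.F_app[OF D A i] by auto
      have p': "p \<in> Sg (length ss)" using p ss(1) by simp
      have "op_of (Alg A) p ys = Tmap (Id_on R) A (incl R) (op_of (Alg (Id_on R)) p ss)"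
        unfolding ys using homsD(4)[OF Tmap_hom[OF D A i] p'] ss(2) by simp
      also have "op_of (Alg (Id_on R)) p ss = \<mu> (Id_on R) (Tmap (Id_on (N (length ss))) (T (Id_on R)) (as ss) p)"
        by (rule Alg_op[OF p' ss(2)])
      finally have "h (op_of (Alg A) p ys) = ?l R (incl R) (\<mu> (Id_on R) (Tmap (Id_on (N (length ss))) (T (Id_on R)) (as ss) p))"
        using hl[OF R(1) iR mult_app[OF D subst_app[OF T.F_obj[OF D] p' ss(2)]]] by simp
      also have "\<dots> = op_of B p (map (?l R (incl R)) ss)"
        by (rule opZ_subst[OF B R(1) fu[OF iR] p' ss(2)])
      also have "map (?l R (incl R)) ss = map h ys"
        unfolding ys using hl[OF R(1) iR] ss(2) by auto
      finally show "h (op_of (Alg A) p ys) = op_of B p (map h ys)" .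
    qed
  qed
  show "\<exists>!h. h \<in> homs (sig Var_M) (Alg A) B \<and> (\<forall>x\<in>Field A. h (\<eta> A x) = f x)"
  proof (rule ex1I)
    show "h \<in> homs (sig Var_M) (Alg A) B \<and> (\<forall>x\<in>Field A. h (\<eta> A x) = f x)" using hh h\<eta> by simp
    fix k assume "k \<in> homs (sig Var_M) (Alg A) B \<and> (\<forall>x\<in>Field A. k (\<eta> A x) = f x)"
    then have k: "k \<in> homs Sg (Alg A) B" "\<And>x. x \<in> Field A \<Longrightarrow> k (\<eta> A x) = f x" by auto
    have km: "k \<in> cont_maps (T A) (cpo_of B)" using homsD(1)[OF k(1)] by simp
    show "k = h"
    proof (rule cont_maps_eqI[OF km h(1)])
      fix x assume x: "x \<in> Field (T A)"
      show "k x = h x"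
      proof (rule T.lan_eqI[OF free Bc km h(1) x])
        fix X t assume X: "finite X" "X \<subseteq> Field A" "incl X \<in> X \<rightarrow>\<^sub>E Field A" "t \<in> Field (T (Id_on X))"
        have s: "set (map (\<eta> A) (enum X)) \<subseteq> Field (T A)" using enum[OF X(1)] X(2) unit_app[OF A] by auto
        have "map k (map (\<eta> A) (enum X)) = map h (map (\<eta> A) (enum X))"
          using k(2) h\<eta> enum[OF X(1)] X(2) by auto
        then have "k (opZ (Alg A) X (\<eta> A) t) = h (opZ (Alg A) X (\<eta> A) t)"
          unfolding opZ_def using homsD(4)[OF k(1), of _ "map (\<eta> A) (enum X)"] homsD(4)[OF hh, of _ "map (\<eta> A) (enum X)"]
            num_app[OF X(1,4)] s by (simp del: map_map map_eq_conv)
        then show "k (T.leaf (can (endo M) A) X (incl X) t) = h (T.leaf (can (endo M) A) X (incl X) t)"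
          using T.can_cocone(2)[OF A X(1,3,4)] leaf_op[OF A X(1,2,4)] by simp
      qed
    qed
  qed
qed

text \<open>The given monad arises on the nose from a suitable adjunction, not merely up to
  isomorphism: functor and unit are those of the monad, and the counit at \<open>Alg X\<close> is
  forced to be the multiplication.\<close>

theorem Var_M_monad: "free_algebra_monad Var_M M"
proof -
  define F :: "('u rel, 'u \<Rightarrow> 'u, 'u calg, 'u \<Rightarrow> 'u) fctr" where "F = \<lparr>fobj = Alg, fmap = Tmap\<rparr>"
  have ob: "cpo_of B \<in> obj CPO" "(\<lambda>x\<in>Field (cpo_of B). x) \<in> cont_maps (cpo_of B) (cpo_of B)" if "B \<in> algs Var_M" for B
    using that algebrasD(1,3)[of B Sg] cont_maps_id by auto
  have ex: "\<exists>h. h \<in> homs Sg (Alg (cpo_of B)) B \<and> (\<forall>x\<in>Field (cpo_of B). h (\<eta> (cpo_of B) x) = x)" if B: "B \<in> algs Var_M" for B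
  proof -
    obtain h where "h \<in> homs (sig Var_M) (Alg (cpo_of B)) B" "\<forall>x\<in>Field (cpo_of B). h (\<eta> (cpo_of B) x) = (\<lambda>x\<in>Field (cpo_of B). x) x"
      using Alg_free[OF ob(1)[OF B]] B ob(2)[OF B] unfolding free_on_def by blast
    then show ?thesis by (intro exI[of _ h]) simp
  qed
  define \<epsilon> where "\<epsilon> = (\<lambda>B\<in>algs Var_M. SOME h. h \<in> homs Sg (Alg (cpo_of B)) B \<and> (\<forall>x\<in>Field (cpo_of B). h (\<eta> (cpo_of B) x) = x))"
  have \<epsilon>: "\<epsilon> B \<in> homs Sg (Alg (cpo_of B)) B \<and> (\<forall>x\<in>Field (cpo_of B). \<epsilon> B (\<eta> (cpo_of B) x) = x)" if "B \<in> algs Var_M" for B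
    using someI_ex[OF ex[OF that]] that unfolding \<epsilon>_def by simp
  interpret F: free_algebra_functor U Var_M F \<eta> \<epsilon>
  proof unfold_locales
    show "Var_M \<in> varieties" by (rule Var_M_variety)
    show "\<eta> \<in> extensional (obj CPO)" by (rule nat_trans_CPO_D(1)[OF unit_trans])
    show "\<epsilon> \<in> extensional (algs Var_M)" unfolding \<epsilon>_def by (rule restrict_extensional)
  qed (use Alg_free Tmap_hom unit_nat \<epsilon> in \<open>auto simp: F_def simp del: Var_M_simps(2)\<close>)
  \<comment> \<open>Both components are homomorphisms out of a free algebra that restrict to the
    identity along the unit.\<close>
  have "mult M = (\<lambda>X\<in>obj CPO. \<epsilon> (Alg X))"
  proof (rule extensionalityI[OF nat_trans_CPO_D(1)[OF mult_trans] restrict_extensional])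
    fix X :: "'u rel" assume X: "X \<in> obj CPO"
    have "\<mu> X = \<epsilon> (Alg X)"
    proof (rule F.hom_eq[OF T.F_obj[OF X] Alg_algs[OF X]])
      show "\<mu> X \<in> homs (sig Var_M) (fobj F (T X)) (Alg X)" using mult_hom[OF X] by (simp add: F_def)
      show "\<epsilon> (Alg X) \<in> homs (sig Var_M) (fobj F (T X)) (Alg X)"
        using F.counit_hom[OF Alg_algs[OF X]] by simp
      show "\<mu> X (\<eta> (T X) x) = \<epsilon> (Alg X) (\<eta> (T X) x)" if "x \<in> Field (T X)" for x
        using mult_unit(1)[OF X that] F.counit_unit[OF Alg_algs[OF X], of x] that by simp
    qed
    then show "\<mu> X = (\<lambda>X\<in>obj CPO. \<epsilon> (Alg X)) X" using X by simp
  qed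
  moreover have "endo M = forgetful \<odot> F"
    unfolding comp_functor_def F_def by simp
  ultimately have "M = adjunction_monad CPO F forgetful \<eta> \<epsilon>"
    unfolding adjunction_monad_def by (simp add: F_def)
  then show ?thesis unfolding free_algebra_monad_def using F.adjunction by blast
qed

end


section \<open>Isomorphic monads and concretely isomorphic varieties\<close>

lemma monad_morphismD:
  assumes "monad_morphism CPO M N c"
  shows "X \<in> obj CPO \<Longrightarrow> c X \<in> cont_maps (fobj (endo M) X) (fobj (endo N) X)"
    "X \<in> obj CPO \<Longrightarrow> Y \<in> obj CPO \<Longrightarrow> f \<in> cont_maps X Y \<Longrightarrow> z \<in> Field (fobj (endo M) X) \<Longrightarrow>
      fmap (endo N) X Y f (c X z) = c Y (fmap (endo M) X Y f z)"
    "X \<in> obj CPO \<Longrightarrow> x \<in> Field X \<Longrightarrow> c X (unit M X x) = unit N X x"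
    "X \<in> obj CPO \<Longrightarrow> z \<in> Field (fobj (endo M) (fobj (endo M) X)) \<Longrightarrow> c X (mult M X z) =
      mult N X (fmap (endo N) (fobj (endo M) X) (fobj (endo N) X) (c X) (c (fobj (endo M) X) z))"
proof -
  have n: "nat_trans CPO CPO (endo M) (endo N) c" using assms unfolding monad_morphism_def Let_def by blast
  show "X \<in> obj CPO \<Longrightarrow> c X \<in> cont_maps (fobj (endo M) X) (fobj (endo N) X)"
    "X \<in> obj CPO \<Longrightarrow> Y \<in> obj CPO \<Longrightarrow> f \<in> cont_maps X Y \<Longrightarrow> z \<in> Field (fobj (endo M) X) \<Longrightarrow>
      fmap (endo N) X Y f (c X z) = c Y (fmap (endo M) X Y f z)"
    using nat_trans_CPO_D(2,3)[OF n] by auto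
  show "c X (unit M X x) = unit N X x" if "X \<in> obj CPO" "x \<in> Field X"
  proof -
    have "compose (Field X) (c X) (unit M X) = unit N X"
      using assms that(1) unfolding monad_morphism_def Let_def by simp
    from fun_cong[OF this, of x] that(2) show ?thesis by (simp add: compose_def)
  qed
  show "c X (mult M X z) =
      mult N X (fmap (endo N) (fobj (endo M) X) (fobj (endo N) X) (c X) (c (fobj (endo M) X) z))"
    if "X \<in> obj CPO" "z \<in> Field (fobj (endo M) (fobj (endo M) X))"
  proof -
    have "compose (Field (fobj (endo M) (fobj (endo M) X))) (c X) (mult M X) =
      compose (Field (fobj (endo M) (fobj (endo M) X))) (mult N X)
        (compose (Field (fobj (endo M) (fobj (endo M) X))) (fmap (endo N) (fobj (endo M) X) (fobj (endo N) X) (c X)) (c (fobj (endo M) X)))"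
      using assms that(1) unfolding monad_morphism_def Let_def by simp
    from fun_cong[OF this, of z] that(2) show ?thesis by (simp add: compose_def)
  qed
qed

lemma monad_morphismI:
  assumes "c \<in> extensional (obj CPO)"
    and "\<And>X. X \<in> obj CPO \<Longrightarrow> c X \<in> cont_maps (fobj (endo M) X) (fobj (endo N) X)"
    and "\<And>X Y f z. X \<in> obj CPO \<Longrightarrow> Y \<in> obj CPO \<Longrightarrow> f \<in> cont_maps X Y \<Longrightarrow> z \<in> Field (fobj (endo M) X) \<Longrightarrow>
      fmap (endo N) X Y f (c X z) = c Y (fmap (endo M) X Y f z)"
    and u: "\<And>X. X \<in> obj CPO \<Longrightarrow> unit N X \<in> extensional (Field X)"
      "\<And>X x. X \<in> obj CPO \<Longrightarrow> x \<in> Field X \<Longrightarrow> c X (unit M X x) = unit N X x"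
    and m: "\<And>X z. X \<in> obj CPO \<Longrightarrow> z \<in> Field (fobj (endo M) (fobj (endo M) X)) \<Longrightarrow> c X (mult M X z) =
      mult N X (fmap (endo N) (fobj (endo M) X) (fobj (endo N) X) (c X) (c (fobj (endo M) X) z))"
  shows "monad_morphism CPO M N c"
  unfolding monad_morphism_def Let_def
proof (intro conjI ballI)
  show "nat_trans CPO CPO (endo M) (endo N) c" by (rule nat_trans_CPO_I) (use assms in auto)
  fix X :: "'a rel" assume X: "X \<in> obj CPO"
  show "compo CPO X (fobj (endo M) X) (fobj (endo N) X) (c X) (unit M X) = unit N X"
    using u[OF X] by (auto simp: compose_def fun_eq_iff extensional_def)
  show "compo CPO (fobj (endo M) (fobj (endo M) X)) (fobj (endo M) X) (fobj (endo N) X) (c X) (mult M X) =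
    compo CPO (fobj (endo M) (fobj (endo M) X)) (fobj (endo N) (fobj (endo N) X)) (fobj (endo N) X) (mult N X)
      (compo CPO (fobj (endo M) (fobj (endo M) X)) (fobj (endo N) (fobj (endo M) X)) (fobj (endo N) (fobj (endo N) X))
        (fmap (endo N) (fobj (endo M) X) (fobj (endo N) X) (c X)) (c (fobj (endo M) X)))"
    using m[OF X] by (auto simp: compose_def fun_eq_iff)
qed

lemma compose_eq_id: "compose S f g = (\<lambda>x\<in>S. x) \<longleftrightarrow> (\<forall>z\<in>S. f (g z) = z)"
  by (auto simp: compose_def fun_eq_iff)

lemma isomorphic_monads_iff:
  "isomorphic_monads CPO M N \<longleftrightarrow> (\<exists>c d. monad_morphism CPO M N c \<and> monad_morphism CPO N M d \<and>
    (\<forall>X\<in>obj CPO. (\<forall>z\<in>Field (fobj (endo M) X). d X (c X z) = z) \<and> (\<forall>z\<in>Field (fobj (endo N) X). c X (d X z) = z)))"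
  unfolding isomorphic_monads_def Let_def CPO_simps compose_eq_id by simp

section \<open>Isomorphism of strongly finitary monads is an equivalence relation\<close>

context small_universe
begin

lemma monad_morphism_id:
  assumes M: "M \<in> strongly_finitary_monads"
  shows "monad_morphism CPO M M (\<lambda>X\<in>obj CPO. \<lambda>x\<in>Field (fobj (endo M) X). (x :: 'u))"
proof -
  interpret M: sf_monad U M by unfold_locales (rule M)
  show ?thesis
  proof (rule monad_morphismI)
    fix X :: "'u rel" assume X: "X \<in> obj CPO"
    note TX = M.T.F_obj[OF X]
    show "(\<lambda>X\<in>obj CPO. \<lambda>x\<in>Field (M.T X). x) X \<in> cont_maps (M.T X) (M.T X)"
      using cont_maps_id[OF CPO_cpo[OF TX]] X by simp
    show "unit M X \<in> extensional (Field X)" by (rule cont_mapsD(2)[OF M.unit_map[OF X]])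
    show "(\<lambda>X\<in>obj CPO. \<lambda>x\<in>Field (M.T X). x) X (unit M X x) = unit M X x" if "x \<in> Field X" for x
      using M.unit_app[OF X that] X by simp
    show "(\<lambda>X\<in>obj CPO. \<lambda>x\<in>Field (M.T X). x) X (mult M X z) =
      mult M X (M.Tmap (M.T X) (M.T X) ((\<lambda>X\<in>obj CPO. \<lambda>x\<in>Field (M.T X). x) X) ((\<lambda>X\<in>obj CPO. \<lambda>x\<in>Field (M.T X). x) (M.T X) z))"
      if "z \<in> Field (M.T (M.T X))" for z
      using that X TX M.mult_app[OF X that] M.T.F_id[OF TX that] by simp
  qed (simp_all add: M.T.F_app)
qed

lemma monad_morphism_comp:
  assumes M: "M \<in> strongly_finitary_monads" and N: "N \<in> strongly_finitary_monads" and Q: "Q \<in> strongly_finitary_monads"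
    and c: "monad_morphism CPO M N c" and d: "monad_morphism CPO N Q d"
  shows "monad_morphism CPO M Q (\<lambda>X\<in>obj CPO. compose (Field (fobj (endo M) X)) (d X) (c X :: 'u \<Rightarrow> 'u))"
    (is "monad_morphism _ _ _ ?e")
proof -
  interpret M: sf_monad U M by unfold_locales (rule M)
  interpret N: sf_monad U N by unfold_locales (rule N)
  interpret Q: sf_monad U Q by unfold_locales (rule Q)
  note c = monad_morphismD[OF c] and d = monad_morphismD[OF d]
  have e: "?e X z = d X (c X z)" if "X \<in> obj CPO" "z \<in> Field (M.T X)" for X z
    using that by (simp add: compose_def)
  have ca: "c X z \<in> Field (N.T X)" if "X \<in> obj CPO" "z \<in> Field (M.T X)" for X z
    by (rule cont_maps_app[OF c(1)[OF that(1)] that(2)])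
  have em: "?e X \<in> cont_maps (M.T X) (Q.T X)" if X: "X \<in> obj CPO" for X
    using cont_maps_compose[OF c(1)[OF X] d(1)[OF X]] X by simp
  show ?thesis
  proof (rule monad_morphismI[OF _ em])
    show "Q.Tmap X Y f (?e X z) = ?e Y (M.Tmap X Y f z)"
      if "X \<in> obj CPO" "Y \<in> obj CPO" "f \<in> cont_maps X Y" "z \<in> Field (M.T X)" for X Y f z
      using e[OF that(1,4)] e[OF that(2) M.T.F_app[OF that]] c(2)[OF that] d(2)[OF that(1-3) ca[OF that(1,4)]] by simp
    fix X :: "'u rel" assume X: "X \<in> obj CPO"
    show "unit Q X \<in> extensional (Field X)" by (rule cont_mapsD(2)[OF Q.unit_map[OF X]])
    show "?e X (unit M X x) = unit Q X x" if "x \<in> Field X" for x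
      using e[OF X M.unit_app[OF X that]] c(3)[OF X that]
        d(3)[OF X that] by simp
    fix z assume z: "z \<in> Field (M.T (M.T X))"
    note MX = M.T.F_obj[OF X] and NX = N.T.F_obj[OF X] and OX = Q.T.F_obj[OF X]
    have cz: "c (M.T X) z \<in> Field (N.T (M.T X))" by (rule ca[OF MX z])
    have dcz: "d (M.T X) (c (M.T X) z) \<in> Field (Q.T (M.T X))" by (rule cont_maps_app[OF d(1)[OF MX] cz])
    have eX: "?e X = compose (Field (M.T X)) (d X) (c X)" using X by simp
    have "?e X (mult M X z) = d X (mult N X (N.Tmap (M.T X) (N.T X) (c X) (c (M.T X) z)))"
      using e[OF X M.mult_app[OF X z]] c(4)[OF X z] by simp
    also have "\<dots> = mult Q X (Q.Tmap (N.T X) (Q.T X) (d X) (d (N.T X) (N.Tmap (M.T X) (N.T X) (c X) (c (M.T X) z))))"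
      by (rule d(4)[OF X N.T.F_app[OF MX NX c(1)[OF X] cz]])
    also have "d (N.T X) (N.Tmap (M.T X) (N.T X) (c X) (c (M.T X) z)) = Q.Tmap (M.T X) (N.T X) (c X) (d (M.T X) (c (M.T X) z))"
      using d(2)[OF MX NX c(1)[OF X] cz] by simp
    also have "Q.Tmap (N.T X) (Q.T X) (d X) (Q.Tmap (M.T X) (N.T X) (c X) (d (M.T X) (c (M.T X) z)))
      = Q.Tmap (M.T X) (Q.T X) (?e X) (d (M.T X) (c (M.T X) z))"
      unfolding eX by (rule Q.T.F_comp[OF MX NX OX c(1)[OF X] d(1)[OF X] dcz])
    also have "d (M.T X) (c (M.T X) z) = ?e (M.T X) z" using e[OF MX z] by simp
    finally show "?e X (mult M X z) = mult Q X (Q.Tmap (M.T X) (Q.T X) (?e X) (?e (M.T X) z))" .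
  qed (rule restrict_extensional)
qed

lemma equiv_monad_iso: "equiv strongly_finitary_monads (monad_iso :: 'u cpo_monad rel)"
proof (rule equivI)
  show "monad_iso \<subseteq> strongly_finitary_monads \<times> (strongly_finitary_monads :: 'u cpo_monad set)"
    unfolding monad_iso_def by blast
  show "refl_on strongly_finitary_monads (monad_iso :: 'u cpo_monad rel)"
    unfolding refl_on_def
  proof
    fix M :: "'u cpo_monad" assume M: "M \<in> strongly_finitary_monads"
    have "isomorphic_monads CPO M M" unfolding isomorphic_monads_iff
      by (rule exI, rule exI, rule conjI[OF monad_morphism_id[OF M] conjI[OF monad_morphism_id[OF M]]]) simp
    then show "(M, M) \<in> monad_iso" unfolding monad_iso_def using M by simp
  qed
  show "sym (monad_iso :: 'u cpo_monad rel)"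
    unfolding sym_def monad_iso_def isomorphic_monads_iff by blast
  show "trans (monad_iso :: 'u cpo_monad rel)"
  proof (rule transI)
    fix M N Q :: "'u cpo_monad" assume MN: "(M, N) \<in> monad_iso" and NO: "(N, Q) \<in> monad_iso"
    then have sf: "M \<in> strongly_finitary_monads" "N \<in> strongly_finitary_monads" "Q \<in> strongly_finitary_monads"
      unfolding monad_iso_def by auto
    obtain c d where c: "monad_morphism CPO M N c" "monad_morphism CPO N M d"
      "\<And>X z. X \<in> obj CPO \<Longrightarrow> z \<in> Field (fobj (endo M) X) \<Longrightarrow> d X (c X z) = z"
      "\<And>X z. X \<in> obj CPO \<Longrightarrow> z \<in> Field (fobj (endo N) X) \<Longrightarrow> c X (d X z) = z"
      using MN unfolding monad_iso_def isomorphic_monads_iff by blast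
    obtain c' d' where c': "monad_morphism CPO N Q c'" "monad_morphism CPO Q N d'"
      "\<And>X z. X \<in> obj CPO \<Longrightarrow> z \<in> Field (fobj (endo N) X) \<Longrightarrow> d' X (c' X z) = z"
      "\<And>X z. X \<in> obj CPO \<Longrightarrow> z \<in> Field (fobj (endo Q) X) \<Longrightarrow> c' X (d' X z) = z"
      using NO unfolding monad_iso_def isomorphic_monads_iff by blast
    have a: "c X z \<in> Field (fobj (endo N) X)" if "X \<in> obj CPO" "z \<in> Field (fobj (endo M) X)" for X z
      by (rule cont_maps_app[OF monad_morphismD(1)[OF c(1) that(1)] that(2)])
    have b: "d' X z \<in> Field (fobj (endo N) X)" if "X \<in> obj CPO" "z \<in> Field (fobj (endo Q) X)" for X z
      by (rule cont_maps_app[OF monad_morphismD(1)[OF c'(2) that(1)] that(2)])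
    have a': "c' X (c X z) \<in> Field (fobj (endo Q) X)" if "X \<in> obj CPO" "z \<in> Field (fobj (endo M) X)" for X z
      by (rule cont_maps_app[OF monad_morphismD(1)[OF c'(1) that(1)] a[OF that]])
    have b': "d X (d' X z) \<in> Field (fobj (endo M) X)" if "X \<in> obj CPO" "z \<in> Field (fobj (endo Q) X)" for X z
      by (rule cont_maps_app[OF monad_morphismD(1)[OF c(2) that(1)] b[OF that]])
    have "isomorphic_monads CPO M Q" unfolding isomorphic_monads_iff
      by (rule exI, rule exI, rule conjI[OF monad_morphism_comp[OF sf c(1) c'(1)] conjI[OF monad_morphism_comp[OF sf(3,2,1) c'(2) c(2)]]])
         (simp add: compose_def a b a' b' c(3,4) c'(3,4))
    then show "(M, Q) \<in> monad_iso" unfolding monad_iso_def using sf by simp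
  qed
qed

end

text \<open>A concrete isomorphism is the identity on homomorphisms, hence given by its effect on algebras.\<close>

definition alg_iso :: "'u variety \<Rightarrow> 'u variety \<Rightarrow> ('u calg \<Rightarrow> 'u calg) \<Rightarrow> ('u calg \<Rightarrow> 'u calg) \<Rightarrow> bool" where
  "alg_iso V W \<phi> \<psi> \<longleftrightarrow>
     (\<forall>A\<in>algs V. \<phi> A \<in> algs W \<and> cpo_of (\<phi> A) = cpo_of A \<and> \<psi> (\<phi> A) = A) \<and>
     (\<forall>B\<in>algs W. \<psi> B \<in> algs V \<and> cpo_of (\<psi> B) = cpo_of B \<and> \<phi> (\<psi> B) = B) \<and>
     (\<forall>A\<in>algs V. \<forall>B\<in>algs V. homs (sig V) A B \<subseteq> homs (sig W) (\<phi> A) (\<phi> B)) \<and>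
     (\<forall>A\<in>algs W. \<forall>B\<in>algs W. homs (sig W) A B \<subseteq> homs (sig V) (\<psi> A) (\<psi> B))"

lemma alg_isoD:
  assumes "alg_iso V W \<phi> \<psi>"
  shows "A \<in> algs V \<Longrightarrow> \<phi> A \<in> algs W" "A \<in> algs V \<Longrightarrow> cpo_of (\<phi> A) = cpo_of A" "A \<in> algs V \<Longrightarrow> \<psi> (\<phi> A) = A"
    "A \<in> algs V \<Longrightarrow> B \<in> algs V \<Longrightarrow> h \<in> homs (sig V) A B \<Longrightarrow> h \<in> homs (sig W) (\<phi> A) (\<phi> B)"
  using assms unfolding alg_iso_def by blast+

lemma alg_iso_sym: "alg_iso V W \<phi> \<psi> \<Longrightarrow> alg_iso W V \<psi> \<phi>"
  unfolding alg_iso_def by auto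

lemma alg_iso_trans: "alg_iso V W \<phi> \<psi> \<Longrightarrow> alg_iso W Z \<phi>' \<psi>' \<Longrightarrow> alg_iso V Z (\<phi>' \<circ> \<phi>) (\<psi> \<circ> \<psi>')"
  unfolding alg_iso_def by (auto simp: subset_iff)

lemma concrete_isomorphism_iff: "(\<exists>\<Phi>. concrete_isomorphism V W \<Phi>) \<longleftrightarrow> (\<exists>\<phi> \<psi>. alg_iso V W \<phi> \<psi>)"
proof
  assume "\<exists>\<Phi>. concrete_isomorphism V W \<Phi>"
  then obtain \<Phi> where \<Phi>: "concrete_isomorphism V W \<Phi>" by blast
  then obtain \<Psi> where F: "is_functor (variety_cat V) (variety_cat W) \<Phi>" and G: "is_functor (variety_cat W) (variety_cat V) \<Psi>"
    and i: "\<forall>A\<in>algs V. fobj \<Psi> (fobj \<Phi> A) = A" "\<forall>A\<in>algs W. fobj \<Phi> (fobj \<Psi> A) = A"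
      "\<forall>A\<in>algs W. \<forall>B\<in>algs W. \<forall>h\<in>homs (sig W) A B. fmap \<Phi> (fobj \<Psi> A) (fobj \<Psi> B) (fmap \<Psi> A B h) = h"
    and U: "\<forall>A\<in>algs V. cpo_of (fobj \<Phi> A) = cpo_of A"
      "\<forall>A\<in>algs V. \<forall>B\<in>algs V. \<forall>h\<in>homs (sig V) A B. fmap \<Phi> A B h = h"
    unfolding concrete_isomorphism_def Let_def by auto
  have Fo: "fobj \<Phi> A \<in> algs W" if "A \<in> algs V" for A using F that unfolding is_functor_def by simp
  have Fm: "fmap \<Phi> A B h \<in> homs (sig W) (fobj \<Phi> A) (fobj \<Phi> B)" if "A \<in> algs V" "B \<in> algs V" "h \<in> homs (sig V) A B" for A B h
    using F that unfolding is_functor_def by simp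
  have Go: "fobj \<Psi> A \<in> algs V" if "A \<in> algs W" for A using G that unfolding is_functor_def by simp
  have Gm: "fmap \<Psi> A B h \<in> homs (sig V) (fobj \<Psi> A) (fobj \<Psi> B)" if "A \<in> algs W" "B \<in> algs W" "h \<in> homs (sig W) A B" for A B h
    using G that unfolding is_functor_def by simp
  \<comment> \<open>The inverse functor fixes homomorphisms too: applying the first functor, which
    does so by concreteness, to its value gives the original homomorphism back.\<close>
  have Gi: "fmap \<Psi> A B h = h" if "A \<in> algs W" "B \<in> algs W" "h \<in> homs (sig W) A B" for A B h
    using i(3) U(2) Go Gm that by metis
  have "alg_iso V W (fobj \<Phi>) (fobj \<Psi>)"
    unfolding alg_iso_def
  proof (intro conjI ballI subsetI)
    show "cpo_of (fobj \<Psi> B) = cpo_of B" if "B \<in> algs W" for B using U(1) Go[OF that] i(2) that by metis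
    show "h \<in> homs (sig W) (fobj \<Phi> A) (fobj \<Phi> B)" if "A \<in> algs V" "B \<in> algs V" "h \<in> homs (sig V) A B" for A B h
      using Fm[OF that] U(2) that by simp
    show "h \<in> homs (sig V) (fobj \<Psi> A) (fobj \<Psi> B)" if "A \<in> algs W" "B \<in> algs W" "h \<in> homs (sig W) A B" for A B h
      using Gm[OF that] Gi[OF that] by simp
  qed (use Fo Go i U in auto)
  then show "\<exists>\<phi> \<psi>. alg_iso V W \<phi> \<psi>" by blast
next
  assume "\<exists>\<phi> \<psi>. alg_iso V W \<phi> \<psi>"
  then obtain \<phi> \<psi> where a: "alg_iso V W \<phi> \<psi>" by blast
  note D = alg_isoD[OF a] and D' = alg_isoD[OF alg_iso_sym[OF a]]
  have f: "is_functor (variety_cat V) (variety_cat W) \<lparr>fobj = \<phi>, fmap = \<lambda>A B h. h\<rparr>"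
    "is_functor (variety_cat W) (variety_cat V) \<lparr>fobj = \<psi>, fmap = \<lambda>A B h. h\<rparr>"
    unfolding is_functor_def by (auto simp: D(1,2) D'(1,2) intro: D(4) D'(4))
  have "concrete_isomorphism V W \<lparr>fobj = \<phi>, fmap = \<lambda>A B h. h\<rparr>"
    unfolding concrete_isomorphism_def Let_def
  proof (intro conjI exI)
    show "is_functor (variety_cat V) (variety_cat W) \<lparr>fobj = \<phi>, fmap = \<lambda>A B h. h\<rparr>" by (rule f(1))
    show "is_functor (variety_cat W) (variety_cat V) \<lparr>fobj = \<psi>, fmap = \<lambda>A B h. h\<rparr>" by (rule f(2))
  qed (auto simp: D(2,3) D'(3))
  then show "\<exists>\<Phi>. concrete_isomorphism V W \<Phi>" by blast
qed

lemma equiv_concrete_iso: "equiv varieties (concrete_iso :: 'u variety rel)"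
proof (rule equivI)
  show "concrete_iso \<subseteq> varieties \<times> (varieties :: 'u variety set)" unfolding concrete_iso_def by blast
  show "refl_on varieties (concrete_iso :: 'u variety rel)"
  proof (unfold refl_on_def, rule)
    fix V :: "'u variety" assume V: "V \<in> varieties"
    have "alg_iso V V id id" unfolding alg_iso_def by simp
    then show "(V, V) \<in> concrete_iso" unfolding concrete_iso_def concrete_isomorphism_iff using V by blast
  qed
  show "sym (concrete_iso :: 'u variety rel)"
    unfolding sym_def concrete_iso_def concrete_isomorphism_iff using alg_iso_sym by blast
  show "trans (concrete_iso :: 'u variety rel)"
    unfolding trans_def concrete_iso_def concrete_isomorphism_iff using alg_iso_trans by blast
qed

section \<open>Comparison of the monads and algebras of two varieties\<close>

locale free_algebra_functors = P: free_algebra_functor U V F \<eta> \<epsilon> + Q: free_algebra_functor U W F' \<eta>' \<epsilon>'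
  for U :: "'u set" and V F \<eta> \<epsilon> and W F' \<eta>' \<epsilon>'
begin

text \<open>The inverse isomorphism makes the free algebras of \<open>W\<close> into algebras of
  \<open>V\<close> over the same cpos, so freeness yields \<open>c\<close>. Each monad morphism law
  compares two homomorphisms from a free algebra that agree on units.\<close>

lemma comparison_morphism:
  assumes iso: "alg_iso V W \<phi> \<psi>"
  shows "\<exists>c. monad_morphism CPO P.M Q.M c \<and>
    (\<forall>X\<in>obj CPO. c X \<in> homs (sig V) (fobj F X) (\<psi> (fobj F' X)) \<and> (\<forall>x\<in>Field X. c X (\<eta> X x) = \<eta>' X x))"
proof -
  note D = alg_isoD[OF iso] and D' = alg_isoD[OF alg_iso_sym[OF iso]]
  have W: "\<psi> (fobj F' X) \<in> algs V" "cpo_of (\<psi> (fobj F' X)) = cpo_of (fobj F' X)" if "X \<in> obj CPO" for X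
    using D'(1,2)[OF Q.F_algs[OF that]] .
  define c where "c = (\<lambda>X\<in>obj CPO. SOME h. h \<in> homs (sig V) (fobj F X) (\<psi> (fobj F' X)) \<and> (\<forall>x\<in>Field X. h (\<eta> X x) = \<eta>' X x))"
  have "\<exists>h. h \<in> homs (sig V) (fobj F X) (\<psi> (fobj F' X)) \<and> (\<forall>x\<in>Field X. h (\<eta> X x) = \<eta>' X x)" if X: "X \<in> obj CPO" for X
    using P.extension[OF X W(1)[OF X], of "\<eta>' X"] Q.unit_map[OF X] W(2)[OF X] by metis
  from someI_ex[OF this] have c: "c X \<in> homs (sig V) (fobj F X) (\<psi> (fobj F' X))" "\<And>x. x \<in> Field X \<Longrightarrow> c X (\<eta> X x) = \<eta>' X x"
    if "X \<in> obj CPO" for X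
    using that unfolding c_def by auto
  have cm: "c X \<in> cont_maps (cpo_of (fobj F X)) (cpo_of (fobj F' X))" if "X \<in> obj CPO" for X
    using homsD(1)[OF c(1)[OF that]] W(2)[OF that] by simp
  have F'm: "fmap F' X Y f \<in> homs (sig V) (\<psi> (fobj F' X)) (\<psi> (fobj F' Y))" if "X \<in> obj CPO" "Y \<in> obj CPO" "f \<in> cont_maps X Y" for X Y f
    by (rule D'(4)[OF Q.F_algs[OF that(1)] Q.F_algs[OF that(2)] Q.fmap_hom[OF that]])
  have "monad_morphism CPO P.M Q.M c"
  proof (rule monad_morphismI)
    show "c \<in> extensional (obj CPO)" unfolding c_def by simp
    fix X Y :: "'u rel" and f z
    assume X: "X \<in> obj CPO" and Y: "Y \<in> obj CPO" and f: "f \<in> cont_maps X Y" and z: "z \<in> Field (fobj (endo P.M) X)"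
    have "compose (Field (cpo_of (fobj F X))) (fmap F' X Y f) (c X) = compose (Field (cpo_of (fobj F X))) (c Y) (fmap F X Y f)"
      by (rule P.hom_eq[OF X W(1)[OF Y] P.F_compose[OF c(1)[OF X] F'm[OF X Y f] X] P.F_compose[OF P.fmap_hom[OF X Y f] c(1)[OF Y] X]])
         (simp add: CPO_compose_app P.unit_app[OF X] c(2)[OF X] c(2)[OF Y] P.fmap_unit[OF X Y f] Q.fmap_unit[OF X Y f] cont_maps_app[OF f])
    from eq_on_compose[OF this, of z] z
    show "fmap (endo Q.M) X Y f (c X z) = c Y (fmap (endo P.M) X Y f z)" by simp
  next
    fix X :: "'u rel" assume X: "X \<in> obj CPO"
    show "c X \<in> cont_maps (fobj (endo P.M) X) (fobj (endo Q.M) X)" using cm[OF X] by simp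
    show "unit Q.M X \<in> extensional (Field X)" using cont_mapsD(2)[OF Q.unit_map[OF X]] by simp
    show "c X (unit P.M X x) = unit Q.M X x" if "x \<in> Field X" for x using c(2)[OF X that] by simp
    let ?TX = "cpo_of (fobj F X)" and ?SX = "cpo_of (fobj F' X)"
    note TX = P.T_obj[OF X] and SX = Q.T_obj[OF X]
    fix z assume z: "z \<in> Field (fobj (endo P.M) (fobj (endo P.M) X))"
    have e': "\<epsilon>' (fobj F' X) \<in> homs (sig V) (\<psi> (fobj F' ?SX)) (\<psi> (fobj F' X))"
      by (rule D'(4)[OF Q.F_algs[OF SX] Q.F_algs[OF X] Q.counit_hom[OF Q.F_algs[OF X]]])
    have r: "compose (Field (cpo_of (fobj F ?TX))) (\<epsilon>' (fobj F' X)) (compose (Field (cpo_of (fobj F ?TX))) (fmap F' ?TX ?SX (c X)) (c ?TX))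
      \<in> homs (sig V) (fobj F ?TX) (\<psi> (fobj F' X))"
      by (rule P.F_compose[OF P.F_compose[OF c(1)[OF TX] F'm[OF TX SX cm[OF X]] TX] e' TX])
    have l: "compose (Field (cpo_of (fobj F ?TX))) (c X) (\<epsilon> (fobj F X)) \<in> homs (sig V) (fobj F ?TX) (\<psi> (fobj F' X))"
      by (rule P.F_compose[OF P.counit_hom[OF P.F_algs[OF X]] c(1)[OF X] TX])
    have "compose (Field (cpo_of (fobj F ?TX))) (c X) (\<epsilon> (fobj F X)) =
      compose (Field (cpo_of (fobj F ?TX))) (\<epsilon>' (fobj F' X)) (compose (Field (cpo_of (fobj F ?TX))) (fmap F' ?TX ?SX (c X)) (c ?TX))"
      by (rule P.hom_eq[OF TX W(1)[OF X] l r])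
         (simp add: CPO_compose_app P.unit_app[OF TX] P.counit_unit[OF P.F_algs[OF X]] c(2)[OF TX]
            Q.fmap_unit[OF TX SX cm[OF X]] Q.counit_unit[OF Q.F_algs[OF X]] cont_maps_app[OF cm[OF X]])
    from eq_on_compose[OF this, of z] z
    show "c X (mult P.M X z) = mult Q.M X (fmap (endo Q.M) (fobj (endo P.M) X) (fobj (endo Q.M) X) (c X) (c (fobj (endo P.M) X) z))"
      using X by (simp add: CPO_compose_app)
  qed
  then show ?thesis using c by blast
qed

text \<open>A monad morphism induces a functor on algebras in the opposite direction: the algebra \<open>B\<close> is
  evaluated by the counit composed with the morphism.\<close>

definition pull :: "('u rel \<Rightarrow> 'u \<Rightarrow> 'u) \<Rightarrow> 'u calg \<Rightarrow> 'u calg" where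
  "pull d B = \<lparr>cpo_of = cpo_of B, op_of = \<lambda>\<tau> bs. if \<tau> \<in> sig W (length bs) \<and> set bs \<subseteq> Field (cpo_of B)
     then \<epsilon> B (d (cpo_of B) (op_of (fobj F' (cpo_of B)) \<tau> (map (\<eta>' (cpo_of B)) bs))) else undefined\<rparr>"

lemma pull_op: "\<tau> \<in> sig W (length bs) \<Longrightarrow> set bs \<subseteq> Field (cpo_of B) \<Longrightarrow>
    op_of (pull d B) \<tau> bs = \<epsilon> B (d (cpo_of B) (op_of (fobj F' (cpo_of B)) \<tau> (map (\<eta>' (cpo_of B)) bs)))"
  by (simp add: pull_def)

lemma pull_cpo [simp]: "cpo_of (pull d B) = cpo_of B"
  by (simp add: pull_def)

context
  fixes d
  assumes d: "monad_morphism CPO Q.M P.M d"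
begin

lemma d_map: "X \<in> obj CPO \<Longrightarrow> d X \<in> cont_maps (cpo_of (fobj F' X)) (cpo_of (fobj F X))"
  using monad_morphismD(1)[OF d] by simp

lemma d_nat: "X \<in> obj CPO \<Longrightarrow> Y \<in> obj CPO \<Longrightarrow> f \<in> cont_maps X Y \<Longrightarrow> z \<in> Field (cpo_of (fobj F' X)) \<Longrightarrow>
    fmap F X Y f (d X z) = d Y (fmap F' X Y f z)"
  using monad_morphismD(2)[OF d, of X Y f z] by simp

lemma d_unit: "X \<in> obj CPO \<Longrightarrow> x \<in> Field X \<Longrightarrow> d X (\<eta>' X x) = \<eta> X x"
  using monad_morphismD(3)[OF d, of X x] by simp

lemma d_mult: "X \<in> obj CPO \<Longrightarrow> z \<in> Field (cpo_of (fobj F' (cpo_of (fobj F' X)))) \<Longrightarrow>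
    d X (\<epsilon>' (fobj F' X) z) = \<epsilon> (fobj F X) (fmap F (cpo_of (fobj F' X)) (cpo_of (fobj F X)) (d X) (d (cpo_of (fobj F' X)) z))"
  using monad_morphismD(4)[OF d, of X z] by simp

text \<open>The counit of \<open>B\<close> composed with \<open>d\<close> is an Eilenberg-Moore
  structure \<open>\<beta>\<close> for the second monad. It is a homomorphism onto the pulled back
  algebra from a free algebra of \<open>W\<close>, so \<open>variety_surj\<close> applies; by
  uniqueness it is also the counit there.\<close>

lemma pull_alg:
  assumes B: "B \<in> algs V"
  shows "pull d B \<in> algs W"
    and "b \<in> Field (cpo_of (fobj F' (cpo_of B))) \<Longrightarrow> \<epsilon>' (pull d B) b = \<epsilon> B (d (cpo_of B) b)"
proof -
  let ?X = "cpo_of B"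
  let ?SX = "cpo_of (fobj F' ?X)"
  note X = P.alg_obj[OF B] and Xc = P.alg_cpo[OF B]
  note SX = Q.T_obj[OF X] and TX = P.T_obj[OF X] and SA = Q.F_algs[OF X]
  define \<beta> where "\<beta> = compose (Field ?SX) (\<epsilon> B) (d ?X)"
  have \<beta>: "\<beta> z = \<epsilon> B (d ?X z)" if "z \<in> Field ?SX" for z using that by (simp add: \<beta>_def compose_def)
  have \<beta>m: "\<beta> \<in> cont_maps ?SX ?X" unfolding \<beta>_def
    by (rule cont_maps_compose[OF d_map[OF X] homsD(1)[OF P.counit_hom[OF B]]])
  have \<beta>\<eta>: "\<beta> (\<eta>' ?X b) = b" if "b \<in> Field ?X" for b
    using \<beta>[OF Q.unit_app[OF X that]] d_unit[OF X that] P.counit_unit[OF B that] by simp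
  have opF: "op_of (fobj F' ?X) \<tau> (map (\<eta>' ?X) bs) \<in> Field ?SX" if "\<tau> \<in> sig W (length bs)" "set bs \<subseteq> Field ?X" for \<tau> bs
    by (rule op_of_closed[OF Q.alg[OF SA]]) (use that Q.unit_app[OF X] in auto)
  have op: "op_of (pull d B) \<tau> bs = \<beta> (op_of (fobj F' ?X) \<tau> (map (\<eta>' ?X) bs))" if "\<tau> \<in> sig W (length bs)" "set bs \<subseteq> Field ?X" for \<tau> bs
    using pull_op[OF that] \<beta>[OF opF[OF that]] by simp
  have pA: "pull d B \<in> algebras (sig W)"
    unfolding algebras_def mem_Collect_eq
  proof (intro conjI allI ballI impI)
    show "cpo_of (pull d B) \<in> obj CPO" using X by simp
    fix n \<tau> assume \<tau>: "\<tau> \<in> sig W n"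
    have c1: "continuous_map (power_cpo ?X n) (power_cpo ?SX n) (map (\<eta>' ?X))"
      by (rule continuous_map_map[OF Xc CPO_cpo[OF SX] cont_mapsD(1)[OF Q.unit_map[OF X]]])
    have "continuous_map (power_cpo ?X n) ?X (\<lambda>bs. \<beta> (op_of (fobj F' ?X) \<tau> (map (\<eta>' ?X) bs)))"
      by (rule continuous_map_comp[OF continuous_map_comp[OF c1 algebrasD(4)[OF Q.alg[OF SA] \<tau>]] cont_mapsD(1)[OF \<beta>m]])
    then show "continuous_map (power_cpo (cpo_of (pull d B)) n) (cpo_of (pull d B)) (op_of (pull d B) \<tau>)"
      unfolding pull_cpo by (rule continuous_map_cong) (use op \<tau> in \<open>auto simp: field_power_cpo[OF Xc]\<close>)
  qed (auto simp: pull_def)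
  \<comment> \<open>The associativity law of the structure \<open>\<beta>\<close>, obtained from the
    multiplication law of \<open>d\<close> and the naturality of \<open>\<epsilon>\<close> and
    \<open>d\<close>.\<close>
  have em: "\<beta> (\<epsilon>' (fobj F' ?X) z) = \<beta> (fmap F' ?SX ?X \<beta> z)" if z: "z \<in> Field (cpo_of (fobj F' ?SX))" for z
  proof -
    have dz: "d ?SX z \<in> Field (cpo_of (fobj F ?SX))" by (rule cont_maps_app[OF d_map[OF SX] z])
    have z': "\<epsilon>' (fobj F' ?X) z \<in> Field ?SX" by (rule homsD(3)[OF Q.counit_hom[OF SA] z])
    have z2: "fmap F ?SX (cpo_of (fobj F ?X)) (d ?X) (d ?SX z) \<in> Field (cpo_of (fobj F (cpo_of (fobj F ?X))))"
      by (rule homsD(3)[OF P.fmap_hom[OF SX TX d_map[OF X]] dz])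
    have "\<beta> (\<epsilon>' (fobj F' ?X) z) = \<epsilon> B (\<epsilon> (fobj F ?X) (fmap F ?SX (cpo_of (fobj F ?X)) (d ?X) (d ?SX z)))"
      using \<beta>[OF z'] d_mult[OF X z] by simp
    also have "\<dots> = \<epsilon> B (fmap F (cpo_of (fobj F ?X)) ?X (\<epsilon> B) (fmap F ?SX (cpo_of (fobj F ?X)) (d ?X) (d ?SX z)))"
      by (rule eq_on_compose[OF P.counit_nat[OF P.F_algs[OF X] B P.counit_hom[OF B]] z2])
    also have "fmap F (cpo_of (fobj F ?X)) ?X (\<epsilon> B) (fmap F ?SX (cpo_of (fobj F ?X)) (d ?X) (d ?SX z)) = fmap F ?SX ?X \<beta> (d ?SX z)"
      using fun_cong[OF P.fmap_comp[OF SX TX X d_map[OF X] homsD(1)[OF P.counit_hom[OF B]]], of "d ?SX z"] dz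
      by (simp add: \<beta>_def CPO_compose_app)
    also have "\<dots> = d ?X (fmap F' ?SX ?X \<beta> z)" by (rule d_nat[OF SX X \<beta>m z])
    also have "\<epsilon> B \<dots> = \<beta> (fmap F' ?SX ?X \<beta> z)"
      using \<beta>[OF homsD(3)[OF Q.fmap_hom[OF SX X \<beta>m] z]] by simp
    finally show ?thesis .
  qed
  have \<beta>h: "\<beta> \<in> homs (sig W) (fobj F' ?X) (pull d B)"
  proof (rule homsI)
    show "\<beta> \<in> cont_maps (cpo_of (fobj F' ?X)) (cpo_of (pull d B))" using \<beta>m by simp
    fix \<tau> xs assume \<tau>: "\<tau> \<in> sig W (length xs)" and xs: "set xs \<subseteq> Field ?SX"
    let ?w = "op_of (fobj F' ?SX) \<tau> (map (\<eta>' ?SX) xs)"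
    have \<eta>xs: "set (map (\<eta>' ?SX) xs) \<subseteq> Field (cpo_of (fobj F' ?SX))" using xs Q.unit_app[OF SX] by auto
    have \<beta>xs: "set (map \<beta> xs) \<subseteq> Field ?X" using xs cont_maps_app[OF \<beta>m] by auto
    have w: "?w \<in> Field (cpo_of (fobj F' ?SX))"
      by (rule op_of_closed[OF Q.alg[OF Q.F_algs[OF SX]] _ \<eta>xs]) (use \<tau> in simp)
    have "\<epsilon>' (fobj F' ?X) ?w = op_of (fobj F' ?X) \<tau> (map (\<epsilon>' (fobj F' ?X)) (map (\<eta>' ?SX) xs))"
      by (rule homsD(4)[OF Q.counit_hom[OF SA] _ \<eta>xs]) (use \<tau> in simp)
    also have "map (\<epsilon>' (fobj F' ?X)) (map (\<eta>' ?SX) xs) = xs"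
      using xs Q.counit_unit[OF SA] by (auto intro!: map_idI)
    finally have "\<beta> (op_of (fobj F' ?X) \<tau> xs) = \<beta> (fmap F' ?SX ?X \<beta> ?w)" using em[OF w] by simp
    also have "fmap F' ?SX ?X \<beta> ?w = op_of (fobj F' ?X) \<tau> (map (fmap F' ?SX ?X \<beta>) (map (\<eta>' ?SX) xs))"
      by (rule homsD(4)[OF Q.fmap_hom[OF SX X \<beta>m] _ \<eta>xs]) (use \<tau> in simp)
    also have "map (fmap F' ?SX ?X \<beta>) (map (\<eta>' ?SX) xs) = map (\<eta>' ?X) (map \<beta> xs)"
      using xs Q.fmap_unit[OF SX X \<beta>m] by auto
    also have "\<beta> (op_of (fobj F' ?X) \<tau> \<dots>) = op_of (pull d B) \<tau> (map \<beta> xs)"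
      using op[of \<tau> "map \<beta> xs"] \<tau> \<beta>xs by simp
    finally show "\<beta> (op_of (fobj F' ?X) \<tau> xs) = op_of (pull d B) \<tau> (map \<beta> xs)" .
  qed
  \<comment> \<open>Surjectivity comes from the unit law of the structure: \<open>\<beta>\<close>
    has the unit as a section.\<close>
  have "Field (cpo_of (pull d B)) \<subseteq> \<beta> ` Field ?SX"
  proof
    fix b assume "b \<in> Field (cpo_of (pull d B))"
    then have b: "b \<in> Field ?X" by simp
    show "b \<in> \<beta> ` Field ?SX" using \<beta>\<eta>[OF b] Q.unit_app[OF X b] by (metis imageI)
  qed
  then show pW: "pull d B \<in> algs W" by (rule variety_surj[OF Q.V SA pA \<beta>h])
  have "\<epsilon>' (pull d B) = \<beta>"
  proof (rule Q.hom_eq[OF X pW])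
    show "\<epsilon>' (pull d B) \<in> homs (sig W) (fobj F' ?X) (pull d B)" using Q.counit_hom[OF pW] by simp
    show "\<beta> \<in> homs (sig W) (fobj F' ?X) (pull d B)" by (rule \<beta>h)
    show "\<epsilon>' (pull d B) (\<eta>' ?X x) = \<beta> (\<eta>' ?X x)" if "x \<in> Field ?X" for x
      using Q.counit_unit[OF pW, of x] \<beta>\<eta>[OF that] that by simp
  qed
  then show "b \<in> Field (cpo_of (fobj F' (cpo_of B))) \<Longrightarrow> \<epsilon>' (pull d B) b = \<epsilon> B (d (cpo_of B) b)"
    using \<beta> by simp
qed

lemma pull_hom:
  assumes A: "A \<in> algs V" and B: "B \<in> algs V" and h: "h \<in> homs (sig V) A B"
  shows "h \<in> homs (sig W) (pull d A) (pull d B)"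
proof (rule homsI)
  show "h \<in> cont_maps (cpo_of (pull d A)) (cpo_of (pull d B))" using homsD(1)[OF h] by simp
  fix \<tau> xs assume \<tau>: "\<tau> \<in> sig W (length xs)" and "set xs \<subseteq> Field (cpo_of (pull d A))"
  then have xs: "set xs \<subseteq> Field (cpo_of A)" by simp
  note X = P.alg_obj[OF A] and Y = P.alg_obj[OF B] and hm = homsD(1)[OF h]
  let ?w = "op_of (fobj F' (cpo_of A)) \<tau> (map (\<eta>' (cpo_of A)) xs)"
  have \<eta>xs: "set (map (\<eta>' (cpo_of A)) xs) \<subseteq> Field (cpo_of (fobj F' (cpo_of A)))" using xs Q.unit_app[OF X] by auto
  have w: "?w \<in> Field (cpo_of (fobj F' (cpo_of A)))"
    by (rule op_of_closed[OF Q.alg[OF Q.F_algs[OF X]] _ \<eta>xs]) (use \<tau> in simp)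
  have hx: "set (map h xs) \<subseteq> Field (cpo_of B)" using xs homsD(3)[OF h] by auto
  have "h (op_of (pull d A) \<tau> xs) = h (\<epsilon> A (d (cpo_of A) ?w))" using pull_op[OF \<tau> xs] by simp
  also have "\<dots> = \<epsilon> B (fmap F (cpo_of A) (cpo_of B) h (d (cpo_of A) ?w))"
    by (rule eq_on_compose[OF P.counit_nat[OF A B h] cont_maps_app[OF d_map[OF X] w]])
  also have "fmap F (cpo_of A) (cpo_of B) h (d (cpo_of A) ?w) = d (cpo_of B) (fmap F' (cpo_of A) (cpo_of B) h ?w)"
    by (rule d_nat[OF X Y hm w])
  also have "fmap F' (cpo_of A) (cpo_of B) h ?w =
      op_of (fobj F' (cpo_of B)) \<tau> (map (fmap F' (cpo_of A) (cpo_of B) h) (map (\<eta>' (cpo_of A)) xs))"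
    by (rule homsD(4)[OF Q.fmap_hom[OF X Y hm] _ \<eta>xs]) (use \<tau> in simp)
  also have "map (fmap F' (cpo_of A) (cpo_of B) h) (map (\<eta>' (cpo_of A)) xs) = map (\<eta>' (cpo_of B)) (map h xs)"
    using xs Q.fmap_unit[OF X Y hm] by auto
  finally show "h (op_of (pull d A) \<tau> xs) = op_of (pull d B) \<tau> (map h xs)"
    using pull_op[of \<tau> "map h xs" B d] \<tau> hx by simp
qed

end

end

context small_universe
begin

text \<open>Pulling back twice evaluates \<open>c\<close> and then \<open>d\<close>, which cancel.
  What remains is the counit applied to an operation on units, and this is the operation of
  \<open>B\<close>.\<close>

lemma pull_pull:
  assumes PQ: "free_algebra_functors U V F \<eta> \<epsilon> W F' \<eta>' \<epsilon>'" and QP: "free_algebra_functors U W F' \<eta>' \<epsilon>' V F \<eta> \<epsilon>"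
    and d: "monad_morphism CPO (adjunction_monad CPO F' forgetful \<eta>' \<epsilon>') (adjunction_monad CPO F forgetful \<eta> \<epsilon>) d"
    and dc: "\<And>X z. X \<in> obj CPO \<Longrightarrow> z \<in> Field (cpo_of (fobj F X)) \<Longrightarrow> d X (c X z) = z"
    and c: "\<And>X z. X \<in> obj CPO \<Longrightarrow> z \<in> Field (cpo_of (fobj F X)) \<Longrightarrow> c X z \<in> Field (cpo_of (fobj F' X))"
    and B: "B \<in> algs V"
  shows "free_algebra_functors.pull \<epsilon>' V F \<eta> c (free_algebra_functors.pull \<epsilon> W F' \<eta>' d B) = B"
proof -
  interpret PQ: free_algebra_functors U V F \<eta> \<epsilon> W F' \<eta>' \<epsilon>' by (rule PQ)
  interpret QP: free_algebra_functors U W F' \<eta>' \<epsilon>' V F \<eta> \<epsilon> by (rule QP)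
  note X = PQ.P.alg_obj[OF B]
  have "op_of (QP.pull c (PQ.pull d B)) \<sigma> bs = op_of B \<sigma> bs" for \<sigma> bs
  proof (cases "\<sigma> \<in> sig V (length bs) \<and> set bs \<subseteq> Field (cpo_of B)")
    case True
    let ?w = "op_of (fobj F (cpo_of B)) \<sigma> (map (\<eta> (cpo_of B)) bs)"
    have \<eta>bs: "set (map (\<eta> (cpo_of B)) bs) \<subseteq> Field (cpo_of (fobj F (cpo_of B)))" using True PQ.P.unit_app[OF X] by auto
    have w: "?w \<in> Field (cpo_of (fobj F (cpo_of B)))"
      by (rule op_of_closed[OF PQ.P.alg[OF PQ.P.F_algs[OF X]] _ \<eta>bs]) (use True in simp)
    have "op_of (QP.pull c (PQ.pull d B)) \<sigma> bs = \<epsilon>' (PQ.pull d B) (c (cpo_of B) ?w)"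
      using QP.pull_op[of \<sigma> bs "PQ.pull d B" c] True by simp
    also have "\<dots> = \<epsilon> B (d (cpo_of B) (c (cpo_of B) ?w))" by (rule PQ.pull_alg(2)[OF d B c[OF X w]])
    also have "\<dots> = \<epsilon> B ?w" using dc[OF X w] by simp
    also have "\<dots> = op_of B \<sigma> (map (\<epsilon> B) (map (\<eta> (cpo_of B)) bs))"
      by (rule homsD(4)[OF PQ.P.counit_hom[OF B] _ \<eta>bs]) (use True in simp)
    also have "map (\<epsilon> B) (map (\<eta> (cpo_of B)) bs) = bs"
      using True PQ.P.counit_unit[OF B] by (auto intro!: map_idI)
    finally show ?thesis .
  next
    \<comment> \<open>Outside the signature or the carrier both algebras carry the normal form
      \<open>undefined\<close>, so the records are equal and not merely isomorphic.\<close>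
    case False
    then have "op_of B \<sigma> bs = undefined" using algebrasD(5)[OF PQ.P.alg[OF B]] by blast
    then show ?thesis using False by (auto simp: QP.pull_def)
  qed
  then have "op_of (QP.pull c (PQ.pull d B)) = op_of B" by blast
  moreover have "cpo_of (QP.pull c (PQ.pull d B)) = cpo_of B" by simp
  ultimately show ?thesis by (intro calg.equality) auto
qed

lemma free_algebra_monadD:
  assumes "V \<in> varieties" "free_algebra_monad V M"
  obtains F \<eta> \<epsilon> where "free_algebra_functor U V F \<eta> \<epsilon>" "M = adjunction_monad CPO F forgetful \<eta> \<epsilon>"
  using assms adjunction_free_algebra_functor unfolding free_algebra_monad_def by blast

lemma free_algebra_monad_exists: "V \<in> varieties \<Longrightarrow> \<exists>M :: 'u cpo_monad. free_algebra_monad V M"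
  using free_algebra_functor_exists free_algebra_functor.adjunction unfolding free_algebra_monad_def by blast

lemma free_algebra_monad_sf:
  fixes M :: "'u cpo_monad"
  assumes "V \<in> varieties" "free_algebra_monad V M"
  shows "M \<in> strongly_finitary_monads"
  by (rule free_algebra_monadD[OF assms]) (use free_algebra_functor.M_strongly_finitary in blast)

text \<open>From varieties to monads the comparison morphisms are inverse by freeness; from monads
  to varieties pulling back along the two morphisms is inverse by \<open>pull_pull\<close>. With
  \<open>V = W\<close> it shows that the monad of a variety is unique up to isomorphism.\<close>

lemma concrete_iso_iff_monad_iso:
  fixes V W :: "'u variety"
  assumes V: "V \<in> varieties" and W: "W \<in> varieties" and M: "free_algebra_monad V M" and N: "free_algebra_monad W N"
  shows "(V, W) \<in> concrete_iso \<longleftrightarrow> (M, N) \<in> monad_iso"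
proof -
  obtain F \<eta> \<epsilon> where P: "free_algebra_functor U V F \<eta> \<epsilon>" and Me: "M = adjunction_monad CPO F forgetful \<eta> \<epsilon>"
    by (rule free_algebra_monadD[OF V M])
  obtain F' \<eta>' \<epsilon>' where Q: "free_algebra_functor U W F' \<eta>' \<epsilon>'" and Ne: "N = adjunction_monad CPO F' forgetful \<eta>' \<epsilon>'"
    by (rule free_algebra_monadD[OF W N])
  have PQ': "free_algebra_functors U V F \<eta> \<epsilon> W F' \<eta>' \<epsilon>'" and QP': "free_algebra_functors U W F' \<eta>' \<epsilon>' V F \<eta> \<epsilon>"
    using P Q by (simp_all add: free_algebra_functors_def)
  interpret PQ: free_algebra_functors U V F \<eta> \<epsilon> W F' \<eta>' \<epsilon>' by (rule PQ')
  interpret QP: free_algebra_functors U W F' \<eta>' \<epsilon>' V F \<eta> \<epsilon> by (rule QP')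
  note sf = free_algebra_monad_sf[OF V M] free_algebra_monad_sf[OF W N]
  show ?thesis
  proof
    assume "(V, W) \<in> concrete_iso"
    then obtain \<phi> \<psi> where iso: "alg_iso V W \<phi> \<psi>" unfolding concrete_iso_def concrete_isomorphism_iff by blast
    obtain c where c: "monad_morphism CPO PQ.P.M PQ.Q.M c" "\<And>X. X \<in> obj CPO \<Longrightarrow> c X \<in> homs (sig V) (fobj F X) (\<psi> (fobj F' X))"
      "\<And>X x. X \<in> obj CPO \<Longrightarrow> x \<in> Field X \<Longrightarrow> c X (\<eta> X x) = \<eta>' X x"
      using PQ.comparison_morphism[OF iso] by blast
    obtain d where d: "monad_morphism CPO PQ.Q.M PQ.P.M d" "\<And>X. X \<in> obj CPO \<Longrightarrow> d X \<in> homs (sig W) (fobj F' X) (\<phi> (fobj F X))"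
      "\<And>X x. X \<in> obj CPO \<Longrightarrow> x \<in> Field X \<Longrightarrow> d X (\<eta>' X x) = \<eta> X x"
      using QP.comparison_morphism[OF alg_iso_sym[OF iso]] by blast
    note D = alg_isoD[OF iso] and D' = alg_isoD[OF alg_iso_sym[OF iso]]
    have dc: "d X (c X z) = z" if X: "X \<in> obj CPO" and z: "z \<in> Field (cpo_of (fobj F X))" for X z
    proof -
      \<comment> \<open>Moved along \<open>\<psi>\<close>, the morphism \<open>d X\<close> becomes a
        homomorphism of \<open>V\<close>, so its composite with \<open>c X\<close> can be compared
        with the identity by freeness.\<close>
      have dh: "d X \<in> homs (sig V) (\<psi> (fobj F' X)) (fobj F X)"
        using D'(4)[OF PQ.Q.F_algs[OF X] D(1)[OF PQ.P.F_algs[OF X]] d(2)[OF X]] D(3)[OF PQ.P.F_algs[OF X]] by simp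
      have "compose (Field (cpo_of (fobj F X))) (d X) (c X) = (\<lambda>z\<in>Field (cpo_of (fobj F X)). z)"
        by (rule PQ.P.hom_eq[OF X PQ.P.F_algs[OF X] PQ.P.F_compose[OF c(2)[OF X] dh X] homs_id[OF PQ.P.alg[OF PQ.P.F_algs[OF X]]]])
           (simp add: CPO_compose_app PQ.P.unit_app[OF X] c(3)[OF X] d(3)[OF X])
      from fun_cong[OF this, of z] z show ?thesis by (simp add: CPO_compose_app)
    qed
    have cd: "c X (d X z) = z" if X: "X \<in> obj CPO" and z: "z \<in> Field (cpo_of (fobj F' X))" for X z
    proof -
      have ch: "c X \<in> homs (sig W) (\<phi> (fobj F X)) (fobj F' X)"
        using D(4)[OF PQ.P.F_algs[OF X] D'(1)[OF PQ.Q.F_algs[OF X]] c(2)[OF X]] D'(3)[OF PQ.Q.F_algs[OF X]] by simp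
      have "compose (Field (cpo_of (fobj F' X))) (c X) (d X) = (\<lambda>z\<in>Field (cpo_of (fobj F' X)). z)"
        by (rule PQ.Q.hom_eq[OF X PQ.Q.F_algs[OF X] PQ.Q.F_compose[OF d(2)[OF X] ch X] homs_id[OF PQ.Q.alg[OF PQ.Q.F_algs[OF X]]]])
           (simp add: CPO_compose_app PQ.Q.unit_app[OF X] c(3)[OF X] d(3)[OF X])
      from fun_cong[OF this, of z] z show ?thesis by (simp add: CPO_compose_app)
    qed
    have "isomorphic_monads CPO M N"
      unfolding isomorphic_monads_iff Me Ne by (intro exI[of _ c] exI[of _ d] conjI c(1) d(1)) (simp add: dc cd)
    then show "(M, N) \<in> monad_iso" unfolding monad_iso_def using sf by simp
  next
    assume "(M, N) \<in> monad_iso"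
    then obtain c d where c: "monad_morphism CPO PQ.P.M PQ.Q.M c" and d: "monad_morphism CPO PQ.Q.M PQ.P.M d"
      and dc: "\<And>X z. X \<in> obj CPO \<Longrightarrow> z \<in> Field (cpo_of (fobj F X)) \<Longrightarrow> d X (c X z) = z"
      and cd: "\<And>X z. X \<in> obj CPO \<Longrightarrow> z \<in> Field (cpo_of (fobj F' X)) \<Longrightarrow> c X (d X z) = z"
      unfolding monad_iso_def isomorphic_monads_iff Me Ne by auto
    have ca: "c X z \<in> Field (cpo_of (fobj F' X))" if "X \<in> obj CPO" "z \<in> Field (cpo_of (fobj F X))" for X z
      by (rule cont_maps_app[OF QP.d_map[OF c that(1)] that(2)])
    have da: "d X z \<in> Field (cpo_of (fobj F X))" if "X \<in> obj CPO" "z \<in> Field (cpo_of (fobj F' X))" for X z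
      by (rule cont_maps_app[OF PQ.d_map[OF d that(1)] that(2)])
    have "alg_iso V W (PQ.pull d) (QP.pull c)"
      unfolding alg_iso_def
    proof (intro conjI ballI subsetI)
      show "QP.pull c (PQ.pull d A) = A" if "A \<in> algs V" for A
        by (rule pull_pull[OF PQ' QP' d dc ca that])
      show "PQ.pull d (QP.pull c B) = B" if "B \<in> algs W" for B
        by (rule pull_pull[OF QP' PQ' c cd da that])
    qed (simp_all add: PQ.pull_alg(1)[OF d] QP.pull_alg(1)[OF c] PQ.pull_hom[OF d] QP.pull_hom[OF c])
    then show "(V, W) \<in> concrete_iso" unfolding concrete_iso_def concrete_isomorphism_iff using V W by blast
  qed
qed

end

text \<open>\<open>P\<close> is a relation because the monad of a variety depends on choices. The
  equivalence in the last hypothesis yields both independence of choices and injectivity.\<close>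

lemma quotient_bij:
  assumes r: "equiv A r" and s: "equiv B s"
    and total: "\<And>a. a \<in> A \<Longrightarrow> \<exists>b. P a b" and B: "\<And>a b. a \<in> A \<Longrightarrow> P a b \<Longrightarrow> b \<in> B"
    and surj: "\<And>b. b \<in> B \<Longrightarrow> \<exists>a\<in>A. P a b"
    and iff: "\<And>a a' b b'. a \<in> A \<Longrightarrow> a' \<in> A \<Longrightarrow> P a b \<Longrightarrow> P a' b' \<Longrightarrow> (a, a') \<in> r \<longleftrightarrow> (b, b') \<in> s"
  shows "\<exists>\<Theta>. bij_betw \<Theta> (A // r) (B // s) \<and> (\<forall>a\<in>A. \<forall>b. P a b \<longrightarrow> \<Theta> (r `` {a}) = s `` {b})"
proof -
  \<comment> \<open>Taking the union over all representatives avoids choosing one; every member of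
    the union turns out to be the same class.\<close>
  define \<Theta> where "\<Theta> C = (\<Union>a\<in>C. \<Union>b\<in>{b. P a b}. s `` {b})" for C
  have \<Theta>: "\<Theta> (r `` {a}) = s `` {b}" if a: "a \<in> A" and b: "P a b" for a b
  proof -
    have eq: "s `` {b'} = s `` {b}" if "(a, a') \<in> r" "P a' b'" for a' b'
    proof -
      have "a' \<in> A" using r that(1) unfolding equiv_def by blast
      then have "(b, b') \<in> s" using iff[OF a _ b that(2)] that(1) by blast
      then show ?thesis by (rule equiv_class_eq[OF s, THEN sym])
    qed
    have aa: "a \<in> r `` {a}" using r a by (simp add: equiv_def refl_on_def)
    show ?thesis
    proof (rule subset_antisym)
      show "\<Theta> (r `` {a}) \<subseteq> s `` {b}" unfolding \<Theta>_def by (intro UN_least) (simp add: eq)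
      show "s `` {b} \<subseteq> \<Theta> (r `` {a})" unfolding \<Theta>_def by (intro UN_upper[THEN subset_trans[rotated], OF aa] UN_upper) (simp add: b)
    qed
  qed
  have "bij_betw \<Theta> (A // r) (B // s)"
    unfolding bij_betw_def
  proof
    show "inj_on \<Theta> (A // r)"
    proof (rule inj_onI)
      fix C D assume C: "C \<in> A // r" and D: "D \<in> A // r" and e: "\<Theta> C = \<Theta> D"
      obtain a where a: "C = r `` {a}" "a \<in> A" using C by (rule quotientE)
      obtain a' where a': "D = r `` {a'}" "a' \<in> A" using D by (rule quotientE)
      obtain b where b: "P a b" using total[OF a(2)] by blast
      obtain b' where b': "P a' b'" using total[OF a'(2)] by blast
      have "s `` {b} = s `` {b'}" using e \<Theta>[OF a(2) b] \<Theta>[OF a'(2) b'] a a' by simp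
      then have "(b, b') \<in> s" by (rule eq_equiv_class[OF _ s B[OF a'(2) b']])
      then have "(a, a') \<in> r" using iff[OF a(2) a'(2) b b'] by blast
      then show "C = D" unfolding a(1) a'(1) by (rule equiv_class_eq[OF r])
    qed
    show "\<Theta> ` (A // r) = B // s"
    proof
      show "\<Theta> ` (A // r) \<subseteq> B // s"
      proof
        fix Y assume "Y \<in> \<Theta> ` (A // r)"
        then obtain C where C: "Y = \<Theta> C" "C \<in> A // r" by blast
        obtain a where a: "C = r `` {a}" "a \<in> A" using C(2) by (rule quotientE)
        obtain b where b: "P a b" using total[OF a(2)] by blast
        show "Y \<in> B // s" unfolding C(1) a(1) \<Theta>[OF a(2) b] by (rule quotientI[OF B[OF a(2) b]])
      qed
      show "B // s \<subseteq> \<Theta> ` (A // r)"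
      proof
        fix Y assume "Y \<in> B // s"
        then obtain b where b: "Y = s `` {b}" "b \<in> B" by (rule quotientE)
        obtain a where a: "a \<in> A" "P a b" using surj[OF b(2)] by blast
        show "Y \<in> \<Theta> ` (A // r)" unfolding b(1) \<Theta>[OF a, symmetric] by (rule imageI[OF quotientI[OF a(1)]])
      qed
    qed
  qed
  then show ?thesis using \<Theta> by blast
qed

theorem corollary4p26:
  assumes "universe TYPE('u)"
  shows "equiv varieties (concrete_iso :: 'u variety rel) \<and>
    equiv strongly_finitary_monads (monad_iso :: 'u cpo_monad rel) \<and>
    (\<forall>V \<in> (varieties :: 'u variety set).
       (\<exists>M. free_algebra_monad V M) \<and>
       (\<forall>M. free_algebra_monad V M \<longrightarrow> M \<in> strongly_finitary_monads)) \<and>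
    (\<exists>\<Theta>. bij_betw \<Theta> ((varieties :: 'u variety set) // concrete_iso)
                     ((strongly_finitary_monads :: 'u cpo_monad set) // monad_iso) \<and>
         (\<forall>V\<in>varieties. \<forall>M. free_algebra_monad V M \<longrightarrow>
            \<Theta> (concrete_iso `` {V}) = monad_iso `` {M}))"
proof -
  interpret small_universe "UNIV :: 'u set"
    by unfold_locales (simp_all add: assms)
  have surj: "\<exists>V\<in>varieties. free_algebra_monad V M" if "M \<in> strongly_finitary_monads" for M :: "'u cpo_monad"
  proof -
    interpret M: sf_monad "UNIV :: 'u set" M by unfold_locales (rule that)
    show ?thesis using M.Var_M_variety M.Var_M_monad by blast
  qed
  show ?thesis
  proof (intro conjI ballI allI impI)
    show "\<exists>\<Theta>. bij_betw \<Theta> ((varieties :: 'u variety set) // concrete_iso)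
        ((strongly_finitary_monads :: 'u cpo_monad set) // monad_iso) \<and>
      (\<forall>V\<in>varieties. \<forall>M. free_algebra_monad V M \<longrightarrow> \<Theta> (concrete_iso `` {V}) = monad_iso `` {M})"
    proof (rule quotient_bij[OF equiv_concrete_iso equiv_monad_iso])
      show "(V, W) \<in> concrete_iso \<longleftrightarrow> (M, N) \<in> monad_iso"
        if "V \<in> varieties" "W \<in> varieties" "free_algebra_monad V M" "free_algebra_monad W N"
        for V W :: "'u variety" and M N
        by (rule concrete_iso_iff_monad_iso[OF that])
    qed (use free_algebra_monad_exists free_algebra_monad_sf surj in auto)
  qed (use equiv_concrete_iso equiv_monad_iso free_algebra_monad_exists free_algebra_monad_sf in auto)
qed

end
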